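(* Let $n\ge 1$ and let $P=(P_1,\dots,P_n)$ be a polynomial map from $\mathbf{C}^n$ to $\mathbf{C}^n$. Suppose there exist constants $c>0$, $R>0$ and rational numbers $0<\delta_j\le \deg P_j$, $j=1,\dots,n$, such that for every $\zeta\in\mathbf{C}^n$ with $\|\zeta\|\ge R$, $$\sum_{j=1}^n \frac{|P_j(\zeta)|}{(1+\|\zeta\|^2)^{\delta_j/2}}\ \ge\ c .$$ Then for any polynomial $Q\in\mathbf{C}[X_1,\dots,X_n]$ with $$\deg Q\le \delta_1+\cdots+\delta_n-n-1,$$ one has $$\sum_{\alpha\in V(P)}\mathrm{Res}_\alpha\Big[\frac{Q\,d\zeta}{P_1\cdots P_n}\Big]=0 .$$
   Context: $\|\cdot\|$ is the Euclidean norm on $\mathbf{C}^n$ and $d\zeta=d\zeta_1\wedge\cdots\wedge d\zeta_n$. $V(P)=\{\zeta\in\mathbf{C}^n: P_1(\zeta)=\cdots=P_n(\zeta)=0\}$ (under the hypothesis this set is bounded, hence finite). For an isolated point $\alpha$ of $V(P)$, the local (Grothendieck) residue is $$\mathrm{Res}_\alpha\Big[\frac{Q\,d\zeta}{P_1\cdots P_n}\Big]=\frac{1}{(2\pi i)^n}\lim_{\epsilon_1,\dots,\epsilon_n\to0}\ \int_{\{\zeta\in U_\alpha:\ |P_1|=\epsilon_1,\dots,|P_n|=\epsilon_n\}}\frac{Q(\zeta)\,d\zeta}{P_1(\zeta)\cdots P_n(\zeta)},$$ where $U_\alpha$ is a bounded open neighbourhood of $\alpha$ whose closure meets $V(P)$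 only at $\alpha$, and the cycle is oriented so that $d\arg P_1\wedge\cdots\wedge d\arg P_n$ is positive (for generic, sufficiently small $\epsilon_j>0$ the integral does not depend on the $\epsilon_j$). *)

theory Defs
  imports "HOL-Analysis.Analysis" "HOL-Library.Poly_Mapping"
begin

text \<open>A polynomial in the variables indexed by \<open>'n\<close> is a finitely supported map from exponent
  vectors to coefficients.\<close>

type_synonym 'n cpoly = "('n \<Rightarrow>\<^sub>0 nat) \<Rightarrow>\<^sub>0 complex"

definition peval :: "'n::finite cpoly \<Rightarrow> complex^'n \<Rightarrow> complex" where
  "peval p z = (\<Sum>m\<in>Poly_Mapping.keys p.
     Poly_Mapping.lookup p m * (\<Prod>i\<in>UNIV. z $ i ^ Poly_Mapping.lookup m i))"

text \<open>The zero polynomial gets degree 0 here; where the convention \<open>deg 0 = -\<infinity>\<close> matters, the zero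
  polynomial has to be treated separately.\<close>

definition total_degree :: "'n::finite cpoly \<Rightarrow> nat" where
  "total_degree p =
     Max (insert 0 ((\<lambda>m. \<Sum>i\<in>UNIV. Poly_Mapping.lookup m i) ` Poly_Mapping.keys p))"

definition pmap :: "('n::finite \<Rightarrow> 'n cpoly) \<Rightarrow> complex^'n \<Rightarrow> complex^'n" where
  "pmap P z = (\<chi> j. peval (P j) z)"

definition zero_set :: "('n::finite \<Rightarrow> 'n cpoly) \<Rightarrow> (complex^'n) set" where
  "zero_set P = {z. \<forall>j. peval (P j) z = 0}"

definition level_cycle ::
  "('n::finite \<Rightarrow> 'n cpoly) \<Rightarrow> (complex^'n) set \<Rightarrow> real^'n \<Rightarrow> (complex^'n) set" where
  "level_cycle P U \<epsilon> = {z\<in>U. \<forall>j. norm (peval (P j) z) = \<epsilon> $ j}"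

text \<open>The matrix of partial derivatives \<open>\<partial>\<phi>\<^sub>i/\<partial>t\<^sub>k\<close>. Its determinant is the coefficient of the pullback
  of \<open>d\<zeta>\<^sub>1 \<and> \<dots> \<and> d\<zeta>\<^sub>n\<close> under \<open>\<phi>\<close> with respect to \<open>dt\<^sub>1 \<and> \<dots> \<and> dt\<^sub>n\<close>.\<close>

definition cjac :: "(real^'n \<Rightarrow> complex^'n) \<Rightarrow> real^'n \<Rightarrow> complex^'n^'n" where
  "cjac \<phi> t = (\<chi> i k. frechet_derivative \<phi> (at t) (axis k 1) $ i)"

text \<open>Since \<open>d arg g = Im (dg / g)\<close>, this is the coefficient of the pullback of
  \<open>d arg P\<^sub>1 \<and> \<dots> \<and> d arg P\<^sub>n\<close> under \<open>\<phi>\<close> with respect to \<open>dt\<^sub>1 \<and> \<dots> \<and> dt\<^sub>n\<close>.\<close>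

definition darg_coeff ::
  "('n::finite \<Rightarrow> 'n cpoly) \<Rightarrow> (real^'n \<Rightarrow> complex^'n) \<Rightarrow> real^'n \<Rightarrow> real" where
  "darg_coeff P \<phi> t =
     det (\<chi> i k. Im (cjac (pmap P \<circ> \<phi>) t $ i $ k / pmap P (\<phi> t) $ i))"

text \<open>Positively oriented injective \<open>C\<^sup>1\<close> parametrisations of pieces of \<open>M\<close>. On a set
  \<open>M = level_cycle P U \<epsilon>\<close> with all \<open>\<epsilon>\<^sub>j > 0\<close>, positivity of the last coefficient forces \<open>\<phi>\<close> to be an
  immersion.\<close>

definition positive_patch ::
  "('n::finite \<Rightarrow> 'n cpoly) \<Rightarrow> (complex^'n) set \<Rightarrow> (real^'n) set \<Rightarrow> (real^'n \<Rightarrow> complex^'n) \<Rightarrow> bool"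
  where
  "positive_patch P M W \<phi> \<longleftrightarrow>
     open W \<and> inj_on \<phi> W \<and> \<phi> ` W \<subseteq> M \<and>
     (\<forall>t\<in>W. \<phi> differentiable (at t)) \<and> continuous_on W (cjac \<phi>) \<and>
     (\<forall>t\<in>W. darg_coeff P \<phi> t > 0)"

text \<open>Vanishing of the \<open>d\<close>-dimensional Hausdorff measure, for \<open>d \<ge> 1\<close>. No bound on the radii is
  needed: small sums force small radii.\<close>

definition hausdorff_null :: "nat \<Rightarrow> 'a::metric_space set \<Rightarrow> bool" where
  "hausdorff_null d S \<longleftrightarrow>
     (\<forall>e>0. \<exists>(c :: nat \<Rightarrow> 'a) (r :: nat \<Rightarrow> real).
        (\<forall>k. 0 \<le> r k) \<and> S \<subseteq> (\<Union>k. cball (c k) (r k)) \<and>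
        summable (\<lambda>k. r k ^ d) \<and> suminf (\<lambda>k. r k ^ d) < e)"

text \<open>\<open>has_cycle_integral P M f I\<close>: the integral of \<open>f d\<zeta>\<^sub>1 \<and> \<dots> \<and> d\<zeta>\<^sub>n\<close> over \<open>M\<close>, oriented by
  \<open>d arg P\<^sub>1 \<and> \<dots> \<and> d arg P\<^sub>n > 0\<close>, converges absolutely with value \<open>I\<close>. It is computed from a countable
  family of disjoint oriented coordinate patches that exhausts \<open>M\<close> up to a set of \<open>n\<close>-dimensional
  measure zero. An exceptional null set cannot be avoided: even on a smooth \<open>M\<close> the form
  \<open>d arg P\<^sub>1 \<and> \<dots> \<and> d arg P\<^sub>n\<close> may vanish at some points, namely those where the Jacobian determinant
  of \<open>P\<close> is zero.\<close>

definition has_cycle_integral ::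
  "('n::finite \<Rightarrow> 'n cpoly) \<Rightarrow> (complex^'n) set \<Rightarrow> (complex^'n \<Rightarrow> complex) \<Rightarrow> complex \<Rightarrow> bool" where
  "has_cycle_integral P M f I \<longleftrightarrow>
     (\<exists>(W :: nat \<Rightarrow> (real^'n) set) (\<phi> :: nat \<Rightarrow> real^'n \<Rightarrow> complex^'n).
        (\<forall>k. positive_patch P M (W k) (\<phi> k)) \<and>
        disjoint_family (\<lambda>k. \<phi> k ` W k) \<and>
        hausdorff_null CARD('n) (M - (\<Union>k. \<phi> k ` W k)) \<and>
        (\<forall>k. (\<lambda>t. f (\<phi> k t) * det (cjac (\<phi> k) t)) absolutely_integrable_on W k) \<and>
        summable (\<lambda>k. integral (W k) (\<lambda>t. norm (f (\<phi> k t) * det (cjac (\<phi> k) t)))) \<and>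
        (\<lambda>k. integral (W k) (\<lambda>t. f (\<phi> k t) * det (cjac (\<phi> k) t))) sums I)"

text \<open>The limit over \<open>\<epsilon> \<rightarrow> 0\<close> is taken over generic \<open>\<epsilon>\<close>, that is, off a Lebesgue null set \<open>N\<close>. The
  value does not depend on the choice of the neighbourhood \<open>U\<close>, so all admissible \<open>U\<close> are required
  to give it.\<close>

definition has_local_residue ::
  "('n::finite \<Rightarrow> 'n cpoly) \<Rightarrow> 'n cpoly \<Rightarrow> complex^'n \<Rightarrow> complex \<Rightarrow> bool" where
  "has_local_residue P Q \<alpha> r \<longleftrightarrow>
     (\<forall>U. open U \<and> bounded U \<and> \<alpha> \<in> U \<and> closure U \<inter> zero_set P = {\<alpha>} \<longrightarrow>
        (\<exists>(N :: (real^'n) set) (I :: real^'n \<Rightarrow> complex).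
           negligible N \<and>
           (\<forall>\<^sub>F \<epsilon> in at 0 within ({\<epsilon>. \<forall>j. 0 < \<epsilon> $ j} - N).
              has_cycle_integral P (level_cycle P U \<epsilon>)
                (\<lambda>z. peval Q z / (\<Prod>j\<in>UNIV. peval (P j) z)) (I \<epsilon>)) \<and>
           ((\<lambda>\<epsilon>. 1 / (2 * of_real pi * \<i>) ^ CARD('n) * I \<epsilon>) \<longlongrightarrow> r)
              (at 0 within ({\<epsilon>. \<forall>j. 0 < \<epsilon> $ j} - N))))"

definition local_residue ::
  "('n::finite \<Rightarrow> 'n cpoly) \<Rightarrow> 'n cpoly \<Rightarrow> complex^'n \<Rightarrow> complex" where
  "local_residue P Q \<alpha> = (THE r. has_local_residue P Q \<alpha> r)"

end

theory Submission
  imports Defs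
begin

text \<open>Let \<open>J\<close> be the Jacobian determinant of \<open>P\<close>. In the logarithmic coordinates \<open>u\<^sub>j = log P\<^sub>j\<close>, with
  \<open>\<rho> = Re u\<close>, the integral of \<open>Q d\<zeta> / (P\<^sub>1 \<cdots> P\<^sub>n)\<close> over the level cycle \<open>|P\<^sub>j| = exp \<rho>\<^sub>j\<close> is \<open>\<i>\<^sup>n\<close> times the sum
  over the sheets of the integral of \<open>Q / J\<close> over \<open>Im u\<close>. Averaging it against test functions \<open>\<alpha>\<^sub>j(\<rho>\<^sub>j)\<close>
  turns it into the volume integral of \<open>\<Prod>\<^sub>j \<alpha>\<^sub>j(ln |P\<^sub>j|) / |P\<^sub>j|\<^sup>2 \<cdot> Q \<cdot> cnj J\<close>, which has no singularities. By
  the divergence theorem and the Piola identity this vanishes whenever some \<open>\<alpha>\<^sub>k\<close> is the derivative of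
  a test function; so it is a constant, the mean, times \<open>\<Prod>\<^sub>j \<integral>\<alpha>\<^sub>j\<close>, and the cycle integral equals this
  constant (up to \<open>\<i>\<^sup>n\<close>) for almost every \<open>\<rho>\<close>. No Sard theorem or homology is needed: Eilenberg's
  inequality shows that for almost every \<open>\<rho>\<close> the points of the cycle outside the charts are
  negligible. The charts exist because \<open>J\<close> does not vanish identically near an isolated zero: for the
  perturbation \<open>P + \<tau>(\<zeta> - a)\<close> the mean of \<open>J\<close> is at least \<open>(2\<pi>)\<^sup>n\<close>, and this survives \<open>\<tau> \<rightarrow> 0\<close>.

  The mean is additive over small neighbourhoods of the zeros, so the sum of the residues is the mean
  over the whole space, divided by \<open>(2\<pi>)\<^sup>n\<close>. Take for \<open>\<alpha>\<^sub>j\<close> a fixed bump translated by \<open>\<delta>\<^sub>j ln \<lambda>\<close>. By the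
  growth hypothesis the weight lives on \<open>|\<zeta>| \<le> K\<lambda>\<close>, and there \<open>2|Q J| \<le> |J|\<^sup>2 / \<lambda> + \<lambda> |Q|\<^sup>2\<close>. The mean of \<open>J\<close>
  does not depend on \<open>\<lambda>\<close>, and the integral of \<open>|Q|\<^sup>2\<close> is \<open>O(\<lambda> powr (2 deg Q + 2n - 2 \<Sum>\<delta>\<^sub>j)) = O(\<lambda> powr -2)\<close>.
  Hence the mean of \<open>Q\<close> is \<open>O(1/\<lambda>)\<close> for every \<open>\<lambda> \<ge> 1\<close>.\<close>

section \<open>Real determinants of complex matrices\<close>

text \<open>Two features of the definitions shape the proof: a single level cycle may run through
  critical points of \<open>P\<close>, and \<open>has_cycle_integral\<close> admits every exhausting
  family of patches while \<open>local_residue\<close> is a definite description. So the analysis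
  takes place in real dimension 2n on averages over levels, single levels are recovered only almost
  everywhere, and independence of the patches is a theorem of its own.

  The averaged form is regular because the change of variables to \<open>u\<close> has real Jacobian
  |J|^2 / prod |P_j|^2: the numerator turns Q / J into Q cnj J, and the supports of the test
  functions keep P_j away from 0.

  \<open>J\<close> also serves as a numerator: for Q = J the integrand Q / J is 1, so the mean
  counts sheets, with (2 pi)^n for each full turn of the angles, and the averaged density is
  nonnegative. Positivity forbids J = 0 identically. The same mean is the bounded partner of Q in
  the final inequality, since it does not see which levels are averaged.\<close>

lemma field_matrix_induct [case_names mult zero_row diagonal swap shear]:
  fixes Q :: "'a::field^'n^'n \<Rightarrow> bool"
  assumes mult: "\<And>A B. Q A \<Longrightarrow> Q B \<Longrightarrow> Q (A ** B)"
    and zero_row: "\<And>A i. row i A = 0 \<Longrightarrow> Q A"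
    and diagonal: "\<And>A. (\<And>i j. i \<noteq> j \<Longrightarrow> A$i$j = 0) \<Longrightarrow> Q A"
    and swap: "\<And>m n. m \<noteq> n \<Longrightarrow> Q (\<chi> i j. of_bool (i = Transposition.transpose m n j))"
    and shear: "\<And>k c. c $ k = 0 \<Longrightarrow> Q (\<chi> i j. of_bool (i = j) + (if j = k then c $ i else 0))"
  shows "Q A"
proof -
  \<comment> \<open>Gaussian elimination, one column at a time: \<open>K\<close> holds the columns
    that may still have entries off the diagonal. A zero in the pivot position is repaired by
    exchanging two columns, both of which lie in \<open>insert k K\<close>; a vanishing row
    \<open>k\<close> is settled at once by \<open>zero_row\<close>.\<close>
  have "Q A" if "finite K" "\<And>i j. i \<noteq> j \<Longrightarrow> j \<notin> K \<Longrightarrow> A$i$j = 0" for K A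
    using that
  proof (induction K arbitrary: A rule: finite_induct)
    case empty
    then show ?case by (auto intro: diagonal)
  next
    case (insert k K)
    have pivot: "Q B" if Bkk: "B$k$k \<noteq> 0" and B0: "\<And>i j. i \<noteq> j \<Longrightarrow> j \<notin> insert k K \<Longrightarrow> B$i$j = 0"
      for B
    proof -
      \<comment> \<open>Subtracting multiples of row \<open>k\<close> clears column
        \<open>k\<close>. Finished columns stay diagonal, since row \<open>k\<close> is zero
        there.\<close>
      define c :: "'a^'n" where "c = (\<chi> i. if i = k then 0 else B$i$k / B$k$k)"
      define C where "C = (\<chi> i j. B$i$j - c$i * B$k$j)"
      have "Q C"
      proof (rule insert.IH)
        fix i j assume "i \<noteq> j" "j \<notin> K"
        then show "C $ i $ j = 0"
          using B0[of i j] B0[of k j] Bkk by (cases "j = k"; cases "i = k") (auto simp: C_def c_def)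
      qed
      moreover have "B = (\<chi> i j. of_bool (i = j) + (if j = k then c $ i else 0)) ** C"
        by (auto simp: matrix_matrix_mult_def vec_eq_iff C_def distrib_right sum.distrib of_bool_def
            if_distrib [of "\<lambda>x. x * y" for y] c_def cong: if_cong)
      ultimately show ?thesis
        using mult[OF shear[of c k]] by (simp add: c_def)
    qed
    show ?case
    proof (cases "row k A = 0")
      case True
      then show ?thesis by (rule zero_row)
    next
      case False
      then obtain l where l: "A$k$l \<noteq> 0"
        by (auto simp: row_def vec_eq_iff)
      show ?thesis
      proof (cases "k = l")
        case True
        then show ?thesis using l insert.prems pivot by blast
      next
        case False
        then have "l \<in> K" using l insert.prems by blast
        let ?B = "\<chi> i j. A $ i $ Transposition.transpose k l j"
        have "Q ?B"
          using l insert.prems \<open>l \<in> K\<close>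
          by (intro pivot) (auto simp: Transposition.transpose_def)
        moreover have "A = ?B ** (\<chi> i j. of_bool (i = Transposition.transpose k l j))"
          by (auto simp: matrix_matrix_mult_def vec_eq_iff of_bool_def
              if_distrib [of "\<lambda>x. y * x" for y] cong: if_cong)
        ultimately show ?thesis
          using mult swap False by metis
      qed
    qed
  qed
  then show ?thesis
    by (metis UNIV_I finite)
qed

text \<open>The type \<open>'n bit0\<close> has twice as many elements as \<open>'n\<close> and is
  well-ordered for every finite \<open>'n\<close>. The real change of variables below is stated for
  well-ordered index types, so the realification of \<open>complex^'n\<close> is indexed in this
  way, through an arbitrary bijection.\<close>

definition real_coord :: "'n::finite \<times> bool \<Rightarrow> 'n bit0" where
  "real_coord = (SOME b. bij b)"

lemma bij_real_coord: "bij (real_coord :: 'n::finite \<times> bool \<Rightarrow> 'n bit0)"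
proof -
  have "card (UNIV :: ('n \<times> bool) set) = card (UNIV :: 'n bit0 set)"
    by (simp add: card_cartesian_product)
  then obtain b :: "'n \<times> bool \<Rightarrow> 'n bit0" where "bij b"
    using finite_same_card_bij[of "UNIV :: ('n \<times> bool) set" "UNIV :: 'n bit0 set"] by auto
  then show ?thesis
    unfolding real_coord_def by (rule someI[where P = bij])
qed

lemma inv_real_coord [simp]: "inv real_coord (real_coord x) = x"
  by (meson bij_real_coord bij_is_inj inv_f_f)

lemma real_coord_inject [simp]: "real_coord x = real_coord y \<longleftrightarrow> x = y"
  by (metis inv_real_coord)

lemma real_coord_cases:
  obtains i b where "k = real_coord (i, b)"
  using bij_real_coord[THEN bij_is_surj] by (metis surj_def surj_pair)

definition complexify :: "real^('n::finite bit0) \<Rightarrow> complex^'n" where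
  "complexify x = (\<chi> i. Complex (x $ real_coord (i, False)) (x $ real_coord (i, True)))"

definition realify :: "complex^'n \<Rightarrow> real^('n::finite bit0)" where
  "realify z = (\<chi> k. let (i, b) = inv real_coord k in if b then Im (z $ i) else Re (z $ i))"

lemma complexify_realify [simp]: "complexify (realify z) = z"
  by (simp add: complexify_def realify_def vec_eq_iff)

lemma realify_complexify [simp]: "realify (complexify x) = x"
proof -
  have "realify (complexify x) $ k = x $ k" for k
  proof -
    obtain i b where "k = real_coord (i, b)"
      by (rule real_coord_cases)
    then show ?thesis
      by (cases b) (simp_all add: complexify_def realify_def)
  qed
  then show ?thesis by (simp add: vec_eq_iff)
qed

lemma linear_complexify: "linear complexify"
  by (rule linearI) (simp_all add: complexify_def vec_eq_iff complex_eq_iff)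

lemma linear_realify: "linear realify"
  by (rule linearI) (simp_all add: realify_def vec_eq_iff split_beta Let_def)

definition rdet :: "(complex^'n \<Rightarrow> complex^'n) \<Rightarrow> real" where
  "rdet f = det (matrix (realify \<circ> f \<circ> complexify))"

lemma rdet_compose:
  assumes "linear f" "linear g"
  shows "rdet (f \<circ> g) = rdet f * rdet g"
proof -
  have "realify \<circ> (f \<circ> g) \<circ> complexify = (realify \<circ> f \<circ> complexify) \<circ> (realify \<circ> g \<circ> complexify)"
    by (simp add: fun_eq_iff)
  then show ?thesis
    unfolding rdet_def using assms linear_complexify linear_realify
    by (metis det_mul linear_compose matrix_compose)
qed

lemma rdet_ident [simp]: "rdet (\<lambda>x. x) = 1"
proof -
  have "realify \<circ> (\<lambda>x. x) \<circ> complexify = id" by (simp add: fun_eq_iff)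
  then show ?thesis unfolding rdet_def by (metis det_I matrix_id)
qed

lemma linear_cmatrix_vector_mult: "linear ((*v) (A :: complex^'n^'n))"
  by (rule linearI) (simp_all add: matrix_vector_mult_def vec_eq_iff scaleR_sum_right
      distrib_left sum.distrib)

lemma rdet_matrix_mult: "rdet ((*v) (A ** B)) = rdet ((*v) A) * rdet ((*v) B)"
proof -
  have "(*v) (A ** B) = (*v) A \<circ> (*v) B"
    by (simp add: fun_eq_iff matrix_vector_mul_assoc)
  then show ?thesis
    by (simp add: rdet_compose linear_cmatrix_vector_mult)
qed

lemma rdet_mat_1 [simp]: "rdet ((*v) (mat 1 :: complex^'n^'n)) = 1"
  using rdet_ident by (metis (no_types, lifting) ext matrix_vector_mul_lid)

lemma rdet_real_diagonal:
  fixes d :: "'n::finite \<Rightarrow> real"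
  shows "rdet (\<lambda>z. \<chi> i. of_real (d i) * z $ i) = (\<Prod>i\<in>UNIV. (d i)\<^sup>2)"
proof -
  let ?M = "matrix (realify \<circ> (\<lambda>z. \<chi> i. of_real (d i) * z $ i) \<circ> complexify)"
  have entry: "?M $ k $ l = (if k = l then d (fst (inv real_coord k)) else 0)" for k l
  proof -
    obtain i b where "k = real_coord (i, b)"
      by (rule real_coord_cases)
    moreover obtain j c where "l = real_coord (j, c)"
      by (rule real_coord_cases)
    ultimately show ?thesis
      by (auto simp: matrix_def realify_def complexify_def axis_def)
  qed
  have "det ?M = (\<Prod>k\<in>UNIV. ?M $ k $ k)"
    by (rule det_diagonal) (simp add: entry)
  also have "\<dots> = (\<Prod>k\<in>UNIV. d (fst (inv real_coord k)))"
    by (simp only: entry refl if_True)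
  also have "\<dots> = (\<Prod>x\<in>(UNIV :: ('n \<times> bool) set). d (fst x))"
    by (rule prod.reindex_bij_betw[OF bij_imp_bij_inv[OF bij_real_coord], of "\<lambda>x. d (fst x)"])
  also have "\<dots> = (\<Prod>i\<in>UNIV. \<Prod>b\<in>(UNIV :: bool set). d i)"
    by (simp add: prod.cartesian_product case_prod_unfold del: prod_constant)
  also have "\<dots> = (\<Prod>i\<in>UNIV. (d i)\<^sup>2)"
    by (simp add: UNIV_bool power2_eq_square)
  finally show ?thesis
    by (simp add: rdet_def)
qed

lemma linear_cnj_vec: "linear (\<lambda>z :: complex^'n. \<chi> i. cnj (z $ i))"
  by (rule linearI) (simp_all add: vec_eq_iff)

text \<open>The absolute value suffices for measures, and it allows each elementary case to be
  settled by a relation between maps instead of expanding a real determinant of size 2n.\<close>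

lemma abs_rdet: "\<bar>rdet ((*v) A)\<bar> = (norm (det A))\<^sup>2"
proof (induction A rule: field_matrix_induct)
  case (mult A B)
  then show ?case
    by (simp add: rdet_matrix_mult abs_mult det_mul norm_mult power_mult_distrib)
next
  case (zero_row A i)
  have nz: "(A *v z) $ i = 0" for z
    using zero_row by (simp add: matrix_vector_mult_def row_def vec_eq_iff)
  have "\<not> surj (realify \<circ> ((*v) A) \<circ> complexify)"
  proof
    assume "surj (realify \<circ> ((*v) A) \<circ> complexify)"
    then obtain x where "(realify \<circ> ((*v) A) \<circ> complexify) x = realify (axis i 1)"
      by (metis surjD)
    then have "A *v complexify x = axis i 1"
      by (metis comp_apply complexify_realify)
    then show False using nz[of "complexify x"] by (simp add: axis_def)
  qed
  moreover have "linear (realify \<circ> ((*v) A) \<circ> complexify)"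
    by (intro linear_compose linear_complexify linear_realify linear_cmatrix_vector_mult)
  ultimately have "rdet ((*v) A) = 0"
    unfolding rdet_def by (metis det_nz_iff_inj linear_injective_imp_surjective)
  then show ?case using zero_row by (simp add: det_zero_row)
next
  case (diagonal A)
  define d where "d i = A $ i $ i" for i
  let ?C = "\<lambda>z :: complex^'a. \<chi> i. cnj (z $ i)"
  have Av: "(*v) A = (\<lambda>z. \<chi> i. d i * z $ i)"
  proof -
    have "(A *v z) $ i = d i * z $ i" for z i
    proof -
      have "(A *v z) $ i = (\<Sum>j\<in>{i}. A $ i $ j * z $ j)"
        unfolding matrix_vector_mult_def vec_lambda_beta
        by (rule sum.mono_neutral_right) (auto simp: diagonal)
      then show ?thesis by (simp add: d_def)
    qed
    then show ?thesis by (simp add: vec_eq_iff fun_eq_iff)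
  qed
  \<comment> \<open>Composing \<open>A\<close> with its conjugate under complex conjugation gives a
    real diagonal map, whose real determinant is known. The sign of \<open>rdet ?C\<close> drops out
    because it occurs twice.\<close>
  have CC: "rdet ?C * rdet ?C = 1"
    using rdet_compose[OF linear_cnj_vec linear_cnj_vec] by (simp add: o_def)
  have "(*v) A \<circ> (?C \<circ> (*v) A \<circ> ?C) = (\<lambda>z. \<chi> i. of_real ((norm (d i))\<^sup>2) * z $ i)"
    by (simp add: Av fun_eq_iff vec_eq_iff complex_norm_square[symmetric] mult.assoc[symmetric]
        flip: of_real_power)
  moreover have "rdet ((*v) A \<circ> (?C \<circ> (*v) A \<circ> ?C)) = rdet ((*v) A) * (rdet ?C * rdet ((*v) A) * rdet ?C)"
    by (simp only: rdet_compose linear_compose linear_cmatrix_vector_mult linear_cnj_vec)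
  ultimately have "rdet ((*v) A) * (rdet ?C * rdet ((*v) A) * rdet ?C) = (\<Prod>i\<in>UNIV. ((norm (d i))\<^sup>2)\<^sup>2)"
    using rdet_real_diagonal[of "\<lambda>i. (norm (d i))\<^sup>2"] by (simp only:)
  with CC have "(rdet ((*v) A))\<^sup>2 = ((\<Prod>i\<in>UNIV. norm (d i))\<^sup>2)\<^sup>2"
    by (simp add: power2_eq_square prod.distrib mult_ac)
  then have "\<bar>rdet ((*v) A)\<bar> = (\<Prod>i\<in>UNIV. norm (d i))\<^sup>2"
    by (metis abs_power2 power2_eq_iff_nonneg power2_abs abs_ge_zero zero_le_power2)
  then show ?case
    using det_diagonal[OF diagonal] by (simp add: d_def prod_norm)
next
  case (swap m n)
  let ?S = "(\<chi> i j. of_bool (i = Transposition.transpose m n j)) :: complex^'a^'a"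
  \<comment> \<open>The transposition is an involution, so both sides are 1.\<close>
  have SS: "?S ** ?S = mat 1"
    by (simp add: matrix_matrix_mult_def vec_eq_iff mat_def of_bool_def
        if_distrib [of "\<lambda>x. y * x" for y] cong: if_cong)
  have "rdet ((*v) ?S) * rdet ((*v) ?S) = 1"
    by (metis SS rdet_mat_1 rdet_matrix_mult)
  moreover have "norm (det ?S) * norm (det ?S) = 1"
    using arg_cong[OF SS, of "\<lambda>M. norm (det M)"] by (simp only: det_mul norm_mult det_I norm_one)
  ultimately show ?case
    by (auto simp: square_eq_1_iff power2_eq_square)
next
  case (shear k c)
  let ?E = "\<lambda>c :: complex^'a. (\<chi> i j. of_bool (i = j) + (if j = k then c $ i else 0)) :: complex^'a^'a"
  let ?D = "(\<chi> i j. if i = j then (if i = k then - 1 else 1) else 0) :: complex^'a^'a"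
  \<comment> \<open>The inverse of a shear is its conjugate by the reflection \<open>?D\<close> in
    coordinate \<open>k\<close>. Hence a shear and its inverse agree in both quantities, whose
    squares are therefore 1.\<close>
  have EE: "?E c ** ?E (- c) = mat 1" and DED: "?D ** (?E c ** ?D) = ?E (- c)" and DD: "?D ** ?D = mat 1"
    using shear by (auto simp: matrix_matrix_mult_def vec_eq_iff mat_def of_bool_def
        if_distrib [of "\<lambda>x. y * x" for y] if_distrib [of "\<lambda>x. x * y" for y] distrib_left distrib_right
        sum.distrib sum_negf cong: if_cong)
  have "rdet ((*v) ?D) * rdet ((*v) ?D) = 1" "norm (det ?D) * norm (det ?D) = 1"
    using arg_cong[OF DD, of "\<lambda>M. norm (det M)"] arg_cong[OF DD, of "\<lambda>M. rdet ((*v) M)"]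
    by (simp_all only: det_mul norm_mult det_I norm_one rdet_matrix_mult rdet_mat_1)
  moreover have "rdet ((*v) (?E (- c))) = rdet ((*v) ?D) * (rdet ((*v) (?E c)) * rdet ((*v) ?D))"
    "norm (det (?E (- c))) = norm (det ?D) * (norm (det (?E c)) * norm (det ?D))"
    unfolding DED[symmetric] by (simp_all only: rdet_matrix_mult det_mul norm_mult)
  ultimately have "rdet ((*v) (?E (- c))) = rdet ((*v) (?E c))" "norm (det (?E (- c))) = norm (det (?E c))"
    by (simp_all add: mult_ac)
  then have "rdet ((*v) (?E c)) * rdet ((*v) (?E c)) = 1" "norm (det (?E c)) * norm (det (?E c)) = 1"
    using arg_cong[OF EE, of "\<lambda>M. norm (det M)"] arg_cong[OF EE, of "\<lambda>M. rdet ((*v) M)"]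
    by (simp_all only: det_mul norm_mult det_I norm_one rdet_matrix_mult rdet_mat_1)
  then show ?case
    by (auto simp: square_eq_1_iff power2_eq_square)
qed


section \<open>Change of variables under holomorphic maps\<close>

text \<open>Preimages of boxes are boxes with permuted side lengths, and boxes determine the
  measure.\<close>

lemma distr_lborel_Basis_bij:
  fixes T :: "'a::euclidean_space \<Rightarrow> 'b::euclidean_space"
  assumes lin: "linear T" and bij: "bij_betw T Basis Basis"
  shows "distr lborel borel T = lborel"
proof (rule lborel_eqI[symmetric])
  have inner: "T x \<bullet> T c = x \<bullet> c" if c: "c \<in> Basis" for x c
  proof -
    have "T x = T (\<Sum>b\<in>Basis. (x \<bullet> b) *\<^sub>R b)"
      by (simp add: euclidean_representation)
    also have "\<dots> = (\<Sum>b\<in>Basis. (x \<bullet> b) *\<^sub>R T b)"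
      using lin by (simp add: linear_sum linear_scale)
    finally have "T x \<bullet> T c = (\<Sum>b\<in>Basis. (x \<bullet> b) * (T b \<bullet> T c))"
      by (simp add: inner_sum_left)
    also have "\<dots> = (\<Sum>b\<in>Basis. if b = c then x \<bullet> b else 0)"
    proof (rule sum.cong)
      fix b :: 'a assume "b \<in> Basis"
      then have "T b \<in> Basis" "T c \<in> Basis" "T b = T c \<longleftrightarrow> b = c"
        using c bij by (auto simp: bij_betw_def inj_on_def)
      then show "(x \<bullet> b) * (T b \<bullet> T c) = (if b = c then x \<bullet> b else 0)"
        by (simp add: inner_Basis)
    qed simp
    finally show ?thesis using c by simp
  qed
  fix l u :: 'b assume le: "\<And>b. b \<in> Basis \<Longrightarrow> l \<bullet> b \<le> u \<bullet> b"
  have meas: "T \<in> borel \<rightarrow>\<^sub>M borel"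
    using lin by (intro borel_measurable_continuous_onI linear_continuous_on) (simp add: linear_conv_bounded_linear)
  have T_Basis: "Basis = T ` Basis" using bij by (simp add: bij_betw_def)
  have "T -` box l u = box (\<Sum>c\<in>Basis. (l \<bullet> T c) *\<^sub>R c) (\<Sum>c\<in>Basis. (u \<bullet> T c) *\<^sub>R c)"
    by (subst box_def, subst T_Basis) (auto simp: box_def inner)
  then have "emeasure (distr lborel borel T) (box l u) = (\<Prod>c\<in>Basis. (u - l) \<bullet> T c)"
    using meas le bij_betwE[OF bij] by (simp add: emeasure_distr emeasure_lborel_box_eq inner_diff_left)
  also have "(\<Prod>c\<in>Basis. (u - l) \<bullet> T c) = (\<Prod>b\<in>Basis. (u - l) \<bullet> b)"
    using prod.reindex_bij_betw[OF bij, of "\<lambda>b. (u - l) \<bullet> b"] by simp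
  finally show "emeasure (distr lborel borel T) (box l u) = (\<Prod>b\<in>Basis. (u - l) \<bullet> b)" .
qed simp

lemma complexify_axis:
  "complexify (axis (real_coord (i, b)) 1) = axis i (if b then \<i> else 1)"
  by (auto simp: complexify_def axis_def vec_eq_iff complex_eq_iff)

lemma distr_complexify: "distr lborel borel complexify = (lborel :: (complex^'a::finite) measure)"
proof (rule distr_lborel_Basis_bij[OF linear_complexify])
  have "inj_on complexify Basis"
    by (metis inj_onI realify_complexify)
  moreover have "complexify ` Basis = (Basis :: (complex^'a) set)"
  proof
    show "complexify ` Basis \<subseteq> (Basis :: (complex^'a) set)"
    proof (rule image_subsetI)
      fix x :: "real^'a bit0" assume "x \<in> Basis"
      then obtain k where k: "x = axis k 1"
        by (auto simp: Basis_vec_def)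
      obtain i b where "k = real_coord (i, b)"
        by (rule real_coord_cases)
      with k show "complexify x \<in> Basis"
        by (cases b) (simp_all add: complexify_axis axis_in_Basis_iff Basis_complex_def)
    qed
    show "Basis \<subseteq> complexify ` (Basis :: (real^'a bit0) set)"
    proof
      fix v :: "complex^'a" assume "v \<in> Basis"
      then obtain i where "v = axis i 1 \<or> v = axis i \<i>"
        by (auto simp: Basis_vec_def Basis_complex_def)
      then have "v = complexify (axis (real_coord (i, False)) 1) \<or> v = complexify (axis (real_coord (i, True)) 1)"
        by (simp add: complexify_axis)
      then show "v \<in> complexify ` Basis"
        by auto
    qed
  qed
  ultimately show "bij_betw complexify Basis (Basis :: (complex^'a) set)"
    by (simp add: bij_betw_def)
qed

text \<open>The equivalence in \<open>has_measure_differentiable_image\<close> concerns finite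
  values. Read in both directions it shows that the two sides are also infinite together.\<close>

lemma emeasure_differentiable_image:
  fixes g :: "real^'m::{finite,wellorder} \<Rightarrow> real^'m::_"
  assumes S: "S \<in> sets lebesgue"
    and der: "\<And>x. x \<in> S \<Longrightarrow> (g has_derivative g' x) (at x within S)"
    and inj: "inj_on g S"
  shows "emeasure lebesgue (g ` S) = (\<integral>\<^sup>+x. ennreal (indicator S x * \<bar>det (matrix (g' x))\<bar>) \<partial>lebesgue)"
proof -
  define F where "F x = indicator S x * \<bar>det (matrix (g' x))\<bar>" for x
  have F: "F x \<ge> 0" for x by (simp add: F_def)
  have "(\<lambda>x. det (matrix (g' x))) \<in> borel_measurable (lebesgue_on S)"
    using borel_measurable_det_Jacobian[OF S der] .
  then have "(\<lambda>x. \<bar>det (matrix (g' x))\<bar>) \<in> borel_measurable (lebesgue_on S)"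
    by measurable
  then have meas: "F \<in> borel_measurable lebesgue"
    unfolding F_def using S by (subst (asm) borel_measurable_restrict_space_iff) (auto simp: mult_ac)
  have hi: "((\<lambda>x. \<bar>det (matrix (g' x))\<bar>) has_integral m) S \<longleftrightarrow> integral\<^sup>N lebesgue F = ennreal m \<and> 0 \<le> m" for m
  proof -
    have "((\<lambda>x. \<bar>det (matrix (g' x))\<bar>) has_integral m) S \<longleftrightarrow> (F has_integral m) UNIV"
      unfolding has_integral_restrict_UNIV[of S, symmetric]
      by (rule has_integral_cong) (auto simp: F_def indicator_def)
    then show ?thesis
      using has_integral_iff_nn_integral_lebesgue[of F m] F meas by simp
  qed
  note M = has_measure_differentiable_image[OF S der inj]
  have gS: "g ` S \<in> sets lebesgue"
    using S der by (intro differentiable_image_in_sets_lebesgue) (auto simp: differentiable_on_def differentiable_def)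
  show ?thesis
  proof (cases "integral\<^sup>N lebesgue F < \<infinity>")
    case True
    then obtain m where m: "integral\<^sup>N lebesgue F = ennreal m" "m \<ge> 0"
      by (metis ennreal_cases infinity_ennreal_def less_irrefl)
    then have "g ` S \<in> lmeasurable" "measure lebesgue (g ` S) = m"
      using M[of m] hi[of m] by auto
    then show ?thesis
      using m by (simp add: emeasure_eq_measure2 F_def)
  next
    case False
    have "emeasure lebesgue (g ` S) = \<infinity>"
    proof (rule ccontr)
      assume "emeasure lebesgue (g ` S) \<noteq> \<infinity>"
      then have "g ` S \<in> lmeasurable"
        using gS by (intro fmeasurableI) (auto simp: less_top)
      then have "integral\<^sup>N lebesgue F = ennreal (measure lebesgue (g ` S))"
        using M hi by blast
      then show False using False by simp
    qed
    then show ?thesis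
      using False by (simp add: F_def[abs_def] less_top[symmetric])
  qed
qed

context
  fixes L :: "'a::euclidean_space \<Rightarrow> 'a" and w :: "'a \<Rightarrow> real" and V
  assumes V: "open V" and inj: "inj_on L V" and contL: "continuous_on V L" and contw: "continuous_on V w"
    and image_measure: "\<And>S. S \<in> sets borel \<Longrightarrow> S \<subseteq> V \<Longrightarrow> L ` S \<in> sets borel \<Longrightarrow>
      emeasure lborel (L ` S) = (\<integral>\<^sup>+z. ennreal (indicator S z * w z) \<partial>lborel)"
begin

lemma open_cov_image: "open (L ` V)"
  using V inj contL by (intro invariance_of_domain)

lemma cov_measurable:
  "(\<lambda>z. if z \<in> V then L z else 0) \<in> borel \<rightarrow>\<^sub>M borel"
  "(\<lambda>z. indicator V z * w z) \<in> borel_measurable borel"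
proof -
  show "(\<lambda>z. if z \<in> V then L z else 0) \<in> borel \<rightarrow>\<^sub>M borel"
    using V contL by (intro borel_measurable_continuous_on_if) auto
  have "(\<lambda>z. indicator V z *\<^sub>R w z) \<in> borel_measurable borel"
    using V contw by (intro borel_measurable_continuous_on_indicator continuous_intros) auto
  then show "(\<lambda>z. indicator V z * w z) \<in> borel_measurable borel"
    by simp
qed

text \<open>The formula for the measure of image sets is turned into an identity of measures once,
  from which nonnegative and complex integrands follow alike. Extending \<open>L\<close> by 0
  outside \<open>V\<close> makes it Borel on the whole space; the density ignores the added
  points.\<close>

lemma distr_cov_image:
  "density lborel (indicator (L ` V)) =
   distr (density lborel (\<lambda>z. ennreal (indicator V z * w z))) borel (\<lambda>z. if z \<in> V then L z else 0)"
  (is "?M1 = distr ?D borel ?L")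
proof (rule measure_eqI)
  note L [measurable] = cov_measurable(1) and [measurable] = cov_measurable(2)
  have D: "(\<lambda>z. ennreal (indicator V z * w z)) \<in> borel_measurable borel" by measurable
  fix X assume "X \<in> sets ?M1"
  then have X [measurable]: "X \<in> sets borel" by simp
  define S where "S = V \<inter> ?L -` X"
  have LV: "open (L ` V)" by (rule open_cov_image)
  have S [measurable]: "S \<in> sets borel"
    unfolding S_def using V measurable_sets_borel[OF L X] by auto
  have LS: "L ` S = X \<inter> L ` V" by (auto simp: S_def)
  have "emeasure ?M1 X = emeasure lborel (L ` S)"
  proof -
    have "emeasure ?M1 X = (\<integral>\<^sup>+u. indicator (L ` V) u * indicator X u \<partial>lborel)"
      using LV by (intro emeasure_density) auto
    also have "\<dots> = (\<integral>\<^sup>+u. indicator (L ` S) u \<partial>lborel)"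
      by (intro nn_integral_cong) (auto simp: LS indicator_def)
    also have "\<dots> = emeasure lborel (L ` S)"
      using LV by (intro nn_integral_indicator) (simp add: LS)
    finally show ?thesis .
  qed
  also have "\<dots> = (\<integral>\<^sup>+z. ennreal (indicator S z * w z) \<partial>lborel)"
    using LV by (intro image_measure S) (auto simp: S_def LS[unfolded S_def])
  also have "\<dots> = (\<integral>\<^sup>+z. ennreal (indicator V z * w z) * indicator (?L -` X) z \<partial>lborel)"
    by (intro nn_integral_cong) (auto simp: S_def indicator_def)
  also have "\<dots> = emeasure (distr ?D borel ?L) X"
    using measurable_sets_borel[OF L X] D by (subst emeasure_distr) (auto simp: emeasure_density)
  finally show "emeasure ?M1 X = emeasure (distr ?D borel ?L) X" .
qed simp

lemma nn_integral_cov: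
  assumes [measurable]: "f \<in> borel_measurable borel"
  shows "(\<integral>\<^sup>+u. indicator (L ` V) u * f u \<partial>lborel) =
    (\<integral>\<^sup>+z. ennreal (indicator V z * w z) * f (L z) \<partial>lborel)"
proof -
  note [measurable] = cov_measurable
  have [measurable]: "L ` V \<in> sets borel"
    using open_cov_image by simp
  have "(\<integral>\<^sup>+u. indicator (L ` V) u * f u \<partial>lborel) = (\<integral>\<^sup>+u. f u \<partial>density lborel (indicator (L ` V)))"
    by (subst nn_integral_density) auto
  also have "\<dots> = (\<integral>\<^sup>+z. ennreal (indicator V z * w z) * f (if z \<in> V then L z else 0) \<partial>lborel)"
    unfolding distr_cov_image by (subst nn_integral_distr) (simp_all add: nn_integral_density)
  also have "\<dots> = (\<integral>\<^sup>+z. ennreal (indicator V z * w z) * f (L z) \<partial>lborel)"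
    by (intro nn_integral_cong) (auto simp: indicator_def)
  finally show ?thesis .
qed

lemma integral_cov:
  fixes f :: "'a \<Rightarrow> complex"
  assumes [measurable]: "f \<in> borel_measurable borel" and w: "\<And>z. z \<in> V \<Longrightarrow> 0 \<le> w z"
  shows "(\<integral>u. indicator (L ` V) u *\<^sub>R f u \<partial>lborel) =
    (\<integral>z. (indicator V z * w z) *\<^sub>R f (L z) \<partial>lborel)"
proof -
  note [measurable] = cov_measurable
  have [measurable]: "L ` V \<in> sets borel"
    using open_cov_image by simp
  have nn: "indicator V z * w z \<ge> 0" for z using w by (simp add: indicator_def)
  have "(\<integral>u. indicator (L ` V) u *\<^sub>R f u \<partial>lborel) = (\<integral>u. f u \<partial>density lborel (\<lambda>u. ennreal (indicator (L ` V) u)))"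
    by (subst integral_density) auto
  also have "\<dots> = (\<integral>u. f u \<partial>density lborel (indicator (L ` V)))"
    by (simp add: ennreal_indicator)
  also have "\<dots> = (\<integral>z. (indicator V z * w z) *\<^sub>R f (if z \<in> V then L z else 0) \<partial>lborel)"
    unfolding distr_cov_image by (subst integral_distr) (simp_all add: integral_density nn)
  also have "\<dots> = (\<integral>z. (indicator V z * w z) *\<^sub>R f (L z) \<partial>lborel)"
    by (intro Bochner_Integration.integral_cong) (auto simp: indicator_def)
  finally show ?thesis .
qed

end

context
  fixes L :: "complex^'n \<Rightarrow> complex^'n" and A :: "complex^'n \<Rightarrow> complex^'n^'n" and V
  assumes V: "open V" and inj: "inj_on L V"
    and der: "\<And>z. z \<in> V \<Longrightarrow> (L has_derivative ((*v) (A z))) (at z)"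
    and cont: "continuous_on V (\<lambda>z. det (A z))"
begin

lemma holomorphic_image_measure:
  assumes S: "S \<in> sets borel" "S \<subseteq> V" and LS: "L ` S \<in> sets borel"
  shows "emeasure lborel (L ` S) = (\<integral>\<^sup>+z. ennreal (indicator S z * (norm (det (A z)))\<^sup>2) \<partial>lborel)"
proof -
  have [measurable]: "complexify \<in> borel \<rightarrow>\<^sub>M (borel :: (complex^'n) measure)"
    by (intro borel_measurable_continuous_onI linear_continuous_on)
      (simp add: linear_complexify flip: linear_conv_bounded_linear)
  define g where "g = realify \<circ> L \<circ> complexify"
  define S' where "S' = complexify -` S"
  have S': "S' \<in> sets borel"
    unfolding S'_def by (rule measurable_sets_borel[OF _ S(1)]) measurable
  have gS': "g ` S' = complexify -` (L ` S)"
  proof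
    show "g ` S' \<subseteq> complexify -` (L ` S)"
      by (auto simp: g_def S'_def)
    show "complexify -` (L ` S) \<subseteq> g ` S'"
    proof
      fix x assume "x \<in> complexify -` (L ` S)"
      then obtain z where "z \<in> S" "complexify x = L z" by auto
      then have "x = g (realify z)" "realify z \<in> S'"
        by (simp_all add: g_def S'_def) (metis realify_complexify)
      then show "x \<in> g ` S'" by blast
    qed
  qed
  have dg: "(g has_derivative (realify \<circ> ((*v) (A (complexify x))) \<circ> complexify)) (at x within S')" if "x \<in> S'" for x
    unfolding g_def
    by (rule has_derivative_at_withinI, intro diff_chain_at linear_imp_has_derivative linear_complexify linear_realify)
      (use that S(2) der in \<open>auto simp: S'_def\<close>)
  have inj_g: "inj_on g S'"
    using inj S(2) unfolding g_def S'_def inj_on_def by (metis comp_apply complexify_realify realify_complexify subsetD vimageD)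
  have "emeasure lborel (L ` S) = emeasure (distr lborel borel complexify) (L ` S)"
    by (simp add: distr_complexify)
  also have "\<dots> = emeasure lborel (g ` S')"
    using LS by (simp add: emeasure_distr gS')
  also have "\<dots> = emeasure lebesgue (g ` S')"
    using measurable_sets_borel[OF \<open>complexify \<in> _\<close> LS] by (simp add: gS')
  also have "\<dots> = (\<integral>\<^sup>+x. ennreal (indicator S' x * \<bar>rdet ((*v) (A (complexify x)))\<bar>) \<partial>lebesgue)"
    unfolding rdet_def by (rule emeasure_differentiable_image[OF _ dg inj_g]) (use S' in auto)
  also have "\<dots> = (\<integral>\<^sup>+x. ennreal (indicator S' x * (norm (det (A (complexify x))))\<^sup>2) \<partial>lebesgue)"
    by (simp only: abs_rdet)
  also have "\<dots> = (\<integral>\<^sup>+x. ennreal (indicator S (complexify x) * (norm (det (A (complexify x))))\<^sup>2) \<partial>lborel)"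
    by (simp add: nn_integral_completion S'_def indicator_vimage o_def flip: indicator_vimage)
  also have "\<dots> = (\<integral>\<^sup>+z. ennreal (indicator S z * (norm (det (A z)))\<^sup>2) \<partial>distr lborel borel complexify)"
  proof (rule nn_integral_distr[symmetric])
    have "(\<lambda>z. indicator V z *\<^sub>R det (A z)) \<in> borel_measurable borel"
      using V cont by (intro borel_measurable_continuous_on_indicator) auto
    then have "(\<lambda>z. indicator S z * (norm (indicator V z *\<^sub>R det (A z)))\<^sup>2) \<in> borel_measurable borel"
      using S(1) by measurable
    also have "(\<lambda>z. indicator S z * (norm (indicator V z *\<^sub>R det (A z)))\<^sup>2) = (\<lambda>z. indicator S z * (norm (det (A z)))\<^sup>2)"
      using S(2) by (auto simp: indicator_def fun_eq_iff)
    finally show "(\<lambda>z. ennreal (indicator S z * (norm (det (A z)))\<^sup>2)) \<in> borel_measurable (distr lborel borel complexify)"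
      by simp
  qed simp
  finally show ?thesis by (simp add: distr_complexify)
qed

lemma holomorphic_continuous: "continuous_on V L" "continuous_on V (\<lambda>z. (norm (det (A z)))\<^sup>2)"
  using der cont by (auto intro!: continuous_at_imp_continuous_on continuous_intros dest: has_derivative_continuous)

lemma open_holomorphic_image: "open (L ` V)"
  using V inj holomorphic_continuous by (intro invariance_of_domain)

lemma nn_integral_holomorphic_cov:
  "f \<in> borel_measurable borel \<Longrightarrow> (\<integral>\<^sup>+u. indicator (L ` V) u * f u \<partial>lborel) =
    (\<integral>\<^sup>+z. ennreal (indicator V z * (norm (det (A z)))\<^sup>2) * f (L z) \<partial>lborel)"
  by (rule nn_integral_cov[OF V inj holomorphic_continuous holomorphic_image_measure])

lemma integral_holomorphic_cov:
  fixes f :: "complex^'n \<Rightarrow> complex"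
  shows "f \<in> borel_measurable borel \<Longrightarrow> (\<integral>u. indicator (L ` V) u *\<^sub>R f u \<partial>lborel) =
    (\<integral>z. (indicator V z * (norm (det (A z)))\<^sup>2) *\<^sub>R f (L z) \<partial>lborel)"
  by (rule integral_cov[OF V inj holomorphic_continuous holomorphic_image_measure]) auto

end

lemma
  fixes L :: "real^'n::{finite,wellorder} \<Rightarrow> real^'n::_"
  assumes V: "open V" and inj: "inj_on L V"
    and der: "\<And>t. t \<in> V \<Longrightarrow> (L has_derivative ((*v) (A t))) (at t)"
    and cont: "continuous_on V (\<lambda>t. det (A t))"
  shows nn_integral_real_cov: "\<And>f. f \<in> borel_measurable borel \<Longrightarrow> (\<integral>\<^sup>+u. indicator (L ` V) u * f u \<partial>lborel) =
      (\<integral>\<^sup>+t. ennreal (indicator V t * \<bar>det (A t)\<bar>) * f (L t) \<partial>lborel)"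
    and integral_real_cov: "\<And>f. f \<in> borel_measurable borel \<Longrightarrow> (\<integral>u. indicator (L ` V) u *\<^sub>R (f u :: complex) \<partial>lborel) =
      (\<integral>t. (indicator V t * \<bar>det (A t)\<bar>) *\<^sub>R f (L t) \<partial>lborel)"
    and open_real_image: "open (L ` V)"
proof -
  have contL: "continuous_on V L"
    using der by (auto intro!: continuous_at_imp_continuous_on dest: has_derivative_continuous)
  have contw: "continuous_on V (\<lambda>t. \<bar>det (A t)\<bar>)"
    using cont by (intro continuous_intros)
  have image: "emeasure lborel (L ` S) = (\<integral>\<^sup>+t. ennreal (indicator S t * \<bar>det (A t)\<bar>) \<partial>lborel)"
    if "S \<in> sets borel" "S \<subseteq> V" "L ` S \<in> sets borel" for S
  proof -
    have "emeasure lebesgue (L ` S) = (\<integral>\<^sup>+t. ennreal (indicator S t * \<bar>det (matrix ((*v) (A t)))\<bar>) \<partial>lebesgue)"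
      by (rule emeasure_differentiable_image)
        (use that der inj in \<open>auto intro: has_derivative_at_withinI inj_on_subset\<close>)
    then show ?thesis using that(3) by (simp add: nn_integral_completion)
  qed
  show "\<And>f. f \<in> borel_measurable borel \<Longrightarrow> (\<integral>\<^sup>+u. indicator (L ` V) u * f u \<partial>lborel) =
      (\<integral>\<^sup>+t. ennreal (indicator V t * \<bar>det (A t)\<bar>) * f (L t) \<partial>lborel)"
    by (rule nn_integral_cov[OF V inj contL contw image])
  show "\<And>f. f \<in> borel_measurable borel \<Longrightarrow> (\<integral>u. indicator (L ` V) u *\<^sub>R (f u :: complex) \<partial>lborel) =
      (\<integral>t. (indicator V t * \<bar>det (A t)\<bar>) *\<^sub>R f (L t) \<partial>lborel)"
    by (rule integral_cov[OF V inj contL contw image]) auto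
  show "open (L ` V)"
    by (rule open_cov_image[OF V inj contL contw image])
qed

text \<open>The splitting used for Fubini: in logarithmic coordinates the first component holds the
  values ln |P_j| and the second one the angles.\<close>

definition re_im_vec :: "(real^'n) \<times> (real^'n) \<Rightarrow> complex^'n" where
  "re_im_vec p = (\<chi> i. Complex (fst p $ i) (snd p $ i))"

lemma distr_re_im_vec: "distr lborel borel re_im_vec = (lborel :: (complex^'n::finite) measure)"
proof (rule distr_lborel_Basis_bij)
  show "linear re_im_vec"
    by (rule linearI) (simp_all add: re_im_vec_def vec_eq_iff complex_eq_iff)
  have ax: "re_im_vec (axis i 1, 0) = axis i 1" "re_im_vec (0, axis i 1) = axis i \<i>" for i :: 'n
    by (auto simp: re_im_vec_def axis_def vec_eq_iff complex_eq_iff)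
  have "inj re_im_vec"
    by (auto simp: inj_def re_im_vec_def vec_eq_iff prod_eq_iff)
  moreover have "re_im_vec ` Basis = (Basis :: (complex^'n) set)"
  proof
    show "re_im_vec ` Basis \<subseteq> (Basis :: (complex^'n) set)"
      by (auto simp: Basis_prod_def Basis_vec_def[where 'a = real] ax)
    show "Basis \<subseteq> re_im_vec ` (Basis :: ((real^'n) \<times> (real^'n)) set)"
    proof
      fix v :: "complex^'n" assume "v \<in> Basis"
      then obtain i where "v = axis i 1 \<or> v = axis i \<i>"
        by (auto simp: Basis_vec_def Basis_complex_def)
      then have "v = re_im_vec (axis i 1, 0) \<or> v = re_im_vec (0, axis i 1)"
        by (simp add: ax)
      then show "v \<in> re_im_vec ` Basis"
        by (auto simp: Basis_prod_def)
    qed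
  qed
  ultimately show "bij_betw re_im_vec Basis (Basis :: (complex^'n) set)"
    by (metis bij_betw_def inj_on_subset top_greatest)
qed

section \<open>Polynomial functions\<close>

text \<open>In contrast to \<open>cpoly\<close>, this class of functions is visibly closed under
  products and determinants, so Jacobians and cofactors stay inside it, and facts about derivatives
  follow by structural induction.\<close>

inductive polyfun :: "(complex^'n \<Rightarrow> complex) \<Rightarrow> bool" where
  polyfun_const: "polyfun (\<lambda>z. c)"
| polyfun_coord: "polyfun (\<lambda>z. z $ i)"
| polyfun_add: "polyfun f \<Longrightarrow> polyfun g \<Longrightarrow> polyfun (\<lambda>z. f z + g z)"
| polyfun_mult: "polyfun f \<Longrightarrow> polyfun g \<Longrightarrow> polyfun (\<lambda>z. f z * g z)"

lemma polyfun_sum: "(\<And>i. i \<in> I \<Longrightarrow> polyfun (f i)) \<Longrightarrow> polyfun (\<lambda>z. \<Sum>i\<in>I. f i z)"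
  by (induction I rule: infinite_finite_induct) (auto intro: polyfun.intros)

lemma polyfun_prod: "(\<And>i. i \<in> I \<Longrightarrow> polyfun (f i)) \<Longrightarrow> polyfun (\<lambda>z. \<Prod>i\<in>I. f i z)"
  by (induction I rule: infinite_finite_induct) (auto intro: polyfun.intros)

lemma polyfun_power: "polyfun f \<Longrightarrow> polyfun (\<lambda>z. f z ^ k)"
  by (induction k) (auto intro: polyfun.intros)

lemma polyfun_peval: "polyfun (peval p)"
  unfolding peval_def by (intro polyfun_sum polyfun_mult polyfun_prod polyfun_power polyfun.intros)

lemma polyfun_det:
  assumes "\<And>i j. polyfun (\<lambda>z. A z $ i $ j)"
  shows "polyfun (\<lambda>z. det (A z :: complex^'m^'m))"
  unfolding det_def by (intro polyfun_sum polyfun_mult polyfun_prod polyfun.intros assms)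

text \<open>A real derivative along the i-th real axis. For polynomial functions the differential is
  complex linear by \<open>polyfun_pd\<close>, so this is the complex partial derivative.\<close>

definition pd :: "(complex^'n \<Rightarrow> complex) \<Rightarrow> 'n \<Rightarrow> complex^'n \<Rightarrow> complex" where
  "pd f i z = frechet_derivative f (at z) (axis i 1)"

lemma pd_eqI:
  assumes "(f has_derivative (\<lambda>v. \<Sum>i\<in>UNIV. D i * v $ i)) (at z)"
  shows "pd f i z = D i"
proof -
  have "frechet_derivative f (at z) = (\<lambda>v. \<Sum>i\<in>UNIV. D i * v $ i)"
    using frechet_derivative_at[OF assms] by simp
  then show ?thesis
    by (simp add: pd_def axis_def if_distrib cong: if_cong)
qed

text \<open>The existence of polynomial partial derivatives passes through sums and products;
  uniqueness of the derivative then identifies them with \<open>pd\<close>.\<close>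

lemma polyfun_pd:
  assumes "polyfun f"
  shows "(f has_derivative (\<lambda>v. \<Sum>i\<in>UNIV. pd f i z * v $ i)) (at z)" and "polyfun (pd f i)"
proof -
  have "\<exists>D. (\<forall>i. polyfun (D i)) \<and> (\<forall>z. (f has_derivative (\<lambda>v. \<Sum>i\<in>UNIV. D i z * v $ i)) (at z))"
    using assms
  proof induction
    case (polyfun_const c)
    show ?case by (rule exI[of _ "\<lambda>_ _. 0"]) (auto intro: polyfun.intros)
  next
    case (polyfun_coord i)
    have "((\<lambda>z. z $ i) has_derivative (\<lambda>v. v $ i)) (at z)" for z :: "complex^'a"
      by (rule bounded_linear_imp_has_derivative) (rule bounded_linear_vec_nth)
    moreover have "(\<Sum>j\<in>UNIV. (if j = i then 1 else 0) * v $ j) = v $ i" for v :: "complex^'a"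
      by (simp add: if_distrib[of "\<lambda>x. x * y" for y] cong: if_cong)
    ultimately show ?case
      by (intro exI[of _ "\<lambda>j _. if j = i then 1 else 0"]) (auto intro: polyfun.intros)
  next
    case (polyfun_add f g)
    then obtain D E where "\<forall>i. polyfun (D i)" "\<forall>i. polyfun (E i)"
      and "\<forall>z. (f has_derivative (\<lambda>v. \<Sum>i\<in>UNIV. D i z * v $ i)) (at z)"
      and "\<forall>z. (g has_derivative (\<lambda>v. \<Sum>i\<in>UNIV. E i z * v $ i)) (at z)"
      by blast
    then show ?case
      by (intro exI[of _ "\<lambda>i z. D i z + E i z"])
        (auto intro!: polyfun.intros derivative_eq_intros simp: distrib_right sum.distrib)
  next
    case (polyfun_mult f g)
    then obtain D E where "\<forall>i. polyfun (D i)" "\<forall>i. polyfun (E i)"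
      and "\<forall>z. (f has_derivative (\<lambda>v. \<Sum>i\<in>UNIV. D i z * v $ i)) (at z)"
      and "\<forall>z. (g has_derivative (\<lambda>v. \<Sum>i\<in>UNIV. E i z * v $ i)) (at z)"
      by blast
    then show ?case using polyfun_mult.hyps
      by (intro exI[of _ "\<lambda>i z. f z * E i z + D i z * g z"])
        (auto intro!: polyfun.intros derivative_eq_intros
          simp: algebra_simps sum.distrib sum_distrib_left sum_distrib_right)
  qed
  then obtain D where D: "\<And>i. polyfun (D i)"
    "\<And>z. (f has_derivative (\<lambda>v. \<Sum>i\<in>UNIV. D i z * v $ i)) (at z)" by blast
  have "pd f = D"
    using D(2) by (intro ext) (rule pd_eqI)
  then show "(f has_derivative (\<lambda>v. \<Sum>i\<in>UNIV. pd f i z * v $ i)) (at z)" "polyfun (pd f i)"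
    using D by simp_all
qed

lemma polyfun_continuous: "polyfun f \<Longrightarrow> continuous_on S f"
  by (meson continuous_at_imp_continuous_on has_derivative_continuous polyfun_pd(1))

lemma pd_const: "pd (\<lambda>z. c) = (\<lambda>i z. 0)"
  by (intro ext, rule pd_eqI) simp

lemma pd_coord: "pd (\<lambda>z. z $ k) = (\<lambda>i z. if i = k then 1 else 0)"
proof (intro ext, rule pd_eqI)
  fix z :: "complex^'a"
  have "((\<lambda>z. z $ k) has_derivative (\<lambda>v. v $ k)) (at z)"
    by (rule bounded_linear_imp_has_derivative) (rule bounded_linear_vec_nth)
  moreover have "(\<lambda>v. v $ k) = (\<lambda>v :: complex^'a. \<Sum>j\<in>UNIV. (if j = k then 1 else 0) * v $ j)"
    by (simp add: if_distrib[of "\<lambda>x. x * y" for y] cong: if_cong)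
  ultimately show "((\<lambda>z. z $ k) has_derivative (\<lambda>v. \<Sum>j\<in>UNIV. (if j = k then 1 else 0) * v $ j)) (at z)"
    by simp
qed

lemma pd_add:
  assumes "polyfun f" "polyfun g"
  shows "pd (\<lambda>z. f z + g z) = (\<lambda>i z. pd f i z + pd g i z)"
  by (intro ext, rule pd_eqI)
    (auto intro!: derivative_eq_intros polyfun_pd(1) assms simp: distrib_right sum.distrib)

lemma pd_mult:
  assumes "polyfun f" "polyfun g"
  shows "pd (\<lambda>z. f z * g z) = (\<lambda>i z. f z * pd g i z + pd f i z * g z)"
  by (intro ext, rule pd_eqI)
    (auto intro!: derivative_eq_intros polyfun_pd(1) assms
      simp: algebra_simps sum.distrib sum_distrib_left sum_distrib_right)

lemma pd_sum:
  assumes "\<And>j. j \<in> I \<Longrightarrow> polyfun (f j)"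
  shows "pd (\<lambda>z. \<Sum>j\<in>I. f j z) i z = (\<Sum>j\<in>I. pd (f j) i z)"
  using assms by (induction I rule: infinite_finite_induct) (simp_all add: pd_const pd_add polyfun_sum)

lemma pd_prod:
  assumes "finite I" "\<And>j. j \<in> I \<Longrightarrow> polyfun (f j)"
  shows "pd (\<lambda>z. \<Prod>j\<in>I. f j z) i z = (\<Sum>j\<in>I. pd (f j) i z * (\<Prod>l\<in>I - {j}. f l z))"
  using assms
proof (induction I rule: finite_induct)
  case empty
  then show ?case by (simp add: pd_const)
next
  case (insert x I)
  have "(\<Sum>j\<in>I. pd (f j) i z * (\<Prod>l\<in>insert x I - {j}. f l z))
      = (\<Sum>j\<in>I. f x z * (pd (f j) i z * (\<Prod>l\<in>I - {j}. f l z)))"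
  proof (rule sum.cong)
    fix j assume "j \<in> I"
    then have "insert x I - {j} = insert x (I - {j})" using insert.hyps by auto
    then show "pd (f j) i z * (\<Prod>l\<in>insert x I - {j}. f l z) = f x z * (pd (f j) i z * (\<Prod>l\<in>I - {j}. f l z))"
      using insert.hyps by (simp add: mult_ac)
  qed simp
  moreover have "insert x I - {x} = I" using insert.hyps by auto
  ultimately show ?case
    using insert by (simp add: pd_mult polyfun_prod sum_distrib_left)
qed

lemma pd_commute:
  assumes "polyfun f"
  shows "pd (pd f i) j z = pd (pd f j) i z"
  using assms
proof (induction arbitrary: z)
  case (polyfun_add f g)
  then show ?case by (simp add: pd_add polyfun_pd(2))
next
  case (polyfun_mult f g)
  then show ?case
    by (simp add: pd_mult pd_add polyfun_pd(2) polyfun.polyfun_mult)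
qed (simp_all add: pd_const pd_coord)

lemma pd_det:
  assumes A: "\<And>i m. polyfun (A i m)"
  shows "pd (\<lambda>z. det (\<chi> i m. A i m z)) l z =
    (\<Sum>j\<in>UNIV. det (\<chi> i m. if i = j then pd (A i m) l z else A i m z))"
proof -
  let ?P = "{p. p permutes (UNIV :: 'a set)}"
  have "pd (\<lambda>z. det (\<chi> i m. A i m z)) l z =
      (\<Sum>p\<in>?P. of_int (sign p) * (\<Sum>j\<in>UNIV. pd (A j (p j)) l z * (\<Prod>i\<in>UNIV - {j}. A i (p i) z)))"
    unfolding det_def vec_lambda_beta
    by (simp add: pd_sum pd_mult pd_prod pd_const A polyfun_prod polyfun_mult polyfun_const)
  also have "\<dots> = (\<Sum>j\<in>UNIV. \<Sum>p\<in>?P. of_int (sign p) * (pd (A j (p j)) l z * (\<Prod>i\<in>UNIV - {j}. A i (p i) z)))"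
    unfolding sum_distrib_left by (rule sum.swap)
  also have "\<dots> = (\<Sum>j\<in>UNIV. det (\<chi> i m. if i = j then pd (A i m) l z else A i m z))"
  proof (rule sum.cong[OF refl])
    fix j :: 'a
    have "(\<Prod>i\<in>UNIV. if i = j then pd (A i (p i)) l z else A i (p i) z) =
        pd (A j (p j)) l z * (\<Prod>i\<in>UNIV - {j}. A i (p i) z)" for p
      by (subst prod.remove[of UNIV j]) auto
    then show "(\<Sum>p\<in>?P. of_int (sign p) * (pd (A j (p j)) l z * (\<Prod>i\<in>UNIV - {j}. A i (p i) z))) =
        det (\<chi> i m. if i = j then pd (A i m) l z else A i m z)"
      unfolding det_def vec_lambda_beta by simp
  qed
  finally show ?thesis .
qed

lemma polyfun_on_line:
  assumes "polyfun f"
  shows "\<exists>p. \<forall>s::real. f (a + s *\<^sub>R v) = poly p (of_real s)"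
  using assms
proof induction
  case (polyfun_const c)
  show ?case by (rule exI[of _ "[:c:]"]) simp
next
  case (polyfun_coord i)
  show ?case by (rule exI[of _ "[:a $ i, v $ i:]"]) (simp add: scaleR_conv_of_real[where 'a = complex])
next
  case (polyfun_add f g)
  then show ?case by (metis poly_add)
next
  case (polyfun_mult f g)
  then show ?case by (metis poly_mult)
qed

text \<open>On every ray from a point where \<open>f\<close> does not vanish, \<open>f\<close> has only finitely many zeros. By
  Fubini, almost all dilates of the zero set are null, hence so is the zero set itself.\<close>

lemma negligible_polyfun_zeros:
  assumes f: "polyfun f" and a: "f a \<noteq> 0"
  shows "negligible {z. f z = 0}"
proof -
  define Z where "Z = {z. f z = 0}"
  have Z [measurable]: "Z \<in> sets borel"
    unfolding Z_def using closed_Collect_eq[OF polyfun_continuous[OF f] continuous_on_const] by simp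
  define T where "T s = (\<lambda>x. a + s *\<^sub>R x)" for s :: real and x :: "complex^'a"
  have T [measurable]: "(\<lambda>(x, s). T s x) \<in> borel \<Otimes>\<^sub>M borel \<rightarrow>\<^sub>M borel"
    unfolding T_def by measurable
  have fin: "finite {s. T s x \<in> Z}" for x
  proof -
    obtain p where p: "\<And>s::real. f (a + s *\<^sub>R x) = poly p (of_real s)"
      using polyfun_on_line[OF f] by blast
    have "p \<noteq> 0" using p[of 0] a by auto
    then have "finite {w. poly p w = 0}" by (rule poly_roots_finite)
    then have "finite (of_real -` {w. poly p w = 0} :: real set)"
      by (rule finite_vimageI) (simp add: inj_on_def)
    then show ?thesis by (simp add: T_def Z_def p vimage_def)
  qed
  have "(\<integral>\<^sup>+s. (\<integral>\<^sup>+x. indicator Z (T s x) \<partial>lborel) \<partial>lborel) = (\<integral>\<^sup>+x. (\<integral>\<^sup>+s. indicator Z (T s x) \<partial>lborel) \<partial>lborel)"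
    by (rule lborel_pair.Fubini') measurable
  also have "\<dots> = (\<integral>\<^sup>+x. emeasure lborel {s. T s x \<in> Z} \<partial>lborel)"
  proof (rule nn_integral_cong)
    fix x
    have "(\<integral>\<^sup>+s. indicator Z (T s x) \<partial>lborel) = (\<integral>\<^sup>+s. indicator {s. T s x \<in> Z} s \<partial>lborel)"
      by (intro nn_integral_cong) (simp add: indicator_def)
    also have "\<dots> = emeasure lborel {s. T s x \<in> Z}"
      using finite_imp_closed[OF fin] by (intro nn_integral_indicator) simp
    finally show "(\<integral>\<^sup>+s. indicator Z (T s x) \<partial>lborel) = emeasure lborel {s. T s x \<in> Z}" .
  qed
  also have "\<dots> = 0"
    by (simp add: emeasure_lborel_countable countable_finite fin)
  finally have "(\<integral>\<^sup>+s. (\<integral>\<^sup>+x. indicator Z (T s x) \<partial>lborel) \<partial>lborel) = 0" .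
  then have "AE s in lborel. (\<integral>\<^sup>+x. indicator Z (T s x) \<partial>lborel) = 0"
    by (subst (asm) nn_integral_0_iff_AE) (auto intro!: lborel.borel_measurable_nn_integral_fst)
  \<comment> \<open>The interval has positive measure, so it contains a good \<open>s\<close>, and
    it keeps \<open>s\<close> away from 0, so that the dilation can be inverted.\<close>
  then obtain s where s: "(\<integral>\<^sup>+x. indicator Z (T s x) \<partial>lborel) = 0" "s \<in> {1..2}"
  proof -
    assume *: "AE s in lborel. (\<integral>\<^sup>+x. indicator Z (T s x) \<partial>lborel) = 0"
    assume hyp: "\<And>s. (\<integral>\<^sup>+x. indicator Z (T s x) \<partial>lborel) = 0 \<Longrightarrow> s \<in> {1..2} \<Longrightarrow> thesis"
    show thesis
    proof (rule ccontr)
      assume "\<not> thesis"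
      then have "AE s in lborel. s \<notin> {1..2::real}"
        using * hyp by (auto elim!: eventually_mono)
      then have "emeasure lborel {1..2::real} = 0"
        by (subst (asm) AE_iff_measurable[of "{1..2}"]) auto
      then show False by simp
    qed
  qed
  have "emeasure lborel {x. T s x \<in> Z} = 0"
  proof -
    have "T s -` Z \<in> sets borel"
      unfolding T_def by (rule measurable_sets_borel[OF _ Z]) measurable
    then have "emeasure lborel (T s -` Z) = (\<integral>\<^sup>+x. indicator (T s -` Z) x \<partial>lborel)"
      by simp
    also have "\<dots> = 0"
      using s(1) by (simp add: indicator_def of_bool_def)
    finally show ?thesis by (simp add: vimage_def)
  qed
  then have "negligible {x. T s x \<in> Z}"
    by (intro negligible_iff_null_sets[THEN iffD2] null_setsI) auto
  then have "negligible (T s ` {x. T s x \<in> Z})"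
    by (rule negligible_differentiable_image_negligible[rotated])
      (auto simp: T_def differentiable_on_def intro!: derivative_intros)
  moreover have "Z \<subseteq> T s ` {x. T s x \<in> Z}"
  proof
    fix z assume "z \<in> Z"
    then show "z \<in> T s ` {x. T s x \<in> Z}"
      using s(2) by (intro image_eqI[of _ _ "(z - a) /\<^sub>R s"]) (auto simp: T_def)
  qed
  ultimately show ?thesis
    unfolding Z_def using negligible_subset by blast
qed

lemma norm_peval_le:
  shows "\<exists>C\<ge>0. \<forall>z. norm (peval p z) \<le> C * (1 + norm z) ^ total_degree p"
proof -
  define C where "C = (\<Sum>m\<in>Poly_Mapping.keys p. norm (Poly_Mapping.lookup p m))"
  have "norm (peval p z) \<le> C * (1 + norm z) ^ total_degree p" for z
  proof -
    have "norm (\<Prod>i\<in>UNIV. z $ i ^ Poly_Mapping.lookup m i) \<le> (1 + norm z) ^ total_degree p"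
      if m: "m \<in> Poly_Mapping.keys p" for m
    proof -
      have "norm (\<Prod>i\<in>UNIV. z $ i ^ Poly_Mapping.lookup m i) = (\<Prod>i\<in>UNIV. norm (z $ i) ^ Poly_Mapping.lookup m i)"
        by (simp add: prod_norm[symmetric] norm_power)
      also have "\<dots> \<le> (\<Prod>i\<in>UNIV. (1 + norm z) ^ Poly_Mapping.lookup m i)"
      proof (intro prod_mono conjI power_mono)
        fix i show "norm (z $ i) \<le> 1 + norm z"
          by (rule order_trans[OF Finite_Cartesian_Product.norm_nth_le]) simp
      qed auto
      also have "\<dots> = (1 + norm z) ^ (\<Sum>i\<in>UNIV. Poly_Mapping.lookup m i)"
        by (simp add: power_sum)
      also have "\<dots> \<le> (1 + norm z) ^ total_degree p"
      proof (rule power_increasing)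
        show "(\<Sum>i\<in>UNIV. Poly_Mapping.lookup m i) \<le> total_degree p"
          unfolding total_degree_def using m by (intro Max_ge) auto
      qed simp
      finally show ?thesis .
    qed
    then have "norm (peval p z) \<le> (\<Sum>m\<in>Poly_Mapping.keys p. norm (Poly_Mapping.lookup p m) * (1 + norm z) ^ total_degree p)"
      unfolding peval_def
      by (intro sum_norm_le) (auto simp: norm_mult intro!: mult_left_mono)
    then show ?thesis by (simp add: C_def sum_distrib_right)
  qed
  moreover have "C \<ge> 0" by (simp add: C_def sum_nonneg)
  ultimately show ?thesis by blast
qed

section \<open>A divergence identity\<close>

text \<open>The difference quotients of \<open>f\<close> in direction \<open>v\<close> integrate to
  0 by translation invariance, and they converge to the derivative under a common bound with compact
  support.\<close>

lemma integral_directional_derivative: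
  fixes f :: "'a::euclidean_space \<Rightarrow> complex"
  assumes K: "compact K" and f0: "\<And>x. x \<notin> K \<Longrightarrow> f x = 0"
    and der: "\<And>x. (f has_derivative f' x) (at x)"
    and cont: "continuous_on UNIV (\<lambda>x. f' x v)"
  shows "integrable lborel (\<lambda>x. f' x v)" and "(\<integral>x. f' x v \<partial>lborel) = 0"
proof -
  have oK: "open (- K)" using K by (simp add: compact_imp_closed open_Compl)
  have g0: "f' x v = 0" if "x \<notin> K" for x
  proof -
    have "(f has_derivative (\<lambda>_. 0)) (at x)"
      by (rule has_derivative_transform_within_open[OF _ oK]) (use that f0 in auto)
    then have "f' x = (\<lambda>_. 0)"
      using der[of x] has_derivative_unique by blast
    then show ?thesis by simp
  qed
  obtain B where B: "\<And>x. norm (f' x v) \<le> B" "B \<ge> 0"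
  proof -
    have "bounded ((\<lambda>x. f' x v) ` K)"
      using K cont by (intro compact_imp_bounded compact_continuous_image) (auto intro: continuous_on_subset)
    then obtain B where "B > 0" "\<And>x. x \<in> K \<Longrightarrow> norm (f' x v) \<le> B"
      by (auto simp: bounded_pos)
    then have "norm (f' x v) \<le> B" for x
      using g0[of x] by (cases "x \<in> K") auto
    then show ?thesis using \<open>B > 0\<close> that by (meson less_imp_le)
  qed
  have contf: "continuous_on UNIV f"
    using der by (auto intro!: continuous_at_imp_continuous_on dest: has_derivative_continuous)
  have ind: "indicator K x *\<^sub>R f x = f x" "indicator K x *\<^sub>R f' x v = f' x v" for x
    using f0[of x] g0[of x] by (auto simp: indicator_def)
  have intf: "integrable lborel f"
    using borel_integrable_compact[OF K, of f] contf by (simp add: ind continuous_on_subset)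
  show "integrable lborel (\<lambda>x. f' x v)"
    using borel_integrable_compact[OF K, of "\<lambda>x. f' x v"] cont by (simp add: ind continuous_on_subset)
  define t where "t n = 1 / real (Suc n)" for n
  have t: "0 < t n" "t n \<le> 1" for n by (auto simp: t_def)
  define D where "D n x = (f (x + t n *\<^sub>R v) - f x) /\<^sub>R t n" for n x
  have transl: "integrable lborel (\<lambda>x. f (x + c))" "(\<integral>x. f (x + c) \<partial>lborel) = (\<integral>x. f x \<partial>lborel)" for c
  proof -
    have m: "(+) c \<in> lborel \<rightarrow>\<^sub>M borel" by simp
    have fm: "f \<in> borel_measurable borel" using contf by (rule borel_measurable_continuous_onI)
    have "integrable (distr lborel borel ((+) c)) f" using intf by (simp add: lborel_distr_plus)
    then show "integrable lborel (\<lambda>x. f (x + c))"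
      using integrable_distr_eq[OF m fm] by (simp add: add.commute)
    show "(\<integral>x. f (x + c) \<partial>lborel) = (\<integral>x. f x \<partial>lborel)"
      using integral_distr[OF m fm] by (simp add: lborel_distr_plus add.commute)
  qed
  have D0: "(\<integral>x. D n x \<partial>lborel) = 0" for n
    unfolding D_def using transl[of "t n *\<^sub>R v"] intf by simp
  \<comment> \<open>The points from which a multiple of \<open>v\<close> with factor at most 1 leads
    into \<open>K\<close>. Every difference quotient vanishes outside this compact set.\<close>
  define K' where "K' = (\<lambda>(x, s). x - s *\<^sub>R v) ` (K \<times> {0..1::real})"
  have K': "compact K'"
    unfolding K'_def using K
    by (intro compact_continuous_image compact_Times) (auto intro!: continuous_intros simp: split_beta)
  have bound: "norm (D n x) \<le> indicator K' x * B" for n x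
  proof (cases "x \<in> K'")
    case True
    have "norm (f (x + t n *\<^sub>R v) - f (x + 0 *\<^sub>R v)) \<le> B * norm (t n - 0)"
    proof (rule differentiable_bound[of "{0..t n}" "\<lambda>s. f (x + s *\<^sub>R v)" "\<lambda>s r. f' (x + s *\<^sub>R v) (r *\<^sub>R v)"])
      fix s
      show "((\<lambda>s. f (x + s *\<^sub>R v)) has_derivative (\<lambda>r. f' (x + s *\<^sub>R v) (r *\<^sub>R v))) (at s within {0..t n})"
        by (rule has_derivative_compose[OF _ der]) (auto intro!: derivative_eq_intros)
      have "f' (x + s *\<^sub>R v) (r *\<^sub>R v) = r *\<^sub>R f' (x + s *\<^sub>R v) v" for r
        using der[of "x + s *\<^sub>R v"] by (meson has_derivative_linear linear_scale)
      then show "onorm (\<lambda>r. f' (x + s *\<^sub>R v) (r *\<^sub>R v)) \<le> B"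
        using B by (intro onorm_le) (simp add: mult.commute[of B] mult_left_mono)
    qed (use t[of n] in auto)
    then show ?thesis
      using True t[of n] by (simp add: D_def divide_simps mult.commute)
  next
    case False
    have notK: "x + s *\<^sub>R v \<notin> K" if "s \<in> {0..1}" for s
    proof
      assume "x + s *\<^sub>R v \<in> K"
      then have "x \<in> K'"
        unfolding K'_def using that by (intro image_eqI[of _ _ "(x + s *\<^sub>R v, s)"]) auto
      then show False using False by simp
    qed
    from notK[of "t n"] notK[of 0] show ?thesis
      using t[of n] False by (simp add: D_def f0)
  qed
  have lim: "(\<lambda>n. D n x) \<longlonglongrightarrow> f' x v" for x
  proof -
    have "((\<lambda>s. f (x + s *\<^sub>R v)) has_vector_derivative f' x v) (at 0)"
      unfolding has_vector_derivative_def
    proof (rule has_derivative_eq_rhs)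
      show "((\<lambda>s. f (x + s *\<^sub>R v)) has_derivative (\<lambda>r. f' (x + 0 *\<^sub>R v) (r *\<^sub>R v))) (at 0)"
        by (rule has_derivative_compose[OF _ der]) (auto intro!: derivative_eq_intros)
      show "(\<lambda>r. f' (x + 0 *\<^sub>R v) (r *\<^sub>R v)) = (\<lambda>r. r *\<^sub>R f' x v)"
        using der[of x] by (auto simp: fun_eq_iff dest!: has_derivative_linear intro: linear_scale)
    qed
    then have "((\<lambda>s. norm (f (x + s *\<^sub>R v) - f x - s *\<^sub>R f' x v) / norm s) \<longlongrightarrow> 0) (at 0)"
      by (simp add: has_vector_derivative_def has_derivative_at)
    moreover have "eventually (\<lambda>s. norm (f (x + s *\<^sub>R v) - f x - s *\<^sub>R f' x v) / norm s =
        norm ((f (x + s *\<^sub>R v) - f x) /\<^sub>R s - f' x v)) (at 0)"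
    proof (simp add: eventually_at_filter, intro always_eventually allI impI)
      fix s :: real assume "s \<noteq> 0"
      then have "(f (x + s *\<^sub>R v) - f x) /\<^sub>R s - f' x v = (f (x + s *\<^sub>R v) - f x - s *\<^sub>R f' x v) /\<^sub>R s"
        by (simp add: scaleR_diff_right)
      then show "norm (f (x + s *\<^sub>R v) - f x - s *\<^sub>R f' x v) / \<bar>s\<bar> =
          norm ((f (x + s *\<^sub>R v) - f x) /\<^sub>R s - f' x v)"
        by (simp add: divide_inverse mult.commute)
    qed
    ultimately have "((\<lambda>s. norm ((f (x + s *\<^sub>R v) - f x) /\<^sub>R s - f' x v)) \<longlongrightarrow> 0) (at 0)"
      by (rule Lim_transform_eventually)
    then have "((\<lambda>s. (f (x + s *\<^sub>R v) - f x) /\<^sub>R s) \<longlongrightarrow> f' x v) (at 0)"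
      by (simp add: tendsto_norm_zero_iff LIM_zero_iff)
    moreover have "filterlim t (at 0) sequentially"
    proof -
      have "t \<longlonglongrightarrow> 0"
        unfolding t_def using LIMSEQ_inverse_real_of_nat by (simp add: divide_inverse del: of_nat_Suc)
      then show ?thesis
        unfolding filterlim_at using t by (simp add: less_imp_neq[THEN not_sym])
    qed
    ultimately show ?thesis
      unfolding D_def by (rule filterlim_compose[where g = "\<lambda>s. (f (x + s *\<^sub>R v) - f x) /\<^sub>R s"])
  qed
  have "(\<lambda>n. \<integral>x. D n x \<partial>lborel) \<longlonglongrightarrow> (\<integral>x. f' x v \<partial>lborel)"
  proof (rule integral_dominated_convergence[where w = "\<lambda>x. indicator K' x * B"])
    show "integrable lborel (\<lambda>x. indicator K' x * B)"
      using borel_integrable_compact[OF K', of "\<lambda>_. B"] by simp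
    show "(\<lambda>x. f' x v) \<in> borel_measurable lborel"
      using cont by (simp add: borel_measurable_continuous_onI)
    show "D n \<in> borel_measurable lborel" for n
      unfolding D_def using contf
      by (auto intro!: borel_measurable_continuous_onI continuous_intros continuous_on_compose2[OF contf])
  qed (use lim bound in auto)
  then show "(\<integral>x. f' x v \<partial>lborel) = 0"
    using LIMSEQ_unique by (simp add: D0) blast
qed

section \<open>Cofactors of the Jacobian matrix and the Piola identity\<close>

definition jac :: "('n \<Rightarrow> complex^'n \<Rightarrow> complex) \<Rightarrow> complex^'n \<Rightarrow> complex" where
  "jac P z = det (\<chi> i m. pd (P i) m z)"

text \<open>The cofactor of the entry (k, l), written as a determinant of full size: putting a unit
  vector into row \<open>k\<close> keeps the index type and makes expansion along that row an
  instance of linearity.\<close>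

definition cofac :: "('n \<Rightarrow> complex^'n \<Rightarrow> complex) \<Rightarrow> 'n \<Rightarrow> 'n \<Rightarrow> complex^'n \<Rightarrow> complex" where
  "cofac P k l z = det (\<chi> i m. if i = k then of_bool (m = l) else pd (P i) m z)"

lemma det_row_expand:
  fixes C :: "'n::finite \<Rightarrow> 'n \<Rightarrow> complex"
  shows "det (\<chi> i m. if i = k then a m else C i m) =
   (\<Sum>l\<in>UNIV. a l * det (\<chi> i m. if i = k then of_bool (m = l) else C i m))"
proof -
  have "(\<chi> i m. if i = k then a m else C i m) =
      (\<chi> i. if i = k then (\<Sum>l\<in>UNIV. a l *s (\<chi> m. of_bool (m = l))) else (\<chi> m. C i m))"
    by (auto simp: vec_eq_iff of_bool_def if_distrib cong: if_cong)
  moreover have "(\<chi> i. if i = k then \<chi> m. of_bool (m = l) else (\<chi> m. C i m)) =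
     (\<chi> i m. if i = k then of_bool (m = l) else C i m)" for l
    by (simp add: vec_eq_iff)
  ultimately show ?thesis
    by (simp add: det_linear_row_sum[where a = "\<lambda>_ l. a l *s (\<chi> m. of_bool (m = l))"] det_row_mul)
qed

text \<open>This is the expansion along row \<open>k\<close> after that row has been replaced by the
  gradient of P_j; for j different from \<open>k\<close> two rows coincide.\<close>

lemma cofac_pd:
  "(\<Sum>l\<in>UNIV. pd (P j) l z * cofac P k l z) = (if j = k then jac P z else 0)"
proof -
  have "(\<Sum>l\<in>UNIV. pd (P j) l z * cofac P k l z) = det (\<chi> i m. if i = k then pd (P j) m z else pd (P i) m z)"
    unfolding cofac_def by (rule det_row_expand[symmetric])
  also have "\<dots> = (if j = k then jac P z else 0)"
  proof (cases "j = k")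
    case True
    then have "(\<chi> i m. if i = k then pd (P j) m z else pd (P i) m z) = (\<chi> i m. pd (P i) m z)"
      by (simp add: vec_eq_iff)
    then show ?thesis using True by (simp add: jac_def)
  next
    case False
    then have "det (\<chi> i m. if i = k then pd (P j) m z else pd (P i) m z) = 0"
      by (intro det_identical_rows[of j k]) (auto simp: row_def vec_eq_iff)
    then show ?thesis using False by simp
  qed
  finally show ?thesis .
qed

text \<open>Differentiating the cofactor row by row puts second derivatives of P_j into row
  \<open>j\<close>. They are symmetric in m and l, whereas exchanging m and l in
  \<open>d j m l\<close> exchanges the rows \<open>j\<close> and \<open>k\<close> and changes the
  sign. So the double sum over m and l cancels for each j.\<close>

lemma piola:
  assumes P: "\<And>j. polyfun (P j)"
  shows "(\<Sum>l\<in>UNIV. pd (cofac P k l) l z) = 0"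
proof -
  define d where "d j m l = det (\<chi> i m'. if i = j then of_bool (m' = m) else
     (if i = k then of_bool (m' = l) else pd (P i) m' z))" for j m l
  define H where "H j m l = pd (pd (P j) m) l z" for j m l
  have anti: "d j l m = - d j m l" if "j \<noteq> k" for j m l
  proof -
    let ?A = "\<chi> i m'. if i = j then of_bool (m' = m) else (if i = k then of_bool (m' = l) else pd (P i) m' z)"
    have "(\<chi> i m'. if i = j then of_bool (m' = l) else (if i = k then of_bool (m' = m) else pd (P i) m' z))
        = (\<chi> i. ?A $ Transposition.transpose j k i)"
      using that by (auto simp: vec_eq_iff Transposition.transpose_def)
    then have "d j l m = of_int (sign (Transposition.transpose j k)) * det ?A"
      unfolding d_def by (simp only:) (rule det_permute_rows, simp add: permutes_swap_id)
    then show ?thesis using that by (simp add: sign_swap_id d_def)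
  qed
  have "pd (cofac P k l) l z = (\<Sum>j\<in>UNIV - {k}. \<Sum>m\<in>UNIV. H j m l * d j m l)" for l
  proof -
    define A where "A i m = (if i = k then (\<lambda>_. of_bool (m = l)) else pd (P i) m)" for i m
    have polyA: "polyfun (A i m)" for i m
      by (auto simp: A_def intro: polyfun_const polyfun_pd(2) P)
    have "cofac P k l = (\<lambda>z. det (\<chi> i m. A i m z))"
      by (auto simp: cofac_def A_def fun_eq_iff intro!: arg_cong[where f = det] simp: vec_eq_iff)
    then have "pd (cofac P k l) l z = (\<Sum>j\<in>UNIV. det (\<chi> i m. if i = j then pd (A i m) l z else A i m z))"
      using pd_det[OF polyA] by simp
    also have "\<dots> = (\<Sum>j\<in>UNIV - {k}. det (\<chi> i m. if i = j then pd (A i m) l z else A i m z))"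
    proof (rule sum.mono_neutral_right)
      have "det (\<chi> i m. if i = k then pd (A i m) l z else A i m z) = 0"
        by (rule det_zero_row(2)[of k]) (simp add: row_def vec_eq_iff A_def pd_const)
      then show "\<forall>i\<in>UNIV - (UNIV - {k}). det (\<chi> ia m. if ia = i then pd (A ia m) l z else A ia m z) = 0"
        by auto
    qed auto
    also have "\<dots> = (\<Sum>j\<in>UNIV - {k}. \<Sum>m\<in>UNIV. H j m l * d j m l)"
    proof (rule sum.cong[OF refl])
      fix j assume "j \<in> UNIV - {k}"
      then have "(\<chi> i m. if i = j then pd (A i m) l z else A i m z) =
        (\<chi> i m. if i = j then H j m l else (if i = k then of_bool (m = l) else pd (P i) m z))"
        by (auto simp: vec_eq_iff A_def H_def)
      then show "det (\<chi> i m. if i = j then pd (A i m) l z else A i m z) = (\<Sum>m\<in>UNIV. H j m l * d j m l)"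
        unfolding d_def by (simp only: det_row_expand[of j "\<lambda>m. H j m l"])
    qed
    finally show ?thesis .
  qed
  then have "(\<Sum>l\<in>UNIV. pd (cofac P k l) l z) = (\<Sum>l\<in>UNIV. \<Sum>j\<in>UNIV - {k}. \<Sum>m\<in>UNIV. H j m l * d j m l)"
    by simp
  also have "\<dots> = (\<Sum>j\<in>UNIV - {k}. \<Sum>l\<in>UNIV. \<Sum>m\<in>UNIV. H j m l * d j m l)"
    by (rule sum.swap)
  also have "\<dots> = 0"
  proof (rule sum.neutral, rule ballI)
    fix j assume "j \<in> UNIV - {k}"
    then have jk: "j \<noteq> k" by simp
    have "(\<Sum>l\<in>UNIV. \<Sum>m\<in>UNIV. H j m l * d j m l) = (\<Sum>l\<in>UNIV. \<Sum>m\<in>UNIV. H j l m * d j l m)"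
      by (rule sum.swap)
    also have "\<dots> = (\<Sum>l\<in>UNIV. \<Sum>m\<in>UNIV. - (H j m l * d j m l))"
    proof (intro sum.cong refl)
      fix l m
      have "H j l m = H j m l" unfolding H_def by (rule pd_commute[OF P])
      then show "H j l m * d j l m = - (H j m l * d j m l)"
        using anti[OF jk, of l m] by simp
    qed
    also have "\<dots> = - (\<Sum>l\<in>UNIV. \<Sum>m\<in>UNIV. H j m l * d j m l)"
      by (simp add: sum_negf)
    finally show "(\<Sum>l\<in>UNIV. \<Sum>m\<in>UNIV. H j m l * d j m l) = 0"
      by simp
  qed
  finally show ?thesis .
qed


text \<open>One setting for two situations: a bounded neighbourhood of an isolated zero with a low
  level, and the whole space with any level under the growth hypothesis. Compactness replaces a
  condition on the boundary of \<open>U\<close>: functions of the P_j supported in |P_j| \<le> exp b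
  can be continued by 0.\<close>

locale proper_poly_map =
  fixes P :: "'n::finite \<Rightarrow> complex^'n \<Rightarrow> complex" and U :: "(complex^'n) set" and b :: real
  assumes polyP: "\<And>j. polyfun (P j)" and openU: "open U"
    and compact_sublevel: "compact {z\<in>U. \<forall>j. norm (P j z) \<le> exp b}"
begin

definition sublevel :: "(complex^'n) set" where
  "sublevel = {z\<in>U. \<forall>j. norm (P j z) \<le> exp b}"

lemma compactK: "compact sublevel"
  using compact_sublevel by (simp add: sublevel_def)

text \<open>Here \<open>p\<close> and \<open>q\<close> are the Wirtinger derivatives of
  \<open>F\<close>. The vector field with components h cnj(cofac k l) prod F_j(P_j) is
  differentiated with respect to the conjugate variables: these do not see \<open>h\<close>, the
  cofactors contribute nothing by \<open>piola\<close>, and by \<open>cofac_pd\<close> only the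
  factor with j = k of the product is left.\<close>

lemma divergence_identity:
  fixes F p q :: "'n \<Rightarrow> complex \<Rightarrow> complex"
  assumes h: "polyfun h"
    and derF: "\<And>j w. (F j has_derivative (\<lambda>v. p j w * v + q j w * cnj v)) (at w)"
    and contp: "\<And>j. continuous_on UNIV (p j)" and contq: "\<And>j. continuous_on UNIV (q j)"
    and zero: "\<And>j w. norm w > exp b \<Longrightarrow> F j w = 0 \<and> p j w = 0 \<and> q j w = 0"
  shows "(\<integral>z. indicator sublevel z *\<^sub>R
    (q k (P k z) * (\<Prod>j\<in>UNIV - {k}. F j (P j z)) * h z * cnj (jac P z)) \<partial>lborel) = 0"
proof -
  define dP where "dP j z v = (\<Sum>m\<in>UNIV. pd (P j) m z * v $ m)" for j z v
  have dP: "(P j has_derivative dP j z) (at z)" for j z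
    unfolding dP_def using polyfun_pd(1)[OF polyP, of j z] .
  define dh where "dh z v = (\<Sum>m\<in>UNIV. pd h m z * v $ m)" for z v
  have dh: "(h has_derivative dh z) (at z)" for z
    unfolding dh_def using polyfun_pd(1)[OF h, of z] .
  have polyC: "polyfun (cofac P k l)" for l
  proof -
    have "polyfun (\<lambda>z. if i = k then of_bool (m = l) else pd (P i) m z)" for i m
      by (cases "i = k") (simp_all add: polyfun_const polyfun_pd(2) polyP)
    then show ?thesis
      unfolding cofac_def[abs_def] by (intro polyfun_det) (simp only: vec_lambda_beta)
  qed
  define dC where "dC l z v = (\<Sum>m\<in>UNIV. pd (cofac P k l) m z * v $ m)" for l z v
  have dC: "(cofac P k l has_derivative dC l z) (at z)" for l z
    unfolding dC_def using polyfun_pd(1)[OF polyC, of l z] .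
  define \<psi> where "\<psi> z = (if z \<in> U then \<Prod>j\<in>UNIV. F j (P j z) else 0)" for z
  define \<psi>' where "\<psi>' z v = (if z \<in> U then \<Sum>j\<in>UNIV.
      (p j (P j z) * dP j z v + q j (P j z) * cnj (dP j z v)) * (\<Prod>i\<in>UNIV - {j}. F i (P i z)) else 0)" for z v
  have oK: "open (- sublevel)" using compactK by (simp add: compact_imp_closed open_Compl)
  have UK: "U \<union> - sublevel = UNIV" by (auto simp: sublevel_def)
  have \<psi>0: "\<psi> z = 0" "\<psi>' z v = 0" if "z \<notin> sublevel" for z v
  proof -
    have "\<psi> z = 0 \<and> \<psi>' z v = 0"
    proof (cases "z \<in> U")
      case True
      then have "\<exists>j. \<not> norm (P j z) \<le> exp b"
        using that by (auto simp: sublevel_def)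
      then obtain j where "norm (P j z) > exp b"
        using not_le by blast
      then have j: "F j (P j z) = 0" "p j (P j z) = 0" "q j (P j z) = 0"
        using zero by blast+
      have "\<psi> z = 0"
        using True j by (auto simp: \<psi>_def)
      moreover have t0: "(p i (P i z) * dP i z v + q i (P i z) * cnj (dP i z v)) * (\<Prod>i\<in>UNIV - {i}. F i (P i z)) = 0" for i
        using j by (cases "i = j") auto
      then have "\<psi>' z v = 0"
        by (simp only: \<psi>'_def t0 sum.neutral_const if_cancel)
      ultimately show ?thesis by simp
    qed (simp add: \<psi>_def \<psi>'_def)
    then show "\<psi> z = 0" "\<psi>' z v = 0" by auto
  qed
  have d\<psi>: "(\<psi> has_derivative \<psi>' z) (at z)" for z
  proof (cases "z \<in> U")
    case True
    have FP: "((\<lambda>z. F j (P j z)) has_derivative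
        (\<lambda>v. p j (P j z) * dP j z v + q j (P j z) * cnj (dP j z v))) (at z)" for j
      by (rule has_derivative_compose[OF dP derF])
    have "((\<lambda>z. \<Prod>j\<in>UNIV. F j (P j z)) has_derivative \<psi>' z) (at z)"
      using has_derivative_prod[of UNIV "\<lambda>j z. F j (P j z)", OF FP] True by (simp add: \<psi>'_def[abs_def])
    then show ?thesis
      by (rule has_derivative_transform_within_open[OF _ openU True]) (simp add: \<psi>_def)
  next
    case False
    then have z: "z \<in> - sublevel" by (simp add: sublevel_def)
    have "\<psi>' z = (\<lambda>_. 0)"
      using \<psi>0(2) z by (intro ext) auto
    then have "((\<lambda>_. 0) has_derivative \<psi>' z) (at z)"
      by simp
    then show ?thesis
      by (rule has_derivative_transform_within_open[OF _ oK z]) (simp add: \<psi>0)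
  qed
  have contF: "continuous_on UNIV (F j)" for j
    using derF by (auto intro!: continuous_at_imp_continuous_on dest: has_derivative_continuous)
  have cont_dP: "continuous_on S (\<lambda>z. dP j z v)" for S j v
    unfolding dP_def by (intro continuous_intros polyfun_continuous polyfun_pd(2) polyP)
  have comp: "continuous_on S (\<lambda>z. g (P j z))" if "continuous_on UNIV g" for g :: "complex \<Rightarrow> complex" and S j
    by (rule continuous_on_compose2[OF that polyfun_continuous[OF polyP]]) simp
  have cont_\<psi>': "continuous_on UNIV (\<lambda>z. \<psi>' z v)" for v
  proof -
    have "continuous_on U (\<lambda>z. \<psi>' z v)"
    proof (subst continuous_on_cong[OF refl])
      show "continuous_on U (\<lambda>z. \<Sum>j\<in>UNIV. (p j (P j z) * dP j z v + q j (P j z) * cnj (dP j z v)) *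
          (\<Prod>i\<in>UNIV - {j}. F i (P i z)))"
        by (intro continuous_intros cont_dP comp contp contq contF)
    qed (simp add: \<psi>'_def)
    moreover have "continuous_on (- sublevel) (\<lambda>z. \<psi>' z v)"
      by (subst continuous_on_cong[OF refl, where g = "\<lambda>_. 0"]) (auto simp: \<psi>0)
    ultimately show ?thesis
      using continuous_on_open_Un[OF openU oK] UK by metis
  qed
  have cont_\<psi>: "continuous_on UNIV \<psi>"
    using d\<psi> by (auto intro!: continuous_at_imp_continuous_on dest: has_derivative_continuous)
  define f where "f l z = h z * cnj (cofac P k l z) * \<psi> z" for l z
  define f' where "f' l z v = h z * cnj (cofac P k l z) * \<psi>' z v +
     (h z * cnj (dC l z v) + dh z v * cnj (cofac P k l z)) * \<psi> z" for l z v
  have df: "(f l has_derivative f' l z) (at z)" for l z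
    unfolding f_def f'_def
    by (intro has_derivative_mult has_derivative_cnj dh dC d\<psi>)
  have f0: "f l z = 0" if "z \<notin> sublevel" for l z
    by (simp add: f_def \<psi>0[OF that])
  have contf': "continuous_on UNIV (\<lambda>z. f' l z v)" for l v
    unfolding f'_def dC_def dh_def
    by (intro continuous_intros polyfun_continuous polyfun_pd(2) polyC h cont_\<psi> cont_\<psi>')
  note I = integral_directional_derivative[OF compactK f0 df contf']
  \<comment> \<open>The combination of the derivatives along 1 and \<i> is twice the derivative with
    respect to the conjugate of z_l.\<close>
  define D where "D z = (\<Sum>l\<in>UNIV. f' l z (axis l 1) + \<i> * f' l z (axis l \<i>))" for z
  have intD: "(\<integral>z. D z \<partial>lborel) = 0"
    unfolding D_def using I by (subst Bochner_Integration.integral_sum) auto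
  define X where "X z = indicator sublevel z *\<^sub>R
    (q k (P k z) * (\<Prod>j\<in>UNIV - {k}. F j (P j z)) * h z * cnj (jac P z))" for z
  have D2: "D z = 2 * X z" for z
  proof (cases "z \<in> sublevel")
    case False
    then show ?thesis by (simp add: D_def f'_def \<psi>0 X_def)
  next
    case True
    then have zU: "z \<in> U" by (simp add: sublevel_def)
    have sel: "(\<Sum>m\<in>UNIV. c m * axis l a $ m) = c l * a" for c :: "'n \<Rightarrow> complex" and l a
      by (simp add: axis_def if_distrib cong: if_cong)
    define G where "G j = (\<Prod>i\<in>UNIV - {j}. F i (P i z))" for j
    have dbar\<psi>: "\<psi>' z (axis l 1) + \<i> * \<psi>' z (axis l \<i>) = (\<Sum>j\<in>UNIV. 2 * q j (P j z) * cnj (pd (P j) l z) * G j)" for l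
      using zU by (simp add: \<psi>'_def dP_def sel G_def[symmetric] sum_distrib_left flip: sum.distrib)
        (simp add: algebra_simps)
    have "f' l z (axis l 1) + \<i> * f' l z (axis l \<i>) =
        h z * cnj (cofac P k l z) * (\<psi>' z (axis l 1) + \<i> * \<psi>' z (axis l \<i>)) +
        2 * h z * \<psi> z * cnj (pd (cofac P k l) l z)" for l
    proof -
      have "dC l z (axis l a) = pd (cofac P k l) l z * a" "dh z (axis l a) = pd h l z * a" for a
        unfolding dC_def dh_def by (rule sel)+
      then show ?thesis
        by (simp add: f'_def algebra_simps)
    qed
    then have "D z = (\<Sum>l\<in>UNIV. h z * cnj (cofac P k l z) * (\<Sum>j\<in>UNIV. 2 * q j (P j z) * cnj (pd (P j) l z) * G j)) +
        2 * h z * \<psi> z * cnj (\<Sum>l\<in>UNIV. pd (cofac P k l) l z)"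
      by (simp add: D_def dbar\<psi> sum.distrib sum_distrib_left)
    also have "\<dots> = (\<Sum>l\<in>UNIV. \<Sum>j\<in>UNIV. h z * 2 * q j (P j z) * G j * cnj (pd (P j) l z * cofac P k l z))"
      by (simp add: piola[OF polyP] sum_distrib_left mult_ac)
    also have "\<dots> = (\<Sum>j\<in>UNIV. \<Sum>l\<in>UNIV. h z * 2 * q j (P j z) * G j * cnj (pd (P j) l z * cofac P k l z))"
      by (rule sum.swap)
    also have "\<dots> = (\<Sum>j\<in>UNIV. h z * 2 * q j (P j z) * G j * cnj (\<Sum>l\<in>UNIV. pd (P j) l z * cofac P k l z))"
      by (simp add: sum_distrib_left)
    also have "\<dots> = h z * 2 * q k (P k z) * G k * cnj (jac P z)"
      unfolding cofac_pd by (simp add: if_distrib[of cnj] if_distrib[of "\<lambda>x. y * x" for y] cong: if_cong)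
    finally show ?thesis using True by (simp add: G_def X_def mult_ac)
  qed
  have "2 * (\<integral>z. X z \<partial>lborel) = 0" using intD by (simp add: D2)
  then show ?thesis by (simp add: X_def)
qed

end

section \<open>Weak constancy of the mean over level tori\<close>

text \<open>Only the upper end of the support is recorded: it has to stay below the level
  \<open>b\<close> that is under control, whereas any lower end keeps the support away from P_j =
  0.\<close>

definition test :: "real \<Rightarrow> (real \<Rightarrow> real) \<Rightarrow> bool" where
  "test b \<alpha> \<longleftrightarrow> (\<exists>\<alpha>' a. (\<forall>x. (\<alpha> has_real_derivative \<alpha>' x) (at x)) \<and> continuous_on UNIV \<alpha>' \<and>
     (\<forall>x. x < a \<or> b < x \<longrightarrow> \<alpha> x = 0))"

lemma testE:
  assumes "test b \<alpha>"
  obtains \<alpha>' a where "\<And>x. (\<alpha> has_real_derivative \<alpha>' x) (at x)" "continuous_on UNIV \<alpha>'"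
    "\<And>x. x < a \<or> b < x \<Longrightarrow> \<alpha> x = 0" "\<And>x. x < a \<or> b < x \<Longrightarrow> \<alpha>' x = 0"
proof -
  obtain \<alpha>' a where *: "\<And>x. (\<alpha> has_real_derivative \<alpha>' x) (at x)" "continuous_on UNIV \<alpha>'"
    "\<And>x. x < a \<or> b < x \<Longrightarrow> \<alpha> x = 0"
    using assms unfolding test_def by blast
  have "\<alpha>' x = 0" if "x < a \<or> b < x" for x
  proof -
    have "(\<alpha> has_real_derivative 0) (at x)"
    proof (rule DERIV_cong_ev[THEN iffD2, OF refl _ refl])
      have "open ({..<a} \<union> {b<..})" "x \<in> {..<a} \<union> {b<..}" using that by auto
      then show "eventually (\<lambda>y. \<alpha> y = 0) (nhds x)"
        by (rule eventually_nhds_in_open[THEN eventually_mono]) (use *(3) in auto)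
    qed simp
    then show ?thesis using *(1) DERIV_unique by blast
  qed
  with * that show thesis by blast
qed

lemma test_continuous: "test b \<alpha> \<Longrightarrow> continuous_on S \<alpha>"
  unfolding test_def by (meson DERIV_continuous continuous_at_imp_continuous_on)

lemma test_supp:
  assumes "test b \<alpha>"
  shows "\<exists>a. \<forall>x. x < a \<or> b < x \<longrightarrow> \<alpha> x = 0"
  using assms unfolding test_def by blast

lemma test_mono: "test b \<alpha> \<Longrightarrow> b \<le> c \<Longrightarrow> test c \<alpha>"
  unfolding test_def by (meson less_le_trans not_le le_less_trans)

lemma test_integrable: 
  assumes "test b \<alpha>"
  shows "integrable lborel \<alpha>"
proof -
  obtain a where a: "\<And>x. x < a \<or> b < x \<Longrightarrow> \<alpha> x = 0"
    using assms unfolding test_def by blast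
  have "integrable lborel (\<lambda>x. indicator {a..b} x *\<^sub>R \<alpha> x)"
    by (rule borel_integrable_compact) (auto intro: test_continuous assms)
  moreover have "(\<lambda>x. indicator {a..b} x *\<^sub>R \<alpha> x) = \<alpha>"
  proof
    fix x show "indicator {a..b} x *\<^sub>R \<alpha> x = \<alpha> x"
      by (cases "x < a \<or> b < x") (auto simp: indicator_def a)
  qed
  ultimately show ?thesis by (simp only:)
qed

lemma test_lincomb:
  assumes "test b \<alpha>" "test b \<beta>"
  shows "test b (\<lambda>x. \<alpha> x - c * \<beta> x)"
proof -
  obtain \<alpha>' a where a: "\<And>x. (\<alpha> has_real_derivative \<alpha>' x) (at x)" "continuous_on UNIV \<alpha>'"
    "\<And>x. x < a \<or> b < x \<Longrightarrow> \<alpha> x = 0"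
    using assms(1) unfolding test_def by blast
  obtain \<beta>' a' where b: "\<And>x. (\<beta> has_real_derivative \<beta>' x) (at x)" "continuous_on UNIV \<beta>'"
    "\<And>x. x < a' \<or> b < x \<Longrightarrow> \<beta> x = 0"
    using assms(2) unfolding test_def by blast
  show ?thesis
    unfolding test_def using a b
    by (intro exI[of _ "\<lambda>x. \<alpha>' x - c * \<beta>' x"] exI[of _ "min a a'"])
      (auto intro!: derivative_eq_intros continuous_intros)
qed

lemma test_primitive:
  assumes \<alpha>: "test b \<alpha>" and 0: "(\<integral>x. \<alpha> x \<partial>lborel) = 0"
  obtains A where "test b A" "\<And>x. (A has_real_derivative \<alpha> x) (at x)"
proof -
  obtain a where a: "\<And>x. x < a \<or> b < x \<Longrightarrow> \<alpha> x = 0"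
    using \<alpha> unfolding test_def by blast
  \<comment> \<open>Starting at \<open>a - 1\<close> makes every x \<ge> a an interior point of an
    interval to which the fundamental theorem applies.\<close>
  define A where "A x = integral {a - 1..x} \<alpha>" for x
  have cont: "continuous_on S \<alpha>" for S using \<alpha> by (rule test_continuous)
  have Aa: "A x = 0" if "x < a" for x
  proof -
    have "A x = integral {a - 1..x} (\<lambda>_. 0)"
      unfolding A_def using that a by (intro integral_cong) auto
    then show ?thesis by simp
  qed
  have der: "(A has_real_derivative \<alpha> x) (at x)" for x
  proof (cases "x < a")
    case True
    have "(A has_real_derivative 0) (at x)"
    proof (rule DERIV_cong_ev[THEN iffD2, OF refl _ refl])
      show "eventually (\<lambda>y. A y = 0) (nhds x)"
        using eventually_nhds_in_open[of "{..<a}" x] True by (auto elim!: eventually_mono simp: Aa)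
    qed simp
    then show ?thesis using a True by simp
  next
    case False
    have "((\<lambda>u. integral {a - 1..u} \<alpha>) has_real_derivative \<alpha> x) (at x within {a - 1..x + 1})"
      by (rule integral_has_real_derivative) (use cont False in auto)
    then have "((\<lambda>u. integral {a - 1..u} \<alpha>) has_real_derivative \<alpha> x) (at x)"
      by (subst (asm) at_within_Icc_at) (use False in auto)
    then show ?thesis by (simp add: A_def[abs_def])
  qed
  have Ab: "A x = 0" if "b < x" for x
  proof -
    have "A x = (LBINT t:{a - 1..x}. \<alpha> t)"
      unfolding A_def by (intro set_borel_integral_eq_integral(2)[symmetric] borel_integrable_atLeastAtMost')
        (rule cont)
    also have "\<dots> = (\<integral>t. \<alpha> t \<partial>lborel)"
      unfolding set_lebesgue_integral_def
    proof (rule Bochner_Integration.integral_cong)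
      fix t show "indicator {a - 1..x} t *\<^sub>R \<alpha> t = \<alpha> t"
        using that by (cases "t < a \<or> b < t") (auto simp: indicator_def a)
    qed simp
    finally show ?thesis using 0 by simp
  qed
  have "test b A"
    unfolding test_def using der cont Aa Ab by (intro exI[of _ \<alpha>] exI[of _ a]) auto
  then show thesis using der that by blast
qed

text \<open>The weight \<open>\<alpha>(ln |w|) / |w|\<^sup>2\<close> is smooth: near \<open>w = 0\<close> it vanishes because \<open>\<alpha>\<close> has compact support,
  and at \<open>w = 0\<close> itself because of the division by zero.\<close>

definition radial :: "(real \<Rightarrow> real) \<Rightarrow> complex \<Rightarrow> complex" where
  "radial \<alpha> w = of_real (\<alpha> (ln (norm w)) / (norm w)\<^sup>2)"

lemma ln_norm_less: "w \<noteq> 0 \<Longrightarrow> norm w < exp a \<Longrightarrow> ln (norm w) < a"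
  by (metis ln_exp ln_less_cancel_iff exp_gt_zero zero_less_norm_iff)

lemma ln_norm_greater: "exp a < norm w \<Longrightarrow> a < ln (norm w)"
  by (metis ln_exp ln_less_cancel_iff exp_gt_zero less_trans)

text \<open>Two open sets cover the plane: the quotient is continuous off the origin, and it is 0
  near the origin. At the origin itself this is due to k > 0 and division by zero.\<close>

lemma continuous_radial_aux:
  assumes cont: "continuous_on UNIV g" and g0: "\<And>x. x < a \<Longrightarrow> g x = 0" and "k > 0"
  shows "continuous_on UNIV (\<lambda>w::complex. g (ln (norm w)) / norm w ^ k :: real)"
proof -
  have "continuous_on {w::complex. w \<noteq> 0} (\<lambda>w. g (ln (norm w)) / norm w ^ k)"
    by (intro continuous_intros continuous_on_compose2[OF cont]) auto
  moreover have "continuous_on (ball 0 (exp a)) (\<lambda>w::complex. g (ln (norm w)) / norm w ^ k)"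
  proof (subst continuous_on_cong[OF refl, where g = "\<lambda>_. 0"])
    fix w :: complex assume w: "w \<in> ball 0 (exp a)"
    show "g (ln (norm w)) / norm w ^ k = 0"
    proof (cases "w = 0")
      case False
      then have "ln (norm w) < a" using w by (intro ln_norm_less) auto
      then show ?thesis by (simp add: g0)
    qed (use \<open>k > 0\<close> in simp)
  qed auto
  moreover have "{w::complex. w \<noteq> 0} \<union> ball 0 (exp a) = UNIV" by auto
  moreover have "open {w::complex. w \<noteq> 0}" by (simp add: open_Collect_neq)
  ultimately show ?thesis
    using continuous_on_open_Un[of "{w::complex. w \<noteq> 0}" "ball 0 (exp a)"] by (metis open_ball)
qed

lemma continuous_radial: "test b \<alpha> \<Longrightarrow> continuous_on S (radial \<alpha>)"
proof -
  assume \<alpha>: "test b \<alpha>"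
  then obtain a where "\<And>x. x < a \<Longrightarrow> \<alpha> x = 0" unfolding test_def by blast
  then have "continuous_on UNIV (\<lambda>w::complex. \<alpha> (ln (norm w)) / (norm w)\<^sup>2)"
    by (intro continuous_radial_aux test_continuous[OF \<alpha>]) auto
  then have "continuous_on UNIV (radial \<alpha>)"
    unfolding radial_def by (rule bounded_linear.continuous_on[OF bounded_linear_of_real])
  then show ?thesis
    by (rule continuous_on_subset) simp
qed

lemma radial_eq_0: "test b \<alpha> \<Longrightarrow> exp b < norm w \<Longrightarrow> radial \<alpha> w = 0"
  using ln_norm_greater unfolding test_def radial_def by auto

text \<open>The weight depends on |w| only, so its differential is 2 G Re(cnj w v). Writing the real
  part as half the sum of cnj w v and w cnj v gives the two Wirtinger derivatives.\<close>

lemma radial_derivative: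
  assumes "test b \<alpha>" and \<alpha>': "\<And>x. (\<alpha> has_real_derivative \<alpha>' x) (at x)"
  defines "G \<equiv> \<lambda>w::complex. (\<alpha>' (ln (norm w)) - 2 * \<alpha> (ln (norm w))) / norm w ^ 4 / 2"
  shows "(radial \<alpha> has_derivative (\<lambda>v. of_real (G w) * cnj w * v + of_real (G w) * w * cnj v)) (at w)"
proof (cases "w = 0")
  case True
  obtain a where a: "\<And>x. x < a \<Longrightarrow> \<alpha> x = 0"
    using assms(1) unfolding test_def by blast
  have "(radial \<alpha> has_derivative (\<lambda>_. 0)) (at w)"
  proof (rule has_derivative_transform_within_open[where f = "\<lambda>_. 0" and s = "ball 0 (exp a)"])
    fix u :: complex assume "u \<in> ball 0 (exp a)"
    then show "0 = radial \<alpha> u"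
      using a[OF ln_norm_less[of u a]] by (cases "u = 0") (auto simp: radial_def)
  qed (use True in auto)
  then show ?thesis using True by (simp add: G_def)
next
  case False
  have n: "((\<lambda>w. norm w) has_derivative (\<lambda>v. (w \<bullet> v) / norm w)) (at w)"
    using has_derivative_norm[OF False] by (simp add: sgn_div_norm divide_inverse mult.commute inner_commute)
  have l: "((\<lambda>w. ln (norm w)) has_derivative (\<lambda>v. (w \<bullet> v) / (norm w)\<^sup>2)) (at w)"
    by (rule has_derivative_eq_rhs[OF has_derivative_ln[OF _ n]]) (use False in \<open>auto simp: power2_eq_square field_simps\<close>)
  have "((\<lambda>w. \<alpha> (ln (norm w))) has_derivative (\<lambda>v. \<alpha>' (ln (norm w)) * ((w \<bullet> v) / (norm w)\<^sup>2))) (at w)"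
    using has_derivative_compose[OF l \<alpha>'[unfolded has_field_derivative_def]] by simp
  then have "((\<lambda>w. \<alpha> (ln (norm w)) / (norm w)\<^sup>2) has_derivative
      (\<lambda>v. 2 * G w * (w \<bullet> v))) (at w)"
    by (rule has_derivative_eq_rhs[OF has_derivative_divide'[OF _ has_derivative_power[OF n]]])
      (use False in \<open>auto simp: G_def fun_eq_iff field_simps power2_eq_square power4_eq_xxxx\<close>)
  then have "(radial \<alpha> has_derivative (\<lambda>v. of_real (2 * G w * (w \<bullet> v)))) (at w)"
    unfolding radial_def[abs_def] by (rule has_derivative_of_real)
  moreover have "of_real (2 * G w * (w \<bullet> v)) = of_real (G w) * cnj w * v + of_real (G w) * w * cnj v" for v
    by (simp add: complex_eq_iff inner_complex_def algebra_simps)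
  ultimately show ?thesis by simp
qed

context proper_poly_map
begin

definition weighted :: "(complex^'n \<Rightarrow> complex) \<Rightarrow> ('n \<Rightarrow> real \<Rightarrow> real) \<Rightarrow> complex" where
  "weighted h \<alpha> = (\<integral>z. indicator sublevel z *\<^sub>R ((\<Prod>j\<in>UNIV. radial (\<alpha> j) (P j z)) * h z * cnj (jac P z)) \<partial>lborel)"

lemma polyfun_jac: "polyfun (jac P)"
  unfolding jac_def[abs_def] by (intro polyfun_det) (simp add: polyfun_pd(2) polyP)

lemma continuous_weight:
  assumes "\<And>j. test b' (\<alpha> j)" and h: "continuous_on S h"
  shows "continuous_on S (\<lambda>z. (\<Prod>j\<in>UNIV. radial (\<alpha> j) (P j z)) * h z * cnj (jac P z))"
  by (intro continuous_intros polyfun_continuous[OF polyfun_jac] h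
      continuous_on_compose2[OF continuous_radial[OF assms(1), of UNIV] polyfun_continuous[OF polyP]]) auto

lemma integrable_weighted:
  assumes "\<And>j. test b' (\<alpha> j)" and h: "polyfun h"
  shows "integrable lborel (\<lambda>z. indicator sublevel z *\<^sub>R ((\<Prod>j\<in>UNIV. radial (\<alpha> j) (P j z)) * h z * cnj (jac P z)))"
  by (rule borel_integrable_compact[OF compactK continuous_weight[OF assms(1) polyfun_continuous[OF h]]])

text \<open>The divergence identity is applied with A(ln |w|) / w in place \<open>k\<close>. Its
  derivative with respect to cnj w is \<alpha>_k(ln |w|) / (2 |w|^2), half of the k-th weight; the
  other places carry their weights unchanged.\<close>

lemma weighted_derivative_eq_0:
  assumes h: "polyfun h" and \<alpha>: "\<And>j. test b (\<alpha> j)"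
    and A: "test b A" "\<And>x. (A has_real_derivative \<alpha> k x) (at x)"
  shows "weighted h \<alpha> = 0"
proof -
  have "\<exists>\<alpha>'. \<forall>j. (\<forall>x. (\<alpha> j has_real_derivative \<alpha>' j x) (at x)) \<and> continuous_on UNIV (\<alpha>' j) \<and>
      (\<exists>a. \<forall>x. x < a \<or> b < x \<longrightarrow> \<alpha> j x = 0 \<and> \<alpha>' j x = 0)"
  proof (rule choice, rule allI)
    fix j show "\<exists>\<alpha>'. (\<forall>x. (\<alpha> j has_real_derivative \<alpha>' x) (at x)) \<and> continuous_on UNIV \<alpha>' \<and>
      (\<exists>a. \<forall>x. x < a \<or> b < x \<longrightarrow> \<alpha> j x = 0 \<and> \<alpha>' x = 0)"
      using testE[OF \<alpha>[of j]] by metis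
  qed
  then obtain \<alpha>' where \<alpha>': "\<And>j x. (\<alpha> j has_real_derivative \<alpha>' j x) (at x)"
    "\<And>j. continuous_on UNIV (\<alpha>' j)" "\<And>j. \<exists>a. \<forall>x. x < a \<or> b < x \<longrightarrow> \<alpha> j x = 0 \<and> \<alpha>' j x = 0"
    by blast
  define G where "G j = (\<lambda>w::complex. (\<alpha>' j (ln (norm w)) - 2 * \<alpha> j (ln (norm w))) / norm w ^ 4 / 2)" for j
  define GA where "GA = (\<lambda>w::complex. (\<alpha> k (ln (norm w)) - 2 * A (ln (norm w))) / norm w ^ 4 / 2)"
  obtain aA where aA: "\<And>x. x < aA \<or> b < x \<Longrightarrow> A x = 0 \<and> \<alpha> k x = 0"
  proof -
    obtain a1 a2 where "\<And>x. x < a1 \<or> b < x \<Longrightarrow> A x = 0" "\<And>x. x < a2 \<or> b < x \<Longrightarrow> \<alpha> k x = 0"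
      using test_supp[OF A(1)] test_supp[OF \<alpha>[of k]] by blast
    then show ?thesis using that[of "min a1 a2"] by auto
  qed
  have contG: "continuous_on UNIV (G j)" for j
  proof -
    obtain a where a: "\<And>x. x < a \<Longrightarrow> \<alpha> j x = 0 \<and> \<alpha>' j x = 0" using \<alpha>'(3)[of j] by blast
    have "continuous_on UNIV (\<lambda>w::complex. (\<alpha>' j (ln (norm w)) - 2 * \<alpha> j (ln (norm w))) / norm w ^ 4)"
      by (rule continuous_radial_aux[where g = "\<lambda>x. \<alpha>' j x - 2 * \<alpha> j x" and a = a])
        (auto intro!: continuous_intros \<alpha>' test_continuous[OF \<alpha>] simp: a)
    then show ?thesis unfolding G_def by (rule continuous_on_divide[OF _ continuous_on_const]) simp
  qed
  have contGA: "continuous_on UNIV GA"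
  proof -
    have "continuous_on UNIV (\<lambda>w::complex. (\<alpha> k (ln (norm w)) - 2 * A (ln (norm w))) / norm w ^ 4)"
      by (rule continuous_radial_aux[where g = "\<lambda>x. \<alpha> k x - 2 * A x" and a = aA])
        (auto intro!: continuous_intros test_continuous[OF \<alpha>] test_continuous[OF A(1)] simp: aA)
    then show ?thesis unfolding GA_def by (rule continuous_on_divide[OF _ continuous_on_const]) simp
  qed
  define F where "F j = (if j = k then (\<lambda>w. radial A w * cnj w) else radial (\<alpha> j))" for j
  define p where "p j = (if j = k then (\<lambda>w. of_real (GA w) * cnj w * cnj w) else (\<lambda>w. of_real (G j w) * cnj w))" for j
  define q where "q j = (if j = k then (\<lambda>w. radial (\<alpha> k) w / 2) else (\<lambda>w. of_real (G j w) * w))" for j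
  have Zk: "of_real (GA w) * w * cnj w + radial A w = radial (\<alpha> k) w / 2" for w
  proof (cases "w = 0")
    case False
    have "w * cnj w = of_real ((norm w)\<^sup>2)" by (rule complex_norm_square[symmetric])
    then have "of_real (GA w) * w * cnj w + radial A w = of_real (GA w * (norm w)\<^sup>2 + A (ln (norm w)) / (norm w)\<^sup>2)"
      by (simp add: radial_def mult.assoc)
    also have "GA w * (norm w)\<^sup>2 + A (ln (norm w)) / (norm w)\<^sup>2 = \<alpha> k (ln (norm w)) / (norm w)\<^sup>2 / 2"
      using False by (simp add: GA_def field_simps power2_eq_square power4_eq_xxxx)
    finally show ?thesis by (simp add: radial_def)
  qed (simp add: radial_def)
  have "(\<integral>z. indicator sublevel z *\<^sub>R (q k (P k z) * (\<Prod>j\<in>UNIV - {k}. F j (P j z)) * h z * cnj (jac P z)) \<partial>lborel) = 0"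
  proof (rule divergence_identity[OF h, where p = p])
    fix j w
    show "(F j has_derivative (\<lambda>v. p j w * v + q j w * cnj v)) (at w)"
    proof (cases "j = k")
      case True
      have "((\<lambda>w. radial A w * cnj w) has_derivative
        (\<lambda>v. radial A w * cnj v + (of_real (GA w) * cnj w * v + of_real (GA w) * w * cnj v) * cnj w)) (at w)"
        unfolding GA_def
        by (intro has_derivative_mult has_derivative_cnj has_derivative_ident radial_derivative[OF A])
      moreover have "radial A w * cnj v + (of_real (GA w) * cnj w * v + of_real (GA w) * w * cnj v) * cnj w =
         p j w * v + q j w * cnj v" for v
        using True Zk[of w] by (simp add: p_def q_def algebra_simps flip: Zk)
      ultimately show ?thesis using True by (simp add: F_def)
    next
      case False
      then show ?thesis
        using radial_derivative[OF \<alpha> \<alpha>'(1), of j w] by (simp add: F_def p_def q_def G_def)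
    qed
    show "continuous_on UNIV (p j)"
      by (cases "j = k") (auto simp: p_def intro!: continuous_intros contG contGA)
    show "continuous_on UNIV (q j)"
      by (cases "j = k") (auto simp: q_def intro!: continuous_intros contG continuous_radial[OF \<alpha>])
    assume w: "exp b < norm w"
    have 1: "b < ln (norm w)" using w by (rule ln_norm_greater)
    then have "G j w = 0" "GA w = 0"
      using \<alpha>'(3)[of j] aA by (auto simp: G_def GA_def)
    then show "F j w = 0 \<and> p j w = 0 \<and> q j w = 0"
      using radial_eq_0[OF \<alpha> w] radial_eq_0[OF A(1) w] by (simp add: F_def p_def q_def)
  qed
  moreover have "q k (P k z) * (\<Prod>j\<in>UNIV - {k}. F j (P j z)) = (\<Prod>j\<in>UNIV. radial (\<alpha> j) (P j z)) / 2" for z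
    by (subst prod.remove[of UNIV k]) (auto simp: q_def F_def intro!: prod.cong)
  then have "(\<integral>z. indicator sublevel z *\<^sub>R (q k (P k z) * (\<Prod>j\<in>UNIV - {k}. F j (P j z)) * h z * cnj (jac P z)) \<partial>lborel)
      = (\<integral>z. (indicator sublevel z *\<^sub>R ((\<Prod>j\<in>UNIV. radial (\<alpha> j) (P j z)) * h z * cnj (jac P z))) / 2 \<partial>lborel)"
    by (intro Bochner_Integration.integral_cong refl) (simp only: times_divide_eq_left scaleR_conv_of_real times_divide_eq_right)
  also have "\<dots> = weighted h \<alpha> / 2"
    unfolding weighted_def by (rule integral_divide_zero)
  ultimately show ?thesis by simp
qed

lemma weighted_update_lincomb:
  assumes h: "polyfun h" and \<alpha>: "\<And>j. test b (\<alpha> j)" and "test b \<beta>"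
  shows "weighted h (\<alpha>(k := (\<lambda>x. \<alpha> k x - c * \<beta> x))) = weighted h \<alpha> - of_real c * weighted h (\<alpha>(k := \<beta>))"
proof -
  have eq: "(\<Prod>j\<in>UNIV. radial ((\<alpha>(k := (\<lambda>x. \<alpha> k x - c * \<beta> x))) j) (P j z)) =
    (\<Prod>j\<in>UNIV. radial (\<alpha> j) (P j z)) - of_real c * (\<Prod>j\<in>UNIV. radial ((\<alpha>(k := \<beta>)) j) (P j z))" for z
  proof -
    have "(\<Prod>j\<in>UNIV - {k}. radial ((\<alpha>(k := \<gamma>)) j) (P j z)) = (\<Prod>j\<in>UNIV - {k}. radial (\<alpha> j) (P j z))" for \<gamma>
      by (rule prod.cong) auto
    then show ?thesis
      by (simp add: prod.remove[of UNIV k] radial_def algebra_simps diff_divide_distrib)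
  qed
  define X where "X \<gamma> z = indicator sublevel z *\<^sub>R ((\<Prod>j\<in>UNIV. radial (\<gamma> j) (P j z)) * h z * cnj (jac P z))" for \<gamma> z
  have X: "integrable lborel (X \<alpha>)" "integrable lborel (X (\<alpha>(k := \<beta>)))"
    unfolding X_def by (intro integrable_weighted[of b] h; use \<alpha> assms(3) in simp)+
  have "weighted h (\<alpha>(k := (\<lambda>x. \<alpha> k x - c * \<beta> x))) = (\<integral>z. X \<alpha> z - of_real c * X (\<alpha>(k := \<beta>)) z \<partial>lborel)"
    unfolding weighted_def X_def eq
    by (intro Bochner_Integration.integral_cong refl) (simp add: algebra_simps scaleR_conv_of_real)
  also have "\<dots> = (\<integral>z. X \<alpha> z \<partial>lborel) - (\<integral>z. of_real c * X (\<alpha>(k := \<beta>)) z \<partial>lborel)"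
    using X by (intro Bochner_Integration.integral_diff) auto
  also have "\<dots> = weighted h \<alpha> - of_real c * weighted h (\<alpha>(k := \<beta>))"
    unfolding weighted_def X_def by (simp only: integral_mult_right_zero)
  finally show ?thesis .
qed

text \<open>A functional that vanishes on derivatives depends on the integral only. In one place at
  a time the multiple of \<beta> with the same integral is subtracted; the rest has integral 0 and
  hence a primitive among the test functions.\<close>

lemma weighted_eq_prod:
  assumes h: "polyfun h" and \<alpha>: "\<And>j. test b (\<alpha> j)" and \<beta>: "test b \<beta>" "(\<integral>x. \<beta> x \<partial>lborel) = 1"
  shows "weighted h \<alpha> = of_real (\<Prod>j\<in>UNIV. \<integral>x. \<alpha> j x \<partial>lborel) * weighted h (\<lambda>_. \<beta>)"
proof -
  have step: "weighted h \<gamma> = of_real (\<integral>x. \<gamma> k x \<partial>lborel) * weighted h (\<gamma>(k := \<beta>))"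
    if \<gamma>: "\<And>j. test b (\<gamma> j)" for \<gamma> k
  proof -
    let ?c = "\<integral>x. \<gamma> k x \<partial>lborel"
    let ?\<delta> = "\<lambda>x. \<gamma> k x - ?c * \<beta> x"
    have t: "test b ?\<delta>" by (rule test_lincomb[OF \<gamma> \<beta>(1)])
    have "(\<integral>x. ?\<delta> x \<partial>lborel) = 0"
      using \<beta> test_integrable[OF \<gamma>] test_integrable[OF \<beta>(1)] by simp
    then obtain A where "test b A" "\<And>x. (A has_real_derivative ?\<delta> x) (at x)"
      using test_primitive[OF t] by blast
    then have "weighted h (\<gamma>(k := ?\<delta>)) = 0"
      using \<gamma> t by (intro weighted_derivative_eq_0[OF h, where k = k and A = A]) auto
    then show ?thesis
      using weighted_update_lincomb[OF h, of \<gamma> \<beta> k ?c] \<gamma> \<beta>(1) by simp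
  qed
  have "weighted h \<alpha> = of_real (\<Prod>j\<in>S. \<integral>x. \<alpha> j x \<partial>lborel) * weighted h (\<lambda>j. if j \<in> S then \<beta> else \<alpha> j)"
    if "finite S" for S
    using that
  proof (induction S rule: finite_induct)
    case (insert k S)
    have "(\<lambda>j. if j \<in> S then \<beta> else \<alpha> j)(k := \<beta>) = (\<lambda>j. if j \<in> insert k S then \<beta> else \<alpha> j)"
      by auto
    moreover have "weighted h (\<lambda>j. if j \<in> S then \<beta> else \<alpha> j) =
        of_real (\<integral>x. (if k \<in> S then \<beta> else \<alpha> k) x \<partial>lborel) * weighted h ((\<lambda>j. if j \<in> S then \<beta> else \<alpha> j)(k := \<beta>))"
      by (rule step) (use \<alpha> \<beta> in auto)
    ultimately show ?case
      using insert by (simp add: mult_ac)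
  qed simp
  from this[of UNIV] show ?thesis by simp
qed

end

section \<open>Explicit continuously differentiable bumps\<close>

lemma DERIV_max_0_power2: "((\<lambda>y::real. (max 0 y)\<^sup>2) has_real_derivative 2 * max 0 y) (at y)"
proof -
  consider "y < 0" | "y = 0" | "y > 0" by linarith
  then show ?thesis
  proof cases
    case 1
    have "((\<lambda>y. (max 0 y)\<^sup>2) has_real_derivative 0) (at y)"
      by (rule has_field_derivative_transform_within_open[OF DERIV_const[of 0], of "{..<0}"]) (use 1 in auto)
    then show ?thesis using 1 by simp
  next
    case 2
    have "((\<lambda>h::real. (max 0 h)\<^sup>2 / h) \<longlongrightarrow> 0) (at 0)"
    proof (rule tendsto_sandwich)
      show "((\<lambda>h::real. - \<bar>h\<bar>) \<longlongrightarrow> 0) (at 0)" "((\<lambda>h::real. \<bar>h\<bar>) \<longlongrightarrow> 0) (at 0)"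
        by (auto intro!: tendsto_eq_intros)
    qed (auto simp: max_def power2_eq_square)
    then show ?thesis using 2 by (simp add: DERIV_def)
  next
    case 3
    have "((\<lambda>y. (max 0 y)\<^sup>2) has_real_derivative 2 * y) (at y)"
      by (rule has_field_derivative_transform_within_open[of "\<lambda>y. y\<^sup>2" _ _ "{0<..}"])
        (use 3 in \<open>auto intro!: derivative_eq_intros\<close>)
    then show ?thesis using 3 by simp
  qed
qed

text \<open>Squaring makes the positive part continuously differentiable, and t / (1 + t) bounds it
  by 1. The parameter \<open>n\<close> has two purposes: n = 1 gives fixed test functions that are
  positive on (c, d), and growing \<open>n\<close> approximates the indicator of (c, d).\<close>

definition bump :: "real \<Rightarrow> real \<Rightarrow> nat \<Rightarrow> real \<Rightarrow> real" where
  "bump c d n x = real n * (max 0 ((x - c) * (d - x)))\<^sup>2 / (1 + real n * (max 0 ((x - c) * (d - x)))\<^sup>2)"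

lemma bump_0_le_1: "0 \<le> bump c d n x" "bump c d n x \<le> 1"
proof -
  define t where "t = real n * (max 0 ((x - c) * (d - x)))\<^sup>2"
  have "t \<ge> 0" by (simp add: t_def)
  then show "0 \<le> bump c d n x" "bump c d n x \<le> 1"
    unfolding bump_def t_def[symmetric] by (simp_all add: field_simps)
qed

lemma bump_eq_0: "c \<le> d \<Longrightarrow> x \<notin> {c<..<d} \<Longrightarrow> bump c d n x = 0"
proof -
  assume "c \<le> d" "x \<notin> {c<..<d}"
  then have "(x - c) * (d - x) \<le> 0"
    by (auto simp: mult_le_0_iff not_less)
  then show ?thesis by (simp add: bump_def)
qed

lemma test_bump:
  assumes "c \<le> d"
  shows "test d (bump c d n)"
proof -
  define w where "w x = (max 0 ((x - c) * (d - x)))\<^sup>2" for x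
  define w' where "w' x = 2 * max 0 ((x - c) * (d - x)) * (c + d - 2 * x)" for x
  have dw: "(w has_real_derivative w' x) (at x)" for x
    unfolding w_def w'_def
    by (rule DERIV_chain2[OF DERIV_max_0_power2]) (auto intro!: derivative_eq_intros)
  have w0: "1 + real n * w x > 0" for x
    by (simp add: w_def add_pos_nonneg)
  have "(bump c d n has_real_derivative real n * w' x / (1 + real n * w x)\<^sup>2) (at x)" for x
    unfolding bump_def[abs_def] w_def[symmetric]
    using w0[of x] by (auto intro!: derivative_eq_intros dw simp: field_simps power2_eq_square)
  moreover have "continuous_on UNIV (\<lambda>x. real n * w' x / (1 + real n * w x)\<^sup>2)"
    unfolding w_def w'_def using w0
    by (intro continuous_intros) (auto simp: w_def dest: less_imp_neq[THEN not_sym])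
  moreover have "bump c d n x = 0" if "x < c \<or> d < x" for x
    using that assms by (intro bump_eq_0) auto
  ultimately show ?thesis
    unfolding test_def by (intro exI[of _ "\<lambda>x. real n * w' x / (1 + real n * w x)\<^sup>2"] exI[of _ c]) simp
qed

lemma bump_tendsto: "c \<le> d \<Longrightarrow> (\<lambda>n. bump c d n x) \<longlonglongrightarrow> indicator {c<..<d} x"
proof (cases "x \<in> {c<..<d}")
  case True
  define w where "w = (max 0 ((x - c) * (d - x)))\<^sup>2"
  have w: "w > 0" using True by (simp add: w_def)
  have "(\<lambda>n. 1 - 1 / (1 + real n * w)) \<longlonglongrightarrow> 1 - 0"
    by (intro tendsto_intros tendsto_divide_0[OF tendsto_const] filterlim_at_top_imp_at_infinity
        filterlim_tendsto_add_at_top[OF tendsto_const] filterlim_at_top_mult_tendsto_pos[OF tendsto_const w] filterlim_real_sequentially)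
  moreover have "1 - 1 / (1 + real n * w) = bump c d n x" for n
  proof -
    have "1 + real n * w > 0" using w by (simp add: add_pos_nonneg)
    moreover have "bump c d n x = real n * w / (1 + real n * w)"
      by (simp only: bump_def w_def)
    ultimately show ?thesis by (simp add: field_simps)
  qed
  ultimately show ?thesis using True by simp
qed (simp add: bump_eq_0)

lemma unit_test_exists: "\<exists>\<beta>. test b \<beta> \<and> (\<integral>x. \<beta> x \<partial>lborel) = 1 \<and> (\<forall>x. 0 \<le> \<beta> x) \<and> (\<forall>x. x < b - 1 \<longrightarrow> \<beta> x = 0)"
proof -
  define I where "I = (\<integral>x. bump (b - 1) b 1 x \<partial>lborel)"
  have t: "test b (bump (b - 1) b 1)" by (rule test_bump) simp
  have "I \<noteq> 0"
  proof
    assume "I = 0"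
    then have "AE x in lborel. bump (b - 1) b 1 x = 0"
      using integral_nonneg_eq_0_iff_AE[OF test_integrable[OF t]] bump_0_le_1 by (simp add: I_def)
    then have "AE x in lborel. x \<notin> {b - 1<..<b}"
      by (rule eventually_mono) (auto simp: bump_def max_def add_nonneg_eq_0_iff)
    then have "emeasure lborel {b - 1<..<b} = 0"
      by (subst (asm) AE_iff_measurable[of "{b - 1<..<b}"]) auto
    then show False by simp
  qed
  moreover have "I \<ge> 0" unfolding I_def by (intro Bochner_Integration.integral_nonneg bump_0_le_1)
  ultimately have I: "I > 0" by simp
  \<comment> \<open>Division by the integral is spelled as a difference so that
    \<open>test_lincomb\<close> applies.\<close>
  define \<beta> where "\<beta> x = 0 - (- 1 / I) * bump (b - 1) b 1 x" for x
  have z: "test b (\<lambda>_. 0)" unfolding test_def by (auto intro!: exI[of _ "\<lambda>_. 0"])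
  have "test b \<beta>" unfolding \<beta>_def by (rule test_lincomb[OF z t])
  moreover have "(\<integral>x. \<beta> x \<partial>lborel) = 1"
    using I by (simp add: \<beta>_def I_def[symmetric] del: One_nat_def)
  moreover have "\<beta> x = 0" if "x < b - 1" for x
    using that by (simp add: \<beta>_def bump_eq_0)
  ultimately show ?thesis
    using I bump_0_le_1 by (intro exI[of _ \<beta>]) (auto simp: \<beta>_def)
qed

context proper_poly_map
begin

lemma weighted_const:
  assumes h: "polyfun h"
  shows "\<exists>\<kappa>. \<forall>\<alpha>. (\<forall>j. test b (\<alpha> j)) \<longrightarrow> weighted h \<alpha> = \<kappa> * of_real (\<Prod>j\<in>UNIV. \<integral>x. \<alpha> j x \<partial>lborel)"
proof -
  obtain \<beta> where "test b \<beta>" "(\<integral>x. \<beta> x \<partial>lborel) = 1"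
    using unit_test_exists by blast
  then have "weighted h \<alpha> = weighted h (\<lambda>_. \<beta>) * of_real (\<Prod>j\<in>UNIV. \<integral>x. \<alpha> j x \<partial>lborel)"
    if "\<forall>j. test b (\<alpha> j)" for \<alpha>
    using weighted_eq_prod[OF h, of \<alpha> \<beta>] that by (simp add: mult.commute)
  then show ?thesis by blast
qed

text \<open>The choice is unambiguous: a test function of integral 1, taken in every place,
  determines the constant.\<close>

definition mean :: "(complex^'n \<Rightarrow> complex) \<Rightarrow> complex" where
  "mean h = (SOME \<kappa>. \<forall>\<alpha>. (\<forall>j. test b (\<alpha> j)) \<longrightarrow> weighted h \<alpha> = \<kappa> * of_real (\<Prod>j\<in>UNIV. \<integral>x. \<alpha> j x \<partial>lborel))"

lemma weighted_mean:
  assumes "polyfun h" and "\<And>j. test b (\<alpha> j)"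
  shows "weighted h \<alpha> = mean h * of_real (\<Prod>j\<in>UNIV. \<integral>x. \<alpha> j x \<partial>lborel)"
  using someI_ex[OF weighted_const[OF assms(1)]] assms(2) unfolding mean_def by blast

end

section \<open>Logarithmic charts\<close>

lemma has_derivative_vec_lambda:
  fixes f :: "'a::real_normed_vector \<Rightarrow> 'n::finite \<Rightarrow> 'b::real_normed_vector"
  assumes "\<And>i. ((\<lambda>x. f x i) has_derivative (\<lambda>v. f' v i)) F"
  shows "((\<lambda>x. \<chi> i. f x i) has_derivative (\<lambda>v. \<chi> i. f' v i)) F"
proof -
  have ax: "bounded_linear (axis i :: 'b \<Rightarrow> 'b^'n)" for i
  proof (rule bounded_linear_intro[where K = 1])
    fix x :: 'b
    have "norm (axis i x :: 'b^'n) \<le> (\<Sum>j\<in>UNIV. norm ((axis i x :: 'b^'n) $ j))"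
      unfolding norm_vec_def by (rule L2_set_le_sum) simp
    also have "\<dots> = norm x"
      by (simp add: axis_def if_distrib[of norm] cong: if_cong)
    finally show "norm (axis i x :: 'b^'n) \<le> norm x * 1" by simp
  qed (auto simp: axis_def vec_eq_iff)
  have eq: "(\<chi> i. g i) = (\<Sum>i\<in>UNIV. axis i (g i))" for g :: "'n \<Rightarrow> 'b"
    by (simp add: vec_eq_iff axis_def)
  show ?thesis
    unfolding eq by (intro has_derivative_sum bounded_linear.has_derivative[OF ax] assms)
qed

lemma continuous_on_det:
  fixes A :: "'a::topological_space \<Rightarrow> complex^'n^'n"
  assumes "\<And>i j. continuous_on S (\<lambda>x. A x $ i $ j)"
  shows "continuous_on S (\<lambda>x. det (A x))"
  unfolding det_def by (intro continuous_intros assms)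

lemma onorm_matrix_le:
  fixes M :: "complex^'n^'n"
  shows "onorm ((*v) M) \<le> (\<Sum>i\<in>UNIV. \<Sum>j\<in>UNIV. norm (M $ i $ j))"
proof (rule onorm_le)
  fix v :: "complex^'n"
  have "norm (M *v v) \<le> (\<Sum>i\<in>UNIV. norm ((M *v v) $ i))"
    unfolding norm_vec_def by (rule L2_set_le_sum) simp
  also have "\<dots> \<le> (\<Sum>i\<in>UNIV. \<Sum>j\<in>UNIV. norm (M $ i $ j) * norm v)"
    by (intro sum_mono) (auto simp: matrix_vector_mult_def norm_mult
        intro!: sum_norm_le mult_left_mono Finite_Cartesian_Product.norm_nth_le)
  finally show "norm (M *v v) \<le> (\<Sum>i\<in>UNIV. \<Sum>j\<in>UNIV. norm (M $ i $ j)) * norm v"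
    by (simp add: sum_distrib_right)
qed

lemma matrix_inv_vector:
  fixes A :: "complex^'n^'n"
  assumes "det A \<noteq> 0"
  shows "matrix_inv A *v (A *v x) = x" "A *v (matrix_inv A *v x) = x"
proof -
  have "invertible A" using assms by (simp add: invertible_det_nz)
  then have "A ** matrix_inv A = mat 1 \<and> matrix_inv A ** A = mat 1"
    unfolding matrix_inv_def invertible_def by (rule someI_ex)
  then show "matrix_inv A *v (A *v x) = x" "A *v (matrix_inv A *v x) = x"
    by (simp_all add: matrix_vector_mul_assoc)
qed

text \<open>Continuity of the matrix entries gives continuity of the derivative in the operator
  norm, which the inverse function theorem asks for.\<close>

lemma locally_injective_holomorphic:
  fixes L :: "complex^'n \<Rightarrow> complex^'n"
  assumes "open S" "a \<in> S" and der: "\<And>z. z \<in> S \<Longrightarrow> (L has_derivative ((*v) (A z))) (at z)"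
    and cont: "\<And>i j. continuous_on S (\<lambda>z. A z $ i $ j)" and det: "det (A a) \<noteq> 0"
  shows "\<exists>r>0. ball a r \<subseteq> S \<and> inj_on L (ball a r)"
proof -
  have "isCont (\<lambda>z. A z $ i $ j) a" for i j
    using cont assms(1,2) by (simp add: continuous_on_eq_continuous_at)
  then have "(\<lambda>z. A z $ i $ j) \<midarrow>a\<rightarrow> A a $ i $ j" for i j
    by (simp add: isCont_def)
  then have cA: "(\<lambda>z. \<Sum>i\<in>UNIV. \<Sum>j\<in>UNIV. norm (A z $ i $ j - A a $ i $ j)) \<midarrow>a\<rightarrow>
      (\<Sum>i\<in>UNIV. \<Sum>j\<in>UNIV. norm (A a $ i $ j - A a $ i $ j))"
    by (intro tendsto_sum tendsto_norm tendsto_diff tendsto_const)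
  show ?thesis
  proof (rule has_derivative_locally_injective[of a S "(*v) (matrix_inv (A a))" "\<lambda>z. (*v) (A z)" L])
    show "bounded_linear ((*v) (matrix_inv (A a)))"
      using linear_cmatrix_vector_mult by (simp add: linear_conv_bounded_linear)
    show "(*v) (matrix_inv (A a)) \<circ> (*v) (A a) = id"
      using matrix_inv_vector[OF det] by auto
    fix e :: real assume "e > 0"
    then obtain d where d: "d > 0" "\<And>z. z \<noteq> a \<Longrightarrow> dist z a < d \<Longrightarrow>
        norm ((\<Sum>i\<in>UNIV. \<Sum>j\<in>UNIV. norm (A z $ i $ j - A a $ i $ j)) - 0) < e"
      using cA[unfolded LIM_def, rule_format, of e] by (auto simp: dist_norm)
    have "onorm (\<lambda>v. A z *v v - A a *v v) < e" if "dist a z < d" for z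
    proof (cases "z = a")
      case True
      then show ?thesis using \<open>e > 0\<close> by (simp add: onorm_zero)
    next
      case False
      have "(\<lambda>v. A z *v v - A a *v v) = (*v) (A z - A a)"
        by (simp add: matrix_vector_mult_diff_rdistrib fun_eq_iff)
      then have "onorm (\<lambda>v. A z *v v - A a *v v) \<le> (\<Sum>i\<in>UNIV. \<Sum>j\<in>UNIV. norm (A z $ i $ j - A a $ i $ j))"
        using onorm_matrix_le[of "A z - A a"] by simp
      also have "\<dots> < e" using d(2)[OF False] that by (simp add: dist_commute)
      finally show ?thesis .
    qed
    then show "\<exists>d>0. \<forall>x. dist a x < d \<longrightarrow> onorm (\<lambda>v. A x *v v - A a *v v) < e"
      using d(1) by blast
  qed (use assms in auto)
qed

text \<open>A countable subcover by balls is made disjoint, and kept open, by removing the earlier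
  closed balls. What is lost lies on countably many spheres.\<close>

lemma disjoint_injective_cover:
  fixes R :: "'a::euclidean_space set"
  assumes "\<And>z. z \<in> R \<Longrightarrow> \<exists>r>0. ball z r \<subseteq> R \<and> inj_on f (ball z r)"
  obtains V :: "nat \<Rightarrow> 'a set" where "\<And>i. open (V i)" "\<And>i. V i \<subseteq> R" "\<And>i. inj_on f (V i)"
    "disjoint_family V" "negligible (R - (\<Union>i. V i))"
proof (cases "R = {}")
  case True
  then show thesis
    using that[of "\<lambda>_. {}"] by (simp add: disjoint_family_on_def)
next
  case False
  obtain r where r: "\<And>z. z \<in> R \<Longrightarrow> r z > 0 \<and> ball z (r z) \<subseteq> R \<and> inj_on f (ball z (r z))"
    using assms by metis
  define \<F> where "\<F> = (\<lambda>z. ball z (r z)) ` R"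
  have "\<And>S. S \<in> \<F> \<Longrightarrow> open S" by (auto simp: \<F>_def)
  then obtain \<F>' where F': "\<F>' \<subseteq> \<F>" "countable \<F>'" "\<Union>\<F>' = \<Union>\<F>"
    by (rule Lindelof)
  have UF: "\<Union>\<F> = R"
  proof
    show "\<Union>\<F> \<subseteq> R" using r by (auto simp: \<F>_def)
    show "R \<subseteq> \<Union>\<F>"
    proof
      fix z assume "z \<in> R"
      then have "z \<in> ball z (r z)" "ball z (r z) \<in> \<F>" using r by (auto simp: \<F>_def)
      then show "z \<in> \<Union>\<F>" by blast
    qed
  qed
  then have ne: "\<F>' \<noteq> {}" using False F' by auto
  have "\<exists>c. \<forall>i. c i \<in> R \<and> from_nat_into \<F>' i = ball (c i) (r (c i))"
  proof (rule choice, rule allI)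
    fix i
    have "from_nat_into \<F>' i \<in> \<F>" using from_nat_into[OF ne] F'(1) by blast
    then show "\<exists>c. c \<in> R \<and> from_nat_into \<F>' i = ball c (r c)" by (auto simp: \<F>_def)
  qed
  then obtain c where c: "\<And>i. c i \<in> R" "\<And>i. from_nat_into \<F>' i = ball (c i) (r (c i))" by blast
  have cover: "R \<subseteq> (\<Union>i. ball (c i) (r (c i)))"
  proof -
    have "range (\<lambda>i. ball (c i) (r (c i))) = \<F>'"
      using range_from_nat_into[OF ne F'(2)] by (simp flip: c(2))
    then show ?thesis using UF F'(3) by simp
  qed
  define V where "V i = ball (c i) (r (c i)) - (\<Union>j<i. cball (c j) (r (c j)))" for i
  show thesis
  proof
    show "open (V i)" for i
      unfolding V_def by (intro open_Diff closed_UN) auto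
    show "V i \<subseteq> R" for i
      using r[OF c(1)] by (auto simp: V_def)
    show "inj_on f (V i)" for i
      using r[OF c(1)[of i]] inj_on_subset by (auto simp: V_def intro: inj_on_subset)
    have disj: "V i \<inter> V j = {}" if "i < j" for i j
      using that by (auto simp: V_def)
    show "disjoint_family V"
      unfolding disjoint_family_on_def by (metis disj Int_commute linorder_less_linear)
    have "R - (\<Union>i. V i) \<subseteq> (\<Union>i. sphere (c i) (r (c i)))"
    proof
      fix z assume z: "z \<in> R - (\<Union>i. V i)"
      then obtain i0 where "z \<in> ball (c i0) (r (c i0))" using cover by blast
      then have "\<exists>i. z \<in> cball (c i) (r (c i))" by (intro exI[of _ i0]) auto
      then obtain i where i: "z \<in> cball (c i) (r (c i))" "\<And>j. j < i \<Longrightarrow> z \<notin> cball (c j) (r (c j))"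
        using exists_least_iff[of "\<lambda>i. z \<in> cball (c i) (r (c i))"] by blast
      have "z \<notin> V i" using z by blast
      then have "z \<notin> ball (c i) (r (c i))" using i(2) unfolding V_def by blast
      then have "z \<in> sphere (c i) (r (c i))" using i(1) by auto
      then show "z \<in> (\<Union>i. sphere (c i) (r (c i)))" by blast
    qed
    then show "negligible (R - (\<Union>i. V i))"
      by (rule negligible_subset[rotated]) (auto intro!: negligible_countable_Union negligible_sphere)
  qed
qed

text \<open>The sign moves the branch cut to the nonnegative values of P_j. It affects neither the
  real part, which is ln |P_j|, nor the derivative.\<close>

definition chart :: "('n \<Rightarrow> complex^'n \<Rightarrow> complex) \<Rightarrow> complex^'n \<Rightarrow> complex^'n" where
  "chart P z = (\<chi> j. Ln (- P j z))"

definition dchart :: "('n \<Rightarrow> complex^'n \<Rightarrow> complex) \<Rightarrow> complex^'n \<Rightarrow> complex^'n^'n" where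
  "dchart P z = (\<chi> j m. pd (P j) m z / P j z)"

definition regular :: "('n \<Rightarrow> complex^'n \<Rightarrow> complex) \<Rightarrow> (complex^'n) set" where
  "regular P = {z. jac P z \<noteq> 0 \<and> (\<forall>j. - P j z \<notin> \<real>\<^sub>\<le>\<^sub>0)}"

lemma regular_nonzero: "z \<in> regular P \<Longrightarrow> P j z \<noteq> 0"
  unfolding regular_def by (metis (mono_tags, lifting) add.inverse_neutral mem_Collect_eq nonpos_Reals_zero_I)

lemma exp_chart: "z \<in> regular P \<Longrightarrow> exp (chart P z $ j) = - P j z"
  by (simp add: chart_def regular_nonzero)

lemma Re_chart: "z \<in> regular P \<Longrightarrow> Re (chart P z $ j) = ln (norm (P j z))"
  by (simp add: chart_def regular_nonzero Re_Ln)

context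
  fixes P :: "'n::finite \<Rightarrow> complex^'n \<Rightarrow> complex"
  assumes polyP: "\<And>j. polyfun (P j)"
begin

lemma polyfun_jacobian: "polyfun (jac P)"
  unfolding jac_def[abs_def] by (intro polyfun_det) (simp add: polyfun_pd(2) polyP)

lemma open_regular: "open (regular P)"
proof -
  have 1: "open {z. jac P z \<noteq> 0}"
    by (intro open_Collect_neq polyfun_continuous[OF polyfun_jacobian] continuous_intros)
  have 2: "open ((\<lambda>z. - P j z) -` (- \<real>\<^sub>\<le>\<^sub>0))" for j
    by (rule open_vimage) (auto intro!: continuous_on_minus polyfun_continuous[OF polyP] simp: open_Compl)
  have "regular P = {z. jac P z \<noteq> 0} \<inter> (\<Inter>j. (\<lambda>z. - P j z) -` (- \<real>\<^sub>\<le>\<^sub>0))"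
    by (auto simp: regular_def)
  then show ?thesis using 1 2 by (simp add: open_INT open_Int)
qed

lemma chart_derivative:
  assumes "z \<in> regular P"
  shows "(chart P has_derivative ((*v) (dchart P z))) (at z)"
proof -
  have "((\<lambda>z. \<chi> j. Ln (- P j z)) has_derivative (\<lambda>v. \<chi> j. (\<Sum>m\<in>UNIV. pd (P j) m z * v $ m) / P j z)) (at z)"
  proof (rule has_derivative_vec_lambda)
    fix j
    have "- P j z \<notin> \<real>\<^sub>\<le>\<^sub>0" using assms by (simp add: regular_def)
    then have "(Ln has_derivative ((*) (inverse (- P j z)))) (at (- P j z))"
      by (rule has_field_derivative_Ln[unfolded has_field_derivative_def])
    moreover have "((\<lambda>z. - P j z) has_derivative (\<lambda>v. - (\<Sum>m\<in>UNIV. pd (P j) m z * v $ m))) (at z)"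
      by (intro has_derivative_minus polyfun_pd(1) polyP)
    ultimately have "((\<lambda>z. Ln (- P j z)) has_derivative (\<lambda>v. inverse (- P j z) * - (\<Sum>m\<in>UNIV. pd (P j) m z * v $ m))) (at z)"
      by (rule has_derivative_compose[rotated])
    then show "((\<lambda>z. Ln (- P j z)) has_derivative (\<lambda>v. (\<Sum>m\<in>UNIV. pd (P j) m z * v $ m) / P j z)) (at z)"
      by (simp add: divide_inverse mult.commute)
  qed
  moreover have "(\<lambda>v. \<chi> j. (\<Sum>m\<in>UNIV. pd (P j) m z * v $ m) / P j z) = (*v) (dchart P z)"
    by (simp add: fun_eq_iff vec_eq_iff matrix_vector_mult_def dchart_def sum_divide_distrib)
  ultimately show ?thesis by (simp add: chart_def[abs_def])
qed

lemma det_dchart: "det (dchart P z) = jac P z / (\<Prod>j\<in>UNIV. P j z)"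
proof -
  have "dchart P z = (\<chi> j. (1 / P j z) *s (\<chi> m. pd (P j) m z))"
    by (simp add: dchart_def vec_eq_iff)
  then have "det (dchart P z) = (\<Prod>j\<in>UNIV. 1 / P j z) * det (\<chi> j. \<chi> m. pd (P j) m z)"
    by (simp only: det_rows_mul)
  then show ?thesis by (simp add: jac_def prod_dividef)
qed

lemma det_dchart_nz: "z \<in> regular P \<Longrightarrow> det (dchart P z) \<noteq> 0"
  using regular_nonzero[of z P] by (simp add: det_dchart) (simp add: regular_def)

lemma continuous_dchart: "continuous_on (regular P) (\<lambda>z. dchart P z $ i $ j)"
  unfolding dchart_def vec_lambda_beta
  by (intro continuous_intros polyfun_continuous polyfun_pd(2) polyP) (simp add: regular_nonzero)

lemma chart_locally_injective:
  assumes "open S" "z \<in> S" "z \<in> regular P"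
  shows "\<exists>r>0. ball z r \<subseteq> S \<inter> regular P \<and> inj_on (chart P) (ball z r)"
  by (rule locally_injective_holomorphic[where A = "dchart P"])
    (use assms in \<open>auto intro!: chart_derivative det_dchart_nz open_regular continuous_on_subset[OF continuous_dchart]\<close>)

lemma chart_inverse_derivative:
  assumes V: "open V" "V \<subseteq> regular P" "inj_on (chart P) V" and z: "z \<in> V"
  shows "(inv_into V (chart P) has_derivative ((*v) (matrix_inv (dchart P z)))) (at (chart P z))"
proof (rule has_derivative_inverse_strong[OF V(1) z, where f' = "(*v) (dchart P z)"])
  show "continuous_on V (chart P)"
    using V(2) by (intro continuous_at_imp_continuous_on ballI has_derivative_continuous[OF chart_derivative]) auto
  show "\<And>x. x \<in> V \<Longrightarrow> inv_into V (chart P) (chart P x) = x" using V(3) by simp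
  show "(chart P has_derivative (*v) (dchart P z)) (at z)" using V(2) z by (intro chart_derivative) auto
  show "(*v) (dchart P z) \<circ> (*v) (matrix_inv (dchart P z)) = id"
    using matrix_inv_vector(2)[OF det_dchart_nz] V(2) z by (auto simp: fun_eq_iff)
qed

lemma chart_cov:
  assumes V: "open V" "V \<subseteq> regular P" "inj_on (chart P) V"
  shows "open (chart P ` V)"
    and "f \<in> borel_measurable borel \<Longrightarrow> (\<integral>\<^sup>+u. indicator (chart P ` V) u * f u \<partial>lborel) =
      (\<integral>\<^sup>+z. ennreal (indicator V z * (norm (jac P z))\<^sup>2 / (\<Prod>j\<in>UNIV. (norm (P j z))\<^sup>2)) * f (chart P z) \<partial>lborel)"
    and "g \<in> borel_measurable borel \<Longrightarrow> (\<integral>u. indicator (chart P ` V) u *\<^sub>R g u \<partial>lborel) =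
      (\<integral>z. (indicator V z * (norm (jac P z))\<^sup>2 / (\<Prod>j\<in>UNIV. (norm (P j z))\<^sup>2)) *\<^sub>R (g (chart P z) :: complex) \<partial>lborel)"
proof -
  have der: "\<And>z. z \<in> V \<Longrightarrow> (chart P has_derivative (*v) (dchart P z)) (at z)"
    using V(2) by (intro chart_derivative) auto
  have cont: "continuous_on V (\<lambda>z. det (dchart P z))"
    by (intro continuous_on_det continuous_on_subset[OF continuous_dchart V(2)])
  have n: "(norm (det (dchart P z)))\<^sup>2 = (norm (jac P z))\<^sup>2 / (\<Prod>j\<in>UNIV. (norm (P j z))\<^sup>2)" for z
    by (simp add: det_dchart norm_divide power_divide prod_norm[symmetric] prod_power_distrib)
  show "open (chart P ` V)"
    by (rule open_holomorphic_image[OF V(1,3) der cont])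
  show "f \<in> borel_measurable borel \<Longrightarrow> (\<integral>\<^sup>+u. indicator (chart P ` V) u * f u \<partial>lborel) =
      (\<integral>\<^sup>+z. ennreal (indicator V z * (norm (jac P z))\<^sup>2 / (\<Prod>j\<in>UNIV. (norm (P j z))\<^sup>2)) * f (chart P z) \<partial>lborel)"
    using nn_integral_holomorphic_cov[OF V(1,3) der cont, of f] by (simp add: n)
  show "g \<in> borel_measurable borel \<Longrightarrow> (\<integral>u. indicator (chart P ` V) u *\<^sub>R g u \<partial>lborel) =
      (\<integral>z. (indicator V z * (norm (jac P z))\<^sup>2 / (\<Prod>j\<in>UNIV. (norm (P j z))\<^sup>2)) *\<^sub>R (g (chart P z) :: complex) \<partial>lborel)"
    using integral_holomorphic_cov[OF V(1,3) der cont, of g] by (simp add: n)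
qed

text \<open>Where \<open>J\<close> is nonzero, \<open>P\<close> has an invertible derivative and
  pulls null sets back to null sets. The branch cuts lie over the vectors with a real coordinate, a
  finite union of hyperplanes.\<close>

lemma negligible_not_regular:
  assumes "negligible {z. jac P z = 0}"
  shows "negligible (- regular P)"
proof -
  define f where "f z = (\<chi> j. P j z)" for z
  define T where "T = {w :: complex^'n. \<exists>j. Im (w $ j) = 0}"
  have "negligible T"
  proof -
    have "T = (\<Union>j. {w. axis j \<i> \<bullet> w = 0})"
      by (auto simp: T_def inner_axis' inner_complex_def)
    moreover have "negligible {w :: complex^'n. axis j \<i> \<bullet> w = 0}" for j
      by (rule negligible_hyperplane) (simp add: axis_eq_0_iff)
    ultimately show ?thesis by auto
  qed
  moreover have "(f has_derivative ((*v) (\<chi> i m. pd (P i) m z))) (at z)" for z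
  proof -
    have "(f has_derivative (\<lambda>v. \<chi> j. \<Sum>m\<in>UNIV. pd (P j) m z * v $ m)) (at z)"
      unfolding f_def by (intro has_derivative_vec_lambda polyfun_pd(1) polyP)
    then show ?thesis by (simp add: matrix_vector_mult_def[abs_def])
  qed
  moreover have "inj ((*v) (\<chi> i m. pd (P i) m z))" if "jac P z \<noteq> 0" for z
    using that unfolding jac_def by (metis injI matrix_inv_vector(1))
  ultimately have "negligible {z \<in> {z. jac P z \<noteq> 0}. f z \<in> T}"
    by (intro negligible_differentiable_vimage[where f' = "\<lambda>z. (*v) (\<chi> i m. pd (P i) m z)"])
      (auto intro: has_derivative_at_withinI)
  moreover have "- regular P \<subseteq> {z. jac P z = 0} \<union> {z \<in> {z. jac P z \<noteq> 0}. f z \<in> T}"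
    by (auto simp: regular_def f_def T_def complex_nonpos_Reals_iff)
  ultimately show ?thesis
    using assms by (meson negligible_Un negligible_subset)
qed

end

section \<open>The Jacobian does not vanish identically near an isolated zero\<close>

lemma compact_sublevel_bounded:
  fixes f :: "'n \<Rightarrow> 'a::euclidean_space \<Rightarrow> complex"
  assumes U: "open U" "bounded U" and f: "\<And>j. continuous_on UNIV (f j)"
    and fr: "\<And>z. z \<in> closure U - U \<Longrightarrow> \<exists>j. norm (f j z) > c"
  shows "compact {z\<in>U. \<forall>j. norm (f j z) \<le> c}"
proof -
  have "{z\<in>U. \<forall>j. norm (f j z) \<le> c} = closure U \<inter> (\<Inter>j. {z. norm (f j z) \<le> c})"
    using fr closure_subset[of U] by (auto simp: not_le[symmetric])
  moreover have "closed {z. norm (f j z) \<le> c}" for j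
    by (intro closed_Collect_le continuous_intros f)
  ultimately show ?thesis
    using U by (simp add: compact_Int_closed closed_INT)
qed

lemma prod_Basis_complex_vec:
  fixes g :: "complex^'n::finite \<Rightarrow> 'b::comm_monoid_mult"
  shows "(\<Prod>b\<in>Basis. g b) = (\<Prod>j\<in>UNIV. g (axis j 1) * g (axis j \<i>))"
proof -
  have B: "Basis = (\<lambda>(j, c). axis j c) ` ((UNIV :: 'n set) \<times> {1, \<i>})"
    by (auto simp: Basis_vec_def Basis_complex_def)
  have inj: "inj_on (\<lambda>(j, c). axis j c) ((UNIV :: 'n set) \<times> {1, \<i>})"
    by (auto simp: inj_on_def axis_eq_axis)
  have "(\<Prod>b\<in>Basis. g b) = prod (g \<circ> (\<lambda>(j, c). axis j c)) ((UNIV :: 'n set) \<times> {1, \<i>})"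
    unfolding B by (rule prod.reindex[OF inj])
  also have "\<dots> = (\<Prod>(j, c)\<in>(UNIV :: 'n set) \<times> {1, \<i>}. g (axis j c))"
    by (intro prod.cong) auto
  also have "\<dots> = (\<Prod>j\<in>UNIV. \<Prod>c\<in>{1, \<i>}. g (axis j c))"
    by (rule prod.cartesian_product[symmetric])
  finally show ?thesis by simp
qed

lemma measurable_vec_nth [measurable]:
  "(\<lambda>x::complex^'n::finite. x $ i) \<in> borel_measurable borel"
  "(\<lambda>x::real^'n::finite. x $ i) \<in> borel_measurable borel"
  by (intro borel_measurable_continuous_onI continuous_intros)+

lemma nn_integral_strip:
  fixes \<beta> :: "real \<Rightarrow> ennreal"
  assumes [measurable]: "\<beta> \<in> borel_measurable borel"
  shows "(\<integral>\<^sup>+u. (\<Prod>j\<in>UNIV. \<beta> (Re (u $ j)) * indicator {-pi<..<pi} (Im (u $ j))) \<partial>(lborel :: (complex^'n::finite) measure))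
    = ((\<integral>\<^sup>+x. \<beta> x \<partial>lborel) * ennreal (2 * pi)) ^ CARD('n)"
proof -
  define F :: "complex^'n \<Rightarrow> real \<Rightarrow> ennreal" where
    "F b = (if \<exists>j. b = axis j 1 then \<beta> else indicator {-pi<..<pi})" for b
  have [measurable]: "F b \<in> borel_measurable borel" for b
    by (cases "\<exists>j. b = axis j 1") (simp_all add: F_def)
  have F1: "F (axis j 1) = \<beta>" "F (axis j \<i>) = indicator {-pi<..<pi}" for j
    by (auto simp: F_def axis_eq_axis)
  have "(\<integral>\<^sup>+u. (\<Prod>j\<in>UNIV. \<beta> (Re (u $ j)) * indicator {-pi<..<pi} (Im (u $ j))) \<partial>(lborel :: (complex^'n) measure))
     = (\<integral>\<^sup>+u. (\<Prod>b\<in>Basis. F b (u \<bullet> b)) \<partial>lborel)"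
    by (simp add: prod_Basis_complex_vec F1 inner_axis inner_complex_def)
  also have "\<dots> = (\<Prod>b\<in>Basis. (\<integral>\<^sup>+x. F b x \<partial>lborel))"
    by (rule nn_integral_lborel_prod) auto
  also have "\<dots> = (\<Prod>j\<in>(UNIV :: 'n set). (\<integral>\<^sup>+x. \<beta> x \<partial>lborel) * ennreal (2 * pi))"
    by (simp add: prod_Basis_complex_vec F1)
  finally show ?thesis by simp
qed

lemma Ln_neg_exp_strip: "Im u \<in> {-pi<..<pi} \<Longrightarrow> Ln (exp u) = u \<and> exp u \<notin> \<real>\<^sub>\<le>\<^sub>0"
proof -
  assume u: "Im u \<in> {-pi<..<pi}"
  then have "Ln (exp u) = u" by simp
  moreover have "exp u \<notin> \<real>\<^sub>\<le>\<^sub>0"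
    using u \<open>Ln (exp u) = u\<close> by (metis Im_Ln_eq_pi complex_nonpos_Reals_iff exp_not_eq_zero greaterThanLessThan_iff
        less_irrefl complex_eq_iff less_eq_real_def zero_complex.sel)
  ultimately show ?thesis by simp
qed

context proper_poly_map
begin

text \<open>For h = J the weighted integrand is nonnegative, so it is bounded below by its part in a
  small ball around \<open>a\<close> on which \<open>P\<close> is injective. In logarithmic
  coordinates this part fills the whole strip of angles, of width 2 pi in each coordinate, over the
  support of \<beta>.\<close>

lemma mean_jac_ge:
  assumes a: "a \<in> U" "\<And>j. P j a = 0" "jac P a \<noteq> 0"
  shows "Re (mean (jac P)) \<ge> (2 * pi) ^ CARD('n)"
proof -
  define f where "f z = (\<chi> j. P j z)" for z
  define S where "S = U \<inter> {z. jac P z \<noteq> 0}"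
  have oS: "open S"
    unfolding S_def using openU
    by (intro open_Int open_Collect_neq polyfun_continuous[OF polyfun_jac] continuous_intros) auto
  have df: "(f has_derivative ((*v) (\<chi> i m. pd (P i) m z))) (at z)" for z
  proof -
    have "(f has_derivative (\<lambda>v. \<chi> j. \<Sum>m\<in>UNIV. pd (P j) m z * v $ m)) (at z)"
      unfolding f_def by (intro has_derivative_vec_lambda polyfun_pd(1) polyP)
    then show ?thesis by (simp add: matrix_vector_mult_def[abs_def])
  qed
  have "\<exists>r>0. ball a r \<subseteq> S \<and> inj_on f (ball a r)"
    by (rule locally_injective_holomorphic[OF oS _ df])
      (use a in \<open>auto simp: S_def jac_def intro!: polyfun_continuous polyfun_pd(2) polyP\<close>)
  then obtain r where r: "r > 0" "ball a r \<subseteq> S" "inj_on f (ball a r)" by blast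
  have "open (f ` ball a r)"
    using r(3) df by (intro invariance_of_domain) (auto intro!: continuous_at_imp_continuous_on dest: has_derivative_continuous)
  moreover have "0 \<in> f ` ball a r"
    using r(1) a(2) by (intro image_eqI[of _ _ a]) (auto simp: f_def vec_eq_iff)
  ultimately obtain s where s: "s > 0" "ball 0 s \<subseteq> f ` ball a r"
    by (meson openE)
  let ?N = "real CARD('n)"
  have N: "?N > 0" by simp
  \<comment> \<open>A vector whose coordinates all have modulus at most exp b' has norm less than
    \<open>s\<close>, so it is a value of \<open>P\<close> on the ball.\<close>
  define b' where "b' = min b (ln (s / (2 * ?N)))"
  have b': "b' \<le> b" "?N * exp b' < s"
  proof -
    have "exp b' \<le> exp (ln (s / (2 * ?N)))" by (simp add: b'_def)
    also have "\<dots> = s / (2 * ?N)" using s(1) N by simp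
    finally have "?N * exp b' \<le> ?N * (s / (2 * ?N))" by (rule mult_left_mono) simp
    also have "\<dots> < s" using s(1) N by simp
    finally show "?N * exp b' < s" .
  qed (simp add: b'_def)
  obtain \<beta> where \<beta>: "test b' \<beta>" "(\<integral>x. \<beta> x \<partial>lborel) = 1" "\<And>x. 0 \<le> \<beta> x"
    using unit_test_exists[of b'] by blast
  have \<beta>b: "test b \<beta>" using test_mono[OF \<beta>(1) b'(1)] .
  have \<beta>0: "\<beta> x = 0" if "x > b'" for x using \<beta>(1) that unfolding test_def by blast
  have \<beta>m [measurable]: "\<beta> \<in> borel_measurable borel"
    using test_continuous[OF \<beta>(1)] by (rule borel_measurable_continuous_onI)
  have \<beta>int: "(\<integral>\<^sup>+x. ennreal (\<beta> x) \<partial>lborel) = 1"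
    using nn_integral_eq_integral[OF test_integrable[OF \<beta>(1)]] \<beta>(2,3) by simp
  define w where "w z = (\<Prod>j\<in>UNIV. \<beta> (ln (norm (P j z))) / (norm (P j z))\<^sup>2) * (norm (jac P z))\<^sup>2" for z
  have w: "w z \<ge> 0" for z unfolding w_def by (intro mult_nonneg_nonneg prod_nonneg) (auto simp: \<beta>)
  have "mean (jac P) = weighted (jac P) (\<lambda>_. \<beta>)"
    using weighted_mean[OF polyfun_jac, of "\<lambda>_. \<beta>"] \<beta>b \<beta>(2) by simp
  also have wt: "\<dots> = (\<integral>z. of_real (indicator sublevel z * w z) \<partial>lborel)"
    unfolding weighted_def
  proof (rule Bochner_Integration.integral_cong[OF refl])
    fix z
    have "jac P z * cnj (jac P z) = of_real ((norm (jac P z))\<^sup>2)" by (rule complex_norm_square[symmetric])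
    then show "indicator sublevel z *\<^sub>R ((\<Prod>j\<in>UNIV. radial \<beta> (P j z)) * jac P z * cnj (jac P z)) =
       of_real (indicator sublevel z * w z)"
      by (simp add: w_def radial_def scaleR_conv_of_real mult.assoc)
  qed
  finally have Re: "Re (mean (jac P)) = (\<integral>z. indicator sublevel z * w z \<partial>lborel)"
    by (simp only: integral_complex_of_real Re_complex_of_real)
  have "integrable lborel (\<lambda>z. complex_of_real (indicator sublevel z * w z))"
  proof -
    have "(\<lambda>z. complex_of_real (indicator sublevel z * w z)) =
      (\<lambda>z. indicator sublevel z *\<^sub>R ((\<Prod>j\<in>UNIV. radial \<beta> (P j z)) * jac P z * cnj (jac P z)))"
    proof
      fix z
      have "jac P z * cnj (jac P z) = of_real ((norm (jac P z))\<^sup>2)" by (rule complex_norm_square[symmetric])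
      then show "complex_of_real (indicator sublevel z * w z) =
        indicator sublevel z *\<^sub>R ((\<Prod>j\<in>UNIV. radial \<beta> (P j z)) * jac P z * cnj (jac P z))"
        by (simp add: w_def radial_def scaleR_conv_of_real mult.assoc)
    qed
    then show ?thesis using integrable_weighted[of b "\<lambda>_. \<beta>" "jac P"] \<beta>b polyfun_jac by simp
  qed
  then have "integrable lborel (\<lambda>z. indicator sublevel z * w z)"
    by (simp only: complex_of_real_integrable_eq)
  then have "ennreal (Re (mean (jac P))) = (\<integral>\<^sup>+z. ennreal (indicator sublevel z * w z) \<partial>lborel)"
    unfolding Re using w by (intro nn_integral_eq_integral[symmetric]) auto
  also have "\<dots> \<ge> ennreal ((2 * pi) ^ CARD('n))"
  proof -
    define V where "V = ball a r \<inter> regular P"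
    have V: "open V" "V \<subseteq> regular P"
      using open_regular[OF polyP] by (auto simp: V_def)
    \<comment> \<open>Exponentiating the chart recovers \<open>P\<close> up to sign, and
      \<open>P\<close> is injective on the ball.\<close>
    have injV: "inj_on (chart P) V"
    proof (rule inj_onI)
      fix x y assume xy: "x \<in> V" "y \<in> V" "chart P x = chart P y"
      then have "- P j x = - P j y" for j
        using exp_chart V(2) by (metis subsetD)
      then have "f x = f y" by (simp add: f_def vec_eq_iff)
      then show "x = y" using r(3) xy by (auto simp: V_def inj_on_def)
    qed
    define F :: "complex^'n \<Rightarrow> ennreal" where "F u = (\<Prod>j\<in>UNIV. ennreal (\<beta> (Re (u $ j))))" for u
    have [measurable]: "F \<in> borel_measurable borel"
      unfolding F_def by measurable
    have "ennreal ((2 * pi) ^ CARD('n)) = ((\<integral>\<^sup>+x. ennreal (\<beta> x) \<partial>lborel) * ennreal (2 * pi)) ^ CARD('n)"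
      by (simp add: \<beta>int ennreal_power)
    also have "\<dots> = (\<integral>\<^sup>+u. (\<Prod>j\<in>UNIV. ennreal (\<beta> (Re (u $ j))) * indicator {-pi<..<pi} (Im (u $ j))) \<partial>(lborel :: (complex^'n) measure))"
      by (rule nn_integral_strip[symmetric]) measurable
    also have "\<dots> \<le> (\<integral>\<^sup>+u. indicator (chart P ` V) u * F u \<partial>lborel)"
    proof (rule nn_integral_mono)
      fix u :: "complex^'n"
      show "(\<Prod>j\<in>UNIV. ennreal (\<beta> (Re (u $ j))) * indicator {-pi<..<pi} (Im (u $ j))) \<le> indicator (chart P ` V) u * F u"
      proof (cases "\<forall>j. Re (u $ j) \<le> b' \<and> Im (u $ j) \<in> {-pi<..<pi}")
        case True
        define y where "y = (\<chi> j. - exp (u $ j))"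
        have "norm y \<le> (\<Sum>j\<in>UNIV. norm (y $ j))"
          unfolding norm_vec_def by (rule L2_set_le_sum) simp
        also have "\<dots> \<le> (\<Sum>j\<in>(UNIV :: 'n set). exp b')"
          using True by (intro sum_mono) (simp add: y_def)
        also have "\<dots> < s" using b'(2) by simp
        finally have "y \<in> f ` ball a r" using s(2) by auto
        then obtain z where z: "z \<in> ball a r" "f z = y" by auto
        then have Pz: "- P j z = exp (u $ j)" for j
          by (simp add: f_def y_def vec_eq_iff)
        have "chart P z = u"
          using True by (simp add: chart_def Pz vec_eq_iff less_imp_le)
        moreover have "- P j z \<notin> \<real>\<^sub>\<le>\<^sub>0" for j
          unfolding Pz using Ln_neg_exp_strip True by blast
        then have "z \<in> V"
          using z(1) r(2) unfolding V_def regular_def S_def by blast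
        ultimately have "u \<in> chart P ` V" by blast
        then show ?thesis using True by (simp add: F_def)
      next
        case False
        then obtain j where "Re (u $ j) > b' \<or> Im (u $ j) \<notin> {-pi<..<pi}" by (meson not_le)
        then have "ennreal (\<beta> (Re (u $ j))) * indicator {-pi<..<pi} (Im (u $ j)) = 0"
          using \<beta>0 by auto
        then have "(\<Prod>j\<in>UNIV. ennreal (\<beta> (Re (u $ j))) * indicator {-pi<..<pi} (Im (u $ j))) = 0"
          by (intro prod_zero) auto
        then show ?thesis by (simp only: zero_le)
      qed
    qed
    also have "\<dots> = (\<integral>\<^sup>+z. ennreal (indicator V z * (norm (jac P z))\<^sup>2 / (\<Prod>j\<in>UNIV. (norm (P j z))\<^sup>2)) * F (chart P z) \<partial>lborel)"
      by (rule chart_cov(2)[OF polyP V injV]) measurable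
    also have "\<dots> \<le> (\<integral>\<^sup>+z. ennreal (indicator sublevel z * w z) \<partial>lborel)"
    proof (rule nn_integral_mono)
      fix z
      show "ennreal (indicator V z * (norm (jac P z))\<^sup>2 / (\<Prod>j\<in>UNIV. (norm (P j z))\<^sup>2)) * F (chart P z) \<le> ennreal (indicator sublevel z * w z)"
      proof (cases "z \<in> V")
        case True
        then have zr: "z \<in> regular P" "z \<in> U" using r(2) by (auto simp: V_def S_def)
        have "F (chart P z) = ennreal (\<Prod>j\<in>UNIV. \<beta> (ln (norm (P j z))))"
          using \<beta>(3) by (simp add: F_def Re_chart[OF zr(1)] prod_ennreal)
        then have eq: "ennreal (indicator V z * (norm (jac P z))\<^sup>2 / (\<Prod>j\<in>UNIV. (norm (P j z))\<^sup>2)) * F (chart P z) = ennreal (w z)"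
          using True \<beta>(3) by (simp add: w_def prod_dividef ennreal_mult[symmetric] prod_nonneg mult_ac)
        show ?thesis
        proof (cases "z \<in> sublevel")
          case False
          then obtain j where "norm (P j z) > exp b" using zr(2) by (auto simp: sublevel_def not_le)
          then have "\<beta> (ln (norm (P j z))) = 0"
            using b'(1) by (intro \<beta>0) (use ln_norm_greater in fastforce)
          then have "w z = 0" by (auto simp: w_def)
          then show ?thesis using eq by simp
        qed (use eq in simp)
      qed simp
    qed
    finally show ?thesis .
  qed
  finally have "ennreal ((2 * pi) ^ CARD('n)) \<le> ennreal (Re (mean (jac P)))" .
  moreover have "Re (mean (jac P)) \<ge> 0" unfolding Re using w by (intro Bochner_Integration.integral_nonneg) simp
  ultimately show ?thesis by (simp add: ennreal_le_iff)
qed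

end

text \<open>The determinant is a polynomial in t. It is not the zero polynomial because its reversal
  det(1 + s A) has the value 1 at s = 0.\<close>

lemma finite_det_shift_zeros:
  fixes A :: "'n::finite \<Rightarrow> 'n \<Rightarrow> complex"
  shows "finite {t. det (\<chi> i m. A i m + t * of_bool (m = i)) = 0}"
proof -
  have poly_det: "poly (det M) x = det (\<chi> i j. poly (M $ i $ j) x)" for M :: "complex poly^'n^'n" and x
    by (simp add: det_def poly_sum poly_prod)
  define p where "p = det (\<chi> i m. [: A i m, of_bool (m = i) :])"
  define q where "q = det (\<chi> i m. [: of_bool (m = i), A i m :])"
  have p: "poly p t = det (\<chi> i m. A i m + t * of_bool (m = i))" for t
    by (simp add: p_def poly_det)
  have q: "poly q t = det (\<chi> i m. of_bool (m = i) + t * A i m)" for t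
    by (simp add: q_def poly_det)
  have pq: "poly q s = s ^ CARD('n) * poly p (1 / s)" if "s \<noteq> 0" for s
  proof -
    have "(\<chi> i m. of_bool (m = i) + s * A i m) = (\<chi> i. s *s (\<chi> m. A i m + 1 / s * of_bool (m = i)))"
      using that by (simp add: vec_eq_iff field_simps)
    then show ?thesis
      by (simp only: q p det_rows_mul) simp
  qed
  have "p \<noteq> 0"
  proof
    assume "p = 0"
    then have "{s. s \<noteq> 0} \<subseteq> {s. poly q s = 0}" using pq by auto
    moreover have "infinite {s :: complex. s \<noteq> 0}"
      by (metis (mono_tags) Collect_neg_eq finite.emptyI finite.insertI finite_compl infinite_UNIV_char_0 singleton_conv)
    ultimately have "q = 0" using poly_roots_finite finite_subset by blast
    moreover have "(\<chi> i m. of_bool (m = i) + 0 * A i m) = mat 1" by (auto simp: vec_eq_iff mat_def)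
    then have "poly q 0 = 1" by (simp add: q)
    ultimately show False by simp
  qed
  then show ?thesis using poly_roots_finite[of p] by (simp add: p)
qed

text \<open>As \<open>J\<close> is a polynomial, one point where it does not vanish already makes
  its zero set negligible. If \<open>J\<close> were 0 everywhere, the integrals that are bounded
  below for the perturbations would converge to 0.\<close>

lemma jac_not_identically_zero:
  fixes P :: "'n::finite \<Rightarrow> complex^'n \<Rightarrow> complex"
  assumes polyP: "\<And>j. polyfun (P j)" and U: "open U" "bounded U" and a: "a \<in> U" "\<And>j. P j a = 0"
    and fr: "\<And>z. z \<in> closure U - U \<Longrightarrow> \<exists>j. P j z \<noteq> 0"
  shows "\<exists>z. jac P z \<noteq> 0"
proof (rule ccontr)
  assume "\<nexists>z. jac P z \<noteq> 0"
  then have J0: "jac P z = 0" for z by blast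
  let ?N = "real CARD('n)"
  have N: "?N > 0" by simp
  define Q where "Q \<tau> j z = P j z + of_real \<tau> * (z $ j - a $ j)" for \<tau> j z
  define c where "c j = - a $ j" for j
  have Q_eq: "Q \<tau> j = (\<lambda>z. P j z + of_real \<tau> * (z $ j + c j))" for \<tau> j
    by (auto simp: Q_def c_def)
  have polyQ: "polyfun (Q \<tau> j)" for \<tau> j
    unfolding Q_eq by (intro polyfun.intros polyP)
  have pdQ: "pd (Q \<tau> j) m z = pd (P j) m z + of_real \<tau> * of_bool (m = j)" for \<tau> j m z
    unfolding Q_eq
    by (simp add: pd_add pd_mult pd_const pd_coord polyP polyfun.intros)
  have jacQ: "jac (Q \<tau>) z = det (\<chi> i m. pd (P i) m z + of_real \<tau> * of_bool (m = i))" for \<tau> z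
    by (simp add: jac_def pdQ)
  have cl: "compact (closure U)" using U by simp
  have fr_compact: "compact (closure U - U)"
    using cl U(1) by (rule compact_diff)
  obtain m where m: "m > 0" "\<And>z. z \<in> closure U - U \<Longrightarrow> (\<Sum>j\<in>UNIV. norm (P j z)) \<ge> m"
  proof (cases "closure U - U = {}")
    case True
    then show ?thesis using that[of 1] by auto
  next
    case False
    have "continuous_on (closure U - U) (\<lambda>z. \<Sum>j\<in>UNIV. norm (P j z))"
      by (intro continuous_intros polyfun_continuous polyP)
    then obtain z0 where z0: "z0 \<in> closure U - U" "\<And>z. z \<in> closure U - U \<Longrightarrow> (\<Sum>j\<in>UNIV. norm (P j z0)) \<le> (\<Sum>j\<in>UNIV. norm (P j z))"
      using continuous_attains_inf[OF fr_compact False] by blast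
    obtain j where "P j z0 \<noteq> 0" using fr[OF z0(1)] by blast
    then have "(\<Sum>j\<in>UNIV. norm (P j z0)) > 0" by (intro sum_pos2[of _ j]) auto
    then show ?thesis using that z0(2) by blast
  qed
  obtain B where B: "B > 0" "\<And>z. z \<in> closure U \<Longrightarrow> norm (z - a) \<le> B"
  proof -
    have "bounded ((\<lambda>z. z - a) ` closure U)"
      by (intro compact_imp_bounded compact_continuous_image cl continuous_intros)
    then show ?thesis using that by (auto simp: bounded_pos)
  qed
  \<comment> \<open>Chosen so that the level \<open>b\<close> works for all perturbations at once:
    on the boundary, |Q_j| \<le> m / (4n) and |\<tau> (z_j - a_j)| \<le> m / (4n) for all j would
    give sum |P_j| \<le> m / 2. The integrals then share one domain, as dominated convergence
    needs.\<close>
  define \<tau>0 where "\<tau>0 = m / (4 * ?N * B)"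
  define b where "b = ln (m / (4 * ?N))"
  have \<tau>0: "\<tau>0 > 0" using m B N by (simp add: \<tau>0_def)
  have eb: "exp b = m / (4 * ?N)" using m N by (simp add: b_def)
  have loc: "proper_poly_map (Q \<tau>) U b" if \<tau>: "0 \<le> \<tau>" "\<tau> \<le> \<tau>0" for \<tau>
  proof
    show "polyfun (Q \<tau> j)" for j by (rule polyQ)
    show "open U" by (rule U)
    show "compact {z \<in> U. \<forall>j. norm (Q \<tau> j z) \<le> exp b}"
    proof (rule compact_sublevel_bounded[OF U])
      show "continuous_on UNIV (Q \<tau> j)" for j by (intro polyfun_continuous polyQ)
      fix z assume z: "z \<in> closure U - U"
      show "\<exists>j. norm (Q \<tau> j z) > exp b"
      proof (rule ccontr)
        assume "\<nexists>j. norm (Q \<tau> j z) > exp b"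
        then have "norm (P j z) \<le> exp b + \<tau>0 * B" for j
        proof -
          have "norm (P j z) \<le> norm (Q \<tau> j z) + norm (of_real \<tau> * (z $ j - a $ j))"
            unfolding Q_def by (metis add_diff_cancel_right' norm_triangle_ineq4)
          also have "norm (of_real \<tau> * (z $ j - a $ j)) = \<tau> * norm ((z - a) $ j)"
            using \<tau> by (simp add: norm_mult)
          also have "\<dots> \<le> \<tau>0 * B"
            using \<tau> B(2)[of z] z Finite_Cartesian_Product.norm_nth_le[of "z - a" j] by (intro mult_mono) auto
          finally show ?thesis using \<open>\<nexists>j. norm (Q \<tau> j z) > exp b\<close> by (smt (verit))
        qed
        then have "(\<Sum>j\<in>UNIV. norm (P j z)) \<le> (\<Sum>j\<in>(UNIV :: 'n set). exp b + \<tau>0 * B)"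
          by (intro sum_mono) auto
        also have "\<dots> = m / 4 + m / 4"
          using N B(1) by (simp add: eb \<tau>0_def field_simps)
        also have "\<dots> < m" using m(1) by simp
        finally show False using m(2)[OF z] by simp
      qed
    qed
  qed
  obtain \<beta> where \<beta>: "test b \<beta>" "(\<integral>x. \<beta> x \<partial>lborel) = 1"
    using unit_test_exists[of b] by blast
  define W where "W \<tau> z = (\<Prod>j\<in>UNIV. radial \<beta> (Q \<tau> j z)) * jac (Q \<tau>) z * cnj (jac (Q \<tau>) z)" for \<tau> z
  have low: "norm (\<integral>z. indicator U z *\<^sub>R W \<tau> z \<partial>lborel) \<ge> (2 * pi) ^ CARD('n)"
    if \<tau>: "0 \<le> \<tau>" "\<tau> \<le> \<tau>0" and nz: "jac (Q \<tau>) a \<noteq> 0" for \<tau>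
  proof -
    interpret proper_poly_map "Q \<tau>" U b by (rule loc[OF \<tau>])
    have "(2 * pi) ^ CARD('n) \<le> Re (mean (jac (Q \<tau>)))"
      by (rule mean_jac_ge[OF a(1)]) (use nz a(2) in \<open>auto simp: Q_def\<close>)
    also have "mean (jac (Q \<tau>)) = weighted (jac (Q \<tau>)) (\<lambda>_. \<beta>)"
      using weighted_mean[OF polyfun_jac, of "\<lambda>_. \<beta>"] \<beta> by simp
    also have "\<dots> = (\<integral>z. indicator U z *\<^sub>R W \<tau> z \<partial>lborel)"
      unfolding weighted_def
    proof (rule Bochner_Integration.integral_cong[OF refl])
      fix z
      show "indicator sublevel z *\<^sub>R ((\<Prod>j\<in>UNIV. radial \<beta> (Q \<tau> j z)) * jac (Q \<tau>) z * cnj (jac (Q \<tau>) z)) = indicator U z *\<^sub>R W \<tau> z"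
      proof (cases "z \<in> U \<and> z \<notin> sublevel")
        case True
        then obtain j where "norm (Q \<tau> j z) > exp b" by (auto simp: sublevel_def not_le)
        then have "radial \<beta> (Q \<tau> j z) = 0" by (rule radial_eq_0[OF \<beta>(1)])
        then have "W \<tau> z = 0" by (auto simp: W_def)
        then show ?thesis using True by simp
      qed (auto simp: indicator_def W_def sublevel_def)
    qed
    finally show ?thesis using complex_Re_le_cmod order_trans by blast
  qed
  \<comment> \<open>Only finitely many \<tau> make the Jacobian matrix of the perturbation singular
    at \<open>a\<close>, so admissible ones exist in every interval next to 0.\<close>
  have "\<exists>\<tau>. \<forall>n. 0 < \<tau> n \<and> \<tau> n \<le> \<tau>0 / real (Suc n) \<and> jac (Q (\<tau> n)) a \<noteq> 0"
  proof (rule choice, rule allI)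
    fix n
    have "finite {t. det (\<chi> i m. pd (P i) m a + t * of_bool (m = i)) = 0}"
      by (rule finite_det_shift_zeros)
    then have "finite (complex_of_real -` {t. det (\<chi> i m. pd (P i) m a + t * of_bool (m = i)) = 0})"
      by (rule finite_vimageI) (simp add: inj_on_def)
    moreover have "infinite {0<..\<tau>0 / real (Suc n)}" using \<tau>0 by (simp add: infinite_Ioc)
    ultimately have "{0<..\<tau>0 / real (Suc n)} - complex_of_real -` {t. det (\<chi> i m. pd (P i) m a + t * of_bool (m = i)) = 0} \<noteq> {}"
      by (intro infinite_imp_nonempty Diff_infinite_finite)
    then show "\<exists>t. 0 < t \<and> t \<le> \<tau>0 / real (Suc n) \<and> jac (Q t) a \<noteq> 0"
      by (auto simp: jacQ)
  qed
  then obtain \<tau> where \<tau>: "\<And>n. 0 < \<tau> n" "\<And>n. \<tau> n \<le> \<tau>0 / real (Suc n)" "\<And>n. jac (Q (\<tau> n)) a \<noteq> 0"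
    by blast
  have \<tau>le: "\<tau> n \<le> \<tau>0" for n
  proof -
    have "\<tau>0 / real (Suc n) \<le> \<tau>0 / 1" using \<tau>0 by (intro divide_left_mono) auto
    then show ?thesis using \<tau>(2)[of n] by simp
  qed
  have \<tau>lim: "\<tau> \<longlonglongrightarrow> 0"
  proof (rule tendsto_sandwich[OF _ _ tendsto_const])
    show "(\<lambda>n. \<tau>0 / real (Suc n)) \<longlonglongrightarrow> 0"
      by (rule LIMSEQ_Suc[OF lim_const_over_n])
  qed (use \<tau> in \<open>auto intro!: always_eventually less_imp_le\<close>)
  have contW: "continuous_on UNIV (\<lambda>(t, z). W t z)"
  proof -
    have 1: "continuous_on UNIV (\<lambda>p. pd (P i) m (snd p))" "continuous_on UNIV (\<lambda>p. P i (snd p))" for i m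
      by (rule continuous_on_compose2[OF polyfun_continuous[of _ UNIV]]; auto intro!: continuous_intros polyfun_pd(2) polyP)+
    have "continuous_on UNIV (\<lambda>p. jac (Q (fst p)) (snd p))"
      unfolding jacQ by (intro continuous_on_det) (auto intro!: continuous_intros 1)
    moreover have "continuous_on UNIV (\<lambda>p. Q (fst p) j (snd p))" for j
      unfolding Q_def by (intro continuous_intros 1)
    then have "continuous_on UNIV (\<lambda>p. radial \<beta> (Q (fst p) j (snd p)))" for j
      by (rule continuous_on_compose2[OF continuous_radial[OF \<beta>(1), of UNIV]]) auto
    ultimately show ?thesis
      unfolding W_def split_beta by (intro continuous_intros)
  qed
  have "compact ({0..\<tau>0} \<times> closure U)" using cl by (intro compact_Times) auto
  then have "bounded ((\<lambda>(t, z). W t z) ` ({0..\<tau>0} \<times> closure U))"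
    by (intro compact_imp_bounded compact_continuous_image continuous_on_subset[OF contW]) auto
  then obtain M where M: "\<And>t z. t \<in> {0..\<tau>0} \<Longrightarrow> z \<in> closure U \<Longrightarrow> norm (W t z) \<le> M"
    by (force simp: bounded_iff)
  have "(\<lambda>n. \<integral>z. indicator U z *\<^sub>R W (\<tau> n) z \<partial>lborel) \<longlonglongrightarrow> (\<integral>z. indicator U z *\<^sub>R W 0 z \<partial>lborel)"
  proof (rule integral_dominated_convergence[where w = "\<lambda>z. indicator (closure U) z *\<^sub>R M"])
    have mW: "W t \<in> borel_measurable borel" for t
    proof (rule borel_measurable_continuous_onI)
      show "continuous_on UNIV (W t)"
        using continuous_on_compose2[OF contW, of UNIV "\<lambda>z. (t, z)"] by (simp add: continuous_intros)
    qed
    show "(\<lambda>z. indicator U z *\<^sub>R W (\<tau> n) z) \<in> borel_measurable lborel" for n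
      using mW U(1) by (auto intro!: borel_measurable_scaleR borel_measurable_indicator)
    show "(\<lambda>z. indicator U z *\<^sub>R W 0 z) \<in> borel_measurable lborel"
      using mW U(1) by (auto intro!: borel_measurable_scaleR borel_measurable_indicator)
    show "integrable lborel (\<lambda>z. indicator (closure U) z *\<^sub>R M)"
      by (rule borel_integrable_compact[OF cl continuous_on_const])
    show "AE z in lborel. (\<lambda>n. indicator U z *\<^sub>R W (\<tau> n) z) \<longlonglongrightarrow> indicator U z *\<^sub>R W 0 z"
    proof (rule AE_I2, rule tendsto_scaleR[OF tendsto_const])
      fix z
      have "(\<lambda>n. (\<lambda>(t, z). W t z) (\<tau> n, z)) \<longlonglongrightarrow> (\<lambda>(t, z). W t z) (0, z)"
        by (rule continuous_on_tendsto_compose[OF contW]) (auto intro!: tendsto_intros \<tau>lim)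
      then show "(\<lambda>n. W (\<tau> n) z) \<longlonglongrightarrow> W 0 z" by simp
    qed
    show "AE z in lborel. norm (indicator U z *\<^sub>R W (\<tau> n) z) \<le> indicator (closure U) z *\<^sub>R M" for n
    proof (rule AE_I2)
      fix z
      have "z \<in> U \<Longrightarrow> z \<in> closure U" using closure_subset by blast
      then show "norm (indicator U z *\<^sub>R W (\<tau> n) z) \<le> indicator (closure U) z *\<^sub>R M"
        using M[of "\<tau> n" z] order_trans[OF norm_ge_zero M[of 0 z]] \<tau>(1)[of n] \<tau>le[of n] \<tau>0
        by (auto simp: indicator_def)
    qed
  qed
  moreover have "W 0 z = 0" for z
  proof -
    have "Q 0 = P" by (intro ext) (simp add: Q_def)
    then show ?thesis using J0 by (simp add: W_def)
  qed
  ultimately have "(\<lambda>n. norm (\<integral>z. indicator U z *\<^sub>R W (\<tau> n) z \<partial>lborel)) \<longlonglongrightarrow> 0"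
    by (simp add: tendsto_norm_zero)
  moreover have "\<forall>n. (2 * pi) ^ CARD('n) \<le> norm (\<integral>z. indicator U z *\<^sub>R W (\<tau> n) z \<partial>lborel)"
    using low[OF less_imp_le[OF \<tau>(1)] \<tau>le \<tau>(3)] by blast
  ultimately have "(2 * pi) ^ CARD('n) \<le> 0"
    by (intro LIMSEQ_le_const) auto
  moreover have "(2 * pi) ^ CARD('n) > 0" by (intro zero_less_power) simp
  ultimately show False by linarith
qed

section \<open>The mean over almost every level torus\<close>

text \<open>Boxes form an intersection-stable generator of the Borel sets, so the vanishing of the
  integrals passes to all Borel sets.\<close>

lemma AE_zero_if_integral_box_zero:
  fixes f :: "'a::euclidean_space \<Rightarrow> complex"
  assumes f: "integrable lborel f" and box: "\<And>l u. (\<integral>x. indicator (box l u) x *\<^sub>R f x \<partial>lborel) = 0"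
  shows "AE x in lborel. f x = 0"
proof (rule sigma_finite_measure.density_zero[OF lborel.sigma_finite_measure_axioms f])
  let ?G = "range (\<lambda>(l, u). box l u) :: 'a set set"
  have sets: "sets (borel :: 'a measure) = sigma_sets UNIV ?G"
    by (subst borel_eq_box) simp
  have ind: "integrable lborel (\<lambda>x. indicator A x *\<^sub>R f x)" if "A \<in> sets borel" for A
    using that f by (intro integrable_mult_indicator) auto
  \<comment> \<open>The step to complements needs the integral over the whole space, which is
    reached by growing boxes.\<close>
  have UN: "((\<integral>x. indicator A x *\<^sub>R f x \<partial>lborel) = 0)" if "A = UNIV" for A
  proof -
    have "(\<lambda>k. \<integral>x. indicator (box (- real k *\<^sub>R One) (real k *\<^sub>R One)) x *\<^sub>R f x \<partial>lborel) \<longlonglongrightarrow> (\<integral>x. f x \<partial>lborel)"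
    proof (rule integral_dominated_convergence[where w = "\<lambda>x. norm (f x)"])
      show "AE x in lborel. (\<lambda>k. indicator (box (- real k *\<^sub>R One) (real k *\<^sub>R One)) x *\<^sub>R f x) \<longlonglongrightarrow> f x"
      proof (rule AE_I2)
        fix x :: 'a
        obtain k0 where k0: "norm x < real k0" using reals_Archimedean2 by blast
        have "eventually (\<lambda>k. indicator (box (- real k *\<^sub>R One) (real k *\<^sub>R One)) x *\<^sub>R f x = f x) sequentially"
          unfolding eventually_sequentially
        proof (intro exI allI impI)
          fix k assume "k0 \<le> k"
          have "\<bar>x \<bullet> i\<bar> < real k" if "i \<in> Basis" for i
            using Basis_le_norm[OF that, of x] k0 \<open>k0 \<le> k\<close> by linarith
          then have "x \<in> box (- real k *\<^sub>R One) (real k *\<^sub>R One)"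
            by (force simp: box_def abs_less_iff)
          then show "indicator (box (- real k *\<^sub>R One) (real k *\<^sub>R One)) x *\<^sub>R f x = f x" by simp
        qed
        then show "(\<lambda>k. indicator (box (- real k *\<^sub>R One) (real k *\<^sub>R One)) x *\<^sub>R f x) \<longlonglongrightarrow> f x"
          by (rule tendsto_eventually)
      qed
    qed (use f in \<open>auto simp: indicator_def\<close>)
    then have "(\<integral>x. f x \<partial>lborel) = 0"
      using LIMSEQ_unique tendsto_const by (auto simp: box)
    then show ?thesis using that by simp
  qed
  fix A :: "'a set" assume "A \<in> sets lborel"
  then have A: "A \<in> sigma_sets UNIV ?G" using sets by simp
  have G: "Int_stable ?G" "?G \<subseteq> Pow UNIV"
    by (auto simp: Int_stable_def box_Int_box)
  from G A have "(\<integral>x. indicator A x *\<^sub>R f x \<partial>lborel) = 0"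
  proof (induction A rule: sigma_sets_induct_disjoint)
    case (compl A)
    then have A: "A \<in> sets borel" using sets by simp
    have "(\<lambda>x. indicator (UNIV - A) x *\<^sub>R f x) = (\<lambda>x. indicator UNIV x *\<^sub>R f x - indicator A x *\<^sub>R f x)"
      by (auto simp: indicator_def)
    then show ?case
      using compl.IH ind[OF A] f UN[of UNIV] by simp
  next
    case (union A)
    then have A: "A i \<in> sets borel" for i using sets by auto
    have "(\<integral>x. indicator (\<Union>i. A i) x *\<^sub>R f x \<partial>lborel) = (suminf (\<lambda>i. (\<integral>x. indicator (A i) x *\<^sub>R f x \<partial>lborel)))"
    proof -
      have "(\<Union>i. A i) \<in> sets borel" using A by auto
      then show ?thesis
        using lebesgue_integral_countable_add[of A lborel f] union.hyps A ind
        by (auto simp: set_lebesgue_integral_def set_integrable_def disjoint_family_on_def)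
    qed
    then show ?case using union.IH by simp
  next
    case (basic A)
    then show ?case using box by auto
  qed auto
  then show "set_lebesgue_integral lborel A f = 0"
    by (simp add: set_lebesgue_integral_def)
qed

lemma prod_Basis_real_vec:
  fixes g :: "real^'n::finite \<Rightarrow> 'b::comm_monoid_mult"
  shows "(\<Prod>b\<in>Basis. g b) = (\<Prod>j\<in>UNIV. g (axis j 1))"
proof -
  have B: "(Basis :: (real^'n) set) = (\<lambda>j. axis j 1) ` (UNIV :: 'n set)"
    by (auto simp: Basis_vec_def)
  show ?thesis
    unfolding B by (subst prod.reindex) (auto simp: inj_on_def axis_eq_axis)
qed

lemma nn_integral_prod_vec:
  fixes \<beta> :: "'n::finite \<Rightarrow> real \<Rightarrow> ennreal"
  assumes [measurable]: "\<And>j. \<beta> j \<in> borel_measurable borel"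
  shows "(\<integral>\<^sup>+x. (\<Prod>j\<in>UNIV. \<beta> j (x $ j)) \<partial>(lborel :: (real^'n) measure)) = (\<Prod>j\<in>UNIV. \<integral>\<^sup>+x. \<beta> j x \<partial>lborel)"
proof -
  \<comment> \<open>The product formula for Lebesgue measure is indexed by basis vectors; the
    description recovers the index of a basis vector.\<close>
  define F :: "real^'n \<Rightarrow> real \<Rightarrow> ennreal" where "F v = \<beta> (THE j. v = axis j 1)" for v
  have F: "F (axis j 1) = \<beta> j" for j
    by (simp add: F_def axis_eq_axis)
  have [measurable]: "F v \<in> borel_measurable borel" for v by (simp add: F_def)
  have "(\<integral>\<^sup>+x. (\<Prod>j\<in>UNIV. \<beta> j (x $ j)) \<partial>(lborel :: (real^'n) measure)) = (\<integral>\<^sup>+x. (\<Prod>b\<in>Basis. F b (x \<bullet> b)) \<partial>lborel)"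
    by (simp add: prod_Basis_real_vec F inner_axis)
  also have "\<dots> = (\<Prod>b\<in>Basis. \<integral>\<^sup>+x. F b x \<partial>lborel)"
    by (rule nn_integral_lborel_prod) auto
  finally show ?thesis by (simp add: prod_Basis_real_vec F)
qed

lemma integral_prod_vec:
  fixes \<beta> :: "'n::finite \<Rightarrow> real \<Rightarrow> real"
  assumes "\<And>j. integrable lborel (\<beta> j)" and nn: "\<And>j x. 0 \<le> \<beta> j x"
  shows "integrable lborel (\<lambda>x::real^'n. \<Prod>j\<in>UNIV. \<beta> j (x $ j))"
    and "(\<integral>x. (\<Prod>j\<in>UNIV. \<beta> j (x $ j)) \<partial>(lborel :: (real^'n) measure)) = (\<Prod>j\<in>UNIV. \<integral>x. \<beta> j x \<partial>lborel)"
proof -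
  have m [measurable]: "\<beta> j \<in> borel_measurable borel" for j
    using borel_measurable_integrable[OF assms(1)[of j]] by simp
  have nneq: "(\<integral>\<^sup>+x. ennreal (\<Prod>j\<in>UNIV. \<beta> j (x $ j)) \<partial>(lborel :: (real^'n) measure)) = ennreal (\<Prod>j\<in>UNIV. \<integral>x. \<beta> j x \<partial>lborel)"
  proof -
    have "(\<integral>\<^sup>+x. ennreal (\<Prod>j\<in>UNIV. \<beta> j (x $ j)) \<partial>(lborel :: (real^'n) measure)) = (\<integral>\<^sup>+x. (\<Prod>j\<in>UNIV. ennreal (\<beta> j (x $ j))) \<partial>lborel)"
      by (simp add: prod_ennreal nn)
    also have "\<dots> = (\<Prod>j\<in>UNIV. \<integral>\<^sup>+x. ennreal (\<beta> j x) \<partial>lborel)"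
      by (rule nn_integral_prod_vec) simp
    also have "\<dots> = (\<Prod>j\<in>UNIV. ennreal (\<integral>x. \<beta> j x \<partial>lborel))"
      using assms by (simp add: nn_integral_eq_integral)
    finally show ?thesis by (simp add: prod_ennreal nn Bochner_Integration.integral_nonneg)
  qed
  have m2: "(\<lambda>x::real^'n. \<Prod>j\<in>UNIV. \<beta> j (x $ j)) \<in> borel_measurable lborel" by measurable
  show "integrable lborel (\<lambda>x::real^'n. \<Prod>j\<in>UNIV. \<beta> j (x $ j))"
    by (rule integrableI_nonneg[OF m2]) (auto simp: nn prod_nonneg nneq)
  show "(\<integral>x. (\<Prod>j\<in>UNIV. \<beta> j (x $ j)) \<partial>(lborel :: (real^'n) measure)) = (\<Prod>j\<in>UNIV. \<integral>x. \<beta> j x \<partial>lborel)"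
    by (subst integral_eq_nn_integral[OF m2])
      (auto simp: nn prod_nonneg nneq intro!: prod_nonneg Bochner_Integration.integral_nonneg)
qed

lemma measurable_re_im_vec [measurable]: "re_im_vec \<in> borel \<rightarrow>\<^sub>M (borel :: (complex^'n::finite) measure)"
proof -
  have "linear (re_im_vec :: _ \<Rightarrow> complex^'n)"
    by (rule linearI) (simp_all add: re_im_vec_def vec_eq_iff complex_eq_iff)
  then show ?thesis
    by (intro borel_measurable_continuous_onI linear_continuous_on) (simp add: linear_conv_bounded_linear)
qed

lemma nn_integral_re_im_vec:
  fixes f :: "complex^'n::finite \<Rightarrow> ennreal"
  assumes [measurable]: "f \<in> borel_measurable borel"
  shows "(\<integral>\<^sup>+u. f u \<partial>lborel) = (\<integral>\<^sup>+\<rho>. (\<integral>\<^sup>+\<theta>. f (re_im_vec (\<rho>, \<theta>)) \<partial>lborel) \<partial>lborel)"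
proof -
  have "(\<integral>\<^sup>+u. f u \<partial>lborel) = (\<integral>\<^sup>+p. f (re_im_vec p) \<partial>lborel)"
    by (subst distr_re_im_vec[symmetric], subst nn_integral_distr) simp_all
  also have "\<dots> = (\<integral>\<^sup>+p. f (re_im_vec p) \<partial>(lborel \<Otimes>\<^sub>M lborel))"
    by (simp only: lborel_prod)
  also have "\<dots> = (\<integral>\<^sup>+\<rho>. (\<integral>\<^sup>+\<theta>. f (re_im_vec (\<rho>, \<theta>)) \<partial>lborel) \<partial>lborel)"
    by (rule lborel.nn_integral_fst[symmetric]) (simp add: lborel_prod)
  finally show ?thesis .
qed

lemma integral_re_im_vec:
  fixes f :: "complex^'n::finite \<Rightarrow> complex"
  assumes f: "integrable lborel f"
  shows "integrable lborel (\<lambda>\<rho>. \<integral>\<theta>. f (re_im_vec (\<rho>, \<theta>)) \<partial>lborel)"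
    and "(\<integral>\<rho>. (\<integral>\<theta>. f (re_im_vec (\<rho>, \<theta>)) \<partial>lborel) \<partial>lborel) = (\<integral>u. f u \<partial>lborel)"
proof -
  have [measurable]: "f \<in> borel_measurable borel"
    using borel_measurable_integrable[OF f] by simp
  have "integrable (distr lborel borel re_im_vec) f" using f by (simp add: distr_re_im_vec)
  then have "integrable lborel (\<lambda>p. f (re_im_vec p))"
    by (subst (asm) integrable_distr_eq) simp_all
  then have i: "integrable (lborel \<Otimes>\<^sub>M lborel) (\<lambda>p. f (re_im_vec p))"
    by (simp only: lborel_prod)
  show "integrable lborel (\<lambda>\<rho>. \<integral>\<theta>. f (re_im_vec (\<rho>, \<theta>)) \<partial>lborel)"
    by (rule lborel_pair.integrable_fst'[OF i])
  have "(\<integral>\<rho>. (\<integral>\<theta>. f (re_im_vec (\<rho>, \<theta>)) \<partial>lborel) \<partial>lborel) = (\<integral>p. f (re_im_vec p) \<partial>(lborel \<Otimes>\<^sub>M lborel))"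
    by (rule lborel_pair.integral_fst'[OF i])
  also have "\<dots> = (\<integral>u. f u \<partial>distr lborel borel re_im_vec)"
    by (subst integral_distr) (simp_all add: lborel_prod)
  finally show "(\<integral>\<rho>. (\<integral>\<theta>. f (re_im_vec (\<rho>, \<theta>)) \<partial>lborel) \<partial>lborel) = (\<integral>u. f u \<partial>lborel)"
    by (simp add: distr_re_im_vec)
qed

locale level_cover = proper_poly_map P U b
  for P :: "'n::finite \<Rightarrow> complex^'n \<Rightarrow> complex" and U :: "(complex^'n) set" and b :: real +
  fixes V :: "nat \<Rightarrow> (complex^'n) set" and h :: "complex^'n \<Rightarrow> complex"
  assumes openV: "\<And>i. open (V i)" and V_regular: "\<And>i. V i \<subseteq> U \<inter> regular P"
    and injV: "\<And>i. inj_on (chart P) (V i)" and disjV: "disjoint_family V"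
    and nullV: "negligible (U - (\<Union>i. V i))" and polyh: "polyfun h"
begin

text \<open>The quotient h / J in the logarithmic coordinate of the i-th chart. Continuing it by 0
  lets every slice be integrated over the full space of angles.\<close>

definition H :: "nat \<Rightarrow> complex^'n \<Rightarrow> complex" where
  "H i u = (if u \<in> chart P ` V i then h (inv_into (V i) (chart P) u) / jac P (inv_into (V i) (chart P) u) else 0)"

lemma Vreg: "V i \<subseteq> regular P" "V i \<subseteq> U"
  using V_regular[of i] by auto

lemma open_chart_image: "open (chart P ` V i)"
  by (rule chart_cov(1)[OF polyP openV Vreg(1) injV])

lemma measurable_H [measurable]: "H i \<in> borel_measurable borel"
  unfolding H_def
proof (rule borel_measurable_continuous_on_if)
  have c: "continuous_on (chart P ` V i) (inv_into (V i) (chart P))"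
    using chart_inverse_derivative[OF polyP openV Vreg(1) injV]
    by (intro continuous_at_imp_continuous_on ballI) (auto dest: has_derivative_continuous)
  have img: "inv_into (V i) (chart P) ` chart P ` V i \<subseteq> V i"
    by (auto intro: inv_into_into)
  have "jac P (inv_into (V i) (chart P) u) \<noteq> 0" if "u \<in> chart P ` V i" for u
    using img that Vreg(1) by (auto simp: regular_def)
  then show "continuous_on (chart P ` V i) (\<lambda>u. h (inv_into (V i) (chart P) u) / jac P (inv_into (V i) (chart P) u))"
    by (intro continuous_intros continuous_on_compose2[OF polyfun_continuous[OF polyh, of UNIV] c]
        continuous_on_compose2[OF polyfun_continuous[OF polyfun_jac, of UNIV] c]) auto
qed (use open_chart_image in auto)

lemma H_chart: "z \<in> V i \<Longrightarrow> H i (chart P z) = h z / jac P z"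
  using injV by (simp add: H_def)

definition weight :: "('n \<Rightarrow> real \<Rightarrow> real) \<Rightarrow> complex^'n \<Rightarrow> complex" where
  "weight \<alpha> z = (\<Prod>j\<in>UNIV. radial (\<alpha> j) (P j z)) * h z * cnj (jac P z)"

definition tens :: "('n \<Rightarrow> real \<Rightarrow> real) \<Rightarrow> real^'n \<Rightarrow> real" where
  "tens \<alpha> \<rho> = (\<Prod>j\<in>UNIV. \<alpha> j (\<rho> $ j))"

lemma weight_sublevel:
  assumes "\<And>j. test b (\<alpha> j)" "z \<in> U"
  shows "indicator sublevel z *\<^sub>R weight \<alpha> z = weight \<alpha> z"
proof (cases "z \<in> sublevel")
  case False
  then have "\<exists>j. \<not> norm (P j z) \<le> exp b" using assms(2) by (auto simp: sublevel_def)
  then obtain j where "norm (P j z) > exp b" using not_le by blast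
  then have "radial (\<alpha> j) (P j z) = 0" by (rule radial_eq_0[OF assms(1)])
  then have "weight \<alpha> z = 0" by (auto simp: weight_def)
  then show ?thesis by simp
qed simp

lemma measurable_weight:
  assumes "\<And>j. test b (\<alpha> j)"
  shows "weight \<alpha> \<in> borel_measurable borel"
  unfolding weight_def[abs_def]
  by (rule borel_measurable_continuous_onI[OF continuous_weight[OF assms polyfun_continuous[OF polyh]]])

lemma measurable_tens:
  assumes "\<And>j. test b (\<alpha> j)"
  shows "tens \<alpha> \<in> borel_measurable borel"
proof -
  have [measurable]: "\<alpha> j \<in> borel_measurable borel" for j
    using test_continuous[OF assms] by (rule borel_measurable_continuous_onI)
  show ?thesis unfolding tens_def[abs_def] by measurable
qed

text \<open>The Jacobian of the chart brings in |J|^2 / prod |P_j|^2: the numerator turns h / J into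
  h cnj J, and the denominator completes the radial weights.\<close>

lemma chart_weight:
  assumes "z \<in> V i"
  shows "((norm (jac P z))\<^sup>2 / (\<Prod>j\<in>UNIV. (norm (P j z))\<^sup>2)) *\<^sub>R
    (tens \<alpha> (\<chi> j. Re (chart P z $ j)) *\<^sub>R H i (chart P z)) = weight \<alpha> z"
proof -
  have z: "z \<in> regular P" using assms Vreg by blast
  then have J: "jac P z \<noteq> 0" by (simp add: regular_def)
  have "complex_of_real ((norm (jac P z))\<^sup>2) * (h z / jac P z) = h z * cnj (jac P z)"
    unfolding complex_norm_square using J by simp
  moreover have "complex_of_real (tens \<alpha> (\<chi> j. Re (chart P z $ j)) / (\<Prod>j\<in>UNIV. (norm (P j z))\<^sup>2)) = (\<Prod>j\<in>UNIV. radial (\<alpha> j) (P j z))"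
    by (simp add: tens_def Re_chart[OF z] radial_def prod_dividef)
  moreover have "((norm (jac P z))\<^sup>2 / (\<Prod>j\<in>UNIV. (norm (P j z))\<^sup>2)) *\<^sub>R
    (tens \<alpha> (\<chi> j. Re (chart P z $ j)) *\<^sub>R (h z / jac P z)) =
    complex_of_real (tens \<alpha> (\<chi> j. Re (chart P z $ j)) / (\<Prod>j\<in>UNIV. (norm (P j z))\<^sup>2)) *
    (complex_of_real ((norm (jac P z))\<^sup>2) * (h z / jac P z))"
    by (simp add: scaleR_conv_of_real)
  ultimately show ?thesis
    unfolding weight_def H_chart[OF assms] by (simp only: mult.assoc)
qed

lemma measurable_Re_vec [measurable]: "(\<lambda>u::complex^'n. \<chi> j. Re (u $ j)) \<in> borel \<rightarrow>\<^sub>M borel"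
  by (intro borel_measurable_continuous_onI continuous_intros)

context
  fixes \<alpha> :: "'n \<Rightarrow> real \<Rightarrow> real" assumes test: "\<And>j. test b (\<alpha> j)"
begin

lemmas [measurable] = measurable_weight[OF test] measurable_tens[OF test]

definition g :: "nat \<Rightarrow> complex^'n \<Rightarrow> complex" where
  "g i u = tens \<alpha> (\<chi> j. Re (u $ j)) *\<^sub>R H i u"

lemma measurable_g [measurable]: "g i \<in> borel_measurable borel"
  unfolding g_def[abs_def] by measurable

lemma g_indicator: "indicator (chart P ` V i) u *\<^sub>R g i u = g i u"
  by (auto simp: g_def H_def indicator_def)

lemma measurable_V [measurable]: "V i \<in> sets borel"
  using openV by simp

lemma nn_integral_g: "(\<integral>\<^sup>+u. ennreal (norm (g i u)) \<partial>lborel) = (\<integral>\<^sup>+z. ennreal (norm (indicator (V i) z *\<^sub>R weight \<alpha> z)) \<partial>lborel)"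
proof -
  have "(\<integral>\<^sup>+u. ennreal (norm (g i u)) \<partial>lborel) = (\<integral>\<^sup>+u. indicator (chart P ` V i) u * ennreal (norm (g i u)) \<partial>lborel)"
    by (intro nn_integral_cong) (auto simp: indicator_def g_def H_def)
  also have "\<dots> = (\<integral>\<^sup>+z. ennreal (indicator (V i) z * (norm (jac P z))\<^sup>2 / (\<Prod>j\<in>UNIV. (norm (P j z))\<^sup>2)) * ennreal (norm (g i (chart P z))) \<partial>lborel)"
    by (rule chart_cov(2)[OF polyP openV Vreg(1) injV]) measurable
  also have "\<dots> = (\<integral>\<^sup>+z. ennreal (norm (indicator (V i) z *\<^sub>R weight \<alpha> z)) \<partial>lborel)"
  proof (intro nn_integral_cong)
    fix z
    show "ennreal (indicator (V i) z * (norm (jac P z))\<^sup>2 / (\<Prod>j\<in>UNIV. (norm (P j z))\<^sup>2)) * ennreal (norm (g i (chart P z))) = ennreal (norm (indicator (V i) z *\<^sub>R weight \<alpha> z))"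
    proof (cases "z \<in> V i")
      case True
      then show ?thesis
        unfolding chart_weight[OF True, of \<alpha>, symmetric] g_def
        by (simp add: ennreal_mult[symmetric] prod_nonneg abs_mult abs_divide norm_mult norm_divide)
    qed simp
  qed
  finally show ?thesis .
qed

lemma integral_g: "(\<integral>u. g i u \<partial>lborel) = (\<integral>z. indicator (V i) z *\<^sub>R weight \<alpha> z \<partial>lborel)"
proof -
  have "(\<integral>u. g i u \<partial>lborel) = (\<integral>u. indicator (chart P ` V i) u *\<^sub>R g i u \<partial>lborel)"
    by (simp only: g_indicator)
  also have "\<dots> = (\<integral>z. (indicator (V i) z * (norm (jac P z))\<^sup>2 / (\<Prod>j\<in>UNIV. (norm (P j z))\<^sup>2)) *\<^sub>R g i (chart P z) \<partial>lborel)"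
    by (rule chart_cov(3)[OF polyP openV Vreg(1) injV]) measurable
  also have "\<dots> = (\<integral>z. indicator (V i) z *\<^sub>R weight \<alpha> z \<partial>lborel)"
  proof (intro Bochner_Integration.integral_cong refl)
    fix z
    show "(indicator (V i) z * (norm (jac P z))\<^sup>2 / (\<Prod>j\<in>UNIV. (norm (P j z))\<^sup>2)) *\<^sub>R g i (chart P z) = indicator (V i) z *\<^sub>R weight \<alpha> z"
    proof (cases "z \<in> V i")
      case True
      then show ?thesis
        unfolding chart_weight[OF True, of \<alpha>, symmetric] g_def by simp
    qed simp
  qed
  finally show ?thesis .
qed

lemma indicator_U_weight: "indicator U z *\<^sub>R weight \<alpha> z = indicator sublevel z *\<^sub>R weight \<alpha> z"
  using weight_sublevel[OF test, of z] by (cases "z \<in> U") (auto simp: indicator_def sublevel_def)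

lemma integrable_U_weight: "integrable lborel (\<lambda>z. indicator U z *\<^sub>R weight \<alpha> z)"
  unfolding indicator_U_weight unfolding weight_def by (rule integrable_weighted[OF test polyh])

lemma integral_U_weight: "(\<integral>z. indicator U z *\<^sub>R weight \<alpha> z \<partial>lborel) = weighted h \<alpha>"
  unfolding indicator_U_weight unfolding weight_def weighted_def ..

lemma suminf_indicator_V: "(suminf (\<lambda>i. indicator (V i) z :: ennreal)) = indicator (\<Union>i. V i) z"
  by (rule suminf_indicator[OF disjV])

text \<open>Since the charts are disjoint, the sum is at most the integral of |weight| over
  \<open>U\<close>. That is finite because the weight is continuous and lives on the compact
  sublevel set.\<close>

lemma suminf_g_finite: "(suminf (\<lambda>i. \<integral>\<^sup>+u. ennreal (norm (g i u)) \<partial>lborel)) < \<infinity>"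
proof -
  have "(suminf (\<lambda>i. \<integral>\<^sup>+u. ennreal (norm (g i u)) \<partial>lborel)) = (suminf (\<lambda>i. \<integral>\<^sup>+z. indicator (V i) z * ennreal (norm (weight \<alpha> z)) \<partial>lborel))"
    unfolding nn_integral_g by (intro suminf_cong nn_integral_cong) (auto simp: indicator_def)
  also have "\<dots> = (\<integral>\<^sup>+z. (suminf (\<lambda>i. indicator (V i) z * ennreal (norm (weight \<alpha> z)))) \<partial>lborel)"
    by (rule nn_integral_suminf[symmetric]) measurable
  also have "\<dots> \<le> (\<integral>\<^sup>+z. ennreal (norm (indicator U z *\<^sub>R weight \<alpha> z)) \<partial>lborel)"
  proof (rule nn_integral_mono)
    fix z
    have "(suminf (\<lambda>i. indicator (V i) z * ennreal (norm (weight \<alpha> z)))) = indicator (\<Union>i. V i) z * ennreal (norm (weight \<alpha> z))"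
      by (simp add: ennreal_suminf_multc suminf_indicator_V)
    also have "\<dots> \<le> ennreal (norm (indicator U z *\<^sub>R weight \<alpha> z))"
      using Vreg(2) by (auto simp: indicator_def)
    finally show "(suminf (\<lambda>i. indicator (V i) z * ennreal (norm (weight \<alpha> z)))) \<le> ennreal (norm (indicator U z *\<^sub>R weight \<alpha> z))" .
  qed
  also have "\<dots> < \<infinity>"
    using integrable_U_weight unfolding integrable_iff_bounded by simp
  finally show ?thesis .
qed

lemma integrable_g: "integrable lborel (g i)"
proof -
  have "(\<integral>\<^sup>+u. ennreal (norm (g i u)) \<partial>lborel) \<noteq> \<infinity>"
    using ennreal_suminf_lessD[OF suminf_g_finite[unfolded infinity_ennreal_def]] by (simp add: less_top)
  then show ?thesis
    unfolding integrable_iff_bounded by (simp add: less_top)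
qed

lemma sums_g: "(\<lambda>i. \<integral>u. g i u \<partial>lborel) sums weighted h \<alpha>"
proof -
  have "(\<lambda>i. \<integral>z. indicator (V i) z *\<^sub>R weight \<alpha> z \<partial>lborel) sums (\<integral>z. (suminf (\<lambda>i. indicator (V i) z *\<^sub>R weight \<alpha> z)) \<partial>lborel)"
  proof (rule sums_integral)
    show "integrable lborel (\<lambda>z. indicator (V i) z *\<^sub>R weight \<alpha> z)" for i
    proof -
      have "(\<integral>\<^sup>+z. ennreal (norm (indicator (V i) z *\<^sub>R weight \<alpha> z)) \<partial>lborel) < \<infinity>"
        using integrable_g[of i] unfolding nn_integral_g[symmetric] integrable_iff_bounded by simp
      then show ?thesis
        unfolding integrable_iff_bounded by simp
    qed
    then have eq: "ennreal (\<integral>z. norm (indicator (V i) z *\<^sub>R weight \<alpha> z) \<partial>lborel) = (\<integral>\<^sup>+u. ennreal (norm (g i u)) \<partial>lborel)" for i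
      unfolding nn_integral_g by (intro nn_integral_eq_integral[symmetric] integrable_norm) auto
    show "summable (\<lambda>i. \<integral>z. norm (indicator (V i) z *\<^sub>R weight \<alpha> z) \<partial>lborel)"
    proof (rule summable_suminf_not_top)
      show "(suminf (\<lambda>i. ennreal (\<integral>z. norm (indicator (V i) z *\<^sub>R weight \<alpha> z) \<partial>lborel))) \<noteq> top"
        unfolding eq using suminf_g_finite by simp
    qed (auto intro!: Bochner_Integration.integral_nonneg)
    show "AE z in lborel. summable (\<lambda>i. norm (indicator (V i) z *\<^sub>R weight \<alpha> z))"
    proof (rule AE_I2)
      fix z
      show "summable (\<lambda>i. norm (indicator (V i) z *\<^sub>R weight \<alpha> z))"
      proof (cases "\<exists>k. z \<in> V k")
        case True
        then obtain k where "z \<in> V k" by blast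
        then have "i \<noteq> k \<Longrightarrow> z \<notin> V i" for i using disjV by (auto simp: disjoint_family_on_def)
        then show ?thesis by (intro summable_finite[of "{k}"]) auto
      qed simp
    qed
  qed
  moreover have "(\<integral>z. (suminf (\<lambda>i. indicator (V i) z *\<^sub>R weight \<alpha> z)) \<partial>lborel) = (\<integral>z. indicator U z *\<^sub>R weight \<alpha> z \<partial>lborel)"
  proof (rule integral_cong_AE)
    have [measurable]: "U \<in> sets borel" using openU by simp
    show "(\<lambda>z. indicator U z *\<^sub>R weight \<alpha> z) \<in> borel_measurable lborel" by measurable
    obtain N where N: "N \<in> null_sets lborel" "U - (\<Union>i. V i) \<subseteq> N"
      using nullV unfolding negligible_iff_null_sets null_sets_completion_iff2 by blast
    have "AE z in lborel. z \<notin> N" using N(1) by (rule AE_not_in)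
    then show "AE z in lborel. (suminf (\<lambda>i. indicator (V i) z *\<^sub>R weight \<alpha> z)) = indicator U z *\<^sub>R weight \<alpha> z"
    proof (rule eventually_mono)
      fix z assume z: "z \<notin> N"
      show "(suminf (\<lambda>i. indicator (V i) z *\<^sub>R weight \<alpha> z)) = indicator U z *\<^sub>R weight \<alpha> z"
      proof (cases "\<exists>k. z \<in> V k")
        case True
        then obtain k where k: "z \<in> V k" by blast
        then have "i \<noteq> k \<Longrightarrow> z \<notin> V i" for i using disjV by (auto simp: disjoint_family_on_def)
        then have "(suminf (\<lambda>i. indicator (V i) z *\<^sub>R weight \<alpha> z)) = (\<Sum>i\<in>{k}. indicator (V i) z *\<^sub>R weight \<alpha> z)"
          by (intro suminf_finite) auto
        moreover have "z \<in> U" using k Vreg(2) by blast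
        ultimately show ?thesis using k by simp
      next
        case False
        then have "z \<notin> U" using z N(2) by blast
        then show ?thesis using False by simp
      qed
    qed
  qed measurable
  ultimately show ?thesis
    by (simp add: integral_g integral_U_weight)
qed

end

end

lemma Re_re_im_vec [simp]: "(\<chi> j. Re (re_im_vec (\<rho>, \<theta>) $ j)) = \<rho>"
  by (simp add: re_im_vec_def vec_eq_iff)

lemma bump_pos:
  assumes "c < x" "x < d"
  shows "bump c d 1 x > 0"
proof -
  define t where "t = (max 0 ((x - c) * (d - x)))\<^sup>2"
  have "t > 0" using assms by (simp add: t_def)
  moreover have "bump c d 1 x = t / (1 + t)" by (simp add: bump_def t_def)
  ultimately show ?thesis by simp
qed

lemma bump_ge_half:
  assumes "c + 1 \<le> x" "x \<le> d - 1"
  shows "bump c d 1 x \<ge> 1 / 2"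
proof -
  have "1 * 1 \<le> (x - c) * (d - x)" using assms by (intro mult_mono) auto
  define t where "t = (max 0 ((x - c) * (d - x)))\<^sup>2"
  have "t \<ge> 1" using \<open>1 * 1 \<le> (x - c) * (d - x)\<close> by (simp add: t_def)
  then have "t / (1 + t) \<ge> 1 / 2" by (simp add: field_simps)
  then show ?thesis by (simp add: bump_def t_def)
qed

context level_cover
begin

definition slice :: "nat \<Rightarrow> real^'n \<Rightarrow> complex" where
  "slice i \<rho> = (\<integral>\<theta>. H i (re_im_vec (\<rho>, \<theta>)) \<partial>lborel)"

text \<open>The absolute version of \<open>slice\<close>. Its values are extended reals, so that it
  is meaningful before any slice is known to be integrable.\<close>

definition nslice :: "nat \<Rightarrow> real^'n \<Rightarrow> ennreal" where
  "nslice i \<rho> = (\<integral>\<^sup>+\<theta>. ennreal (norm (H i (re_im_vec (\<rho>, \<theta>)))) \<partial>lborel)"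

lemma measurable_H_pair [measurable]:
  "(\<lambda>p. H i (re_im_vec p)) \<in> borel_measurable (borel \<Otimes>\<^sub>M borel)"
proof -
  have "(\<lambda>p. H i (re_im_vec p)) \<in> borel_measurable borel" by measurable
  then show ?thesis by (simp add: borel_prod)
qed

lemma measurable_H_slice [measurable]: "(\<lambda>\<theta>. H i (re_im_vec (\<rho>, \<theta>))) \<in> borel_measurable borel"
proof -
  have "continuous_on UNIV (\<lambda>\<theta>::real^'n. re_im_vec (\<rho>, \<theta>))"
    unfolding re_im_vec_def by (intro continuous_intros)
  then have [measurable]: "(\<lambda>\<theta>::real^'n. re_im_vec (\<rho>, \<theta>)) \<in> borel \<rightarrow>\<^sub>M borel"
    by (rule borel_measurable_continuous_onI)
  show ?thesis by measurable
qed

lemma measurable_nslice [measurable]: "nslice i \<in> borel_measurable borel"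
proof -
  have "(\<lambda>\<rho>. \<integral>\<^sup>+\<theta>. ennreal (norm (H i (re_im_vec (\<rho>, \<theta>)))) \<partial>lborel) \<in> borel_measurable borel"
    by measurable
  then show ?thesis unfolding nslice_def[abs_def] .
qed

lemma measurable_slice [measurable]: "slice i \<in> borel_measurable borel"
proof -
  have "(\<lambda>\<rho>. \<integral>\<theta>. H i (re_im_vec (\<rho>, \<theta>)) \<partial>lborel) \<in> borel_measurable borel"
    by (rule lborel.borel_measurable_lebesgue_integral) (simp add: split_beta')
  then show ?thesis unfolding slice_def[abs_def] .
qed

lemma nn_tens_slice:
  assumes test: "\<And>j. test b (\<alpha> j)"
  shows "(\<integral>\<^sup>+\<rho>. ennreal \<bar>tens \<alpha> \<rho>\<bar> * suminf (\<lambda>i. nslice i \<rho>) \<partial>lborel) < \<infinity>"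
    and "(suminf (\<lambda>i. \<integral>\<^sup>+\<rho>. ennreal \<bar>tens \<alpha> \<rho>\<bar> * nslice i \<rho> \<partial>lborel)) < \<infinity>"
proof -
  note [measurable] = measurable_tens[where \<alpha> = \<alpha>, OF test]
  have eq: "(\<integral>\<^sup>+u. ennreal (norm (g \<alpha> i u)) \<partial>lborel) = (\<integral>\<^sup>+\<rho>. ennreal \<bar>tens \<alpha> \<rho>\<bar> * nslice i \<rho> \<partial>lborel)" for i
  proof -
    have "g \<alpha> i \<in> borel_measurable borel"
      by (rule measurable_g[where \<alpha> = \<alpha>, OF test])
    then have m: "(\<lambda>u. ennreal (norm (g \<alpha> i u))) \<in> borel_measurable borel"
      by (intro measurable_compose[OF measurable_compose[OF _ borel_measurable_norm] measurable_ennreal])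
    have "(\<integral>\<^sup>+u. ennreal (norm (g \<alpha> i u)) \<partial>lborel) = (\<integral>\<^sup>+\<rho>. (\<integral>\<^sup>+\<theta>. ennreal (norm (g \<alpha> i (re_im_vec (\<rho>, \<theta>)))) \<partial>lborel) \<partial>lborel)"
      by (rule nn_integral_re_im_vec[OF m])
    also have "\<dots> = (\<integral>\<^sup>+\<rho>. ennreal \<bar>tens \<alpha> \<rho>\<bar> * nslice i \<rho> \<partial>lborel)"
      unfolding g_def[where \<alpha> = \<alpha>, OF test] nslice_def
      by (intro nn_integral_cong, subst nn_integral_cmult[symmetric]) (auto simp: ennreal_mult)
    finally show ?thesis .
  qed
  show 2: "(suminf (\<lambda>i. \<integral>\<^sup>+\<rho>. ennreal \<bar>tens \<alpha> \<rho>\<bar> * nslice i \<rho> \<partial>lborel)) < \<infinity>"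
    unfolding eq[symmetric] by (rule suminf_g_finite[where \<alpha> = \<alpha>, OF test])
  have "(\<integral>\<^sup>+\<rho>. ennreal \<bar>tens \<alpha> \<rho>\<bar> * suminf (\<lambda>i. nslice i \<rho>) \<partial>lborel) = (\<integral>\<^sup>+\<rho>. (suminf (\<lambda>i. ennreal \<bar>tens \<alpha> \<rho>\<bar> * nslice i \<rho>)) \<partial>lborel)"
    by (simp add: ennreal_suminf_cmult)
  also have "\<dots> = (suminf (\<lambda>i. \<integral>\<^sup>+\<rho>. ennreal \<bar>tens \<alpha> \<rho>\<bar> * nslice i \<rho> \<partial>lborel))"
    by (rule nn_integral_suminf) measurable
  finally show "(\<integral>\<^sup>+\<rho>. ennreal \<bar>tens \<alpha> \<rho>\<bar> * suminf (\<lambda>i. nslice i \<rho>) \<partial>lborel) < \<infinity>"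
    using 2 by simp
qed

text \<open>A finite integral against a test function that is positive on a box forces finiteness
  almost everywhere in that box. The boxes with lower bound -m exhaust the region.\<close>

lemma AE_nslice_finite: "AE \<rho> in lborel. (\<forall>j. \<rho> $ j < b) \<longrightarrow> suminf (\<lambda>i. nslice i \<rho>) < \<infinity>"
proof -
  have "AE \<rho> in lborel. (\<forall>j. - real m < \<rho> $ j \<and> \<rho> $ j < b) \<longrightarrow> suminf (\<lambda>i. nslice i \<rho>) < \<infinity>" for m
  proof (cases "- real m \<le> b")
    case True
    define \<alpha> :: "'n \<Rightarrow> real \<Rightarrow> real" where "\<alpha> j = bump (- real m) b 1" for j
    have test: "test b (\<alpha> j)" for j unfolding \<alpha>_def by (rule test_bump[OF True])
    note [measurable] = measurable_tens[where \<alpha> = \<alpha>, OF test]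
    have "AE \<rho> in lborel. ennreal \<bar>tens \<alpha> \<rho>\<bar> * suminf (\<lambda>i. nslice i \<rho>) \<noteq> \<infinity>"
      using nn_tens_slice(1)[where \<alpha> = \<alpha>, OF test] by (intro nn_integral_noteq_infinite) auto
    then show ?thesis
    proof (rule eventually_mono, intro impI)
      fix \<rho> assume fin: "ennreal \<bar>tens \<alpha> \<rho>\<bar> * suminf (\<lambda>i. nslice i \<rho>) \<noteq> \<infinity>" and "\<forall>j. - real m < \<rho> $ j \<and> \<rho> $ j < b"
      then have "tens \<alpha> \<rho> > 0" unfolding tens_def \<alpha>_def by (intro prod_pos ballI bump_pos) auto
      then show "suminf (\<lambda>i. nslice i \<rho>) < \<infinity>"
        using fin by (auto simp: ennreal_mult_eq_top_iff less_top)
    qed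
  next
    case False
    then show ?thesis by (intro AE_I2) (meson less_trans not_le order.strict_implies_order)
  qed
  then have "AE \<rho> in lborel. \<forall>m. (\<forall>j. - real m < \<rho> $ j \<and> \<rho> $ j < b) \<longrightarrow> suminf (\<lambda>i. nslice i \<rho>) < \<infinity>"
    by (intro AE_all_countable[THEN iffD2] allI)
  then show ?thesis
  proof (rule eventually_mono, intro impI)
    fix \<rho> :: "real^'n" assume *: "\<forall>m. (\<forall>j. - real m < \<rho> $ j \<and> \<rho> $ j < b) \<longrightarrow> suminf (\<lambda>i. nslice i \<rho>) < \<infinity>"
      and "\<forall>j. \<rho> $ j < b"
    obtain m where "norm \<rho> < real m" using reals_Archimedean2 by blast
    then have "- real m < \<rho> $ j" for j
      using component_le_norm_cart[of \<rho> j] by linarith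
    then show "suminf (\<lambda>i. nslice i \<rho>) < \<infinity>" using * \<open>\<forall>j. \<rho> $ j < b\<close> by blast
  qed
qed

lemma slice_summable:
  assumes "suminf (\<lambda>i. nslice i \<rho>) < \<infinity>"
  shows "integrable lborel (\<lambda>\<theta>. H i (re_im_vec (\<rho>, \<theta>)))"
    and "summable (\<lambda>i. \<integral>\<theta>. norm (H i (re_im_vec (\<rho>, \<theta>))) \<partial>lborel)"
    and "summable (\<lambda>i. norm (slice i \<rho>))"
proof -
  have fin: "nslice i \<rho> < \<infinity>" for i
    using ennreal_suminf_lessD[OF assms[unfolded infinity_ennreal_def]] by simp
  show int: "integrable lborel (\<lambda>\<theta>. H i (re_im_vec (\<rho>, \<theta>)))" for i
    using fin[of i] unfolding integrable_iff_bounded nslice_def by simp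
  have eq: "ennreal (\<integral>\<theta>. norm (H i (re_im_vec (\<rho>, \<theta>))) \<partial>lborel) = nslice i \<rho>" for i
    unfolding nslice_def by (intro nn_integral_eq_integral[symmetric] integrable_norm int) auto
  show s: "summable (\<lambda>i. \<integral>\<theta>. norm (H i (re_im_vec (\<rho>, \<theta>))) \<partial>lborel)"
  proof (rule summable_suminf_not_top)
    show "(suminf (\<lambda>i. ennreal (\<integral>\<theta>. norm (H i (re_im_vec (\<rho>, \<theta>))) \<partial>lborel))) \<noteq> top"
      unfolding eq using assms by simp
  qed (auto intro!: Bochner_Integration.integral_nonneg)
  show "summable (\<lambda>i. norm (slice i \<rho>))"
    by (rule summable_comparison_test'[OF s, of 0]) (simp add: slice_def integral_norm_bound)
qed

definition total :: "real^'n \<Rightarrow> complex" where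
  "total \<rho> = suminf (\<lambda>i. slice i \<rho>)"

lemma measurable_total [measurable]: "total \<in> borel_measurable borel"
  unfolding total_def[abs_def] by measurable

text \<open>The test functions depend on the real parts only, so Fubini moves them in front of the
  integral over the angles. For almost every \<rho> either the test function is 0 or the slices are
  summable, which allows the sum over the charts to be exchanged with the integral.\<close>

lemma integral_tens_total:
  assumes test: "\<And>j. test b (\<alpha> j)"
  shows "integrable lborel (\<lambda>\<rho>. tens \<alpha> \<rho> *\<^sub>R total \<rho>)"
    and "(\<integral>\<rho>. tens \<alpha> \<rho> *\<^sub>R total \<rho> \<partial>lborel) = weighted h \<alpha>"
proof -
  note [measurable] = measurable_tens[where \<alpha> = \<alpha>, OF test]
  define f where "f i \<rho> = tens \<alpha> \<rho> *\<^sub>R slice i \<rho>" for i \<rho>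
  have fg: "f i \<rho> = (\<integral>\<theta>. g \<alpha> i (re_im_vec (\<rho>, \<theta>)) \<partial>lborel)" for i \<rho>
    unfolding g_def[where \<alpha> = \<alpha>, OF test] f_def slice_def by simp
  have intf: "integrable lborel (f i)" and If: "(\<integral>\<rho>. f i \<rho> \<partial>lborel) = (\<integral>u. g \<alpha> i u \<partial>lborel)" for i
    unfolding fg using integral_re_im_vec[OF integrable_g[where \<alpha> = \<alpha> and i = i, OF test]] by auto
  have bound: "ennreal (norm (f i \<rho>)) \<le> ennreal \<bar>tens \<alpha> \<rho>\<bar> * nslice i \<rho>" for i \<rho>
  proof (cases "integrable lborel (\<lambda>\<theta>. H i (re_im_vec (\<rho>, \<theta>)))")
    case True
    then have "ennreal (norm (slice i \<rho>)) \<le> nslice i \<rho>"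
      unfolding slice_def nslice_def by (rule integral_norm_bound_ennreal)
    then show ?thesis by (simp add: f_def ennreal_mult mult_left_mono)
  next
    case False
    then show ?thesis by (simp add: f_def slice_def not_integrable_integral_eq)
  qed
  have nn: "ennreal (\<integral>\<rho>. norm (f i \<rho>) \<partial>lborel) \<le> (\<integral>\<^sup>+\<rho>. ennreal \<bar>tens \<alpha> \<rho>\<bar> * nslice i \<rho> \<partial>lborel)" for i
  proof -
    have "ennreal (\<integral>\<rho>. norm (f i \<rho>) \<partial>lborel) = (\<integral>\<^sup>+\<rho>. ennreal (norm (f i \<rho>)) \<partial>lborel)"
      by (intro nn_integral_eq_integral[symmetric] integrable_norm intf) auto
    also have "\<dots> \<le> (\<integral>\<^sup>+\<rho>. ennreal \<bar>tens \<alpha> \<rho>\<bar> * nslice i \<rho> \<partial>lborel)"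
      by (intro nn_integral_mono bound)
    finally show ?thesis .
  qed
  have sum1: "summable (\<lambda>i. \<integral>\<rho>. norm (f i \<rho>) \<partial>lborel)"
  proof (rule summable_suminf_not_top)
    have "(suminf (\<lambda>i. ennreal (\<integral>\<rho>. norm (f i \<rho>) \<partial>lborel))) \<le> (suminf (\<lambda>i. \<integral>\<^sup>+\<rho>. ennreal \<bar>tens \<alpha> \<rho>\<bar> * nslice i \<rho> \<partial>lborel))"
      by (intro suminf_le nn) auto
    also have "\<dots> < \<infinity>" by (rule nn_tens_slice(2)[where \<alpha> = \<alpha>, OF test])
    finally show "(suminf (\<lambda>i. ennreal (\<integral>\<rho>. norm (f i \<rho>) \<partial>lborel))) \<noteq> top" by simp
  qed (auto intro!: Bochner_Integration.integral_nonneg)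
  have AEfin: "AE \<rho> in lborel. ennreal \<bar>tens \<alpha> \<rho>\<bar> * suminf (\<lambda>i. nslice i \<rho>) \<noteq> \<infinity>"
    using nn_tens_slice(1)[where \<alpha> = \<alpha>, OF test] by (intro nn_integral_noteq_infinite) auto
  have good: "tens \<alpha> \<rho> = 0 \<or> suminf (\<lambda>i. nslice i \<rho>) < \<infinity>"
    if "ennreal \<bar>tens \<alpha> \<rho>\<bar> * suminf (\<lambda>i. nslice i \<rho>) \<noteq> \<infinity>" for \<rho>
    using that by (auto simp: ennreal_mult_eq_top_iff less_top)
  have sum2: "AE \<rho> in lborel. summable (\<lambda>i. norm (f i \<rho>))"
    using AEfin
  proof (rule eventually_mono)
    fix \<rho> assume "ennreal \<bar>tens \<alpha> \<rho>\<bar> * suminf (\<lambda>i. nslice i \<rho>) \<noteq> \<infinity>"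
    from good[OF this] show "summable (\<lambda>i. norm (f i \<rho>))"
    proof
      assume "suminf (\<lambda>i. nslice i \<rho>) < \<infinity>"
      from slice_summable(3)[OF this] show ?thesis by (simp add: f_def summable_mult)
    qed (simp add: f_def)
  qed
  have eq: "AE \<rho> in lborel. suminf (\<lambda>i. f i \<rho>) = tens \<alpha> \<rho> *\<^sub>R total \<rho>"
    using AEfin
  proof (rule eventually_mono)
    fix \<rho> assume "ennreal \<bar>tens \<alpha> \<rho>\<bar> * suminf (\<lambda>i. nslice i \<rho>) \<noteq> \<infinity>"
    from good[OF this] show "suminf (\<lambda>i. f i \<rho>) = tens \<alpha> \<rho> *\<^sub>R total \<rho>"
    proof
      assume "suminf (\<lambda>i. nslice i \<rho>) < \<infinity>"
      from slice_summable(3)[OF this] have "summable (\<lambda>i. slice i \<rho>)" by (rule summable_norm_cancel)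
      then show ?thesis unfolding f_def total_def by (rule suminf_scaleR_right[symmetric])
    qed (simp add: f_def)
  qed
  have m1: "(\<lambda>\<rho>. suminf (\<lambda>i. f i \<rho>)) \<in> borel_measurable lborel"
    unfolding f_def by measurable
  have m2: "(\<lambda>\<rho>. tens \<alpha> \<rho> *\<^sub>R total \<rho>) \<in> borel_measurable lborel"
    by measurable
  show "integrable lborel (\<lambda>\<rho>. tens \<alpha> \<rho> *\<^sub>R total \<rho>)"
    using integrable_suminf[OF intf sum2 sum1] integrable_cong_AE[OF m1 m2 eq] by simp
  have "(\<integral>\<rho>. tens \<alpha> \<rho> *\<^sub>R total \<rho> \<partial>lborel) = (\<integral>\<rho>. suminf (\<lambda>i. f i \<rho>) \<partial>lborel)"
    by (rule integral_cong_AE[OF m1 m2 eq, symmetric])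
  moreover have "(\<lambda>i. \<integral>u. g \<alpha> i u \<partial>lborel) sums (\<integral>\<rho>. suminf (\<lambda>i. f i \<rho>) \<partial>lborel)"
    using sums_integral[OF intf sum2 sum1] by (simp add: If)
  ultimately show "(\<integral>\<rho>. tens \<alpha> \<rho> *\<^sub>R total \<rho> \<partial>lborel) = weighted h \<alpha>"
    using sums_g[where \<alpha> = \<alpha>, OF test] sums_unique2 by simp
qed

lemma integral_tens_deviation:
  assumes test: "\<And>j. test b (\<alpha> j)" and nn: "\<And>j x. 0 \<le> \<alpha> j x"
  shows "integrable lborel (\<lambda>\<rho>. tens \<alpha> \<rho> *\<^sub>R (total \<rho> - mean h))"
    and "(\<integral>\<rho>. tens \<alpha> \<rho> *\<^sub>R (total \<rho> - mean h) \<partial>lborel) = 0"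
proof -
  have t: "integrable lborel (tens \<alpha>)" "(\<integral>\<rho>. tens \<alpha> \<rho> \<partial>lborel) = (\<Prod>j\<in>UNIV. \<integral>x. \<alpha> j x \<partial>lborel)"
    unfolding tens_def[abs_def] using integral_prod_vec[of \<alpha>] test_integrable[OF test] nn by auto
  have c: "integrable lborel (\<lambda>\<rho>. tens \<alpha> \<rho> *\<^sub>R mean h)" "(\<integral>\<rho>. tens \<alpha> \<rho> *\<^sub>R mean h \<partial>lborel) = weighted h \<alpha>"
    using t weighted_mean[where \<alpha> = \<alpha>, OF polyh test] by (simp_all add: scaleR_conv_of_real mult.commute)
  show "integrable lborel (\<lambda>\<rho>. tens \<alpha> \<rho> *\<^sub>R (total \<rho> - mean h))"
    using integral_tens_total(1)[where \<alpha> = \<alpha>, OF test] c(1) by (simp add: scaleR_diff_right)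
  show "(\<integral>\<rho>. tens \<alpha> \<rho> *\<^sub>R (total \<rho> - mean h) \<partial>lborel) = 0"
    using integral_tens_total[where \<alpha> = \<alpha>, OF test] c by (simp add: scaleR_diff_right)
qed

text \<open>Weak constancy becomes pointwise because products of bumps approximate the indicators of
  boxes: the deviation from the mean has integral 0 over each of them.\<close>

lemma AE_total_eq_mean: "AE \<rho> in lborel. (\<forall>j. \<rho> $ j < b - 1) \<longrightarrow> total \<rho> = mean h"
proof -
  have "AE \<rho> in lborel. (\<forall>j. - real m < \<rho> $ j \<and> \<rho> $ j < b - 1) \<longrightarrow> total \<rho> = mean h" for m
  proof (cases "- real m \<le> b - 1")
    case True
    define B where "B = {\<rho> :: real^'n. \<forall>j. - real m < \<rho> $ j \<and> \<rho> $ j < b - 1}"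
    have B_box: "B = box (\<chi> j. - real m) (\<chi> j. b - 1)" by (auto simp: B_def mem_box_cart)
    then have [measurable]: "B \<in> sets borel" by simp
    define f where "f \<rho> = indicator B \<rho> *\<^sub>R (total \<rho> - mean h)" for \<rho>
    \<comment> \<open>The support exceeds the box \<open>B\<close> by 1 on every side, so the
      product of the bumps is at least (1/2)^n on \<open>B\<close>, and the deviation is integrable
      there. This is the reason for the bound \<open>b - 1\<close>.\<close>
    define \<alpha> :: "'n \<Rightarrow> real \<Rightarrow> real" where "\<alpha> j = bump (- real m - 1) b 1" for j
    have test: "test b (\<alpha> j)" for j unfolding \<alpha>_def using True by (intro test_bump) simp
    note [measurable] = measurable_tens[where \<alpha> = \<alpha>, OF test]
    have dev: "integrable lborel (\<lambda>\<rho>. tens \<alpha> \<rho> *\<^sub>R (total \<rho> - mean h))"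
      by (rule integral_tens_deviation(1)[where \<alpha> = \<alpha>, OF test]) (simp add: \<alpha>_def bump_0_le_1)
    have intf: "integrable lborel f"
    proof (rule Bochner_Integration.integrable_bound)
      show "integrable lborel (\<lambda>\<rho>. 2 ^ CARD('n) *\<^sub>R (tens \<alpha> \<rho> *\<^sub>R (total \<rho> - mean h)))"
        using dev by (rule integrable_scaleR_right)
      show "f \<in> borel_measurable lborel" unfolding f_def by measurable
      show "AE \<rho> in lborel. norm (f \<rho>) \<le> norm (2 ^ CARD('n) *\<^sub>R (tens \<alpha> \<rho> *\<^sub>R (total \<rho> - mean h)))"
      proof (rule AE_I2)
        fix \<rho>
        show "norm (f \<rho>) \<le> norm (2 ^ CARD('n) *\<^sub>R (tens \<alpha> \<rho> *\<^sub>R (total \<rho> - mean h)))"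
        proof (cases "\<rho> \<in> B")
          case True
          then have "(\<Prod>j\<in>(UNIV :: 'n set). 1 / 2) \<le> tens \<alpha> \<rho>"
            unfolding tens_def \<alpha>_def by (intro prod_mono conjI bump_ge_half) (auto simp: B_def less_imp_le)
          then have "1 \<le> 2 ^ CARD('n) * tens \<alpha> \<rho>"
            by (simp add: power_one_over field_simps)
          then have "1 * norm (total \<rho> - mean h) \<le> \<bar>2 ^ CARD('n) * tens \<alpha> \<rho>\<bar> * norm (total \<rho> - mean h)"
            by (intro mult_right_mono) auto
          then show ?thesis using True by (simp add: f_def abs_mult mult.assoc)
        qed (simp add: f_def)
      qed
    qed
    have "AE \<rho> in lborel. f \<rho> = 0"
    proof (rule AE_zero_if_integral_box_zero[OF intf])
      fix l u :: "real^'n"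
      \<comment> \<open>The box is cut down to \<open>B\<close>, so that the bumps over it are
        supported below the level \<open>b\<close>.\<close>
      define l' where "l' = (\<chi> j. max (l $ j) (- real m))"
      define u' where "u' = (\<chi> j. min (u $ j) (b - 1))"
      have eq: "indicator (box l u) \<rho> *\<^sub>R f \<rho> = indicator (box l' u') \<rho> *\<^sub>R (total \<rho> - mean h)" for \<rho>
        by (auto simp: indicator_def f_def B_def l'_def u'_def mem_box_cart)
      show "(\<integral>\<rho>. indicator (box l u) \<rho> *\<^sub>R f \<rho> \<partial>lborel) = 0"
      proof (cases "\<forall>j. l' $ j \<le> u' $ j")
        case False
        then have "box l' u' = {}" by (force simp: mem_box_cart not_le dest: less_trans)
        then show ?thesis unfolding eq by simp
      next
        case True
        define \<beta> where "\<beta> k j = bump (l' $ j) (u' $ j) k" for k j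
        have test\<beta>: "test b (\<beta> k j)" for k j
          unfolding \<beta>_def by (rule test_mono[OF test_bump]) (use True in \<open>auto simp: u'_def\<close>)
        have tens_lim: "(\<lambda>k. tens (\<beta> k) \<rho>) \<longlonglongrightarrow> indicator (box l' u') \<rho>" for \<rho>
        proof -
          have "(\<lambda>k. tens (\<beta> k) \<rho>) \<longlonglongrightarrow> (\<Prod>j\<in>UNIV. indicator {l' $ j<..<u' $ j} (\<rho> $ j))"
            unfolding tens_def \<beta>_def using True by (intro tendsto_prod bump_tendsto) auto
          moreover have "(\<Prod>j\<in>UNIV. indicator {l' $ j<..<u' $ j} (\<rho> $ j) :: real) = indicator (box l' u') \<rho>"
            by (auto simp: indicator_def mem_box_cart prod_zero_iff)
          ultimately show ?thesis by simp
        qed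
        have "(\<lambda>k. \<integral>\<rho>. tens (\<beta> k) \<rho> *\<^sub>R (total \<rho> - mean h) \<partial>lborel) \<longlonglongrightarrow>
          (\<integral>\<rho>. indicator (box l' u') \<rho> *\<^sub>R (total \<rho> - mean h) \<partial>lborel)"
        proof (rule integral_dominated_convergence[where w = "\<lambda>\<rho>. norm (f \<rho>)"])
          show "integrable lborel (\<lambda>\<rho>. norm (f \<rho>))" using intf by simp
          show "(\<lambda>\<rho>. tens (\<beta> k) \<rho> *\<^sub>R (total \<rho> - mean h)) \<in> borel_measurable lborel" for k
            using measurable_tens[where \<alpha> = "\<beta> k", OF test\<beta>] by measurable
          show "AE \<rho> in lborel. (\<lambda>k. tens (\<beta> k) \<rho> *\<^sub>R (total \<rho> - mean h)) \<longlonglongrightarrow> indicator (box l' u') \<rho> *\<^sub>R (total \<rho> - mean h)"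
            by (intro AE_I2 tendsto_scaleR tens_lim tendsto_const)
          show "AE \<rho> in lborel. norm (tens (\<beta> k) \<rho> *\<^sub>R (total \<rho> - mean h)) \<le> norm (f \<rho>)" for k
          proof (rule AE_I2)
            fix \<rho>
            show "norm (tens (\<beta> k) \<rho> *\<^sub>R (total \<rho> - mean h)) \<le> norm (f \<rho>)"
            proof (cases "\<rho> \<in> box l' u'")
              case True
              then have "\<rho> \<in> B" by (auto simp: B_def l'_def u'_def mem_box_cart)
              moreover have "\<bar>tens (\<beta> k) \<rho>\<bar> \<le> 1"
              proof -
                have "tens (\<beta> k) \<rho> \<le> 1" "tens (\<beta> k) \<rho> \<ge> 0"
                  unfolding tens_def \<beta>_def by (auto intro!: prod_le_1 prod_nonneg bump_0_le_1)
                then show ?thesis by simp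
              qed
              ultimately show ?thesis by (simp add: f_def mult_left_le_one_le)
            next
              case False
              then obtain j where "\<rho> $ j \<notin> {l' $ j<..<u' $ j}" by (auto simp: mem_box_cart)
              then have "\<beta> k j (\<rho> $ j) = 0"
                unfolding \<beta>_def using \<open>\<forall>j. l' $ j \<le> u' $ j\<close> by (intro bump_eq_0) auto
              then have "tens (\<beta> k) \<rho> = 0" by (auto simp: tens_def)
              then show ?thesis by simp
            qed
          qed
        qed measurable
        moreover have "(\<integral>\<rho>. tens (\<beta> k) \<rho> *\<^sub>R (total \<rho> - mean h) \<partial>lborel) = 0" for k
          by (rule integral_tens_deviation(2)[where \<alpha> = "\<beta> k", OF test\<beta>]) (simp add: \<beta>_def bump_0_le_1)
        ultimately have "(\<lambda>k. 0) \<longlonglongrightarrow> (\<integral>\<rho>. indicator (box l' u') \<rho> *\<^sub>R (total \<rho> - mean h) \<partial>lborel)"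
          by simp
        then show ?thesis
          unfolding eq using LIMSEQ_unique[OF _ tendsto_const] by blast
      qed
    qed
    then show ?thesis
      by (rule eventually_mono) (auto simp: f_def B_def)
  next
    case False
    then show ?thesis by (intro AE_I2) (meson less_trans not_le order.strict_implies_order)
  qed
  then have "AE \<rho> in lborel. \<forall>m. (\<forall>j. - real m < \<rho> $ j \<and> \<rho> $ j < b - 1) \<longrightarrow> total \<rho> = mean h"
    by (intro AE_all_countable[THEN iffD2] allI)
  then show ?thesis
  proof (rule eventually_mono, intro impI)
    fix \<rho> :: "real^'n" assume *: "\<forall>m. (\<forall>j. - real m < \<rho> $ j \<and> \<rho> $ j < b - 1) \<longrightarrow> total \<rho> = mean h"
      and "\<forall>j. \<rho> $ j < b - 1"
    obtain m where "norm \<rho> < real m" using reals_Archimedean2 by blast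
    then have "- real m < \<rho> $ j" for j
      using component_le_norm_cart[of \<rho> j] by linarith
    then show "total \<rho> = mean h" using * \<open>\<forall>j. \<rho> $ j < b - 1\<close> by blast
  qed
qed

end

section \<open>Sets of vanishing Hausdorff measure\<close>

lemma emeasure_cball_le:
  fixes y :: "'a::euclidean_space"
  assumes "0 \<le> r"
  shows "emeasure lborel (cball y r) \<le> ennreal ((2 * r) ^ DIM('a))"
proof -
  have "cball y r \<subseteq> cbox (y - r *\<^sub>R One) (y + r *\<^sub>R One)"
  proof
    fix x assume "x \<in> cball y r"
    then have "\<bar>(x - y) \<bullet> i\<bar> \<le> r" if "i \<in> Basis" for i
      using Basis_le_norm[OF that, of "x - y"] by (simp add: dist_norm norm_minus_commute)
    then show "x \<in> cbox (y - r *\<^sub>R One) (y + r *\<^sub>R One)"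
      by (force simp: mem_box algebra_simps abs_le_iff)
  qed
  then have "emeasure lborel (cball y r) \<le> emeasure lborel (cbox (y - r *\<^sub>R One) (y + r *\<^sub>R One))"
    by (intro emeasure_mono) auto
  also have "\<dots> = ennreal (\<Prod>b\<in>(Basis :: 'a set). 2 * r)"
    using assms by (subst emeasure_lborel_cbox) (auto simp: algebra_simps)
  finally show ?thesis by simp
qed

lemma hausdorff_null_subset: "hausdorff_null d S \<Longrightarrow> T \<subseteq> S \<Longrightarrow> hausdorff_null d T"
  unfolding hausdorff_null_def by (meson order_trans)

lemma negligible_ball_cover:
  fixes S :: "'a::euclidean_space set"
  assumes S: "negligible S" "bounded S" and e: "0 < e"
  shows "\<exists>(c :: nat \<Rightarrow> 'a) (r :: nat \<Rightarrow> real). (\<forall>k. 0 \<le> r k) \<and> S \<subseteq> (\<Union>k. cball (c k) (r k)) \<and>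
    summable (\<lambda>k. r k ^ DIM('a)) \<and> suminf (\<lambda>k. r k ^ DIM('a)) \<le> e"
proof -
  let ?D = "DIM('a)"
  obtain M where M: "M > 0" "\<And>x. x \<in> S \<Longrightarrow> norm x \<le> M"
    using S(2) by (auto simp: bounded_pos)
  \<comment> \<open>A cube, so that the dyadic intervals covering \<open>S\<close> are cubes too;
    the volume of a cube is comparable to a power of its diameter.\<close>
  define B where "B = cbox (- M *\<^sub>R One) (M *\<^sub>R (One :: 'a))"
  have "S \<subseteq> B"
  proof
    fix x assume "x \<in> S"
    then have "\<bar>x \<bullet> i\<bar> \<le> M" if "i \<in> Basis" for i
      using Basis_le_norm[OF that, of x] M(2)[of x] by simp
    then show "x \<in> B" by (force simp: B_def mem_box abs_le_iff)
  qed
  \<comment> \<open>A cube of side s lies in the ball of radius D s around a corner, where D is the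
    dimension. Passing from volumes to powers of radii therefore costs the factor D^D.\<close>
  define e' where "e' = e / real ?D ^ ?D"
  have D0: "real ?D > 0" by simp
  have e': "e' > 0" using e by (simp add: e'_def)
  obtain \<D> where \<D>: "countable \<D>"
    "\<And>K. K \<in> \<D> \<Longrightarrow> K \<subseteq> B \<and> K \<noteq> {} \<and> (\<exists>c d. K = cbox c d)"
    "pairwise (\<lambda>A B. interior A \<inter> interior B = {}) \<D>"
    "\<And>u v. cbox u v \<in> \<D> \<Longrightarrow> \<exists>n. \<forall>i \<in> Basis. v \<bullet> i - u \<bullet> i = (M *\<^sub>R One \<bullet> i - (- M *\<^sub>R One) \<bullet> i) / 2^n"
    "S \<subseteq> \<Union>\<D>" "\<Union>\<D> \<in> lmeasurable" "measure lebesgue (\<Union>\<D>) \<le> measure lebesgue S + e'"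
    using measurable_outer_intervals_bounded[OF negligible_imp_measurable[OF S(1)] \<open>S \<subseteq> B\<close>[unfolded B_def] e']
    unfolding B_def by metis
  have cube: "\<exists>u s. s > 0 \<and> K \<subseteq> cball u (real ?D * s) \<and> measure lebesgue K = s ^ ?D" if KD: "K \<in> \<D>" for K
  proof -
    obtain u v where K: "K = cbox u v" using \<D>(2)[OF KD] by blast
    obtain n where n: "\<forall>i \<in> Basis. v \<bullet> i - u \<bullet> i = (M *\<^sub>R One \<bullet> i - (- M *\<^sub>R One) \<bullet> i) / 2^n"
      using \<D>(4)[of u v] KD K by blast
    define s where "s = 2 * M / 2 ^ n"
    have s: "v \<bullet> i - u \<bullet> i = s" if "i \<in> Basis" for i
      using n that by (simp add: s_def)
    have s0: "s > 0" using M by (simp add: s_def)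
    have "measure lebesgue K = (\<Prod>i\<in>(Basis :: 'a set). s)"
    proof -
      have "\<forall>i\<in>Basis. u \<bullet> i \<le> v \<bullet> i" using s s0 by (auto simp: algebra_simps)
      then show ?thesis using s by (simp add: K content_cbox inner_diff_left cong: prod.cong)
    qed
    moreover have "K \<subseteq> cball u (real ?D * s)"
    proof
      fix x assume "x \<in> K"
      then have *: "\<bar>(x - u) \<bullet> i\<bar> \<le> s" if "i \<in> Basis" for i
        using s[OF that] that by (auto simp: K mem_box inner_diff_left)
      have "norm (x - u) \<le> (\<Sum>i\<in>Basis. \<bar>(x - u) \<bullet> i\<bar>)" by (rule norm_le_l1)
      also have "\<dots> \<le> (\<Sum>i\<in>(Basis :: 'a set). s)" by (rule sum_mono) (rule *)
      finally show "x \<in> cball u (real ?D * s)" by (simp add: dist_norm norm_minus_commute)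
    qed
    ultimately show ?thesis using s0 by auto
  qed
  then obtain u s where us: "\<And>K. K \<in> \<D> \<Longrightarrow> s K > 0 \<and> K \<subseteq> cball (u K) (real ?D * s K) \<and> measure lebesgue K = s K ^ ?D"
    by metis
  \<comment> \<open>The countable family may be finite; indices outside \<open>I\<close> get a ball
    of radius 0.\<close>
  define I where "I = to_nat_on \<D> ` \<D>"
  define c where "c k = (if k \<in> I then u (from_nat_into \<D> k) else 0)" for k
  define r where "r k = (if k \<in> I then real ?D * s (from_nat_into \<D> k) else 0)" for k
  have inD: "from_nat_into \<D> k \<in> \<D>" if "k \<in> I" for k
    using that \<D>(1) by (auto simp: I_def)
  have r0: "0 \<le> r k" for k
    using us[OF inD] by (auto simp: r_def intro!: mult_nonneg_nonneg less_imp_le)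
  have partial: "(\<Sum>k<n. r k ^ ?D) \<le> e" for n
  proof -
    define F where "F = from_nat_into \<D> ` ({..<n} \<inter> I)"
    have F: "finite F" "F \<subseteq> \<D>" using inD by (auto simp: F_def)
    have inj: "inj_on (from_nat_into \<D>) ({..<n} \<inter> I)"
      using \<D>(1) by (auto simp: inj_on_def I_def)
    have "(\<Sum>k<n. r k ^ ?D) = (\<Sum>k\<in>{..<n} \<inter> I. r k ^ ?D)"
      by (rule sum.mono_neutral_right) (auto simp: r_def)
    also have "\<dots> = (\<Sum>k\<in>{..<n} \<inter> I. real ?D ^ ?D * measure lebesgue (from_nat_into \<D> k))"
      using us[OF inD] by (intro sum.cong) (auto simp: r_def power_mult_distrib)
    also have "\<dots> = real ?D ^ ?D * (\<Sum>K\<in>F. measure lebesgue K)"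
      unfolding F_def by (subst sum.reindex[OF inj]) (simp add: sum_distrib_left)
    also have "(\<Sum>K\<in>F. measure lebesgue K) = measure lebesgue (\<Union>F)"
    proof (rule measure_negligible_finite_Union[symmetric, OF F(1)])
      show "K \<in> lmeasurable" if KF: "K \<in> F" for K
      proof -
        obtain a b where "K = cbox a b" using KF F(2) \<D>(2) by blast
        then show ?thesis by simp
      qed
      show "pairwise (\<lambda>S T. negligible (S \<inter> T)) F"
      proof (rule pairwiseI)
        fix K L assume KL: "K \<in> F" "L \<in> F" "K \<noteq> L"
        then have "K \<in> \<D>" "L \<in> \<D>" using F(2) by auto
        obtain a b where "K = cbox a b" using \<D>(2)[OF \<open>K \<in> \<D>\<close>] by blast
        moreover obtain c d where "L = cbox c d" using \<D>(2)[OF \<open>L \<in> \<D>\<close>] by blast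
        ultimately have "convex (K \<inter> L)" by (simp add: convex_Int)
        moreover have "interior (K \<inter> L) = {}"
          using KL F(2) \<D>(3) by (simp add: pairwise_def subset_iff)
        ultimately show "negligible (K \<inter> L)" by (simp add: negligible_convex_interior)
      qed
    qed
    also have "measure lebesgue (\<Union>F) \<le> measure lebesgue (\<Union>\<D>)"
    proof (rule measure_mono_fmeasurable)
      show "\<Union>F \<subseteq> \<Union>\<D>" using F(2) by blast
      show "\<Union>F \<in> sets lebesgue"
      proof (rule sets.finite_Union[OF F(1)])
        show "F \<subseteq> sets lebesgue"
        proof
          fix K assume "K \<in> F"
          then obtain a b where "K = cbox a b" using F(2) \<D>(2) by blast
          then show "K \<in> sets lebesgue" by simp
        qed
      qed
    qed (rule \<D>(6))
    also have "measure lebesgue (\<Union>\<D>) \<le> e'"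
      using \<D>(7) negligible_imp_measure0[OF S(1)] by simp
    also have "real ?D ^ ?D * e' = e" using D0 by (simp add: e'_def)
    finally show ?thesis using D0 by (simp add: mult_left_mono)
  qed
  have summ: "summable (\<lambda>k. r k ^ ?D)"
    by (rule summableI_nonneg_bounded[OF _ partial]) (simp add: r0)
  show ?thesis
  proof (intro exI conjI allI)
    show "0 \<le> r k" for k by (rule r0)
    show "S \<subseteq> (\<Union>k. cball (c k) (r k))"
    proof
      fix x assume "x \<in> S"
      then obtain K where K: "K \<in> \<D>" "x \<in> K" using \<D>(5) by blast
      define k where "k = to_nat_on \<D> K"
      have "k \<in> I" "from_nat_into \<D> k = K" using K(1) \<D>(1) by (auto simp: k_def I_def)
      then have "x \<in> cball (c k) (r k)" using us[OF K(1)] K(2) by (auto simp: c_def r_def)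
      then show "x \<in> (\<Union>k. cball (c k) (r k))" by blast
    qed
    show "summable (\<lambda>k. r k ^ ?D)" by (rule summ)
    show "suminf (\<lambda>k. r k ^ ?D) \<le> e" by (rule suminf_le_const[OF summ partial])
  qed
qed

text \<open>Eilenberg's inequality for null sets: cover \<open>Z\<close> by balls of small total volume and integrate
  the \<open>d\<close>-dimensional size of the part of the cover that meets the fibre.\<close>

lemma AE_hausdorff_null_fibre:
  fixes Z :: "'a::euclidean_space set" and F :: "'a \<Rightarrow> 'b::euclidean_space"
  assumes Z: "negligible Z" "bounded Z" and dim: "DIM('a) = DIM('b) + d" "0 < d"
    and lip: "\<And>x y. x \<in> Z \<Longrightarrow> y \<in> Z \<Longrightarrow> norm (F x - F y) \<le> L * norm (x - y)" and L: "L \<ge> 0"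
  shows "AE v in lborel. hausdorff_null d {z\<in>Z. F z = v}"
proof -
  let ?D = "DIM('a)" and ?m = "DIM('b)"
  \<comment> \<open>The total sizes are summable over \<open>k\<close>; this will force the sizes of
    the covers of almost every fibre to tend to 0.\<close>
  have "\<exists>c r. \<forall>k. (\<forall>i. 0 \<le> r k i) \<and> Z \<subseteq> (\<Union>i. cball (c k i) (r k i)) \<and> summable (\<lambda>i. r k i ^ ?D) \<and> suminf (\<lambda>i. r k i ^ ?D) \<le> (1/2) ^ k"
    (is "\<exists>c r. \<forall>k. ?Q k (c k) (r k)")
  proof -
    have "\<exists>p. \<forall>k. ?Q k (fst (p k)) (snd (p k))"
    proof (rule choice, rule allI)
      fix k
      have "\<exists>c r. ?Q k c r"
        by (rule negligible_ball_cover[OF Z]) simp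
      then obtain c r where "?Q k c r" by (elim exE)
      then have "?Q k (fst (c, r)) (snd (c, r))" unfolding fst_conv snd_conv .
      then show "\<exists>p. ?Q k (fst p) (snd p)" by (rule exI)
    qed
    then obtain p where "\<forall>k. ?Q k (fst (p k)) (snd (p k))" by (elim exE)
    then show ?thesis by (intro exI[of _ "\<lambda>k. fst (p k)"] exI[of _ "\<lambda>k. snd (p k)"])
  qed
  then obtain c r where cr: "\<forall>k. ?Q k (c k) (r k)" by (elim exE)
  have r0: "\<And>k i. 0 \<le> r k i" and cov: "\<And>k. Z \<subseteq> (\<Union>i. cball (c k i) (r k i))"
    and summ: "\<And>k. summable (\<lambda>i. r k i ^ ?D)" and small: "\<And>k. suminf (\<lambda>i. r k i ^ ?D) \<le> (1/2) ^ k"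
    using cr by simp_all
  \<comment> \<open>\<open>F\<close> is Lipschitz on \<open>Z\<close> only, so a ball containing the
    image of \<open>Z\<close> within a covering ball is centred at the image of a chosen point of
    \<open>Z\<close>. This costs the factor 2 in the radius.\<close>
  define C where "C k i = (if Z \<inter> cball (c k i) (r k i) = {} then {} else
      cball (F (SOME z. z \<in> Z \<inter> cball (c k i) (r k i))) (L * (2 * r k i)))" for k i
  have C: "F z \<in> C k i" if "z \<in> Z" "z \<in> cball (c k i) (r k i)" for z k i
  proof -
    define z0 where "z0 = (SOME z. z \<in> Z \<inter> cball (c k i) (r k i))"
    have z0: "z0 \<in> Z \<inter> cball (c k i) (r k i)"
      unfolding z0_def by (rule someI[of _ z]) (use that in auto)
    have "norm (z0 - z) \<le> 2 * r k i"
      using z0 that(2) dist_triangle3[of z0 z "c k i"] by (simp add: dist_norm[symmetric])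
    then have "norm (F z0 - F z) \<le> L * (2 * r k i)"
      using lip[of z0 z] z0 that(1) L by (meson IntD1 mult_left_mono order_trans)
    moreover have "Z \<inter> cball (c k i) (r k i) \<noteq> {}" using z0 by blast
    then have "C k i = cball (F z0) (L * (2 * r k i))" unfolding C_def z0_def by (simp only: if_False)
    ultimately show ?thesis by (simp add: dist_norm)
  qed
  have [measurable]: "C k i \<in> sets borel" for k i by (simp add: C_def)
  \<comment> \<open>The d-dimensional size of those balls of the k-th cover that can meet the fibre
    over \<open>v\<close>.\<close>
  define \<psi> where "\<psi> k v = suminf (\<lambda>i. ennreal (r k i ^ d) * indicator (C k i) v)" for k v
  have [measurable]: "\<psi> k \<in> borel_measurable borel" for k
    unfolding \<psi>_def[abs_def] by measurable
  have int\<psi>: "(\<integral>\<^sup>+v. \<psi> k v \<partial>lborel) \<le> ennreal ((4 * L) ^ ?m * (1/2) ^ k)" for k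
  proof -
    have "(\<integral>\<^sup>+v. \<psi> k v \<partial>lborel) = suminf (\<lambda>i. \<integral>\<^sup>+v. ennreal (r k i ^ d) * indicator (C k i) v \<partial>lborel)"
      unfolding \<psi>_def by (rule nn_integral_suminf) measurable
    also have "\<dots> \<le> suminf (\<lambda>i. ennreal ((4 * L) ^ ?m * r k i ^ ?D))"
    proof (rule suminf_le)
      fix i
      have "(\<integral>\<^sup>+v. ennreal (r k i ^ d) * indicator (C k i) v \<partial>lborel) = ennreal (r k i ^ d) * emeasure lborel (C k i)"
        by (simp add: nn_integral_cmult)
      also have "\<dots> \<le> ennreal (r k i ^ d) * ennreal ((2 * (L * (2 * r k i))) ^ ?m)"
        using emeasure_cball_le[of "L * (2 * r k i)"] L r0 by (intro mult_left_mono) (auto simp: C_def)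
      also have "\<dots> = ennreal ((4 * L) ^ ?m * r k i ^ ?D)"
        using r0 L by (simp add: ennreal_mult[symmetric] dim(1) power_add power_mult_distrib mult_ac)
      finally show "(\<integral>\<^sup>+v. ennreal (r k i ^ d) * indicator (C k i) v \<partial>lborel) \<le> ennreal ((4 * L) ^ ?m * r k i ^ ?D)" .
    qed auto
    also have "\<dots> = ennreal ((4 * L) ^ ?m * suminf (\<lambda>i. r k i ^ ?D))"
    proof -
      have "summable (\<lambda>i. (4 * L) ^ ?m * r k i ^ ?D)" using summ by (rule summable_mult)
      then have "suminf (\<lambda>i. ennreal ((4 * L) ^ ?m * r k i ^ ?D)) = ennreal (suminf (\<lambda>i. (4 * L) ^ ?m * r k i ^ ?D))"
        using r0 L by (intro suminf_ennreal2) auto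
      then show ?thesis using summ by (simp add: suminf_mult)
    qed
    also have "\<dots> \<le> ennreal ((4 * L) ^ ?m * (1/2) ^ k)"
      using small L by (intro ennreal_leI mult_left_mono) auto
    finally show ?thesis .
  qed
  have "(\<integral>\<^sup>+v. suminf (\<lambda>k. \<psi> k v) \<partial>lborel) = suminf (\<lambda>k. \<integral>\<^sup>+v. \<psi> k v \<partial>lborel)"
    by (rule nn_integral_suminf) measurable
  also have "\<dots> \<le> suminf (\<lambda>k. ennreal ((4 * L) ^ ?m * (1/2) ^ k))"
    by (intro suminf_le int\<psi>) auto
  also have "\<dots> < \<infinity>"
  proof -
    have "summable (\<lambda>k. (4 * L) ^ ?m * (1/2::real) ^ k)" by (intro summable_mult summable_geometric) simp
    then have "suminf (\<lambda>k. ennreal ((4 * L) ^ ?m * (1/2) ^ k)) = ennreal (suminf (\<lambda>k. (4 * L) ^ ?m * (1/2::real) ^ k))"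
      using L by (intro suminf_ennreal2) auto
    then show ?thesis by simp
  qed
  finally have "AE v in lborel. suminf (\<lambda>k. \<psi> k v) \<noteq> \<infinity>"
    by (intro nn_integral_noteq_infinite) auto
  then show ?thesis
  proof (rule eventually_mono)
    fix v assume fin: "suminf (\<lambda>k. \<psi> k v) \<noteq> \<infinity>"
    have fink: "\<psi> k v \<noteq> top" for k
      using ennreal_suminf_lessD[of "\<lambda>k. \<psi> k v" top k] fin by (simp add: less_top)
    define p where "p k = enn2real (\<psi> k v)" for k
    have p: "\<psi> k v = ennreal (p k)" "p k \<ge> 0" for k
      using fink[of k] by (simp_all add: p_def less_top)
    have "summable p"
      by (rule summable_suminf_not_top) (use p fin in auto)
    then have p_lim: "p \<longlonglongrightarrow> 0" by (rule summable_LIMSEQ_zero)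
    show "hausdorff_null d {z\<in>Z. F z = v}"
      unfolding hausdorff_null_def
    proof (intro allI impI)
      fix e :: real assume "e > 0"
      then obtain k where k: "p k < e"
        using p_lim by (metis (no_types, lifting) eventually_sequentially order_tendstoD(2) order_refl)
      define r' where "r' i = (if v \<in> C k i then r k i else 0)" for i
      \<comment> \<open>A discarded ball keeps its place with radius 0; as d > 0, it contributes
        nothing to the sum.\<close>
      have r': "ennreal (r' i ^ d) = ennreal (r k i ^ d) * indicator (C k i) v" for i
        using dim(2) by (simp add: r'_def)
      have s: "suminf (\<lambda>i. ennreal (r' i ^ d)) = ennreal (p k)"
        unfolding r' p(1)[symmetric] \<psi>_def ..
      have nn: "0 \<le> r' i ^ d" for i using r0 by (simp add: r'_def)
      have summ': "summable (\<lambda>i. r' i ^ d)"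
        by (rule summable_suminf_not_top) (use nn s in auto)
      have "ennreal (suminf (\<lambda>i. r' i ^ d)) = ennreal (p k)"
        using suminf_ennreal2[OF nn summ'] s by simp
      then have "suminf (\<lambda>i. r' i ^ d) = p k"
        using p(2) suminf_nonneg[OF summ' nn] by simp
      moreover have "{z \<in> Z. F z = v} \<subseteq> (\<Union>i. cball (c k i) (r' i))"
      proof
        fix z assume "z \<in> {z \<in> Z. F z = v}"
        then have z: "z \<in> Z" "F z = v" by auto
        then obtain i where "z \<in> cball (c k i) (r k i)" using cov[of k] by blast
        then have "z \<in> cball (c k i) (r' i)" using C[OF z(1)] z(2) by (simp add: r'_def)
        then show "z \<in> (\<Union>i. cball (c k i) (r' i))" by blast
      qed
      ultimately show "\<exists>c r. (\<forall>k. 0 \<le> r k) \<and> {z \<in> Z. F z = v} \<subseteq> (\<Union>k. cball (c k) (r k)) \<and>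
          summable (\<lambda>k. r k ^ d) \<and> suminf (\<lambda>k. r k ^ d) < e"
        using k summ' r0 by (intro exI[of _ "c k"] exI[of _ r']) (auto simp: r'_def)
    qed
  qed
qed

text \<open>Where the expansion constants are uniform, \<phi> has a locally Lipschitz inverse, which
  pulls small covers of \<open>Z\<close> back to small covers. The constants depend on the point, so
  the set is split into the countably many pieces \<open>E n\<close>.\<close>

lemma negligible_expanding_vimage:
  fixes \<phi> :: "'a::euclidean_space \<Rightarrow> 'b::metric_space"
  assumes Z: "hausdorff_null DIM('a) Z"
    and exp: "\<And>t. t \<in> W \<Longrightarrow> \<exists>m>0. \<exists>\<delta>>0. \<forall>s\<in>W. norm (s - t) < \<delta> \<longrightarrow> norm (s - t) \<le> m * dist (\<phi> s) (\<phi> t)"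
  shows "negligible {t\<in>W. \<phi> t \<in> Z}"
proof -
  let ?D = "DIM('a)"
  define E where "E n = {t\<in>W. \<phi> t \<in> Z \<and> (\<forall>s\<in>W. norm (s - t) < 1 / real (Suc n) \<longrightarrow> norm (s - t) \<le> real (Suc n) * dist (\<phi> s) (\<phi> t))}" for n
  have "{t\<in>W. \<phi> t \<in> Z} \<subseteq> (\<Union>n. E n)"
  proof
    fix t assume "t \<in> {t\<in>W. \<phi> t \<in> Z}"
    then have t: "t \<in> W" "\<phi> t \<in> Z" by auto
    obtain m \<delta> where m: "m > 0" "\<delta> > 0" "\<And>s. s \<in> W \<Longrightarrow> norm (s - t) < \<delta> \<Longrightarrow> norm (s - t) \<le> m * dist (\<phi> s) (\<phi> t)"
      using exp[OF t(1)] by blast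
    obtain n where n: "max m (1 / \<delta>) < real n" using reals_Archimedean2 by blast
    have "m \<le> real (Suc n)" using n by simp
    moreover have "1 / real (Suc n) \<le> \<delta>"
    proof -
      have "1 / \<delta> < real (Suc n)" using n by simp
      then show ?thesis using m(2) by (simp add: field_simps)
    qed
    ultimately have "norm (s - t) \<le> real (Suc n) * dist (\<phi> s) (\<phi> t)" if "s \<in> W" "norm (s - t) < 1 / real (Suc n)" for s
      using m(3)[OF that(1)] that(2) by (meson less_le_trans mult_right_mono order_trans zero_le_dist)
    then have "t \<in> E n" using t unfolding E_def by blast
    then show "t \<in> (\<Union>n. E n)" by blast
  qed
  moreover have "negligible (E n)" for n
    unfolding locally_negligible_alt[of "E n"]
  proof (intro ballI)
    fix q assume q: "q \<in> E n"
    define m where "m = real (Suc n)"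
    have m: "m > 0" by (simp add: m_def)
    \<comment> \<open>Two points of this ball differ by less than 1 / m, the range in which the
      expansion estimate is available on \<open>E n\<close>.\<close>
    define X where "X = E n \<inter> ball q (1 / (2 * m))"
    have X: "norm (s - t) \<le> m * dist (\<phi> s) (\<phi> t)" if "s \<in> X" "t \<in> X" for s t
    proof -
      have "norm (s - t) < 1 / (2 * m) + 1 / (2 * m)"
        using that dist_triangle3[of s t q] by (auto simp: X_def dist_norm norm_minus_commute)
      then have "norm (s - t) < 1 / m" using m by (simp add: field_simps)
      then show ?thesis using that by (auto simp: X_def E_def m_def)
    qed
    have "negligible X"
      unfolding negligible_outer_le
    proof (intro allI impI)
      fix e :: real assume e: "e > 0"
      define e' where "e' = e / (4 * m) ^ ?D"
      have "e' > 0" using e m by (simp add: e'_def)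
      then have "\<exists>c r. (\<forall>k. 0 \<le> r k) \<and> Z \<subseteq> (\<Union>k. cball (c k) (r k)) \<and> summable (\<lambda>k. r k ^ ?D) \<and> suminf (\<lambda>k. r k ^ ?D) < e'"
        using Z unfolding hausdorff_null_def by simp
      then obtain c r where cr: "(\<forall>k. 0 \<le> r k) \<and> Z \<subseteq> (\<Union>k. cball (c k) (r k)) \<and> summable (\<lambda>k. r k ^ ?D) \<and> suminf (\<lambda>k. r k ^ ?D) < e'"
        by (elim exE)
      have r: "\<And>k. 0 \<le> r k" "Z \<subseteq> (\<Union>k. cball (c k) (r k))" "summable (\<lambda>k. r k ^ ?D)" "suminf (\<lambda>k. r k ^ ?D) < e'"
        using cr by simp_all
      \<comment> \<open>The centres of the new balls have to be points of \<open>X\<close>. Where no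
        point of \<open>X\<close> is mapped into the k-th ball, \<open>t k\<close> is arbitrary and
        its ball merely enlarges \<open>T\<close>.\<close>
      define t where "t k = (SOME t. t \<in> X \<and> \<phi> t \<in> cball (c k) (r k))" for k
      define T where "T = (\<Union>k. cball (t k) (m * (2 * r k)))"
      have XT: "X \<subseteq> T"
      proof
        fix s assume s: "s \<in> X"
        then have "\<phi> s \<in> Z" by (simp add: X_def E_def)
        then obtain k where k: "\<phi> s \<in> cball (c k) (r k)" using r(2) by blast
        have "t k \<in> X \<and> \<phi> (t k) \<in> cball (c k) (r k)"
          unfolding t_def by (rule someI[of _ s]) (use s k in blast)
        then have "norm (t k - s) \<le> m * dist (\<phi> (t k)) (\<phi> s)" "dist (\<phi> (t k)) (\<phi> s) \<le> 2 * r k"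
          using X s k dist_triangle3[of "\<phi> (t k)" "\<phi> s" "c k"] by auto
        then have "norm (t k - s) \<le> m * (2 * r k)" using m by (meson mult_left_mono less_imp_le order_trans)
        then show "s \<in> T" unfolding T_def by (auto simp: dist_norm)
      qed
      have T: "T \<in> sets borel" unfolding T_def by auto
      have "emeasure lborel T \<le> suminf (\<lambda>k. emeasure lborel (cball (t k) (m * (2 * r k))))"
        unfolding T_def by (intro emeasure_subadditive_countably) auto
      also have "\<dots> \<le> suminf (\<lambda>k. ennreal ((4 * m) ^ ?D * r k ^ ?D))"
      proof (intro suminf_le)
        fix k
        show "emeasure lborel (cball (t k) (m * (2 * r k))) \<le> ennreal ((4 * m) ^ ?D * r k ^ ?D)"
        proof -
          have "2 * (m * (2 * r k)) = (4 * m) * r k" by simp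
          then show ?thesis
            using emeasure_cball_le[of "m * (2 * r k)" "t k"] m r(1)[of k] by (simp only: power_mult_distrib) simp
        qed
      qed auto
      also have "\<dots> = ennreal ((4 * m) ^ ?D * suminf (\<lambda>k. r k ^ ?D))"
      proof -
        have "summable (\<lambda>k. (4 * m) ^ ?D * r k ^ ?D)" using r(3) by (rule summable_mult)
        then have "suminf (\<lambda>k. ennreal ((4 * m) ^ ?D * r k ^ ?D)) = ennreal (suminf (\<lambda>k. (4 * m) ^ ?D * r k ^ ?D))"
          using r(1) m by (intro suminf_ennreal2) auto
        then show ?thesis using r(3) by (simp add: suminf_mult)
      qed
      also have "\<dots> \<le> ennreal ((4 * m) ^ ?D * e')"
        using r(4) m by (intro ennreal_leI mult_left_mono) auto
      also have "(4 * m) ^ ?D * e' = e" using m by (simp add: e'_def)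
      finally have le: "emeasure lborel T \<le> ennreal e" .
      then have "T \<in> lmeasurable" using T by (intro fmeasurableI) (auto simp: less_top[symmetric] top_unique)
      moreover have "measure lebesgue T \<le> e"
        using le e T unfolding measure_def by (simp add: enn2real_leI)
      ultimately show "\<exists>T. X \<subseteq> T \<and> T \<in> lmeasurable \<and> measure lebesgue T \<le> e" using XT by blast
    qed
    moreover have "openin (top_of_set (E n)) X" unfolding X_def by (rule openin_open_Int) simp
    moreover have "q \<in> X" using q m by (simp add: X_def)
    ultimately show "\<exists>U. openin (top_of_set (E n)) U \<and> q \<in> U \<and> negligible U" by blast
  qed
  ultimately show ?thesis
    by (meson negligible_countable_Union negligible_subset countable_image countableI_type rangeE image_iff negligible_Union_nat)
qed

section \<open>Integrals over level cycles\<close>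

text \<open>Real tangent vectors become complex ones, so that the matrix \<open>cjac\<close> acts on
  them as a complex matrix and can be multiplied with complex Jacobian matrices.\<close>

definition cvec :: "real^'n \<Rightarrow> complex^'n" where
  "cvec v = (\<chi> k. complex_of_real (v $ k))"

lemma cjac_derivative:
  fixes \<phi> :: "real^'n \<Rightarrow> complex^'n"
  assumes "\<phi> differentiable (at t)"
  shows "(\<phi> has_derivative (\<lambda>v. cjac \<phi> t *v cvec v)) (at t)"
proof -
  have d: "(\<phi> has_derivative frechet_derivative \<phi> (at t)) (at t)"
    using assms frechet_derivative_works by blast
  interpret D: linear "frechet_derivative \<phi> (at t)" using d by (rule has_derivative_linear)
  have "frechet_derivative \<phi> (at t) v = cjac \<phi> t *v cvec v" for v
  proof -
    have "v = (\<Sum>k\<in>UNIV. v $ k *\<^sub>R axis k 1)"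
      by (simp add: vec_eq_iff axis_def if_distrib cong: if_cong)
    then have "frechet_derivative \<phi> (at t) v = (\<Sum>k\<in>UNIV. v $ k *\<^sub>R frechet_derivative \<phi> (at t) (axis k 1))"
      by (metis (no_types, lifting) D.scale D.sum sum.cong)
    then show ?thesis
      by (simp add: vec_eq_iff cjac_def cvec_def matrix_vector_mult_def scaleR_conv_of_real[where 'a = complex] mult.commute)
  qed
  then have "frechet_derivative \<phi> (at t) = (\<lambda>v. cjac \<phi> t *v cvec v)" by (rule ext)
  then show ?thesis using d by simp
qed

lemma cjac_eqI:
  fixes \<phi> :: "real^'n \<Rightarrow> complex^'n"
  assumes "(\<phi> has_derivative (\<lambda>v. B *v cvec v)) (at t)"
  shows "cjac \<phi> t = B"
proof -
  have "frechet_derivative \<phi> (at t) = (\<lambda>v. B *v cvec v)"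
    using frechet_derivative_at[OF assms] by simp
  then show ?thesis
    by (simp add: vec_eq_iff cjac_def cvec_def matrix_vector_mult_def axis_def if_distrib cong: if_cong)
qed

lemma det_of_real_matrix:
  fixes A :: "real^'n^'n"
  shows "det (\<chi> i k. complex_of_real (A $ i $ k)) = of_real (det A)"
  by (simp add: det_def)

text \<open>At each point at most one piece is present, so the partial sums of the norms are bounded
  by the integral of the norm over \<open>W\<close>.\<close>

lemma integral_countable_pieces:
  fixes F :: "'a::euclidean_space \<Rightarrow> complex" and S :: "nat \<Rightarrow> 'a set"
  assumes F: "integrable lborel (\<lambda>x. indicator W x *\<^sub>R F x)"
    and S: "\<And>i. S i \<in> sets borel" "\<And>i. S i \<subseteq> W" "disjoint_family S" and null: "negligible (W - (\<Union>i. S i))"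
  shows "summable (\<lambda>i. norm (\<integral>x. indicator (S i) x *\<^sub>R F x \<partial>lborel))"
    and "suminf (\<lambda>i. norm (\<integral>x. indicator (S i) x *\<^sub>R F x \<partial>lborel)) \<le> (\<integral>x. norm (indicator W x *\<^sub>R F x) \<partial>lborel)"
    and "suminf (\<lambda>i. \<integral>x. indicator (S i) x *\<^sub>R F x \<partial>lborel) = (\<integral>x. indicator W x *\<^sub>R F x \<partial>lborel)"
proof -
  define G where "G x = indicator W x *\<^sub>R F x" for x
  have G: "integrable lborel G" using F by (simp add: G_def[abs_def])
  have SG: "indicator (S i) x *\<^sub>R F x = indicator (S i) x *\<^sub>R G x" for i x
    using S(2)[of i] by (auto simp: G_def indicator_def)
  have intS: "integrable lborel (\<lambda>x. indicator A x *\<^sub>R G x)" if "A \<in> sets borel" for A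
    using that G by (intro integrable_mult_indicator) auto
  have partial: "(\<Sum>i<n. norm (\<integral>x. indicator (S i) x *\<^sub>R G x \<partial>lborel)) \<le> (\<integral>x. norm (G x) \<partial>lborel)" for n
  proof -
    have "(\<Sum>i<n. norm (\<integral>x. indicator (S i) x *\<^sub>R G x \<partial>lborel)) \<le> (\<Sum>i<n. \<integral>x. norm (indicator (S i) x *\<^sub>R G x) \<partial>lborel)"
      by (intro sum_mono integral_norm_bound)
    also have "\<dots> = (\<integral>x. (\<Sum>i<n. norm (indicator (S i) x *\<^sub>R G x)) \<partial>lborel)"
      by (rule Bochner_Integration.integral_sum[symmetric]) (intro integrable_norm intS S)
    also have "\<dots> \<le> (\<integral>x. norm (G x) \<partial>lborel)"
    proof (rule integral_mono)
      show "integrable lborel (\<lambda>x. \<Sum>i<n. norm (indicator (S i) x *\<^sub>R G x))"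
        by (intro Bochner_Integration.integrable_sum integrable_norm intS S)
      show "integrable lborel (\<lambda>x. norm (G x))" using G by simp
      fix x
      show "(\<Sum>i<n. norm (indicator (S i) x *\<^sub>R G x)) \<le> norm (G x)"
      proof (cases "\<exists>k<n. x \<in> S k")
        case True
        then obtain k where k: "k < n" "x \<in> S k" by blast
        then have "i \<noteq> k \<Longrightarrow> x \<notin> S i" for i using S(3) by (auto simp: disjoint_family_on_def)
        then have eq: "(\<Sum>i<n. norm (indicator (S i) x *\<^sub>R G x)) = (\<Sum>i\<in>{k}. norm (indicator (S i) x *\<^sub>R G x))"
          using k by (intro sum.mono_neutral_right) auto
        show ?thesis unfolding eq using k(2) by simp
      next
        case False
        then have eq: "(\<Sum>i<n. norm (indicator (S i) x *\<^sub>R G x)) = 0"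
          by (intro sum.neutral) auto
        show ?thesis unfolding eq by simp
      qed
    qed
    finally show ?thesis .
  qed
  show summ: "summable (\<lambda>i. norm (\<integral>x. indicator (S i) x *\<^sub>R F x \<partial>lborel))"
    unfolding SG by (rule summableI_nonneg_bounded[OF _ partial]) simp
  show "suminf (\<lambda>i. norm (\<integral>x. indicator (S i) x *\<^sub>R F x \<partial>lborel)) \<le> (\<integral>x. norm (indicator W x *\<^sub>R F x) \<partial>lborel)"
    using suminf_le_const[OF summ[unfolded SG] partial] unfolding SG G_def .
  have U: "(\<Union>i. S i) \<in> sets borel" using S(1) by auto
  have "(\<integral>x. indicator (\<Union>i. S i) x *\<^sub>R G x \<partial>lborel) = suminf (\<lambda>i. \<integral>x. indicator (S i) x *\<^sub>R G x \<partial>lborel)"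
    using lebesgue_integral_countable_add[of S lborel G] S intS[OF U]
    by (auto simp: set_lebesgue_integral_def set_integrable_def disjoint_family_on_def)
  moreover have "(\<integral>x. indicator (\<Union>i. S i) x *\<^sub>R G x \<partial>lborel) = (\<integral>x. G x \<partial>lborel)"
  proof (rule integral_cong_AE)
    obtain N where N: "N \<in> null_sets lborel" "W - (\<Union>i. S i) \<subseteq> N"
      using null unfolding negligible_iff_null_sets null_sets_completion_iff2 by blast
    have "AE x in lborel. x \<notin> N" using N(1) by (rule AE_not_in)
    then show "AE x in lborel. indicator (\<Union>i. S i) x *\<^sub>R G x = G x"
      by (rule eventually_mono) (use N(2) in \<open>auto simp: indicator_def G_def\<close>)
  qed (use G intS[OF U] in auto)
  ultimately show "suminf (\<lambda>i. \<integral>x. indicator (S i) x *\<^sub>R F x \<partial>lborel) = (\<integral>x. indicator W x *\<^sub>R F x \<partial>lborel)"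
    by (simp add: SG G_def)
qed

text \<open>Fubini for the counting measure on the index \<open>k\<close>.\<close>

lemma suminf_swap:
  fixes a :: "nat \<Rightarrow> nat \<Rightarrow> complex"
  assumes 1: "\<And>i. summable (\<lambda>k. norm (a k i))" and 2: "\<And>k. summable (\<lambda>i. norm (a k i))"
    and 3: "summable (\<lambda>i. suminf (\<lambda>k. norm (a k i)))"
  shows "suminf (\<lambda>k. suminf (\<lambda>i. a k i)) = suminf (\<lambda>i. suminf (\<lambda>k. a k i))"
proof -
  have int: "integrable (count_space UNIV) (\<lambda>k. a k i)" for i
    using 1[of i] by (simp add: integrable_count_space_nat_iff)
  have norms: "(\<integral>k. norm (a k i) \<partial>count_space UNIV) = suminf (\<lambda>k. norm (a k i))" for i
    by (rule integral_count_space_nat) (use int in simp)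
  have AE: "AE k in count_space UNIV. summable (\<lambda>i. norm (a k i))" using 2 by simp
  have S: "summable (\<lambda>i. \<integral>k. norm (a k i) \<partial>count_space UNIV)" unfolding norms by (rule 3)
  have "integrable (count_space UNIV) (\<lambda>k. suminf (\<lambda>i. a k i))"
    by (rule integrable_suminf[OF int AE S])
  then have "suminf (\<lambda>k. suminf (\<lambda>i. a k i)) = (\<integral>k. suminf (\<lambda>i. a k i) \<partial>count_space UNIV)"
    by (rule integral_count_space_nat[symmetric])
  also have "\<dots> = suminf (\<lambda>i. \<integral>k. a k i \<partial>count_space UNIV)"
    by (rule integral_suminf[OF int AE S])
  also have "\<dots> = suminf (\<lambda>i. suminf (\<lambda>k. a k i))"
    using int by (simp add: integral_count_space_nat)
  finally show ?thesis .
qed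

lemma absolutely_integrable_on_lborel_iff:
  fixes F :: "'a::euclidean_space \<Rightarrow> complex"
  assumes m: "(\<lambda>x. indicator W x *\<^sub>R F x) \<in> borel_measurable borel"
  shows "F absolutely_integrable_on W \<longleftrightarrow> integrable lborel (\<lambda>x. indicator W x *\<^sub>R F x)"
    and "F absolutely_integrable_on W \<Longrightarrow> integral W F = (\<integral>x. indicator W x *\<^sub>R F x \<partial>lborel)"
proof -
  show "F absolutely_integrable_on W \<longleftrightarrow> integrable lborel (\<lambda>x. indicator W x *\<^sub>R F x)"
    unfolding set_integrable_def using m by (simp add: integrable_completion)
  assume "F absolutely_integrable_on W"
  then have "integral W F = set_lebesgue_integral lebesgue W F"
    by (rule set_lebesgue_integral_eq_integral(2)[symmetric])
  then show "integral W F = (\<integral>x. indicator W x *\<^sub>R F x \<partial>lborel)"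
    unfolding set_lebesgue_integral_def using m by (simp add: integral_completion)
qed

text \<open>The two conditions on \<rho> are those that hold for almost every low level, by
  \<open>AE_nslice_finite\<close> and \<open>AE_hausdorff_null_fibre\<close>.\<close>

locale cycle_level = level_cover "\<lambda>j. peval (p j)" U b V "peval Q"
  for p :: "'n::{finite,wellorder} \<Rightarrow> 'n cpoly" and Q :: "'n cpoly" and U b V +
  fixes \<rho> :: "(real, 'n) vec"
  assumes fin: "suminf (\<lambda>i. nslice i \<rho>) < \<infinity>"
    and null: "hausdorff_null CARD('n) (level_cycle p U (\<chi> j. exp (\<rho> $ j)) - (\<Union>i. V i))"
begin

abbreviation P :: "'n \<Rightarrow> (complex, 'n) vec \<Rightarrow> complex" where "P \<equiv> \<lambda>j. peval (p j)"

definition M :: "((complex, 'n) vec) set" where "M = level_cycle p U (\<chi> j. exp (\<rho> $ j))"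

definition form :: "(complex, 'n) vec \<Rightarrow> complex" where
  "form z = peval Q z / (\<Prod>j\<in>UNIV. peval (p j) z)"

lemma norm_P_M: "z \<in> M \<Longrightarrow> norm (P j z) = exp (\<rho> $ j)"
  by (simp add: M_def level_cycle_def)

lemma P_nz: "z \<in> M \<Longrightarrow> P j z \<noteq> 0"
  using norm_P_M[of z j] by auto

lemma chart_M:
  assumes "z \<in> M" "z \<in> regular P"
  shows "chart P z = re_im_vec (\<rho>, \<chi> j. Im (chart P z $ j))"
  using assms Re_chart[OF assms(2)] norm_P_M[OF assms(1)]
  by (simp add: re_im_vec_def vec_eq_iff complex_eq_iff)

lemma pmap_derivative: "(pmap p has_derivative ((*v) (\<chi> i m. pd (P i) m z))) (at z)"
proof -
  have "((\<lambda>z. \<chi> j. peval (p j) z) has_derivative (\<lambda>v. \<chi> j. \<Sum>m\<in>UNIV. pd (P j) m z * v $ m)) (at z)"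
    by (intro has_derivative_vec_lambda polyfun_pd(1) polyP)
  then show ?thesis by (simp add: matrix_vector_mult_def[abs_def] pmap_def[abs_def])
qed

section \<open>Arbitrary positive patches on a level cycle\<close>

context
  fixes W \<phi> assumes patch: "positive_patch p M W \<phi>"
begin

lemma patch_M: "t \<in> W \<Longrightarrow> \<phi> t \<in> M"
  using patch by (auto simp: positive_patch_def)

lemma patch_open: "open W" and patch_inj: "inj_on \<phi> W"
  using patch by (auto simp: positive_patch_def)

lemma patch_derivative: "t \<in> W \<Longrightarrow> (\<phi> has_derivative (\<lambda>v. cjac \<phi> t *v cvec v)) (at t)"
  using patch by (intro cjac_derivative) (auto simp: positive_patch_def)

lemma patch_continuous: "continuous_on W \<phi>" "continuous_on W (\<lambda>t. cjac \<phi> t $ i $ k)"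
proof -
  show "continuous_on W \<phi>"
    by (intro continuous_at_imp_continuous_on ballI has_derivative_continuous[OF patch_derivative])
  have "continuous_on W (cjac \<phi>)" using patch by (simp add: positive_patch_def)
  then show "continuous_on W (\<lambda>t. cjac \<phi> t $ i $ k)" by (intro continuous_intros)
qed

definition dtheta :: "(real, 'n) vec \<Rightarrow> ((real, 'n) vec, 'n) vec" where
  "dtheta t = (\<chi> i k. Im (cjac (pmap p \<circ> \<phi>) t $ i $ k / pmap p (\<phi> t) $ i))"

lemma det_dtheta: "t \<in> W \<Longrightarrow> det (dtheta t) > 0"
  using patch by (auto simp: positive_patch_def dtheta_def darg_coeff_def)

lemma cjac_pmap:
  assumes t: "t \<in> W"
  shows "cjac (pmap p \<circ> \<phi>) t = (\<chi> i m. pd (P i) m (\<phi> t)) ** cjac \<phi> t"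
proof (rule cjac_eqI)
  have "(pmap p \<circ> \<phi> has_derivative (\<lambda>v. (\<chi> i m. pd (P i) m (\<phi> t)) *v (cjac \<phi> t *v cvec v))) (at t)"
    using diff_chain_at[OF patch_derivative[OF t] pmap_derivative] by (simp add: o_def)
  then show "(pmap p \<circ> \<phi> has_derivative (\<lambda>v. ((\<chi> i m. pd (P i) m (\<phi> t)) ** cjac \<phi> t) *v cvec v)) (at t)"
    by (simp add: matrix_vector_mul_assoc)
qed

text \<open>Along the patch |P_i| is constant, so the logarithmic derivative of P_i is purely
  imaginary.\<close>

lemma cjac_pmap_dtheta:
  assumes t: "t \<in> W"
  shows "cjac (pmap p \<circ> \<phi>) t $ i $ k = \<i> * P i (\<phi> t) * of_real (dtheta t $ i $ k)"
proof -
  define E where "E = cjac (pmap p \<circ> \<phi>) t"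
  define w where "w = P i (\<phi> t)"
  have w: "w \<noteq> 0" unfolding w_def by (rule P_nz[OF patch_M[OF t]])
  have dE: "(pmap p \<circ> \<phi> has_derivative (\<lambda>v. E *v cvec v)) (at t)"
    unfolding E_def cjac_pmap[OF t] using diff_chain_at[OF patch_derivative[OF t] pmap_derivative]
    by (simp add: o_def matrix_vector_mul_assoc)
  have dcomp: "((\<lambda>s. (pmap p \<circ> \<phi>) s $ i) has_derivative (\<lambda>v. (E *v cvec v) $ i)) (at t)"
    using bounded_linear.has_derivative[OF bounded_linear_vec_nth dE] .
  have "((\<lambda>s. (pmap p \<circ> \<phi>) s $ i \<bullet> (pmap p \<circ> \<phi>) s $ i) has_derivative
      (\<lambda>v. (pmap p \<circ> \<phi>) t $ i \<bullet> (E *v cvec v) $ i + (E *v cvec v) $ i \<bullet> (pmap p \<circ> \<phi>) t $ i)) (at t)"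
    by (rule has_derivative_inner[OF dcomp dcomp])
  moreover have "((\<lambda>s. (pmap p \<circ> \<phi>) s $ i \<bullet> (pmap p \<circ> \<phi>) s $ i) has_derivative (\<lambda>_. 0)) (at t)"
  proof (rule has_derivative_transform_within_open[OF has_derivative_const patch_open t])
    fix s assume "s \<in> W"
    then show "(exp (\<rho> $ i))\<^sup>2 = (pmap p \<circ> \<phi>) s $ i \<bullet> (pmap p \<circ> \<phi>) s $ i"
      using norm_P_M[OF patch_M, of s i] by (simp add: pmap_def power2_norm_eq_inner[symmetric])
  qed
  ultimately have "(\<lambda>v. (pmap p \<circ> \<phi>) t $ i \<bullet> (E *v cvec v) $ i + (E *v cvec v) $ i \<bullet> (pmap p \<circ> \<phi>) t $ i) = (\<lambda>_. 0)"
    by (rule has_derivative_unique)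
  then have "w \<bullet> (E *v cvec (axis k 1)) $ i + (E *v cvec (axis k 1)) $ i \<bullet> w = 0"
    by (simp add: fun_eq_iff pmap_def w_def)
  moreover have "(E *v cvec (axis k 1)) $ i = E $ i $ k"
    by (simp add: matrix_vector_mult_def cvec_def axis_def if_distrib cong: if_cong)
  ultimately have "w \<bullet> E $ i $ k = 0" by (simp add: inner_commute)
  then have "Re (E $ i $ k / w) = 0"
    by (simp add: Re_divide inner_complex_def mult.commute add.commute)
  then have "E $ i $ k / w = \<i> * of_real (Im (E $ i $ k / w))"
    by (simp add: complex_eq_iff)
  then have "E $ i $ k = \<i> * w * of_real (Im (E $ i $ k / w))"
    using w by (simp add: field_simps)
  then show ?thesis by (simp add: E_def w_def dtheta_def pmap_def)
qed

lemma dchart_cjac: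
  assumes t: "t \<in> W"
  shows "dchart P (\<phi> t) ** cjac \<phi> t = (\<chi> i k. \<i> * of_real (dtheta t $ i $ k))"
proof -
  have "(dchart P (\<phi> t) ** cjac \<phi> t) $ i $ k = cjac (pmap p \<circ> \<phi>) t $ i $ k / P i (\<phi> t)" for i k
    unfolding cjac_pmap[OF t] by (simp add: matrix_matrix_mult_def dchart_def sum_divide_distrib)
  then show ?thesis
    using P_nz[OF patch_M[OF t]] by (simp add: vec_eq_iff cjac_pmap_dtheta[OF t])
qed

lemma jac_det_cjac:
  assumes t: "t \<in> W"
  shows "jac P (\<phi> t) * det (cjac \<phi> t) = \<i> ^ CARD('n) * (\<Prod>j\<in>UNIV. P j (\<phi> t)) * of_real (det (dtheta t))"
proof -
  have "jac P (\<phi> t) * det (cjac \<phi> t) = det (cjac (pmap p \<circ> \<phi>) t)"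
    unfolding cjac_pmap[OF t] by (simp add: det_mul jac_def)
  also have "cjac (pmap p \<circ> \<phi>) t = (\<chi> i. (\<i> * P i (\<phi> t)) *s (\<chi> k. of_real (dtheta t $ i $ k)))"
    by (simp add: vec_eq_iff cjac_pmap_dtheta[OF t])
  also have "det \<dots> = (\<Prod>i\<in>UNIV. \<i> * P i (\<phi> t)) * det (\<chi> i k. complex_of_real (dtheta t $ i $ k))"
    by (simp only: det_rows_mul)
  finally show ?thesis by (simp add: det_of_real_matrix prod.distrib)
qed

lemma jac_patch_nz: "t \<in> W \<Longrightarrow> jac P (\<phi> t) \<noteq> 0" and det_cjac_nz: "t \<in> W \<Longrightarrow> det (cjac \<phi> t) \<noteq> 0"
proof -
  assume t: "t \<in> W"
  have "jac P (\<phi> t) * det (cjac \<phi> t) \<noteq> 0"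
    unfolding jac_det_cjac[OF t] using P_nz[OF patch_M[OF t]] det_dtheta[OF t] by simp
  then show "jac P (\<phi> t) \<noteq> 0" "det (cjac \<phi> t) \<noteq> 0" by auto
qed

text \<open>In terms of forms: J d\<zeta> is the wedge product of the dP_j, and dP_j / P_j pulls
  back to \<i> times d arg P_j.\<close>

lemma form_det_cjac:
  assumes t: "t \<in> W"
  shows "form (\<phi> t) * det (cjac \<phi> t) = \<i> ^ CARD('n) * (of_real (det (dtheta t)) * (peval Q (\<phi> t) / jac P (\<phi> t)))"
proof -
  have "det (cjac \<phi> t) = \<i> ^ CARD('n) * (\<Prod>j\<in>UNIV. P j (\<phi> t)) * of_real (det (dtheta t)) / jac P (\<phi> t)"
    using jac_det_cjac[OF t] jac_patch_nz[OF t] by (simp add: field_simps)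
  moreover have "(\<Prod>j\<in>UNIV. P j (\<phi> t)) \<noteq> 0" using P_nz[OF patch_M[OF t]] by simp
  ultimately show ?thesis by (simp add: form_def)
qed

text \<open>Positive orientation makes the complex determinant of the derivative nonzero. Hence the
  real derivative is injective and bounded below, and near \<open>t\<close> the remainder is at most
  half of this lower bound.\<close>

lemma patch_expanding:
  assumes t: "t \<in> W"
  shows "\<exists>m>0. \<exists>\<delta>>0. \<forall>s\<in>W. norm (s - t) < \<delta> \<longrightarrow> norm (s - t) \<le> m * dist (\<phi> s) (\<phi> t)"
proof -
  define D where "D v = cjac \<phi> t *v cvec v" for v
  have dD: "(\<phi> has_derivative D) (at t)" unfolding D_def[abs_def] by (rule patch_derivative[OF t])
  have "inj D"
  proof (rule injI)
    fix x y assume "D x = D y"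
    then have "cvec x = cvec y"
      unfolding D_def using matrix_inv_vector(1)[OF det_cjac_nz[OF t]] by metis
    then show "x = y" by (simp add: cvec_def vec_eq_iff)
  qed
  then obtain B where B: "B > 0" "\<And>v. B * norm v \<le> norm (D v)"
    using linear_inj_bounded_below_pos[OF has_derivative_linear[OF dD]] by blast
  have "\<exists>\<delta>>0. \<forall>s. norm (s - t) < \<delta> \<longrightarrow> norm (\<phi> s - \<phi> t - D (s - t)) \<le> B / 2 * norm (s - t)"
    using dD B(1) unfolding has_derivative_at_alt by (metis half_gt_zero)
  then obtain \<delta> where \<delta>: "\<delta> > 0" "\<And>s. norm (s - t) < \<delta> \<Longrightarrow> norm (\<phi> s - \<phi> t - D (s - t)) \<le> B / 2 * norm (s - t)"
    by blast
  have "norm (s - t) \<le> (2 / B) * dist (\<phi> s) (\<phi> t)" if "norm (s - t) < \<delta>" for s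
  proof -
    have "B * norm (s - t) \<le> norm (D (s - t))" by (rule B(2))
    also have "\<dots> \<le> norm (\<phi> s - \<phi> t) + norm (\<phi> s - \<phi> t - D (s - t))"
      by (metis norm_triangle_sub norm_minus_commute)
    also have "\<dots> \<le> norm (\<phi> s - \<phi> t) + B / 2 * norm (s - t)" using \<delta>(2)[OF that] by simp
    finally show ?thesis using B(1) by (simp add: dist_norm field_simps)
  qed
  then show ?thesis using B(1) \<delta>(1) by (intro exI[of _ "2 / B"]) auto
qed

lemma negligible_patch_vimage:
  "hausdorff_null CARD('n) Z \<Longrightarrow> negligible {t\<in>W. \<phi> t \<in> Z}"
  by (rule negligible_expanding_vimage[OF _ patch_expanding]) simp_all

lemma measurable_patch_form:
  "(\<lambda>t. indicator W t *\<^sub>R (form (\<phi> t) * det (cjac \<phi> t))) \<in> borel_measurable borel"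
proof (rule borel_measurable_continuous_on_indicator)
  have "continuous_on W (\<lambda>t. peval q (\<phi> t))" for q
    by (rule continuous_on_compose2[OF polyfun_continuous[OF polyfun_peval, of UNIV] patch_continuous(1)]) simp
  then show "continuous_on W (\<lambda>t. form (\<phi> t) * det (cjac \<phi> t))"
    unfolding form_def using P_nz[OF patch_M]
    by (intro continuous_intros continuous_on_det patch_continuous) auto
qed (use patch_open in simp)

definition piece :: "nat \<Rightarrow> ((real, 'n) vec) set" where
  "piece i = {t\<in>W. \<phi> t \<in> V i}"

definition angle :: "(real, 'n) vec \<Rightarrow> (real, 'n) vec" where
  "angle t = (\<chi> j. Im (chart P (\<phi> t) $ j))"

lemma open_piece: "open (piece i)"
proof -
  have "piece i = W \<inter> \<phi> -` V i" by (auto simp: piece_def)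
  then show ?thesis using continuous_open_preimage[OF patch_continuous(1) patch_open openV] by simp
qed

lemma piece_regular: "t \<in> piece i \<Longrightarrow> \<phi> t \<in> regular P"
  using Vreg(1) by (auto simp: piece_def)

lemma chart_angle: "t \<in> piece i \<Longrightarrow> re_im_vec (\<rho>, angle t) = chart P (\<phi> t)"
  unfolding angle_def by (rule chart_M[OF patch_M piece_regular, symmetric]) (auto simp: piece_def)

lemma inj_angle: "inj_on angle (piece i)"
proof (rule inj_onI)
  fix s t assume st: "s \<in> piece i" "t \<in> piece i" "angle s = angle t"
  then have "chart P (\<phi> s) = chart P (\<phi> t)" by (metis chart_angle)
  then have "\<phi> s = \<phi> t" using injV[of i] st by (auto simp: piece_def inj_on_def)
  then show "s = t" using patch_inj st by (auto simp: piece_def inj_on_def)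
qed

lemma angle_derivative:
  assumes "t \<in> piece i"
  shows "(angle has_derivative ((*v) (dtheta t))) (at t)"
proof -
  have t: "t \<in> W" using assms by (simp add: piece_def)
  have "(chart P \<circ> \<phi> has_derivative (\<lambda>v. dchart P (\<phi> t) *v (cjac \<phi> t *v cvec v))) (at t)"
    using diff_chain_at[OF patch_derivative[OF t] chart_derivative[OF polyP piece_regular[OF assms]]] by (simp add: o_def)
  then have d: "(chart P \<circ> \<phi> has_derivative (\<lambda>v. (\<chi> i k. \<i> * of_real (dtheta t $ i $ k)) *v cvec v)) (at t)"
    by (simp add: matrix_vector_mul_assoc dchart_cjac[OF t])
  have "((\<lambda>s. \<chi> j. Im ((chart P \<circ> \<phi>) s $ j)) has_derivative
      (\<lambda>v. \<chi> j. Im (((\<chi> i k. \<i> * of_real (dtheta t $ i $ k)) *v cvec v) $ j))) (at t)"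
    by (intro has_derivative_vec_lambda bounded_linear.has_derivative[OF bounded_linear_Im]
        bounded_linear.has_derivative[OF bounded_linear_vec_nth] d)
  moreover have "(\<chi> j. Im (((\<chi> i k. \<i> * of_real (dtheta t $ i $ k)) *v cvec v) $ j)) = dtheta t *v v" for v
    by (simp add: vec_eq_iff matrix_vector_mult_def cvec_def)
  ultimately show ?thesis by (simp add: angle_def[abs_def] o_def)
qed

lemma continuous_det_dtheta: "continuous_on (piece i) (\<lambda>t. det (dtheta t))"
proof -
  have entry: "dtheta t $ a $ k = Im (\<Sum>m\<in>UNIV. dchart P (\<phi> t) $ a $ m * cjac \<phi> t $ m $ k)" if "t \<in> piece i" for t a k
  proof -
    have "(dchart P (\<phi> t) ** cjac \<phi> t) $ a $ k = \<i> * of_real (dtheta t $ a $ k)"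
      using dchart_cjac[of t] that by (simp add: piece_def)
    then show ?thesis by (simp add: matrix_matrix_mult_def)
  qed
  have sub: "piece i \<subseteq> W" by (auto simp: piece_def)
  have "continuous_on (piece i) (\<lambda>t. dchart P (\<phi> t) $ a $ m)" for a m
    by (rule continuous_on_compose2[OF continuous_dchart[OF polyP] continuous_on_subset[OF patch_continuous(1) sub]])
      (auto simp: piece_regular)
  then have "continuous_on (piece i) (\<lambda>t. Im (\<Sum>m\<in>UNIV. dchart P (\<phi> t) $ a $ m * cjac \<phi> t $ m $ k))" for a k
    by (intro continuous_on_Im continuous_on_sum continuous_on_mult continuous_on_subset[OF patch_continuous(2) sub])
  then have "continuous_on (piece i) (\<lambda>t. dtheta t $ a $ k)" for a k
    by (subst continuous_on_cong[OF refl entry]) auto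
  then show ?thesis unfolding det_def
    by (intro continuous_on_sum continuous_on_mult continuous_on_const continuous_on_prod)
qed

lemma open_angle_piece: "open (angle ` piece i)"
  by (rule open_real_image[OF open_piece inj_angle angle_derivative continuous_det_dtheta])

text \<open>The angles of the i-th chart serve as new variables on the piece. Positive orientation
  makes their Jacobian \<open>det (dtheta t)\<close> positive, so the absolute value in the change
  of variables hides no sign.\<close>

lemma integral_piece:
  "(\<integral>t. indicator (piece i) t *\<^sub>R (form (\<phi> t) * det (cjac \<phi> t)) \<partial>lborel) =
   \<i> ^ CARD('n) * (\<integral>\<theta>. indicator (angle ` piece i) \<theta> *\<^sub>R H i (re_im_vec (\<rho>, \<theta>)) \<partial>lborel)"
proof -
  have "(\<integral>\<theta>. indicator (angle ` piece i) \<theta> *\<^sub>R H i (re_im_vec (\<rho>, \<theta>)) \<partial>lborel) =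
    (\<integral>t. (indicator (piece i) t * \<bar>det (dtheta t)\<bar>) *\<^sub>R H i (re_im_vec (\<rho>, angle t)) \<partial>lborel)"
    by (rule integral_real_cov[OF open_piece inj_angle angle_derivative continuous_det_dtheta]) measurable
  then have "\<i> ^ CARD('n) * (\<integral>\<theta>. indicator (angle ` piece i) \<theta> *\<^sub>R H i (re_im_vec (\<rho>, \<theta>)) \<partial>lborel) =
    (\<integral>t. \<i> ^ CARD('n) * ((indicator (piece i) t * \<bar>det (dtheta t)\<bar>) *\<^sub>R H i (re_im_vec (\<rho>, angle t))) \<partial>lborel)"
    by (simp only: integral_mult_right_zero)
  also have "\<dots> = (\<integral>t. indicator (piece i) t *\<^sub>R (form (\<phi> t) * det (cjac \<phi> t)) \<partial>lborel)"
  proof (rule Bochner_Integration.integral_cong[OF refl])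
    fix t
    show "\<i> ^ CARD('n) * ((indicator (piece i) t * \<bar>det (dtheta t)\<bar>) *\<^sub>R H i (re_im_vec (\<rho>, angle t))) =
      indicator (piece i) t *\<^sub>R (form (\<phi> t) * det (cjac \<phi> t))"
    proof (cases "t \<in> piece i")
      case True
      then have "t \<in> W" "\<phi> t \<in> V i" by (auto simp: piece_def)
      then show ?thesis
        using True det_dtheta[of t]
        by (simp add: chart_angle H_chart form_det_cjac scaleR_conv_of_real)
    qed simp
  qed
  finally show ?thesis by simp
qed

end

section \<open>The patches given by the charts\<close>

definition dom :: "nat \<Rightarrow> ((real, 'n) vec) set" where
  "dom i = {\<theta>. re_im_vec (\<rho>, \<theta>) \<in> chart P ` V i}"

definition param :: "nat \<Rightarrow> (real, 'n) vec \<Rightarrow> (complex, 'n) vec" where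
  "param i \<theta> = inv_into (V i) (chart P) (re_im_vec (\<rho>, \<theta>))"

lemma param_V: "\<theta> \<in> dom i \<Longrightarrow> param i \<theta> \<in> V i" "\<theta> \<in> dom i \<Longrightarrow> chart P (param i \<theta>) = re_im_vec (\<rho>, \<theta>)"
  unfolding dom_def param_def by (simp_all add: inv_into_into f_inv_into_f)

lemma re_im_vec_derivative:
  "((\<lambda>\<theta>. re_im_vec (\<rho>, \<theta>)) has_derivative (\<lambda>v. \<chi> j. \<i> * of_real (v $ j))) (at \<theta>)"
proof -
  have eq: "(\<lambda>\<theta>. re_im_vec (\<rho>, \<theta>)) = (\<lambda>\<theta>. \<chi> j. of_real (\<rho> $ j) + \<i> * of_real (\<theta> $ j))"
    by (simp add: re_im_vec_def fun_eq_iff vec_eq_iff complex_eq_iff)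
  show ?thesis
    unfolding eq
    by (intro has_derivative_vec_lambda)
      (auto intro!: derivative_eq_intros bounded_linear.has_derivative[OF bounded_linear_vec_nth])
qed

lemma open_dom: "open (dom i)"
proof -
  have "continuous_on UNIV (\<lambda>\<theta>. re_im_vec (\<rho>, \<theta>))"
    by (intro continuous_at_imp_continuous_on ballI has_derivative_continuous[OF re_im_vec_derivative])
  then have "open ((\<lambda>\<theta>. re_im_vec (\<rho>, \<theta>)) -` chart P ` V i)"
    by (intro open_vimage open_chart_image)
  then show ?thesis by (simp add: dom_def vimage_def)
qed

lemma param_derivative:
  assumes "\<theta> \<in> dom i"
  shows "(param i has_derivative (\<lambda>v. (\<chi> a k. matrix_inv (dchart P (param i \<theta>)) $ a $ k * \<i>) *v cvec v)) (at \<theta>)"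
proof -
  have "(inv_into (V i) (chart P) has_derivative ((*v) (matrix_inv (dchart P (param i \<theta>))))) (at (re_im_vec (\<rho>, \<theta>)))"
    using chart_inverse_derivative[OF polyP openV Vreg(1) injV param_V(1)[OF assms]] param_V(2)[OF assms] by simp
  then have "(param i has_derivative (\<lambda>v. matrix_inv (dchart P (param i \<theta>)) *v (\<chi> j. \<i> * of_real (v $ j)))) (at \<theta>)"
    unfolding param_def[abs_def] by (rule has_derivative_compose[OF re_im_vec_derivative])
  moreover have "matrix_inv (dchart P (param i \<theta>)) *v (\<chi> j. \<i> * of_real (v $ j)) =
     (\<chi> a k. matrix_inv (dchart P (param i \<theta>)) $ a $ k * \<i>) *v cvec v" for v
    by (simp add: vec_eq_iff matrix_vector_mult_def cvec_def mult_ac)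
  ultimately show ?thesis by simp
qed

lemma continuous_param: "continuous_on (dom i) (param i)"
  by (intro continuous_at_imp_continuous_on ballI has_derivative_continuous[OF param_derivative])

lemma cjac_param: "\<theta> \<in> dom i \<Longrightarrow> cjac (param i) \<theta> = (\<chi> a k. matrix_inv (dchart P (param i \<theta>)) $ a $ k * \<i>)"
  by (intro cjac_eqI param_derivative)

text \<open>Cramer's rule in a form that makes the entries of the inverse visibly continuous, as
  required for \<open>cjac (param i)\<close>.\<close>

lemma matrix_inv_entry:
  fixes A :: "((complex, 'n) vec, 'n) vec"
  assumes "det A \<noteq> 0"
  shows "matrix_inv A $ a $ k = det (\<chi> i j. if j = a then axis k 1 $ i else A $ i $ j) / det A"
proof -
  have "A *v (matrix_inv A *v axis k 1) = axis k 1" by (rule matrix_inv_vector(2)[OF assms])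
  then have "matrix_inv A *v axis k 1 = (\<chi> a. det (\<chi> i j. if j = a then axis k 1 $ i else A $ i $ j) / det A)"
    using cramer[OF assms] by blast
  moreover have "(matrix_inv A *v axis k 1) $ a = matrix_inv A $ a $ k"
    by (simp add: matrix_vector_mult_def axis_def if_distrib cong: if_cong)
  ultimately show ?thesis by simp
qed

lemma param_regular: "\<theta> \<in> dom i \<Longrightarrow> param i \<theta> \<in> regular P"
  using param_V(1) Vreg(1) by blast

lemma P_param:
  assumes "\<theta> \<in> dom i"
  shows "P j (param i \<theta>) = - exp (of_real (\<rho> $ j) + \<i> * of_real (\<theta> $ j))"
proof -
  have "- P j (param i \<theta>) = exp (re_im_vec (\<rho>, \<theta>) $ j)"
    using exp_chart[OF param_regular[OF assms], of j] param_V(2)[OF assms] by simp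
  moreover have "re_im_vec (\<rho>, \<theta>) $ j = of_real (\<rho> $ j) + \<i> * of_real (\<theta> $ j)"
    by (simp add: re_im_vec_def complex_eq_iff)
  ultimately show ?thesis by (metis minus_minus)
qed

lemma param_in_M: "\<theta> \<in> dom i \<Longrightarrow> param i \<theta> \<in> M"
  using param_V(1)[of \<theta> i] Vreg(2)[of i] by (auto simp: M_def level_cycle_def P_param)

text \<open>On this patch P_j = - exp(\<rho>_j + \<i> \<theta>_j), so d arg P_j =
  d\<theta>_j.\<close>

lemma darg_param:
  assumes \<theta>: "\<theta> \<in> dom i"
  shows "darg_coeff p (param i) \<theta> = 1"
proof -
  have "((\<lambda>\<theta>. \<chi> j. - exp (of_real (\<rho> $ j) + \<i> * of_real (\<theta> $ j))) has_derivative
      (\<lambda>v. \<chi> j. - exp (of_real (\<rho> $ j) + \<i> * of_real (\<theta> $ j)) * (\<i> * of_real (v $ j)))) (at \<theta>)"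
  proof (rule has_derivative_vec_lambda)
    fix j
    have "((\<lambda>\<theta>::(real, 'n) vec. of_real (\<rho> $ j) + \<i> * of_real (\<theta> $ j)) has_derivative (\<lambda>v. \<i> * of_real (v $ j))) (at \<theta>)"
      by (auto intro!: derivative_eq_intros bounded_linear.has_derivative[OF bounded_linear_vec_nth])
    then have "((\<lambda>\<theta>::(real, 'n) vec. exp (of_real (\<rho> $ j) + \<i> * of_real (\<theta> $ j))) has_derivative
        (\<lambda>v. exp (of_real (\<rho> $ j) + \<i> * of_real (\<theta> $ j)) * (\<i> * of_real (v $ j)))) (at \<theta>)"
      by (rule has_derivative_compose[OF _ DERIV_exp[unfolded has_field_derivative_def]])
    from has_derivative_minus[OF this]
    show "((\<lambda>\<theta>::(real, 'n) vec. - exp (of_real (\<rho> $ j) + \<i> * of_real (\<theta> $ j))) has_derivative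
        (\<lambda>v. - exp (of_real (\<rho> $ j) + \<i> * of_real (\<theta> $ j)) * (\<i> * of_real (v $ j)))) (at \<theta>)"
      by simp
  qed
  then have "(pmap p \<circ> param i has_derivative
      (\<lambda>v. \<chi> j. - exp (of_real (\<rho> $ j) + \<i> * of_real (\<theta> $ j)) * (\<i> * of_real (v $ j)))) (at \<theta>)"
    by (rule has_derivative_transform_within_open[OF _ open_dom \<theta>]) (simp add: pmap_def P_param vec_eq_iff)
  moreover have "(\<chi> j. - exp (of_real (\<rho> $ j) + \<i> * of_real (\<theta> $ j)) * (\<i> * of_real (v $ j))) =
      (\<chi> j k. if j = k then P j (param i \<theta>) * \<i> else 0) *v cvec v" for v
    by (simp add: vec_eq_iff matrix_vector_mult_def cvec_def P_param[OF \<theta>] if_distrib[of "\<lambda>x. x * y" for y] cong: if_cong)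
  ultimately have "cjac (pmap p \<circ> param i) \<theta> = (\<chi> j k. if j = k then P j (param i \<theta>) * \<i> else 0)"
    by (intro cjac_eqI) simp
  then have "(\<chi> j k. Im (cjac (pmap p \<circ> param i) \<theta> $ j $ k / pmap p (param i \<theta>) $ j)) = mat 1"
    using P_nz[OF param_in_M[OF \<theta>]] by (simp add: vec_eq_iff mat_def pmap_def)
  then show ?thesis by (simp add: darg_coeff_def)
qed

lemma positive_patch_param: "positive_patch p M (dom i) (param i)"
  unfolding positive_patch_def
proof (intro conjI ballI)
  show "open (dom i)" by (rule open_dom)
  show "inj_on (param i) (dom i)"
  proof (rule inj_onI)
    fix s t assume "s \<in> dom i" "t \<in> dom i" "param i s = param i t"
    then have "re_im_vec (\<rho>, s) = re_im_vec (\<rho>, t)" by (metis param_V(2))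
    then show "s = t" by (simp add: re_im_vec_def vec_eq_iff)
  qed
  show "param i ` dom i \<subseteq> M" using param_in_M by auto
  show "\<theta> \<in> dom i \<Longrightarrow> param i differentiable (at \<theta>)" for \<theta>
    using param_derivative differentiable_def by blast
  show "\<theta> \<in> dom i \<Longrightarrow> darg_coeff p (param i) \<theta> > 0" for \<theta>
    by (simp add: darg_param)
  have "continuous_on (dom i) (\<lambda>\<theta>. matrix_inv (dchart P (param i \<theta>)) $ a $ k)" for a k
  proof (subst continuous_on_cong[OF refl matrix_inv_entry])
    show "\<theta> \<in> dom i \<Longrightarrow> det (dchart P (param i \<theta>)) \<noteq> 0" for \<theta>
      by (intro det_dchart_nz polyP param_regular)
    have c: "continuous_on (dom i) (\<lambda>\<theta>. dchart P (param i \<theta>) $ a $ m)" for a m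
      by (rule continuous_on_compose2[OF continuous_dchart[OF polyP] continuous_param]) (auto simp: param_regular)
    have "continuous_on (dom i) (\<lambda>\<theta>. if m = a then axis k 1 $ l else dchart P (param i \<theta>) $ l $ m)" for l m
      by (cases "m = a") (auto intro: c)
    then show "continuous_on (dom i) (\<lambda>\<theta>. det (\<chi> l m. if m = a then axis k 1 $ l else dchart P (param i \<theta>) $ l $ m) / det (dchart P (param i \<theta>)))"
      using det_dchart_nz[OF polyP param_regular] by (intro continuous_on_divide continuous_on_det) (auto simp: c)
  qed
  then have "continuous_on (dom i) (\<lambda>\<theta>. \<chi> a k. matrix_inv (dchart P (param i \<theta>)) $ a $ k * \<i>)"
    by (intro continuous_on_vec_lambda continuous_on_mult continuous_on_const)
  then show "continuous_on (dom i) (cjac (param i))"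
    by (subst continuous_on_cong[OF refl cjac_param]) auto
qed

lemma H_slice_indicator: "indicator (dom i) \<theta> *\<^sub>R H i (re_im_vec (\<rho>, \<theta>)) = H i (re_im_vec (\<rho>, \<theta>))"
  by (simp add: dom_def H_def indicator_def)

lemma form_param:
  assumes "\<theta> \<in> dom i"
  shows "form (param i \<theta>) * det (cjac (param i) \<theta>) = \<i> ^ CARD('n) * H i (re_im_vec (\<rho>, \<theta>))"
proof -
  have "det (dtheta (param i) \<theta>) = 1"
    using darg_param[OF assms] by (simp add: dtheta_def[OF positive_patch_param] darg_coeff_def)
  then show ?thesis
    using form_det_cjac[OF positive_patch_param assms] H_chart[OF param_V(1)[OF assms]] param_V(2)[OF assms] by simp
qed

lemma M_diff_param: "M - (\<Union>i. param i ` dom i) \<subseteq> M - (\<Union>i. V i)"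
proof -
  have "z \<in> param i ` dom i" if "z \<in> M" "z \<in> V i" for z i
  proof -
    have zr: "z \<in> regular P" using that Vreg(1) by blast
    define \<theta> where "\<theta> = (\<chi> j. Im (chart P z $ j))"
    have c: "chart P z = re_im_vec (\<rho>, \<theta>)" unfolding \<theta>_def by (rule chart_M[OF that(1) zr])
    then have "\<theta> \<in> dom i" using that(2) by (auto simp: dom_def intro!: image_eqI[of _ _ z])
    moreover have "param i \<theta> = z" using that(2) injV by (simp add: param_def c[symmetric])
    ultimately show ?thesis by blast
  qed
  then show ?thesis by blast
qed

theorem has_cycle_integral_total: "has_cycle_integral p M form (\<i> ^ CARD('n) * total \<rho>)"
  unfolding has_cycle_integral_def
proof (intro exI[of _ dom] exI[of _ param] conjI allI)
  define F where "F i \<theta> = form (param i \<theta>) * det (cjac (param i) \<theta>)" for i \<theta>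
  have FH: "indicator (dom i) \<theta> *\<^sub>R F i \<theta> = \<i> ^ CARD('n) * H i (re_im_vec (\<rho>, \<theta>))" for i \<theta>
    using form_param[of \<theta> i] H_slice_indicator[of i \<theta>] by (cases "\<theta> \<in> dom i") (auto simp: F_def)
  have m: "(\<lambda>\<theta>. indicator (dom i) \<theta> *\<^sub>R F i \<theta>) \<in> borel_measurable borel" for i
    unfolding FH by measurable
  have abs: "F i absolutely_integrable_on dom i" for i
    unfolding absolutely_integrable_on_lborel_iff(1)[OF m] FH using slice_summable(1)[OF fin, of i] by simp
  show "positive_patch p M (dom i) (param i)" for i by (rule positive_patch_param)
  show "disjoint_family (\<lambda>k. param k ` dom k)"
    unfolding disjoint_family_on_def
  proof (intro ballI impI, rule ccontr)
    fix k l assume "k \<noteq> l" "param k ` dom k \<inter> param l ` dom l \<noteq> {}"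
    then obtain z where "z \<in> V k" "z \<in> V l" using param_V(1) by fastforce
    moreover have "V k \<inter> V l = {}" using disjV \<open>k \<noteq> l\<close> by (auto simp: disjoint_family_on_def)
    ultimately show False by blast
  qed
  show "hausdorff_null CARD('n) (M - (\<Union>k. param k ` dom k))"
    by (rule hausdorff_null_subset[OF null[folded M_def] M_diff_param])
  show "(\<lambda>t. form (param k t) * det (cjac (param k) t)) absolutely_integrable_on dom k" for k
    using abs[of k] by (simp add: F_def[abs_def])
  have I: "integral (dom k) (F k) = \<i> ^ CARD('n) * slice k \<rho>" for k
    using absolutely_integrable_on_lborel_iff(2)[OF m abs, of k] by (simp add: FH slice_def)
  have "summable (\<lambda>k. slice k \<rho>)" using slice_summable(3)[OF fin] by (rule summable_norm_cancel)
  then have "(\<lambda>k. slice k \<rho>) sums total \<rho>" unfolding total_def by (rule summable_sums)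
  then show "(\<lambda>k. integral (dom k) (\<lambda>t. form (param k t) * det (cjac (param k) t))) sums (\<i> ^ CARD('n) * total \<rho>)"
    using I by (simp add: F_def[abs_def] sums_mult)
  have N: "integral (dom k) (\<lambda>t. norm (F k t)) = (\<integral>\<theta>. norm (H k (re_im_vec (\<rho>, \<theta>))) \<partial>lborel)" for k
  proof -
    have "(\<lambda>t. norm (F k t)) absolutely_integrable_on dom k"
      using absolutely_integrable_norm[OF abs[of k]] by (simp add: o_def)
    then have "integral (dom k) (\<lambda>t. norm (F k t)) = (LINT t:dom k|lebesgue. norm (F k t))"
      by (rule set_lebesgue_integral_eq_integral(2)[symmetric])
    also have "\<dots> = (\<integral>\<theta>. norm (indicator (dom k) \<theta> *\<^sub>R F k \<theta>) \<partial>lebesgue)"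
      unfolding set_lebesgue_integral_def by (intro Bochner_Integration.integral_cong) auto
    also have "\<dots> = (\<integral>\<theta>. norm (H k (re_im_vec (\<rho>, \<theta>))) \<partial>lebesgue)"
      unfolding FH by (simp add: norm_mult norm_power)
    also have "\<dots> = (\<integral>\<theta>. norm (H k (re_im_vec (\<rho>, \<theta>))) \<partial>lborel)"
      by (intro integral_completion) measurable
    finally show ?thesis .
  qed
  show "summable (\<lambda>k. integral (dom k) (\<lambda>t. norm (form (param k t) * det (cjac (param k) t))))"
    using slice_summable(2)[OF fin] N by (simp add: F_def[abs_def])
qed

text \<open>Any family of patches is compared with the charts through the double array
  \<open>a k i\<close>, the integral of \<open>H i\<close> over the angles of the part of chart
  \<open>i\<close> that patch \<open>k\<close> covers. Up to \<i>^n, rows add up to the patch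
  integrals, and columns add up to the slices; both miss only null sets, because patches pull sets
  of vanishing Hausdorff measure back to null sets. Absolute summability over the charts permits the
  exchange of the sums.\<close>

theorem has_cycle_integral_unique:
  assumes "has_cycle_integral p M form I"
  shows "I = \<i> ^ CARD('n) * total \<rho>"
proof -
  obtain W \<phi> where patch: "\<And>k. positive_patch p M (W k) (\<phi> k)" and disj: "disjoint_family (\<lambda>k. \<phi> k ` W k)"
    and rest: "hausdorff_null CARD('n) (M - (\<Union>k. \<phi> k ` W k))"
    and abs: "\<And>k. (\<lambda>t. form (\<phi> k t) * det (cjac (\<phi> k) t)) absolutely_integrable_on W k"
    and sums: "(\<lambda>k. integral (W k) (\<lambda>t. form (\<phi> k t) * det (cjac (\<phi> k) t))) sums I"
    using assms unfolding has_cycle_integral_def by blast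
  define F where "F k t = form (\<phi> k t) * det (cjac (\<phi> k) t)" for k t
  define S where "S k i = piece (W k) (\<phi> k) i" for k i
  define A where "A k i = angle (\<phi> k) ` S k i" for k i
  define a where "a k i = (\<integral>\<theta>. indicator (A k i) \<theta> *\<^sub>R H i (re_im_vec (\<rho>, \<theta>)) \<partial>lborel)" for k i
  have S_iff: "t \<in> S k i \<longleftrightarrow> t \<in> W k \<and> \<phi> k t \<in> V i" for t k i
    by (simp add: S_def piece_def[OF patch])
  have chA: "re_im_vec (\<rho>, angle (\<phi> k) t) = chart P (\<phi> k t)" if "t \<in> S k i" for t k i
    using chart_angle[OF patch] that by (simp add: S_def)
  have m: "(\<lambda>t. indicator (W k) t *\<^sub>R F k t) \<in> borel_measurable borel" for k
    unfolding F_def by (rule measurable_patch_form[OF patch])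
  have intF: "integrable lborel (\<lambda>t. indicator (W k) t *\<^sub>R F k t)"
    and IF: "integral (W k) (F k) = (\<integral>t. indicator (W k) t *\<^sub>R F k t \<partial>lborel)" for k
    using absolutely_integrable_on_lborel_iff[OF m] abs[of k] by (simp_all add: F_def[abs_def])
  have row: "integral (W k) (F k) = \<i> ^ CARD('n) * suminf (\<lambda>i. a k i)"
    and row_abs: "summable (\<lambda>i. norm (a k i))" for k
  proof -
    have piece: "(\<integral>t. indicator (S k i) t *\<^sub>R F k t \<partial>lborel) = \<i> ^ CARD('n) * a k i" for i
      unfolding S_def F_def a_def A_def by (rule integral_piece[OF patch])
    have Sb: "S k i \<in> sets borel" for i using open_piece[OF patch] by (simp add: S_def)
    have Sdisj: "disjoint_family (S k)"
      unfolding disjoint_family_on_def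
    proof (intro ballI impI, rule ccontr)
      fix i l assume "i \<noteq> l" "S k i \<inter> S k l \<noteq> {}"
      then obtain t where "\<phi> k t \<in> V i" "\<phi> k t \<in> V l" by (auto simp: S_iff)
      moreover have "V i \<inter> V l = {}" using disjV \<open>i \<noteq> l\<close> by (auto simp: disjoint_family_on_def)
      ultimately show False by blast
    qed
    have "W k - (\<Union>i. S k i) \<subseteq> {t\<in>W k. \<phi> k t \<in> M - (\<Union>i. V i)}"
      using patch_M[OF patch] by (auto simp: S_iff)
    then have Snull: "negligible (W k - (\<Union>i. S k i))"
      using negligible_patch_vimage[OF patch null[folded M_def]] negligible_subset by blast
    note pieces = integral_countable_pieces[OF intF Sb _ Sdisj Snull]
    have sub: "S k i \<subseteq> W k" for i by (auto simp: S_iff)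
    have "summable (\<lambda>i. norm (\<i> ^ CARD('n) * a k i))"
      using pieces(1)[OF sub] unfolding piece .
    then show sa: "summable (\<lambda>i. norm (a k i))" by (simp add: norm_mult norm_power)
    have "integral (W k) (F k) = suminf (\<lambda>i. \<i> ^ CARD('n) * a k i)"
      unfolding IF using pieces(3)[OF sub] unfolding piece by simp
    then show "integral (W k) (F k) = \<i> ^ CARD('n) * suminf (\<lambda>i. a k i)"
      using suminf_mult[OF summable_norm_cancel[OF sa]] by simp
  qed
  have col: "suminf (\<lambda>k. a k i) = slice i \<rho>" and col_abs: "summable (\<lambda>k. norm (a k i))"
    and col_le: "suminf (\<lambda>k. norm (a k i)) \<le> (\<integral>\<theta>. norm (H i (re_im_vec (\<rho>, \<theta>))) \<partial>lborel)" for i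
  proof -
    have int: "integrable lborel (\<lambda>\<theta>. indicator (dom i) \<theta> *\<^sub>R H i (re_im_vec (\<rho>, \<theta>)))"
      unfolding H_slice_indicator by (rule slice_summable(1)[OF fin])
    have Ab: "A k i \<in> sets borel" for k using open_angle_piece[OF patch] by (simp add: A_def S_def)
    have sub: "A k i \<subseteq> dom i" for k
      by (auto simp: A_def dom_def chA S_iff)
    have Adisj: "disjoint_family (\<lambda>k. A k i)"
      unfolding disjoint_family_on_def
    proof (intro ballI impI, rule ccontr)
      fix k l assume "k \<noteq> l" "A k i \<inter> A l i \<noteq> {}"
      then obtain s t where st: "s \<in> S k i" "t \<in> S l i" "angle (\<phi> k) s = angle (\<phi> l) t" by (auto simp: A_def)
      then have "chart P (\<phi> k s) = chart P (\<phi> l t)" by (metis chA)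
      then have "\<phi> k s = \<phi> l t" using injV[of i] st by (auto simp: S_iff inj_on_def)
      then show False using disj st \<open>k \<noteq> l\<close> by (auto simp: disjoint_family_on_def S_iff)
    qed
    have "dom i - (\<Union>k. A k i) \<subseteq> {\<theta>\<in>dom i. param i \<theta> \<in> M - (\<Union>k. \<phi> k ` W k)}"
    proof
      fix \<theta> assume \<theta>: "\<theta> \<in> dom i - (\<Union>k. A k i)"
      have "param i \<theta> \<notin> \<phi> k ` W k" for k
      proof
        assume "param i \<theta> \<in> \<phi> k ` W k"
        then obtain t where t: "t \<in> W k" "\<phi> k t = param i \<theta>" by auto
        then have tS: "t \<in> S k i" using \<theta> param_V(1)[of \<theta> i] by (simp add: S_iff)
        have "re_im_vec (\<rho>, angle (\<phi> k) t) = re_im_vec (\<rho>, \<theta>)"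
          using chA[OF tS] t(2) param_V(2)[of \<theta> i] \<theta> by simp
        then have "angle (\<phi> k) t = \<theta>" by (simp add: re_im_vec_def vec_eq_iff)
        then show False using \<theta> tS by (auto simp: A_def)
      qed
      then show "\<theta> \<in> {\<theta>\<in>dom i. param i \<theta> \<in> M - (\<Union>k. \<phi> k ` W k)}"
        using \<theta> param_in_M by auto
    qed
    then have Anull: "negligible (dom i - (\<Union>k. A k i))"
      using negligible_patch_vimage[OF positive_patch_param rest] negligible_subset by blast
    note pieces = integral_countable_pieces[OF int Ab sub Adisj Anull, folded a_def]
    show "summable (\<lambda>k. norm (a k i))" by (rule pieces(1))
    show "suminf (\<lambda>k. norm (a k i)) \<le> (\<integral>\<theta>. norm (H i (re_im_vec (\<rho>, \<theta>))) \<partial>lborel)"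
      using pieces(2) unfolding H_slice_indicator .
    show "suminf (\<lambda>k. a k i) = slice i \<rho>"
      using pieces(3) unfolding H_slice_indicator slice_def .
  qed
  have "summable (\<lambda>i. suminf (\<lambda>k. norm (a k i)))"
    by (rule summable_comparison_test'[OF slice_summable(2)[OF fin], of 0])
      (use col_le col_abs in \<open>simp add: suminf_nonneg\<close>)
  then have swap: "suminf (\<lambda>k. suminf (\<lambda>i. a k i)) = suminf (\<lambda>i. suminf (\<lambda>k. a k i))"
    by (rule suminf_swap[OF col_abs row_abs])
  have sI: "(\<lambda>k. \<i> ^ CARD('n) * suminf (\<lambda>i. a k i)) sums I"
    using sums unfolding F_def[symmetric] by (simp add: row)
  have "(\<lambda>k. \<i> ^ CARD('n) * suminf (\<lambda>i. a k i) / \<i> ^ CARD('n)) sums (I / \<i> ^ CARD('n))"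
    by (rule sums_divide[OF sI])
  then have "I / \<i> ^ CARD('n) = suminf (\<lambda>k. suminf (\<lambda>i. a k i))"
    by (simp add: sums_iff)
  also have "\<dots> = total \<rho>" unfolding swap col total_def ..
  finally show ?thesis by (simp add: field_simps)
qed

end

section \<open>Local residues\<close>

lemma AE_lborel_imp_negligible:
  fixes Q :: "'a::euclidean_space \<Rightarrow> bool"
  assumes "AE x in lborel. Q x"
  shows "negligible {x. \<not> Q x}"
proof -
  obtain N where N: "N \<in> null_sets lborel" "{x. \<not> Q x} \<subseteq> N"
    using assms unfolding eventually_ae_filter by (auto simp: space_lborel)
  then have "negligible N" by (simp add: negligible_iff_null_sets null_sets_completionI)
  then show ?thesis using N(2) negligible_subset by blast
qed

lemma polyfun_lipschitz:
  fixes f :: "complex^'n \<Rightarrow> complex"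
  assumes f: "polyfun f"
  shows "\<exists>L\<ge>0. \<forall>x\<in>cball 0 R. \<forall>y\<in>cball 0 R. norm (f x - f y) \<le> L * norm (x - y)"
proof -
  have "\<exists>B. \<forall>z\<in>cball 0 R. norm (pd f i z) \<le> B" for i
  proof -
    have "compact (pd f i ` cball 0 R)"
      by (rule compact_continuous_image[OF polyfun_continuous[OF polyfun_pd(2)[OF f]] compact_cball])
    then show ?thesis by (auto dest!: compact_imp_bounded simp: bounded_iff)
  qed
  then obtain B where B: "\<And>i z. z \<in> cball 0 R \<Longrightarrow> norm (pd f i z) \<le> B i" by metis
  define L where "L = (\<Sum>i\<in>UNIV. \<bar>B i\<bar>)"
  have "onorm (\<lambda>v. \<Sum>i\<in>UNIV. pd f i z * v $ i) \<le> L" if "z \<in> cball 0 R" for z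
  proof (rule onorm_le)
    fix v :: "complex^'n"
    have "norm (\<Sum>i\<in>UNIV. pd f i z * v $ i) \<le> (\<Sum>i\<in>UNIV. norm (pd f i z * v $ i))" by (rule norm_sum)
    also have "\<dots> \<le> (\<Sum>i\<in>UNIV. \<bar>B i\<bar> * norm v)"
      unfolding norm_mult
    proof (intro sum_mono mult_mono)
      show "norm (pd f i z) \<le> \<bar>B i\<bar>" for i using B[OF that, of i] by linarith
      show "norm (v $ i) \<le> norm v" for i by (rule Finite_Cartesian_Product.norm_nth_le)
    qed auto
    finally show "norm (\<Sum>i\<in>UNIV. pd f i z * v $ i) \<le> L * norm v" by (simp add: L_def sum_distrib_right)
  qed
  note onL = this
  have "norm (f x - f y) \<le> L * norm (x - y)" if "x \<in> cball 0 R" "y \<in> cball 0 R" for x y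
    by (rule differentiable_bound[OF convex_cball has_derivative_at_withinI[OF polyfun_pd(1)[OF f]] onL that])
  moreover have "L \<ge> 0" by (simp add: L_def sum_nonneg)
  ultimately show ?thesis by blast
qed

section \<open>Comparison of means over different domains\<close>

lemma sublevel_avoids_compact:
  fixes f :: "'n::finite \<Rightarrow> 'a::topological_space \<Rightarrow> complex"
  assumes C: "compact C" and f: "\<And>j. continuous_on C (f j)" and nz: "\<And>z. z \<in> C \<Longrightarrow> \<exists>j. f j z \<noteq> 0"
  shows "\<exists>c0. \<forall>c\<le>c0. \<forall>z\<in>C. \<exists>j. norm (f j z) > exp c"
proof (cases "C = {}")
  case False
  define g where "g z = (\<Sum>j\<in>UNIV. norm (f j z))" for z
  have "continuous_on C g" unfolding g_def by (intro continuous_on_sum continuous_on_norm f)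
  then obtain z0 where z0: "z0 \<in> C" "\<And>z. z \<in> C \<Longrightarrow> g z0 \<le> g z"
    using continuous_attains_inf[OF C False] by blast
  obtain j0 where "f j0 z0 \<noteq> 0" using nz[OF z0(1)] by blast
  then have g0: "g z0 > 0"
    unfolding g_def by (intro sum_pos2[of UNIV j0]) auto
  have card: "real CARD('n) > 0" by simp
  have "\<exists>j. norm (f j z) > exp c" if c: "c \<le> ln (g z0 / (2 * real CARD('n)))" and z: "z \<in> C" for c z
  proof (rule ccontr)
    assume "\<nexists>j. norm (f j z) > exp c"
    then have "g z \<le> (\<Sum>j\<in>(UNIV :: 'n set). exp c)" unfolding g_def by (intro sum_mono) (simp add: not_less)
    also have "\<dots> = real CARD('n) * exp c" by simp
    also have "\<dots> \<le> real CARD('n) * exp (ln (g z0 / (2 * real CARD('n))))"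
      using c by (intro mult_left_mono) auto
    also have "\<dots> = g z0 / 2" using g0 card by simp
    finally show False using z0(2)[OF z] g0 by linarith
  qed
  then show ?thesis by blast
qed simp

text \<open>With a unit test function of a lower level \<open>c\<close> the mean becomes an integral
  over \<open>U\<close> that does not mention \<open>b\<close>. This makes means for different
  domains and levels comparable.\<close>

lemma (in proper_poly_map) mean_unit_test:
  assumes \<beta>: "test c \<beta>" "c \<le> b" "(\<integral>x. \<beta> x \<partial>lborel) = 1" and h: "polyfun h"
  defines "w \<equiv> \<lambda>z. (\<Prod>j\<in>UNIV. radial \<beta> (P j z)) * h z * cnj (jac P z)"
  shows "mean h = (\<integral>z. indicator U z *\<^sub>R w z \<partial>lborel)" "integrable lborel (\<lambda>z. indicator U z *\<^sub>R w z)"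
proof -
  have t: "test b \<beta>" using test_mono[OF \<beta>(1,2)] .
  have eq: "indicator U z *\<^sub>R w z = indicator sublevel z *\<^sub>R w z" for z
  proof (cases "z \<in> U \<and> z \<notin> sublevel")
    case True
    then obtain j where "norm (P j z) > exp b" by (auto simp: sublevel_def not_le)
    then have "radial \<beta> (P j z) = 0" by (rule radial_eq_0[OF t])
    then have "(\<Prod>j\<in>UNIV. radial \<beta> (P j z)) = 0" by (intro prod_zero) auto
    then show ?thesis by (simp add: w_def)
  qed (auto simp: sublevel_def indicator_def)
  have "mean h = weighted h (\<lambda>_. \<beta>)"
    using weighted_mean[OF h, of "\<lambda>_. \<beta>"] t \<beta>(3) by simp
  then show "mean h = (\<integral>z. indicator U z *\<^sub>R w z \<partial>lborel)"
    unfolding eq by (simp add: weighted_def w_def)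
  show "integrable lborel (\<lambda>z. indicator U z *\<^sub>R w z)"
    unfolding eq unfolding w_def by (rule integrable_weighted[OF t h])
qed

text \<open>All means are computed with one test function of the common level \<open>c\<close>. Its
  weight vanishes where some |P_j| exceeds exp c, so the indicators have to match on the remaining
  set only.\<close>

lemma mean_decomposition:
  fixes P :: "'n::finite \<Rightarrow> complex^'n \<Rightarrow> complex"
  assumes U: "proper_poly_map P U b" and W: "\<And>i. i \<in> I \<Longrightarrow> proper_poly_map P (W i) (b' i)"
    and c: "c \<le> b" "\<And>i. i \<in> I \<Longrightarrow> c \<le> b' i" and h: "polyfun h" and I: "finite I"
    and ind: "\<And>z. (\<And>j. norm (P j z) \<le> exp c) \<Longrightarrow> indicator U z = (\<Sum>i\<in>I. indicator (W i) z :: real)"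
  shows "proper_poly_map.mean P U b h = (\<Sum>i\<in>I. proper_poly_map.mean P (W i) (b' i) h)"
proof -
  obtain \<beta> where \<beta>: "test c \<beta>" "(\<integral>x. \<beta> x \<partial>lborel) = 1" using unit_test_exists by blast
  define w where "w z = (\<Prod>j\<in>UNIV. radial \<beta> (P j z)) * h z * cnj (jac P z)" for z
  have eq: "indicator U z *\<^sub>R w z = (\<Sum>i\<in>I. indicator (W i) z *\<^sub>R w z)" for z
  proof (cases "\<forall>j. norm (P j z) \<le> exp c")
    case True
    then show ?thesis using ind[of z] by (simp add: scaleR_left.sum)
  next
    case False
    then obtain j where "norm (P j z) > exp c" by (auto simp: not_le)
    then have "radial \<beta> (P j z) = 0" by (rule radial_eq_0[OF \<beta>(1)])
    then have "(\<Prod>j\<in>UNIV. radial \<beta> (P j z)) = 0" by (intro prod_zero) auto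
    then have "w z = 0" unfolding w_def by (simp only: mult_zero_left)
    then show ?thesis by simp
  qed
  have "proper_poly_map.mean P U b h = (\<integral>z. indicator U z *\<^sub>R w z \<partial>lborel)"
    unfolding w_def by (rule proper_poly_map.mean_unit_test(1)[OF U \<beta>(1) c(1) \<beta>(2) h])
  also have "\<dots> = (\<Sum>i\<in>I. \<integral>z. indicator (W i) z *\<^sub>R w z \<partial>lborel)"
    unfolding eq
    by (rule Bochner_Integration.integral_sum)
      (unfold w_def, rule proper_poly_map.mean_unit_test(2)[OF W \<beta>(1) c(2) \<beta>(2) h])
  also have "\<dots> = (\<Sum>i\<in>I. proper_poly_map.mean P (W i) (b' i) h)"
    unfolding w_def
    by (rule sum.cong[OF refl]) (rule proper_poly_map.mean_unit_test(1)[OF W \<beta>(1) c(2) \<beta>(2) h, symmetric])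
  finally show ?thesis .
qed

definition isolating :: "('n::finite \<Rightarrow> 'n cpoly) \<Rightarrow> complex^'n \<Rightarrow> (complex^'n) set \<Rightarrow> bool" where
  "isolating p a U \<longleftrightarrow> open U \<and> bounded U \<and> a \<in> U \<and> closure U \<inter> zero_set p = {a}"

lemma isolating_proper:
  assumes "isolating p a U"
  shows "\<exists>b. proper_poly_map (\<lambda>j. peval (p j)) U b"
proof -
  have U: "open U" "bounded U" "a \<in> U" "closure U \<inter> zero_set p = {a}" using assms by (auto simp: isolating_def)
  have "compact (closure U - U)"
    using U by (intro compact_diff) (auto simp: compact_closure)
  then obtain b where b: "\<And>z. z \<in> closure U - U \<Longrightarrow> \<exists>j. norm (peval (p j) z) > exp b"
    using sublevel_avoids_compact[of "closure U - U" "\<lambda>j. peval (p j)"] U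
    by (force simp: zero_set_def intro!: polyfun_continuous polyfun_peval)
  have "proper_poly_map (\<lambda>j. peval (p j)) U b"
    by unfold_locales
      (auto intro!: polyfun_peval U compact_sublevel_bounded polyfun_continuous b)
  then show ?thesis by blast
qed

text \<open>The two closures minus the common part \<open>U \<inter> U'\<close> form a compact set
  free of zeros. A level so low that the sublevel set avoids this set cannot distinguish the two
  neighbourhoods.\<close>

lemma isolating_mean_unique:
  assumes U: "isolating p a U" "proper_poly_map (\<lambda>j. peval (p j)) U b"
    and U': "isolating p a U'" "proper_poly_map (\<lambda>j. peval (p j)) U' b'" and h: "polyfun h"
  shows "proper_poly_map.mean (\<lambda>j. peval (p j)) U b h = proper_poly_map.mean (\<lambda>j. peval (p j)) U' b' h"
proof -
  let ?P = "\<lambda>j. peval (p j)"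
  define C where "C = (closure U \<union> closure U') - (U \<inter> U')"
  have "compact C"
    unfolding C_def using U(1) U'(1) by (intro compact_diff compact_Un) (auto simp: isolating_def compact_closure)
  moreover have "\<exists>j. peval (p j) z \<noteq> 0" if "z \<in> C" for z
  proof -
    have "z \<notin> zero_set p"
    proof
      assume "z \<in> zero_set p"
      then have "z = a" using that U(1) U'(1) by (auto simp: C_def isolating_def)
      then show False using that U(1) U'(1) by (simp add: C_def isolating_def)
    qed
    then show ?thesis by (simp add: zero_set_def)
  qed
  ultimately obtain c0 where c0: "\<And>c z. c \<le> c0 \<Longrightarrow> z \<in> C \<Longrightarrow> \<exists>j. norm (peval (p j) z) > exp c"
    using sublevel_avoids_compact[of C ?P] by (metis polyfun_continuous polyfun_peval)
  define c where "c = min c0 (min b b')"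
  have "indicator U z = (\<Sum>i\<in>{()}. indicator U' z :: real)" if "\<And>j. norm (peval (p j) z) \<le> exp c" for z
  proof -
    have "z \<notin> C" using c0[of c z] that by (force simp: c_def not_less[symmetric])
    then have "z \<in> U \<longleftrightarrow> z \<in> U'" using closure_subset[of U] closure_subset[of U'] by (auto simp: C_def)
    then show ?thesis by (simp add: indicator_def)
  qed
  then have "proper_poly_map.mean ?P U b h = (\<Sum>i\<in>{()}. proper_poly_map.mean ?P U' b' h)"
    by (intro mean_decomposition[where c = c] U(2) U'(2) h) (auto simp: c_def)
  then show ?thesis by simp
qed

text \<open>Existence and uniqueness of the cycle integral are kept in one equivalence, because the
  definite description in \<open>local_residue\<close> calls for both.\<close>

lemma generic_cycle_integral:
  fixes p :: "'n::{finite,wellorder} \<Rightarrow> 'n cpoly" and Q :: "'n cpoly"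
  assumes iso: "isolating p a U" and proper: "proper_poly_map (\<lambda>j. peval (p j)) U b"
  defines "f \<equiv> \<lambda>z. peval Q z / (\<Prod>j\<in>UNIV. peval (p j) z)"
    and "J \<equiv> \<i> ^ CARD('n) * proper_poly_map.mean (\<lambda>j. peval (p j)) U b (peval Q)"
  shows "\<exists>N. negligible N \<and> (\<forall>\<epsilon>. (\<forall>j. 0 < \<epsilon> $ j \<and> \<epsilon> $ j < exp (b - 1)) \<and> \<epsilon> \<notin> N \<longrightarrow>
    (\<forall>I. has_cycle_integral p (level_cycle p U \<epsilon>) f I \<longleftrightarrow> I = J))"
proof -
  let ?P = "\<lambda>j. peval (p j)"
  have U: "open U" "bounded U" "a \<in> U" "closure U \<inter> zero_set p = {a}" using iso by (auto simp: isolating_def)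
  have polyP: "polyfun (?P j)" for j by (rule polyfun_peval)
  obtain z where z: "jac ?P z \<noteq> 0"
  proof (rule exE[OF jac_not_identically_zero[of ?P U a]])
    have "a \<in> zero_set p" using U(4) by blast
    then show "peval (p j) a = 0" for j by (simp add: zero_set_def)
    fix z assume z: "z \<in> closure U - U"
    then have "z \<noteq> a" using U(3) by blast
    then have "z \<notin> zero_set p" using z U(4) by blast
    then show "\<exists>j. peval (p j) z \<noteq> 0" by (simp add: zero_set_def)
  qed (use polyP U in auto)
  have nreg: "negligible (- regular ?P)"
    by (intro negligible_not_regular polyP negligible_polyfun_zeros[where f = "jac ?P" and a = z] polyfun_jacobian z)
  obtain V where V: "\<And>i. open (V i)" "\<And>i. V i \<subseteq> U \<inter> regular ?P" "\<And>i. inj_on (chart ?P) (V i)"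
    "disjoint_family V" "negligible (U \<inter> regular ?P - (\<Union>i::nat. V i))"
  proof (rule disjoint_injective_cover[of "U \<inter> regular ?P" "chart ?P"])
    show "\<exists>r>0. ball z r \<subseteq> U \<inter> regular ?P \<and> inj_on (chart ?P) (ball z r)" if "z \<in> U \<inter> regular ?P" for z
      using chart_locally_injective[OF polyP U(1), of z] that by auto
  qed blast
  have nV: "negligible (U - (\<Union>i. V i))"
    by (rule negligible_subset[OF negligible_Un[OF nreg V(5)]]) auto
  interpret level_cover ?P U b V "peval Q"
    using proper V nV polyfun_peval by (intro level_cover.intro level_cover_axioms.intro)
  obtain R where R: "U \<subseteq> cball 0 R" using U(2) by (metis bounded_iff mem_cball_0 subsetI)
  \<comment> \<open>Level cycles are fibres of this map from real dimension 2n to real dimension n.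
    It is Lipschitz on bounded sets, so Eilenberg's inequality applies to the null set outside the
    charts with d = n.\<close>
  define F where "F z = (\<chi> j. norm (?P j z))" for z
  have "\<exists>L\<ge>0. \<forall>x\<in>cball 0 R. \<forall>y\<in>cball 0 R. norm (F x - F y) \<le> L * norm (x - y)"
  proof -
    obtain L where L: "\<And>j. L j \<ge> 0" "\<And>j x y. x \<in> cball 0 R \<Longrightarrow> y \<in> cball 0 R \<Longrightarrow> norm (?P j x - ?P j y) \<le> L j * norm (x - y)"
      using polyfun_lipschitz[OF polyP, of R] by metis
    have "norm (F x - F y) \<le> (\<Sum>j\<in>UNIV. L j) * norm (x - y)" if "x \<in> cball 0 R" "y \<in> cball 0 R" for x y
    proof -
      have "norm (F x - F y) \<le> (\<Sum>j\<in>UNIV. norm ((F x - F y) $ j))"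
        unfolding norm_vec_def by (rule L2_set_le_sum) simp
      also have "\<dots> \<le> (\<Sum>j\<in>UNIV. L j * norm (x - y))"
      proof (rule sum_mono)
        fix j
        have "norm ((F x - F y) $ j) \<le> norm (?P j x - ?P j y)"
          by (simp add: F_def norm_triangle_ineq3)
        also have "\<dots> \<le> L j * norm (x - y)" by (rule L(2)[OF that])
        finally show "norm ((F x - F y) $ j) \<le> L j * norm (x - y)" .
      qed
      finally show ?thesis by (simp add: sum_distrib_right)
    qed
    then show ?thesis using L(1) by (intro exI[of _ "\<Sum>j\<in>UNIV. L j"]) (auto intro: sum_nonneg)
  qed
  then obtain L where L: "L \<ge> 0" "\<And>x y. x \<in> cball 0 R \<Longrightarrow> y \<in> cball 0 R \<Longrightarrow> norm (F x - F y) \<le> L * norm (x - y)"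
    by blast
  have "AE v in lborel. hausdorff_null CARD('n) {z\<in>U - (\<Union>i. V i). F z = v}"
  proof (rule AE_hausdorff_null_fibre[OF nV _ _ _ _ L(1)])
    show "bounded (U - (\<Union>i. V i))" using U(2) by (rule bounded_subset) auto
    show "DIM((complex, 'n) vec) = DIM((real, 'n) vec) + CARD('n)" by simp
    show "norm (F x - F y) \<le> L * norm (x - y)" if "x \<in> U - (\<Union>i. V i)" "y \<in> U - (\<Union>i. V i)" for x y
      using that R by (intro L(2)) auto
  qed simp
  note N1 = AE_lborel_imp_negligible[OF this]
  \<comment> \<open>The exceptional levels of the averaging argument live in logarithmic
    coordinates; the differentiable map \<open>e\<close> below carries them to a null set of values
    \<epsilon>.\<close>
  define T where "T = {\<rho> :: (real, 'n) vec. \<not> (((\<forall>j. \<rho> $ j < b) \<longrightarrow> suminf (\<lambda>i. nslice i \<rho>) < \<infinity>) \<and>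
    ((\<forall>j. \<rho> $ j < b - 1) \<longrightarrow> total \<rho> = mean (peval Q)))}"
  have nT: "negligible T"
    unfolding T_def by (intro AE_lborel_imp_negligible AE_conjI AE_nslice_finite AE_total_eq_mean)
  define e where "e \<rho> = (\<chi> j. exp (\<rho> $ j))" for \<rho> :: "(real, 'n) vec"
  have "negligible (e ` T)"
  proof (rule negligible_differentiable_image_negligible[OF _ nT])
    have "(e has_derivative (\<lambda>v. \<chi> j. exp (\<rho> $ j) * v $ j)) (at \<rho>)" for \<rho>
      unfolding e_def[abs_def]
      by (intro has_derivative_vec_lambda)
        (auto intro!: derivative_eq_intros bounded_linear.has_derivative[OF bounded_linear_vec_nth])
    then show "e differentiable_on T"
      unfolding differentiable_on_def differentiable_def by (blast intro: has_derivative_at_withinI)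
  qed simp
  then have N: "negligible ({v. \<not> hausdorff_null CARD('n) {z\<in>U - (\<Union>i. V i). F z = v}} \<union> e ` T)" (is "negligible ?N")
    using N1 by (rule negligible_Un[rotated])
  have main: "has_cycle_integral p (level_cycle p U \<epsilon>) f I \<longleftrightarrow> I = J"
    if \<epsilon>: "\<And>j. 0 < \<epsilon> $ j" "\<And>j. \<epsilon> $ j < exp (b - 1)" "\<epsilon> \<notin> ?N" for \<epsilon> I
  proof -
    define \<rho> :: "(real, 'n) vec" where "\<rho> = (\<chi> j. ln (\<epsilon> $ j))"
    have e\<rho>: "e \<rho> = \<epsilon>" using \<epsilon>(1) by (simp add: e_def \<rho>_def vec_eq_iff)
    then have "\<rho> \<notin> T" using \<epsilon>(3) by blast
    moreover have \<rho>b: "\<rho> $ j < b - 1" for j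
      using \<epsilon>(1,2)[of j] ln_less_cancel_iff[of "\<epsilon> $ j" "exp (b - 1)"] by (simp add: \<rho>_def)
    moreover have "\<rho> $ j < b" for j using \<rho>b[of j] by linarith
    ultimately have fin: "suminf (\<lambda>i. nslice i \<rho>) < \<infinity>" and tot: "total \<rho> = mean (peval Q)"
      unfolding T_def by blast+
    have cyc: "level_cycle p U \<epsilon> - (\<Union>i. V i) = {z\<in>U - (\<Union>i. V i). F z = \<epsilon>}"
      by (auto simp: level_cycle_def F_def vec_eq_iff)
    have null: "hausdorff_null CARD('n) (level_cycle p U (\<chi> j. exp (\<rho> $ j)) - (\<Union>i. V i))"
      using \<epsilon>(3) e\<rho> cyc by (simp add: e_def)
    interpret C: cycle_level p Q U b V \<rho>
      by unfold_locales (fact fin null)+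
    have M: "C.M = level_cycle p U \<epsilon>" using e\<rho> by (simp add: C.M_def e_def)
    have form: "C.form = f" by (simp add: fun_eq_iff f_def C.form_def)
    have "has_cycle_integral p (level_cycle p U \<epsilon>) f J"
      using C.has_cycle_integral_total unfolding M form tot J_def .
    moreover have "I = J" if "has_cycle_integral p (level_cycle p U \<epsilon>) f I"
      using C.has_cycle_integral_unique[of I] that unfolding M form tot J_def .
    ultimately show ?thesis by blast
  qed
  show ?thesis
    by (intro exI[of _ ?N] conjI N allI impI main) auto
qed

text \<open>Whichever null set is removed, the filter of generic levels stays nontrivial, and limits
  along it are unique.\<close>

lemma positive_minus_negligible_islimpt:
  fixes N :: "(real^'n) set"
  assumes "negligible N"
  shows "0 islimpt ({\<epsilon>. \<forall>j. 0 < \<epsilon> $ j} - N)"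
  unfolding islimpt_approachable
proof (intro allI impI)
  fix e :: real assume e: "e > 0"
  define G where "G = (\<Inter>j. {\<epsilon> :: real^'n. 0 < \<epsilon> $ j}) \<inter> ball 0 e"
  have "open G" unfolding G_def
    by (intro open_Int open_INT ballI open_Collect_less continuous_intros) auto
  moreover have "(\<chi> j. e / (2 * real CARD('n))) \<in> G"
  proof -
    have "norm (\<chi> j::'n. e / (2 * real CARD('n))) \<le> (\<Sum>j\<in>(UNIV :: 'n set). norm (e / (2 * real CARD('n))))"
      unfolding norm_vec_def by (rule order_trans[OF L2_set_le_sum]) simp_all
    also have "\<dots> = e / 2" using e by simp
    finally show ?thesis using e by (simp add: G_def)
  qed
  ultimately have "\<not> negligible G" using open_not_negligible by blast
  then have "\<not> G \<subseteq> N" using assms negligible_subset by blast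
  then obtain x where "x \<in> G" "x \<notin> N" by blast
  then show "\<exists>x'\<in>{\<epsilon>. \<forall>j. 0 < \<epsilon> $ j} - N. x' \<noteq> 0 \<and> dist x' 0 < e"
    by (intro bexI[of _ x]) (auto simp: G_def dist_commute)
qed

text \<open>The factor \<i>^n of the cycle integral cancels against the one in (2 pi
  \<i>)^n.\<close>

theorem local_residue_eq_mean:
  fixes p :: "'n::{finite,wellorder} \<Rightarrow> 'n cpoly"
  assumes iso: "isolating p a U" and proper: "proper_poly_map (\<lambda>j. peval (p j)) U b"
  shows "local_residue p Q a = proper_poly_map.mean (\<lambda>j. peval (p j)) U b (peval Q) / (2 * of_real pi) ^ CARD('n)"
proof -
  let ?P = "\<lambda>j. peval (p j)" and ?f = "\<lambda>z. peval Q z / (\<Prod>j\<in>UNIV. peval (p j) z)"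
  define \<mu> where "\<mu> = proper_poly_map.mean ?P U b (peval Q)"
  define J where "J = \<i> ^ CARD('n) * \<mu>"
  define pos where "pos = {\<epsilon> :: (real, 'n) vec. \<forall>j. 0 < \<epsilon> $ j}"
  define k where "k = 1 / (2 * of_real pi * \<i>) ^ CARD('n)"
  have kJ: "k * J = \<mu> / (2 * of_real pi) ^ CARD('n)"
    by (simp add: k_def J_def power_mult_distrib)
  have ev: "\<exists>N. negligible N \<and> (\<forall>N'. N \<subseteq> N' \<longrightarrow> (\<forall>\<^sub>F \<epsilon> in at 0 within (pos - N').
      \<forall>I. has_cycle_integral p (level_cycle p U' \<epsilon>) ?f I \<longleftrightarrow> I = J))"
    if iso': "isolating p a U'" for U'
  proof -
    obtain b' where b': "proper_poly_map ?P U' b'" using isolating_proper[OF iso'] by blast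
    have "proper_poly_map.mean ?P U' b' (peval Q) = \<mu>"
      unfolding \<mu>_def by (rule isolating_mean_unique[OF iso' b' iso proper polyfun_peval])
    then obtain N where N: "negligible N" "\<And>\<epsilon> I. (\<forall>j. 0 < \<epsilon> $ j \<and> \<epsilon> $ j < exp (b' - 1)) \<Longrightarrow> \<epsilon> \<notin> N \<Longrightarrow>
        has_cycle_integral p (level_cycle p U' \<epsilon>) ?f I \<longleftrightarrow> I = J"
      using generic_cycle_integral[OF iso' b', of Q] unfolding J_def by blast
    have "\<forall>\<^sub>F \<epsilon> in at 0 within (pos - N'). \<forall>I. has_cycle_integral p (level_cycle p U' \<epsilon>) ?f I \<longleftrightarrow> I = J"
      if "N \<subseteq> N'" for N'
      unfolding eventually_at
    proof (intro exI[of _ "exp (b' - 1)"] conjI ballI impI allI)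
      fix \<epsilon> I assume \<epsilon>: "\<epsilon> \<in> pos - N'" "\<epsilon> \<noteq> 0 \<and> dist \<epsilon> 0 < exp (b' - 1)"
      have "0 < \<epsilon> $ j \<and> \<epsilon> $ j < exp (b' - 1)" for j
        using \<epsilon> component_le_norm_cart[of \<epsilon> j] by (auto simp: pos_def)
      then show "has_cycle_integral p (level_cycle p U' \<epsilon>) ?f I \<longleftrightarrow> I = J"
        using \<epsilon>(1) that by (intro N(2)) auto
    qed simp
    then show ?thesis using N(1) by blast
  qed
  have "has_local_residue p Q a (k * J)"
    unfolding has_local_residue_def
  proof (intro allI impI)
    fix U' assume "open U' \<and> bounded U' \<and> a \<in> U' \<and> closure U' \<inter> zero_set p = {a}"
    then have "isolating p a U'" by (simp add: isolating_def)
    then obtain N where N: "negligible N" "\<forall>\<^sub>F \<epsilon> in at 0 within (pos - N).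
        \<forall>I. has_cycle_integral p (level_cycle p U' \<epsilon>) ?f I \<longleftrightarrow> I = J"
      using ev by blast
    have "\<forall>\<^sub>F \<epsilon> in at 0 within (pos - N). has_cycle_integral p (level_cycle p U' \<epsilon>) ?f J"
      using N(2) by (rule eventually_mono) simp
    then show "\<exists>N I. negligible N \<and>
        (\<forall>\<^sub>F \<epsilon> in at 0 within {\<epsilon>. \<forall>j. 0 < \<epsilon> $ j} - N. has_cycle_integral p (level_cycle p U' \<epsilon>) ?f (I \<epsilon>)) \<and>
        ((\<lambda>\<epsilon>. 1 / (2 * of_real pi * \<i>) ^ CARD('n) * I \<epsilon>) \<longlongrightarrow> k * J) (at 0 within {\<epsilon>. \<forall>j. 0 < \<epsilon> $ j} - N)"
      unfolding k_def pos_def using N(1) by (intro exI[of _ N] exI[of _ "\<lambda>_. J"] conjI tendsto_const)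
  qed
  moreover have "r = k * J" if r: "has_local_residue p Q a r" for r
  proof -
    obtain N where N: "negligible N" "\<And>N'. N \<subseteq> N' \<Longrightarrow> \<forall>\<^sub>F \<epsilon> in at 0 within (pos - N').
        \<forall>I. has_cycle_integral p (level_cycle p U \<epsilon>) ?f I \<longleftrightarrow> I = J"
      using ev[OF iso] by blast
    obtain N' I where N': "negligible N'"
      "\<forall>\<^sub>F \<epsilon> in at 0 within (pos - N'). has_cycle_integral p (level_cycle p U \<epsilon>) ?f (I \<epsilon>)"
      "((\<lambda>\<epsilon>. k * I \<epsilon>) \<longlongrightarrow> r) (at 0 within (pos - N'))"
      using r iso unfolding has_local_residue_def isolating_def k_def pos_def by blast
    \<comment> \<open>A competing residue comes with its own null set \<open>N'\<close> and its own
      integrals \<open>I\<close>; both exceptional sets are removed before the limits are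
      compared.\<close>
    let ?F = "at 0 within (pos - (N \<union> N'))"
    have le: "?F \<le> at 0 within (pos - N')" by (rule at_le) auto
    have "\<forall>\<^sub>F \<epsilon> in ?F. has_cycle_integral p (level_cycle p U \<epsilon>) ?f (I \<epsilon>)"
      using N'(2) le by (rule filter_leD[rotated])
    then have "\<forall>\<^sub>F \<epsilon> in ?F. k * I \<epsilon> = k * J"
      using N(2)[of "N \<union> N'", OF Un_upper1] by eventually_elim simp
    then have "((\<lambda>\<epsilon>. k * I \<epsilon>) \<longlongrightarrow> k * J) ?F" by (rule tendsto_eventually)
    moreover have "((\<lambda>\<epsilon>. k * I \<epsilon>) \<longlongrightarrow> r) ?F" using N'(3) le by (rule tendsto_mono[rotated])
    moreover have "?F \<noteq> bot"
      using positive_minus_negligible_islimpt[OF negligible_Un[OF N(1) N'(1)]]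
      by (simp add: pos_def trivial_limit_within)
    ultimately show ?thesis using tendsto_unique by blast
  qed
  ultimately have "local_residue p Q a = k * J" unfolding local_residue_def by (rule the_equality)
  then show ?thesis using kJ by (simp add: \<mu>_def)
qed

section \<open>Vanishing of the global mean\<close>

context proper_poly_map
begin

text \<open>The integrated form of 2 |h J| \<le> t |J|^2 + |h|^2 / t. The first term is again a
  weighted integral, with \<open>J\<close> in place of \<open>h\<close>, and so is governed by the
  mean of \<open>J\<close>; \<open>t\<close> remains free to balance the two terms.\<close>

lemma norm_weighted_le:
  assumes test: "\<And>j. test b (\<alpha> j)" and nonneg: "\<And>j x. 0 \<le> \<alpha> j x" and h: "polyfun h" and t: "t > 0"
  defines "w \<equiv> \<lambda>z. norm (\<Prod>j\<in>UNIV. radial (\<alpha> j) (P j z))"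
  shows "2 * norm (weighted h \<alpha>) \<le>
    t * Re (weighted (jac P) \<alpha>) + (\<integral>z. indicator sublevel z *\<^sub>R (w z * (norm (h z))\<^sup>2) \<partial>lborel) / t"
proof -
  have rad: "(\<Prod>j\<in>UNIV. radial (\<alpha> j) (P j z)) = of_real (w z)" for z
  proof -
    have eq: "(\<Prod>j\<in>UNIV. radial (\<alpha> j) (P j z)) = of_real (\<Prod>j\<in>UNIV. \<alpha> j (ln (norm (P j z))) / (norm (P j z))\<^sup>2)"
      by (simp only: radial_def of_real_prod)
    have "(\<Prod>j\<in>UNIV. \<alpha> j (ln (norm (P j z))) / (norm (P j z))\<^sup>2) \<ge> 0"
      by (intro prod_nonneg) (simp add: nonneg)
    then show ?thesis unfolding w_def eq norm_of_real by (simp only: abs_of_nonneg)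
  qed
  have cw: "continuous_on S w" for S
    unfolding w_def
    by (intro continuous_on_norm continuous_on_prod
        continuous_on_compose2[OF continuous_radial[OF test, of UNIV] polyfun_continuous[OF polyP]]) auto
  have int: "integrable lborel (\<lambda>z. indicator sublevel z *\<^sub>R (w z * (norm (g z))\<^sup>2))" if "polyfun g" for g
    by (intro borel_integrable_compact[OF compactK] continuous_on_mult continuous_on_power continuous_on_norm
        cw polyfun_continuous that)
  have J: "weighted (jac P) \<alpha> = of_real (\<integral>z. indicator sublevel z *\<^sub>R (w z * (norm (jac P z))\<^sup>2) \<partial>lborel)"
  proof -
    have "jac P z * cnj (jac P z) = of_real ((norm (jac P z))\<^sup>2)" for z by (rule complex_norm_square[symmetric])
    then have "indicator sublevel z *\<^sub>R ((\<Prod>j\<in>UNIV. radial (\<alpha> j) (P j z)) * jac P z * cnj (jac P z)) =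
        of_real (indicator sublevel z *\<^sub>R (w z * (norm (jac P z))\<^sup>2))" for z
      by (simp add: rad scaleR_conv_of_real mult.assoc)
    then show ?thesis unfolding weighted_def by (simp only: integral_complex_of_real)
  qed
  have "norm (weighted h \<alpha>) \<le> (\<integral>z. norm (indicator sublevel z *\<^sub>R ((\<Prod>j\<in>UNIV. radial (\<alpha> j) (P j z)) * h z * cnj (jac P z))) \<partial>lborel)"
    unfolding weighted_def by (rule integral_norm_bound)
  also have "\<dots> \<le> (\<integral>z. t / 2 * (indicator sublevel z *\<^sub>R (w z * (norm (jac P z))\<^sup>2)) +
      1 / (2 * t) * (indicator sublevel z *\<^sub>R (w z * (norm (h z))\<^sup>2)) \<partial>lborel)"
  proof (rule integral_mono)
    show "integrable lborel (\<lambda>z. norm (indicator sublevel z *\<^sub>R ((\<Prod>j\<in>UNIV. radial (\<alpha> j) (P j z)) * h z * cnj (jac P z))))"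
      by (intro integrable_norm integrable_weighted[where \<alpha> = \<alpha>, OF test] h)
    show "integrable lborel (\<lambda>z. t / 2 * (indicator sublevel z *\<^sub>R (w z * (norm (jac P z))\<^sup>2)) +
      1 / (2 * t) * (indicator sublevel z *\<^sub>R (w z * (norm (h z))\<^sup>2)))"
      by (intro Bochner_Integration.integrable_add integrable_mult_right int h polyfun_jac)
    fix z
    let ?h = "norm (h z)" and ?J = "norm (jac P z)"
    have "0 \<le> (t * ?J - ?h)\<^sup>2 / (2 * t)" using t by simp
    also have "\<dots> = t / 2 * ?J\<^sup>2 + 1 / (2 * t) * ?h\<^sup>2 - ?h * ?J"
      using t by (simp add: field_simps power2_eq_square)
    finally have "w z * (?h * ?J) \<le> w z * (t / 2 * ?J\<^sup>2 + 1 / (2 * t) * ?h\<^sup>2)"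
      by (intro mult_left_mono) (simp_all add: w_def)
    then show "norm (indicator sublevel z *\<^sub>R ((\<Prod>j\<in>UNIV. radial (\<alpha> j) (P j z)) * h z * cnj (jac P z))) \<le>
      t / 2 * (indicator sublevel z *\<^sub>R (w z * (norm (jac P z))\<^sup>2)) +
      1 / (2 * t) * (indicator sublevel z *\<^sub>R (w z * (norm (h z))\<^sup>2))"
      by (cases "z \<in> sublevel") (simp_all add: norm_mult w_def algebra_simps)
  qed
  also have "\<dots> = t / 2 * Re (weighted (jac P) \<alpha>) + 1 / (2 * t) * (\<integral>z. indicator sublevel z *\<^sub>R (w z * (norm (h z))\<^sup>2) \<partial>lborel)"
    unfolding J using int[OF h] int[OF polyfun_jac] by (simp add: Bochner_Integration.integral_add)
  finally show ?thesis using t by (simp add: field_simps)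
qed

end

lemma test_shift:
  assumes "test b \<beta>"
  shows "test (b + s) (\<lambda>x. \<beta> (x - s))" "(\<integral>x. \<beta> (x - s) \<partial>lborel) = (\<integral>x. \<beta> x \<partial>lborel)"
proof -
  obtain \<beta>' a where b: "\<And>x. (\<beta> has_real_derivative \<beta>' x) (at x)" "continuous_on UNIV \<beta>'"
    "\<And>x. x < a \<or> b < x \<Longrightarrow> \<beta> x = 0"
    using assms unfolding test_def by blast
  have "((\<lambda>x. \<beta> (x - s)) has_real_derivative \<beta>' (x - s)) (at x)" for x
    using DERIV_shift[of \<beta> "\<beta>' (x - s)" x "- s"] b(1)[of "x - s"] by simp
  moreover have "continuous_on UNIV (\<lambda>x. \<beta>' (x - s))"
    by (intro continuous_on_compose2[OF b(2)] continuous_intros) auto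
  moreover have "\<beta> (x - s) = 0" if "x < a + s \<or> b + s < x" for x using that by (intro b(3)) auto
  ultimately show "test (b + s) (\<lambda>x. \<beta> (x - s))"
    unfolding test_def by (intro exI[of _ "\<lambda>x. \<beta>' (x - s)"] exI[of _ "a + s"]) auto
  show "(\<integral>x. \<beta> (x - s) \<partial>lborel) = (\<integral>x. \<beta> x \<partial>lborel)"
    using lborel_integral_real_affine[of 1 \<beta> "- s"] by simp
qed

section \<open>Consequences of the growth hypothesis\<close>

locale polynomial_growth =
  fixes p :: "'n::finite \<Rightarrow> 'n cpoly" and \<delta> :: "'n \<Rightarrow> real" and c R :: real
  assumes c: "c > 0" and R: "R > 0" and \<delta>: "\<And>j. 0 < \<delta> j"
    and growth: "\<And>z. norm z \<ge> R \<Longrightarrow>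
      (\<Sum>j\<in>UNIV. norm (peval (p j) z) / (1 + (norm z)\<^sup>2) powr (\<delta> j / 2)) \<ge> c"
begin

text \<open>If norm z \<ge> R, one summand of the growth condition is at least c / n. With |P_j|
  \<le> l^\<delta>_j for its index this gives norm z \<le> (n / c)^(1 / \<delta>_j) l. The sum
  dominates all indices, and \<open>R\<close> covers the remaining z since l \<ge> 1.\<close>

definition K :: real where
  "K = R + (\<Sum>j\<in>UNIV. (real CARD('n) / c) powr (1 / \<delta> j))"

lemma K_ge: "K \<ge> 0" "K \<ge> R" "K \<ge> (real CARD('n) / c) powr (1 / \<delta> j)"
proof -
  have s: "(real CARD('n) / c) powr (1 / \<delta> j) \<le> (\<Sum>j\<in>UNIV. (real CARD('n) / c) powr (1 / \<delta> j))"
    by (rule member_le_sum) auto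
  moreover have "0 \<le> (real CARD('n) / c) powr (1 / \<delta> j)" by simp
  ultimately show "K \<ge> 0" "K \<ge> R" "K \<ge> (real CARD('n) / c) powr (1 / \<delta> j)"
    unfolding K_def using R by linarith+
qed

lemma norm_le_of_sublevel:
  assumes l: "l \<ge> 1" and z: "\<And>j. norm (peval (p j) z) \<le> l powr \<delta> j"
  shows "norm z \<le> K * l"
proof (cases "norm z \<ge> R")
  case False
  then have "norm z \<le> K * 1" using K_ge(2) by simp
  also have "\<dots> \<le> K * l" using K_ge(1) l by (rule mult_left_mono[rotated])
  finally show ?thesis .
next
  case True
  let ?n = "real CARD('n)"
  have "\<exists>j. c / ?n \<le> norm (peval (p j) z) / (1 + (norm z)\<^sup>2) powr (\<delta> j / 2)"
  proof (rule ccontr)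
    assume "\<nexists>j. c / ?n \<le> norm (peval (p j) z) / (1 + (norm z)\<^sup>2) powr (\<delta> j / 2)"
    then have "(\<Sum>j\<in>UNIV. norm (peval (p j) z) / (1 + (norm z)\<^sup>2) powr (\<delta> j / 2)) < (\<Sum>j\<in>(UNIV :: 'n set). c / ?n)"
      by (intro sum_strict_mono) (auto simp: not_le)
    then show False using growth[OF True] by simp
  qed
  then obtain j where j: "c / ?n \<le> norm (peval (p j) z) / (1 + (norm z)\<^sup>2) powr (\<delta> j / 2)" by blast
  have z0: "norm z > 0" using True R by linarith
  have "norm z powr \<delta> j = ((norm z)\<^sup>2) powr (\<delta> j / 2)"
    using z0 by (simp add: powr_powr flip: powr_numeral)
  also have "\<dots> \<le> (1 + (norm z)\<^sup>2) powr (\<delta> j / 2)"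
    using \<delta>[of j] by (intro powr_mono2) auto
  finally have 1: "norm z powr \<delta> j \<le> (1 + (norm z)\<^sup>2) powr (\<delta> j / 2)" .
  have "1 + (norm z)\<^sup>2 > 0" by (simp add: add_pos_nonneg)
  then have "c / ?n * (1 + (norm z)\<^sup>2) powr (\<delta> j / 2) \<le> norm (peval (p j) z)"
    using j by (simp add: pos_le_divide_eq)
  then have "c / ?n * norm z powr \<delta> j \<le> l powr \<delta> j"
    using z[of j] mult_left_mono[OF 1, of "c / ?n"] c by simp
  then have "norm z powr \<delta> j \<le> ?n / c * l powr \<delta> j" using c by (simp add: field_simps)
  then have "(norm z powr \<delta> j) powr (1 / \<delta> j) \<le> (?n / c * l powr \<delta> j) powr (1 / \<delta> j)"
    using \<delta>[of j] by (intro powr_mono2) auto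
  also have "\<dots> = (?n / c) powr (1 / \<delta> j) * l"
    using c l \<delta>[of j] by (subst powr_mult) (simp_all add: powr_powr)
  also have "\<dots> \<le> K * l" using K_ge(3) l by (intro mult_right_mono) auto
  finally show ?thesis using z0 \<delta>[of j] by (simp add: powr_powr)
qed

lemma proper_global: "proper_poly_map (\<lambda>j. peval (p j)) UNIV b"
proof
  show "polyfun (peval (p j))" for j by (rule polyfun_peval)
  \<comment> \<open>Large enough that exp b \<le> exp s powr \<delta>_j for all j, which turns the
    common level into the scaled levels of \<open>norm_le_of_sublevel\<close>.\<close>
  define s where "s = (\<Sum>j\<in>UNIV. \<bar>b\<bar> / \<delta> j)"
  have s: "\<bar>b\<bar> / \<delta> j \<le> s" for j
    unfolding s_def by (rule member_le_sum) (auto simp: \<delta> less_imp_le)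
  have s0: "s \<ge> 0" unfolding s_def by (intro sum_nonneg) (simp add: \<delta> less_imp_le)
  have eb: "exp b \<le> exp s powr \<delta> j" for j
    using s[of j] \<delta>[of j] by (simp add: powr_def field_simps)
  have "{z \<in> UNIV. \<forall>j. norm (peval (p j) z) \<le> exp b} \<subseteq> cball 0 (K * exp s)"
  proof
    fix z assume "z \<in> {z \<in> UNIV. \<forall>j. norm (peval (p j) z) \<le> exp b}"
    then have zb: "norm (peval (p j) z) \<le> exp b" for j by simp
    have "norm (peval (p j) z) \<le> exp s powr \<delta> j" for j by (rule order_trans[OF zb eb])
    then show "z \<in> cball 0 (K * exp s)" using norm_le_of_sublevel[of "exp s" z] s0 by simp
  qed
  then have "bounded {z \<in> UNIV. \<forall>j. norm (peval (p j) z) \<le> exp b}"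
    using bounded_cball bounded_subset by blast
  moreover have "closed (\<Inter>j. {z. norm (peval (p j) z) \<le> exp b})"
    by (intro closed_INT ballI closed_Collect_le continuous_on_norm polyfun_continuous polyfun_peval continuous_on_const)
  moreover have "(\<Inter>j. {z. norm (peval (p j) z) \<le> exp b}) = {z \<in> UNIV. \<forall>j. norm (peval (p j) z) \<le> exp b}" by auto
  ultimately show "compact {z \<in> UNIV. \<forall>j. norm (peval (p j) z) \<le> exp b}"
    by (simp add: compact_eq_bounded_closed)
qed simp

abbreviation global_mean :: "(complex^'n \<Rightarrow> complex) \<Rightarrow> complex" where
  "global_mean h \<equiv> proper_poly_map.mean (\<lambda>j. peval (p j)) UNIV 0 h"

lemma global_mean_eq:
  assumes "polyfun h"
  shows "proper_poly_map.mean (\<lambda>j. peval (p j)) UNIV b h = global_mean h"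
proof -
  have "proper_poly_map.mean (\<lambda>j. peval (p j)) UNIV b h = (\<Sum>i\<in>{()}. global_mean h)"
    by (intro mean_decomposition[where c = "min 0 b" and W = "\<lambda>_. UNIV" and b' = "\<lambda>_. 0"] proper_global assms) auto
  then show ?thesis by simp
qed

theorem global_mean_eq_0:
  assumes deg: "Q = 0 \<or> real (total_degree Q) \<le> (\<Sum>j\<in>UNIV. \<delta> j) - real CARD('n) - 1"
  shows "global_mean (peval Q) = 0"
proof (cases "Q = 0")
  case True
  \<comment> \<open>For Q = 0 no degree bound is available, because \<open>total_degree\<close>
    assigns it 0; here the integrand itself is 0.\<close>
  obtain \<beta> where \<beta>: "test 0 \<beta>" "(\<integral>x. \<beta> x \<partial>lborel) = 1" using unit_test_exists[of 0] by blast
  have "peval Q z = 0" for z using True by (simp add: peval_def)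
  then show ?thesis
    using proper_poly_map.mean_unit_test(1)[OF proper_global[of 0] \<beta>(1) order_refl \<beta>(2) polyfun_peval[of Q]] by simp
next
  case False
  let ?P = "\<lambda>j. peval (p j)" and ?n = "CARD('n)" and ?d = "total_degree Q"
  define \<sigma> where "\<sigma> = (\<Sum>j\<in>UNIV. \<delta> j)"
  have deg': "real ?d + real ?n + 1 \<le> \<sigma>" using deg False by (simp add: \<sigma>_def)
  obtain \<beta> where \<beta>: "test 0 \<beta>" "(\<integral>x. \<beta> x \<partial>lborel) = 1" "\<And>x. 0 \<le> \<beta> x" "\<And>x. x < -1 \<Longrightarrow> \<beta> x = 0"
    using unit_test_exists[of 0] by auto
  have "\<exists>B. \<forall>x. \<beta> x \<le> B"
  proof -
    have "compact (\<beta> ` {-1..0})"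
      by (rule compact_continuous_image[OF test_continuous[OF \<beta>(1)]]) simp
    then have "bdd_above (\<beta> ` {-1..0})" by (intro bounded_imp_bdd_above compact_imp_bounded)
    then obtain B where B: "\<And>x. x \<in> {-1..0} \<Longrightarrow> \<beta> x \<le> B" unfolding bdd_above_def by blast
    have "\<beta> x \<le> max B 0" for x
    proof (cases "x \<in> {-1..0}")
      case True
      then show ?thesis using B[of x] by simp
    next
      case False
      then have "x < -1 \<or> 0 < x" by auto
      then have "\<beta> x = 0" using \<beta>(1,4) unfolding test_def by blast
      then show ?thesis by simp
    qed
    then show ?thesis by blast
  qed
  then obtain B where B: "\<And>x. \<beta> x \<le> B" by blast
  have B0: "B \<ge> 0" using \<beta>(3)[of 0] B[of 0] by linarith
  obtain C where C: "C \<ge> 0" "\<And>z. norm (peval Q z) \<le> C * (1 + norm z) ^ ?d"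
    using norm_peval_le[of Q] by blast
  define D where "D = Re (global_mean (jac ?P))"
  \<comment> \<open>This collects the constants of the three factors that scale with
    \<open>l\<close>: the weight, the squared bound for Q on the ball of radius K l, and the volume
    of that ball.\<close>
  define C' where "C' = (B * exp 2) ^ ?n * (C * (1 + K) ^ ?d)\<^sup>2 * (2 * K) ^ (2 * ?n)"
  have bound: "2 * norm (global_mean (peval Q)) \<le> (D + C') / l" if l: "l \<ge> 1" for l
  proof -
    define L where "L = ln l"
    have L: "L \<ge> 0" "exp L = l" using l by (simp_all add: L_def)
    have powl: "l powr x = exp (x * L)" for x using l by (simp add: powr_def L_def)
    \<comment> \<open>The shift confines the weight to values of |P_j| between l^\<delta>_j / e and
      l^\<delta>_j.\<close>
    define \<alpha> where "\<alpha> j x = \<beta> (x - \<delta> j * L)" for j x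
    \<comment> \<open>A common upper bound for the levels \<delta>_j L; by
      \<open>global_mean_eq\<close> the mean does not depend on it.\<close>
    define b where "b = \<sigma> * L"
    have db: "\<delta> j * L \<le> b" for j
      unfolding b_def \<sigma>_def using L(1) \<delta> by (intro mult_right_mono member_le_sum) (auto simp: less_imp_le)
    have test': "test (\<delta> j * L) (\<alpha> j)" for j
      using test_shift(1)[OF \<beta>(1), of "\<delta> j * L"] by (simp add: \<alpha>_def[abs_def])
    have test: "test b (\<alpha> j)" for j using test_mono[OF test' db] .
    have unit: "(\<integral>x. \<alpha> j x \<partial>lborel) = 1" for j
      using test_shift(2)[OF \<beta>(1), of "\<delta> j * L"] \<beta>(2) by (simp add: \<alpha>_def)
    have nonneg: "0 \<le> \<alpha> j x" for j x by (simp add: \<alpha>_def \<beta>(3))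
    interpret proper_poly_map ?P UNIV b by (rule proper_global)
    have mean: "weighted h \<alpha> = global_mean h" if "polyfun h" for h
      using weighted_mean[where \<alpha> = \<alpha>, OF that test] global_mean_eq[OF that, of b] by (simp add: unit)
    define w where "w z = norm (\<Prod>j\<in>UNIV. radial (\<alpha> j) (?P j z))" for z
    define r where "r = K * l"
    have r0: "r \<ge> 0" using K_ge(1) l by (simp add: r_def)
    define M where "M = (B * exp 2) ^ ?n * l powr (- 2 * \<sigma>) * (C * (1 + K) ^ ?d * l ^ ?d)\<^sup>2"
    have M0: "M \<ge> 0" unfolding M_def using B0 by simp
    \<comment> \<open>On the support |u| is at least l^\<delta>_j / e, and the inverse square of
      this bound produces the constant \<open>exp 2\<close>.\<close>
    have rad_le: "norm (radial (\<alpha> j) u) \<le> B * exp 2 * l powr (- 2 * \<delta> j)" for j u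
    proof (cases "\<alpha> j (ln (norm u)) = 0 \<or> u = 0")
      case True
      then show ?thesis using B0 by (auto simp: radial_def)
    next
      case False
      then have "\<not> ln (norm u) - \<delta> j * L < -1" using \<beta>(4) by (auto simp: \<alpha>_def)
      then have "\<delta> j * L - 1 \<le> ln (norm u)" by simp
      then have "exp (\<delta> j * L - 1) \<le> norm u" using False by (metis exp_le_cancel_iff exp_ln zero_less_norm_iff)
      then have "(exp (\<delta> j * L - 1))\<^sup>2 \<le> (norm u)\<^sup>2" by (intro power_mono) auto
      then have "\<alpha> j (ln (norm u)) / (norm u)\<^sup>2 \<le> B / (exp (\<delta> j * L - 1))\<^sup>2"
        using B0 B by (intro frac_le) (auto simp: \<alpha>_def)
      also have "\<dots> = B * exp 2 * l powr (- 2 * \<delta> j)"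
        by (simp add: powl exp_double[symmetric] exp_minus exp_diff field_simps flip: exp_add)
      finally show ?thesis using nonneg[of j "ln (norm u)"] by (simp add: radial_def norm_divide norm_power)
    qed
    have wM: "w z \<le> (B * exp 2) ^ ?n * l powr (- 2 * \<sigma>)" for z
    proof -
      have "w z \<le> (\<Prod>j\<in>UNIV. B * exp 2 * l powr (- 2 * \<delta> j))"
        unfolding w_def prod_norm[symmetric] by (intro prod_mono conjI rad_le) auto
      also have "\<dots> = (B * exp 2) ^ ?n * l powr (- 2 * \<sigma>)"
      proof -
        have "(\<Prod>j\<in>UNIV. l powr (- 2 * \<delta> j)) = l powr (- 2 * \<sigma>)"
          using l by (simp add: \<sigma>_def sum_distrib_left powr_sum[symmetric] sum_negf)
        then show ?thesis by (simp add: prod.distrib)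
      qed
      finally show ?thesis .
    qed
    have w0: "w z = 0" if "z \<notin> cball 0 r" for z
    proof -
      have "\<exists>j. norm (?P j z) > l powr \<delta> j"
        using norm_le_of_sublevel[OF l, of z] that by (auto simp: r_def not_le[symmetric])
      then obtain j where "norm (?P j z) > exp (\<delta> j * L)" by (auto simp: powl)
      then have "radial (\<alpha> j) (?P j z) = 0" by (rule radial_eq_0[OF test'])
      then have "(\<Prod>j\<in>UNIV. radial (\<alpha> j) (?P j z)) = 0" by (intro prod_zero) auto
      then show ?thesis unfolding w_def by (simp only: norm_zero)
    qed
    have wQ: "w z * (norm (peval Q z))\<^sup>2 \<le> M" if "z \<in> cball 0 r" for z
    proof -
      have "1 + norm z \<le> 1 * l + K * l" using that l by (simp add: r_def)
      then have "1 + norm z \<le> (1 + K) * l" by (simp add: algebra_simps)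
      then have "(1 + norm z) ^ ?d \<le> ((1 + K) * l) ^ ?d" by (intro power_mono) auto
      then have "norm (peval Q z) \<le> C * ((1 + K) * l) ^ ?d"
        using C(2)[of z] mult_left_mono[OF _ C(1)] order_trans by blast
      then have "norm (peval Q z) \<le> C * (1 + K) ^ ?d * l ^ ?d" by (simp add: power_mult_distrib mult.assoc)
      then have "(norm (peval Q z))\<^sup>2 \<le> (C * (1 + K) ^ ?d * l ^ ?d)\<^sup>2" by (intro power_mono) auto
      then show ?thesis
        unfolding M_def using wM[of z] B0 by (intro mult_mono) auto
    qed
    have ball_fin: "emeasure lborel (cball (0 :: complex^'n) r) < \<infinity>" by (rule emeasure_lborel_cball_finite)
    have "(\<integral>z. indicator sublevel z *\<^sub>R (w z * (norm (peval Q z))\<^sup>2) \<partial>lborel) \<le> (\<integral>z. indicator (cball (0 :: complex^'n) r) z * M \<partial>lborel)"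
    proof (rule integral_mono)
      have "continuous_on sublevel w"
        unfolding w_def
        by (intro continuous_on_norm continuous_on_prod
            continuous_on_compose2[OF continuous_radial[OF test, of UNIV] polyfun_continuous[OF polyP]]) auto
      then show "integrable lborel (\<lambda>z. indicator sublevel z *\<^sub>R (w z * (norm (peval Q z))\<^sup>2))"
        by (intro borel_integrable_compact[OF compactK] continuous_on_mult continuous_on_power continuous_on_norm
            polyfun_continuous polyfun_peval)
      show "integrable lborel (\<lambda>z :: complex^'n. indicator (cball 0 r) z * M)"
        using ball_fin by (intro integrable_mult_left integrable_real_indicator) auto
      show "indicator sublevel z *\<^sub>R (w z * (norm (peval Q z))\<^sup>2) \<le> indicator (cball 0 r) z * M" for z
        using wQ[of z] w0[of z] M0 by (cases "z \<in> cball 0 r") (auto simp: indicator_def)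
    qed
    also have "\<dots> = measure lborel (cball (0 :: complex^'n) r) * M" by simp
    also have "\<dots> \<le> (2 * r) ^ (2 * ?n) * M"
    proof (rule mult_right_mono[OF _ M0])
      have "emeasure lborel (cball (0 :: complex^'n) r) \<le> ennreal ((2 * r) ^ (2 * ?n))"
        using emeasure_cball_le[OF r0, of "0 :: complex^'n"] by (simp add: mult.commute)
      then show "measure lborel (cball (0 :: complex^'n) r) \<le> (2 * r) ^ (2 * ?n)"
        using r0 by (simp add: measure_def enn2real_leI)
    qed
    also have "\<dots> = C' * (l ^ (2 * ?n) * l ^ (2 * ?d) * l powr (- 2 * \<sigma>))"
      by (simp add: C'_def M_def r_def power_mult_distrib power_mult[symmetric] mult_ac)
    \<comment> \<open>The volume, |Q|^2 and the weights contribute 2n, 2 deg Q and -2 \<sigma> to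
      the exponent; the degree hypothesis makes the total at most -2.\<close>
    also have "l ^ (2 * ?n) * l ^ (2 * ?d) * l powr (- 2 * \<sigma>) = l powr (2 * real ?n + 2 * real ?d - 2 * \<sigma>)"
      using l by (simp add: powr_add powr_diff powr_minus powr_realpow[symmetric] field_simps)
    also have "C' * \<dots> \<le> C' * l powr (-2)"
    proof (rule mult_left_mono)
      show "l powr (2 * real ?n + 2 * real ?d - 2 * \<sigma>) \<le> l powr (-2)" using l deg' by (intro powr_mono) auto
      show "0 \<le> C'" unfolding C'_def using B0 by simp
    qed
    finally have I: "(\<integral>z. indicator sublevel z *\<^sub>R (w z * (norm (peval Q z))\<^sup>2) \<partial>lborel) \<le> C' * l powr (-2)" .
    \<comment> \<open>With t = 1 / l both terms are of order 1 / l.\<close>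
    have "2 * norm (weighted (peval Q) \<alpha>) \<le> 1 / l * Re (weighted (jac ?P) \<alpha>) +
        (\<integral>z. indicator sublevel z *\<^sub>R (w z * (norm (peval Q z))\<^sup>2) \<partial>lborel) / (1 / l)"
      unfolding w_def using l by (intro norm_weighted_le[where \<alpha> = \<alpha>, OF test nonneg polyfun_peval]) simp
    also have "\<dots> \<le> 1 / l * D + C' * l powr (-2) / (1 / l)"
      using I l by (intro add_mono divide_right_mono) (auto simp: D_def mean polyfun_jac)
    also have "\<dots> = (D + C') / l"
      using l by (simp add: powr_minus powr_numeral power2_eq_square field_simps)
    finally show ?thesis by (simp add: mean polyfun_peval)
  qed
  have "((\<lambda>l. (D + C') / l) \<longlongrightarrow> 0) at_top"
    by (rule tendsto_divide_0[OF tendsto_const filterlim_at_top_imp_at_infinity[OF filterlim_ident]])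
  then have "2 * norm (global_mean (peval Q)) \<le> 0"
    by (rule tendsto_lowerbound) (auto simp: eventually_at_top_linorder intro!: exI[of _ 1] bound)
  then show ?thesis by simp
qed

end

lemma global_mean_eq_sum_local:
  fixes p :: "'n::finite \<Rightarrow> 'n cpoly"
  assumes proper: "proper_poly_map (\<lambda>j. peval (p j)) UNIV b" and fin: "finite (zero_set p)" and h: "polyfun h"
  shows "\<exists>W b'. (\<forall>a\<in>zero_set p. isolating p a (W a) \<and> proper_poly_map (\<lambda>j. peval (p j)) (W a) (b' a)) \<and>
    proper_poly_map.mean (\<lambda>j. peval (p j)) UNIV b h = (\<Sum>a\<in>zero_set p. proper_poly_map.mean (\<lambda>j. peval (p j)) (W a) (b' a) h)"
proof -
  let ?P = "\<lambda>j. peval (p j)" and ?Z = "zero_set p"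
  \<comment> \<open>The inserted 1 keeps the minimum defined when there are fewer than two zeros.
    Balls of radius d / 3 around distinct zeros are disjoint.\<close>
  define d where "d = Min (insert 1 ((\<lambda>(x, y). dist x y) ` {(x, y)\<in>?Z \<times> ?Z. x \<noteq> y}))"
  have fin': "finite {(x, y)\<in>?Z \<times> ?Z. x \<noteq> y}" by (rule finite_subset[OF _ finite_cartesian_product[OF fin fin]]) auto
  have d0: "d > 0" unfolding d_def using fin' by (subst Min_gr_iff) auto
  have dd: "d \<le> dist x y" if "x \<in> ?Z" "y \<in> ?Z" "x \<noteq> y" for x y
    unfolding d_def using fin' that by (intro Min_le) (auto intro!: image_eqI[of _ _ "(x, y)"])
  define W where "W a = ball a (d / 3)" for a :: "complex^'n"
  have iso: "isolating p a (W a)" if "a \<in> ?Z" for a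
  proof -
    have "x = a" if "x \<in> cball a (d / 3)" "x \<in> ?Z" for x
      using dd[of a x] \<open>a \<in> ?Z\<close> that d0 by force
    moreover have "a \<in> cball a (d / 3)" using d0 by simp
    ultimately show ?thesis using d0 that by (auto simp: isolating_def W_def)
  qed
  have "\<exists>b'. \<forall>a\<in>?Z. proper_poly_map ?P (W a) (b' a)"
    by (rule bchoice) (blast intro: isolating_proper iso)
  then obtain b' where b': "\<And>a. a \<in> ?Z \<Longrightarrow> proper_poly_map ?P (W a) (b' a)" by blast
  \<comment> \<open>Below a level that avoids this compact set, the sublevel set lies inside the
    balls around the zeros, which is the situation of \<open>mean_decomposition\<close>.\<close>
  define C where "C = {z\<in>UNIV. \<forall>j. norm (?P j z) \<le> exp b} - (\<Union>a\<in>?Z. W a)"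
  have "compact C"
    unfolding C_def using proper_poly_map.compact_sublevel[OF proper] by (intro compact_diff open_UN) (auto simp: W_def)
  moreover have "\<exists>j. ?P j z \<noteq> 0" if "z \<in> C" for z
  proof -
    have "z \<in> W z" using d0 by (simp add: W_def)
    then have "z \<notin> ?Z" using that by (auto simp: C_def)
    then show ?thesis by (simp add: zero_set_def)
  qed
  ultimately obtain c0 where c0: "\<And>c z. c \<le> c0 \<Longrightarrow> z \<in> C \<Longrightarrow> \<exists>j. norm (?P j z) > exp c"
    using sublevel_avoids_compact[of C ?P] by (metis polyfun_continuous polyfun_peval)
  define c where "c = Min (insert c0 (insert b (b' ` ?Z)))"
  have c: "c \<le> c0" "c \<le> b" "\<And>a. a \<in> ?Z \<Longrightarrow> c \<le> b' a"
    using fin by (auto simp: c_def simp del: Min_insert intro!: Min_le)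
  have "proper_poly_map.mean ?P UNIV b h = (\<Sum>a\<in>?Z. proper_poly_map.mean ?P (W a) (b' a) h)"
  proof (rule mean_decomposition[OF proper b' c(2,3) h fin])
    fix z assume z: "\<And>j. norm (?P j z) \<le> exp c"
    then have "norm (?P j z) \<le> exp b" for j using c(2) order_trans[OF z] by simp
    moreover have "z \<notin> C" using c0[OF c(1), of z] z by (force simp: not_less[symmetric])
    ultimately obtain a where a: "a \<in> ?Z" "z \<in> W a" by (auto simp: C_def)
    have "x = a" if "x \<in> ?Z" "z \<in> W x" for x
    proof (rule ccontr)
      assume "x \<noteq> a"
      then have "d \<le> dist x a" using dd that a by blast
      also have "\<dots> \<le> dist x z + dist a z" by (rule dist_triangle2)
      also have "\<dots> < d / 3 + d / 3" using that a by (intro add_strict_mono) (auto simp: W_def)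
      finally show False using d0 by simp
    qed
    then have "indicator (W x) z = (0 :: real)" if "x \<in> ?Z - {a}" for x using that by (auto simp: indicator_def)
    then have "(\<Sum>x\<in>?Z. indicator (W x) z :: real) = (\<Sum>x\<in>{a}. indicator (W x) z)"
      using a(1) fin by (intro sum.mono_neutral_right) simp_all
    also have "\<dots> = indicator UNIV z" using a by simp
    finally show "indicator UNIV z = (\<Sum>x\<in>?Z. indicator (W x) z :: real)" by simp
  qed
  then show ?thesis using iso b' by blast
qed

theorem theorem1p1:
  fixes P :: "'n::{finite,wellorder} \<Rightarrow> 'n cpoly"
    and Q :: "'n cpoly"
    and \<delta> :: "'n \<Rightarrow> real"
    and c R :: real
  assumes "c > 0" and "R > 0"
    and "\<And>j. \<delta> j \<in> \<rat>"
    and "\<And>j. 0 < \<delta> j"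
    and "\<And>j. \<delta> j \<le> real (total_degree (P j))"
    and "\<And>\<zeta> :: complex^'n::_. norm \<zeta> \<ge> R \<Longrightarrow>
           (\<Sum>j\<in>UNIV. norm (peval (P j) \<zeta>) / (1 + (norm \<zeta>)\<^sup>2) powr (\<delta> j / 2)) \<ge> c"
    and "Q = 0 \<or> real (total_degree Q) \<le> (\<Sum>j\<in>UNIV. \<delta> j) - real CARD('n) - 1"
  shows "(\<Sum>\<alpha>\<in>zero_set P. local_residue P Q \<alpha>) = 0"
proof (cases "finite (zero_set P)")
  case True
  interpret polynomial_growth P \<delta> c R
    by unfold_locales (fact assms)+
  obtain W b' where W: "\<forall>a\<in>zero_set P. isolating P a (W a) \<and> proper_poly_map (\<lambda>j. peval (P j)) (W a) (b' a)"
    and sum: "global_mean (peval Q) =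
      (\<Sum>a\<in>zero_set P. proper_poly_map.mean (\<lambda>j. peval (P j)) (W a) (b' a) (peval Q))"
    using global_mean_eq_sum_local[OF proper_global True polyfun_peval] by blast
  have "(\<Sum>a\<in>zero_set P. local_residue P Q a) =
      (\<Sum>a\<in>zero_set P. proper_poly_map.mean (\<lambda>j. peval (P j)) (W a) (b' a) (peval Q) / (2 * of_real pi) ^ CARD('n))"
    using W by (intro sum.cong[OF refl] local_residue_eq_mean) auto
  also have "\<dots> = global_mean (peval Q) / (2 * of_real pi) ^ CARD('n)"
    unfolding sum by (rule sum_divide_distrib[symmetric])
  finally show ?thesis using global_mean_eq_0[OF assms(7)] by simp
\<comment> \<open>For an infinite index set the sum is 0 by convention.\<close>
qed simp

end
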